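(* Let $H_\lambda$, $\lambda\in\Delta$, be a holomorphic family of hyperbolic, unstably connected H\'enon maps of degree $d$. Let $\Psi_\lambda$ be the Buzzard--Verma holomorphic motion, defined on $U^+_0$ over $\Delta$, and let $\Phi_\lambda:J^-_+(\lambda)\to\Sigma_+$ be the Bedford--Smillie solenoidal map of $H_\lambda$. Then $$\Phi_0(p)=\Phi_\lambda(\Psi_\lambda(p))$$ for all $\lambda\in\Delta$ and all $p\in J^-_+(0)$. In particular, $\Psi_\lambda$ is holomorphic on each leaf of $J^-_+(0)$ for each fixed $\lambda\in\Delta$.
   Context: H\'enon maps. A H\'enon map is a composition $H=F_1\circ\cdots\circ F_m$ with $F_j(x,y)=(y,P_j(y)-b_jx)$ on $\mathbb C^2$, $P_j$ a monic complex polynomial of degree $\ge2$, $b_j\in\mathbb C\setminus\{0\}$ (every nonelementary polynomial diffeomorphism of $\mathbb C^2$ is conjugate to such a map); $d=\deg H=\prod_j\deg P_j$. $K^+$ (resp. $K^-$) is the set of points with bounded orbit under iteration of $H$ (resp. $H^{-1}$), $J^\pm=\partial K^\pm$, $J=J^+\cap J^-$, $U^+=\mathbb C^2\setminus K^+$, $J^-_+=J^-\cap U^+$. $H$ is hyperbolic if it is uniformly hyperbolic on $J$. Then each unstable manifold $W^u(p)$, $p\in J$, is conformally equivalent to $\mathbb C$; these are the leaves of a lamination of $W^u(J)$, which is $J^-$ minus finitely many periodic sinks, and the components of their intersections with $U^+$ are the leaves of $J^-_+$. $H$ is unstably connected if for some (equivalently, every) saddle periodic point $p$, some (equivalently, each)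 component of $W^u(p)\cap U^+$ is simply connected. Families. $\Delta$ is a disk or polydisk of parameters with basepoint $0$; $H_\lambda$ depends holomorphically on $\lambda$, has constant degree $d$, and the family is defined, hyperbolic and unstably connected over the closed polydisk $\overline\Delta$. Objects attached to $H_\lambda$ carry the index $\lambda$, e.g. $U^+_\lambda$, $J^-_+(\lambda)$. Solenoid. $\mathbb D$ is the closed unit disk and $\Sigma_+=\{\mathbf z\in(\mathbb C\setminus\mathbb D)^{\mathbb Z}: z_{t+1}=z_t^d\ \forall t\in\mathbb Z\}$ with the product topology and shift $\sigma(\mathbf z)_t=z_{t+1}$. Solenoidal map. For $R$ large let $V^+=\{(x,y):|y|\ge|x|,\ |y|\ge R\}$; then $V^+\subset U^+$ and $H(V^+)\subset V^+$. On $V^+$ put $\varphi^+(p)=\lim_{n\to\infty}(\pi_y H^n(p))^{1/d^n}$, where $\pi_y$ is projection to the second coordinate and the root is chosen to approximate $y$. For $H$ unstably connected (Bedford--Smillie), $\varphi^+$ has a unique continuous extension from $J^-\cap V^+$ to $J^-_+$, with values in $\mathbb C\setminus\mathbb D$, satisfying $\varphi^+(H(p))=\varphi^+(p)^d$. The Bedford--Smillie solenoidal map $\Phi:J^-_+\to\Sigma_+$ is $\Phi(p)_t=\varphi^+(H^t(p))$, $t\in\mathbb Z$; it satisfies $\sigma\Phi=\Phi H$ and is a finite-degree covering map, holomorphic and injective on leaves of $J^-_+$. Harmonic Beltrami coefficient. $\mu$ is harmonic on an open set $U\subset\hat{\mathbb C}$ if $\mu=\overline{\nu}/\rho^2$ on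 $U$ with $\nu$ holomorphic on $U$ and $\rho^2$ the area density of the hyperbolic metric of $U$. Holomorphic motion. A holomorphic motion of $E\subset\hat{\mathbb C}$ over $\Delta$ is a map $\alpha:\Delta\times E\to\hat{\mathbb C}$ with $\alpha(0,\cdot)=\mathrm{id}$, each $\alpha(\lambda,\cdot)$ injective, each $\alpha(\cdot,z)$ holomorphic. Buzzard--Verma motion. It is the map $\Psi$ on $\Delta\times(J^+_0\cup U^+_0\cup J^-_0)$, with $\Psi_\lambda=\Psi(\lambda,\cdot)$ taking values in $J^+_\lambda\cup U^+_\lambda\cup J^-_\lambda$ (with $\Delta$ small enough that it is defined over $\Delta$), having the properties: (1) $\Psi_0(p)=p$; (2) each $\Psi_\lambda$ is a homeomorphism; (3) $\Psi_\lambda(p)$ is holomorphic in $\lambda$ for each $p$; (4) $\Psi_\lambda$ maps each leaf of $J^-_0$ to a leaf of $J^-_\lambda$, and similarly for leaves of $J^+_0\cup U^+_0$ (on $J^+$ these are stable manifolds; on $U^+$ they are the leaves of the holomorphic foliation defined by $\partial G^+$, where $G^+(p)=\lim_n d^{-n}\log_+\|H^n(p)\|$); (5) $\Psi_\lambda H_0=H_\lambda\Psi_\lambda$; (6) for $p_0\in J_0$, $q_0\in W^u(p_0)\setminus\{p_0\}$, and the conformal parametrizations $\tau_\lambda:\mathbb C\to W^u(\Psi_\lambda(p_0))$, holomorphic in $(\lambda,z)$, with $\tau_\lambda(0)=\Psi_\lambda(p_0)$ and $\tau_\lambda(1)=\Psi_\lambda(q_0)$, the maps $\tau_\lambda^{-1}\Psi_\lambda\tau_0:\mathbb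 C\to\mathbb C$ form a holomorphic motion with harmonic Beltrami coefficient on $\tau_0^{-1}(W^u(p_0)\setminus J_0)$. *)

theory Defs
  imports "HOL-Analysis.Analysis" "HOL-Computational_Algebra.Polynomial"
begin

section \<open>Complex normed vector spaces and holomorphic maps\<close>

text \<open>
  The library only provides holomorphy for functions of one complex variable. Parameters live in
  \<open>complex ^ 'n\<close>, the phase space is \<open>complex \<times> complex\<close>, and products of the two occur as domains;
  the class equips all of them with their complex scalar multiplication.
\<close>

class complex_normed_vector = real_normed_vector +
  fixes scaleC :: "complex \<Rightarrow> 'a \<Rightarrow> 'a"  (infixr "*\<^sub>C" 75)
  assumes scaleC_add_right: "a *\<^sub>C (x + y) = a *\<^sub>C x + a *\<^sub>C y"
    and scaleC_add_left: "(a + b) *\<^sub>C x = a *\<^sub>C x + b *\<^sub>C x"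
    and scaleC_scaleC: "a *\<^sub>C (b *\<^sub>C x) = (a * b) *\<^sub>C x"
    and scaleR_scaleC: "r *\<^sub>R x = complex_of_real r *\<^sub>C x"
    and norm_scaleC: "norm (a *\<^sub>C x) = cmod a * norm x"

instantiation complex :: complex_normed_vector
begin
definition "scaleC_complex (a::complex) (x::complex) = a * x"
instance
  by standard
    (simp_all add: scaleC_complex_def algebra_simps norm_mult scaleR_conv_of_real)
end

instantiation prod :: (complex_normed_vector, complex_normed_vector) complex_normed_vector
begin
definition "scaleC_prod (a::complex) (x::'a \<times> 'b) = (a *\<^sub>C fst x, a *\<^sub>C snd x)"
instance
proof
  fix a b :: complex and r :: real and x y :: "'a \<times> 'b"
  show "a *\<^sub>C (x + y) = a *\<^sub>C x + a *\<^sub>C y"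
    by (simp add: scaleC_prod_def scaleC_add_right)
  show "(a + b) *\<^sub>C x = a *\<^sub>C x + b *\<^sub>C x"
    by (simp add: scaleC_prod_def scaleC_add_left)
  show "a *\<^sub>C (b *\<^sub>C x) = (a * b) *\<^sub>C x"
    by (simp add: scaleC_prod_def scaleC_scaleC)
  show "r *\<^sub>R x = complex_of_real r *\<^sub>C x"
    by (simp add: scaleC_prod_def scaleR_prod_def scaleR_scaleC)
  have "(norm (a *\<^sub>C x))\<^sup>2 = (cmod a * norm x)\<^sup>2"
    by (simp add: scaleC_prod_def norm_prod_def norm_scaleC power_mult_distrib algebra_simps)
  then show "norm (a *\<^sub>C x) = cmod a * norm x"
    by (simp add: power2_eq_iff_nonneg)
qed
end

instantiation vec :: (complex_normed_vector, finite) complex_normed_vector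
begin
definition "scaleC_vec (a::complex) (x::'a ^ 'b) = (\<chi> i. a *\<^sub>C (x $ i))"
instance
proof
  fix a b :: complex and r :: real and x y :: "'a ^ 'b"
  show "a *\<^sub>C (x + y) = a *\<^sub>C x + a *\<^sub>C y"
    by (simp add: scaleC_vec_def scaleC_add_right vec_eq_iff)
  show "(a + b) *\<^sub>C x = a *\<^sub>C x + b *\<^sub>C x"
    by (simp add: scaleC_vec_def scaleC_add_left vec_eq_iff)
  show "a *\<^sub>C (b *\<^sub>C x) = (a * b) *\<^sub>C x"
    by (simp add: scaleC_vec_def scaleC_scaleC vec_eq_iff)
  show "r *\<^sub>R x = complex_of_real r *\<^sub>C x"
    by (simp add: scaleC_vec_def scaleR_scaleC vec_eq_iff)
  show "norm (a *\<^sub>C x) = cmod a * norm x"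
    by (simp add: scaleC_vec_def norm_vec_def norm_scaleC L2_set_right_distrib)
qed
end

text \<open>Intended for open \<open>S\<close>: complex differentiability at every point of \<open>S\<close>.\<close>

definition holomorphic_map_on ::
    "('a::complex_normed_vector \<Rightarrow> 'b::complex_normed_vector) \<Rightarrow> 'a set \<Rightarrow> bool"  where
  "holomorphic_map_on f S \<longleftrightarrow>
     (\<forall>z\<in>S. \<exists>f'. (f has_derivative f') (at z) \<and> (\<forall>c v. f' (c *\<^sub>C v) = c *\<^sub>C f' v))"

definition csubspace :: "'a::complex_normed_vector set \<Rightarrow> bool" where
  "csubspace E \<longleftrightarrow> 0 \<in> E \<and> (\<forall>x\<in>E. \<forall>y\<in>E. x + y \<in> E) \<and> (\<forall>c. \<forall>x\<in>E. c *\<^sub>C x \<in> E)"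


section \<open>H\'enon maps\<close>

type_synonym C2 = "complex \<times> complex"

definition henon_factor :: "complex poly \<Rightarrow> complex \<Rightarrow> C2 \<Rightarrow> C2" where
  "henon_factor P b = (\<lambda>(x, y). (y, poly P y - b * x))"

definition henon_map :: "nat \<Rightarrow> (C2 \<Rightarrow> C2) \<Rightarrow> bool" where
  "henon_map d H \<longleftrightarrow>
     (\<exists>Fs :: (complex poly \<times> complex) list.
        Fs \<noteq> [] \<and>
        (\<forall>(P, b)\<in>set Fs. lead_coeff P = 1 \<and> degree P \<ge> 2 \<and> b \<noteq> 0) \<and>
        H = foldr (\<lambda>(P, b) G. henon_factor P b \<circ> G) Fs id \<and>
        d = (\<Prod>(P, b)\<leftarrow>Fs. degree P))"

definition K_plus :: "(C2 \<Rightarrow> C2) \<Rightarrow> C2 set" where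
  "K_plus H = {p. bounded (range (\<lambda>n. (H ^^ n) p))}"

definition K_minus :: "(C2 \<Rightarrow> C2) \<Rightarrow> C2 set" where
  "K_minus H = {p. bounded (range (\<lambda>n. (inv H ^^ n) p))}"

definition J_plus :: "(C2 \<Rightarrow> C2) \<Rightarrow> C2 set" where
  "J_plus H = frontier (K_plus H)"

definition J_minus :: "(C2 \<Rightarrow> C2) \<Rightarrow> C2 set" where
  "J_minus H = frontier (K_minus H)"

definition Julia :: "(C2 \<Rightarrow> C2) \<Rightarrow> C2 set" where
  "Julia H = J_plus H \<inter> J_minus H"

definition U_plus :: "(C2 \<Rightarrow> C2) \<Rightarrow> C2 set" where
  "U_plus H = - K_plus H"

definition J_minus_plus :: "(C2 \<Rightarrow> C2) \<Rightarrow> C2 set" where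
  "J_minus_plus H = J_minus H \<inter> U_plus H"

definition hyperbolic :: "(C2 \<Rightarrow> C2) \<Rightarrow> bool" where
  "hyperbolic H \<longleftrightarrow>
     (\<exists>(Es :: C2 \<Rightarrow> C2 set) (Eu :: C2 \<Rightarrow> C2 set) (C :: real) (\<kappa> :: real).
        C > 0 \<and> 0 < \<kappa> \<and> \<kappa> < 1 \<and>
        (\<forall>p\<in>Julia H.
           csubspace (Es p) \<and> csubspace (Eu p) \<and>
           Es p \<inter> Eu p = {0} \<and> (\<forall>w. \<exists>u\<in>Es p. \<exists>v\<in>Eu p. w = u + v) \<and>
           frechet_derivative H (at p) ` Es p = Es (H p) \<and>
           frechet_derivative H (at p) ` Eu p = Eu (H p) \<and>
           (\<forall>n. \<forall>v\<in>Es p. norm (frechet_derivative (H ^^ n) (at p) v) \<le> C * \<kappa> ^ n * norm v) \<and>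
           (\<forall>n. \<forall>v\<in>Eu p. norm (frechet_derivative (inv H ^^ n) (at p) v) \<le> C * \<kappa> ^ n * norm v)))"


section \<open>Stable and unstable manifolds, leaves\<close>

definition W_stable :: "(C2 \<Rightarrow> C2) \<Rightarrow> C2 \<Rightarrow> C2 set" where
  "W_stable H p = {q. (\<lambda>n. dist ((H ^^ n) q) ((H ^^ n) p)) \<longlonglongrightarrow> 0}"

definition W_unstable :: "(C2 \<Rightarrow> C2) \<Rightarrow> C2 \<Rightarrow> C2 set" where
  "W_unstable H p = {q. (\<lambda>n. dist ((inv H ^^ n) q) ((inv H ^^ n) p)) \<longlonglongrightarrow> 0}"

text \<open>
  \<open>W\<^sup>u(p)\<close> is only an injectively immersed copy of the plane, and its topology as a leaf is finer
  than its topology as a subset of the phase space. The leaf topology and the conformal structure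
  are accessed through a conformal parametrization \<open>\<tau>\<close>: a component of \<open>W\<^sup>u(p) \<inter> U\<^sup>+\<close> is the image
  under \<open>\<tau>\<close> of a connected component of \<open>\<tau>\<^sup>-\<^sup>1(U\<^sup>+)\<close> in the plane.
\<close>

definition unstable_param :: "(C2 \<Rightarrow> C2) \<Rightarrow> C2 \<Rightarrow> (complex \<Rightarrow> C2) \<Rightarrow> bool" where
  "unstable_param H p \<tau> \<longleftrightarrow>
     holomorphic_map_on \<tau> UNIV \<and> inj \<tau> \<and> (\<forall>z. frechet_derivative \<tau> (at z) 1 \<noteq> 0) \<and>
     range \<tau> = W_unstable H p"

definition saddle_periodic :: "(C2 \<Rightarrow> C2) \<Rightarrow> C2 \<Rightarrow> bool" where
  "saddle_periodic H p \<longleftrightarrow>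
     (\<exists>n>0. (H ^^ n) p = p \<and>
        (\<exists>\<alpha> \<beta> v w. cmod \<alpha> < 1 \<and> 1 < cmod \<beta> \<and> v \<noteq> 0 \<and> w \<noteq> 0 \<and>
           frechet_derivative (H ^^ n) (at p) v = \<alpha> *\<^sub>C v \<and>
           frechet_derivative (H ^^ n) (at p) w = \<beta> *\<^sub>C w))"

definition unstably_connected :: "(C2 \<Rightarrow> C2) \<Rightarrow> bool" where
  "unstably_connected H \<longleftrightarrow>
     (\<exists>p \<tau> C. saddle_periodic H p \<and> unstable_param H p \<tau> \<and>
        C \<in> components (\<tau> -` U_plus H) \<and> simply_connected C)"

definition leaves_J_minus :: "(C2 \<Rightarrow> C2) \<Rightarrow> C2 set set" where
  "leaves_J_minus H = W_unstable H ` Julia H"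

text \<open>The leaves of \<open>J\<^sup>-\<^sub>+\<close> are the sets \<open>\<tau> ` C\<close> with \<open>leaf_chart H \<tau> C\<close>.\<close>

definition leaf_chart :: "(C2 \<Rightarrow> C2) \<Rightarrow> (complex \<Rightarrow> C2) \<Rightarrow> complex set \<Rightarrow> bool" where
  "leaf_chart H \<tau> C \<longleftrightarrow>
     (\<exists>p\<in>Julia H. unstable_param H p \<tau> \<and> C \<in> components (\<tau> -` U_plus H))"

definition holomorphic_on_leaves_J_minus_plus :: "(C2 \<Rightarrow> C2) \<Rightarrow> (C2 \<Rightarrow> C2) \<Rightarrow> bool" where
  "holomorphic_on_leaves_J_minus_plus H f \<longleftrightarrow>
     (\<forall>\<tau> C. leaf_chart H \<tau> C \<longrightarrow> holomorphic_map_on (f \<circ> \<tau>) C)"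

definition green_plus :: "nat \<Rightarrow> (C2 \<Rightarrow> C2) \<Rightarrow> C2 \<Rightarrow> real" where
  "green_plus d H p = lim (\<lambda>n. max 0 (ln (norm ((H ^^ n) p))) / real d ^ n)"

text \<open>The (1,0)-part \<open>\<partial>G\<close> of the differential of a real function \<open>G\<close>, as a complex linear form.\<close>

definition del_form :: "(C2 \<Rightarrow> real) \<Rightarrow> C2 \<Rightarrow> C2 \<Rightarrow> complex" where
  "del_form G p v =
     (complex_of_real (frechet_derivative G (at p) v)
       - \<i> * complex_of_real (frechet_derivative G (at p) (\<i> *\<^sub>C v))) / 2"

text \<open>
  The leaf through \<open>p\<close> of the foliation of \<open>U\<^sup>+\<close> with tangent spaces \<open>ker \<partial>G\<^sup>+\<close>: all points reached
  from \<open>p\<close> along differentiable paths tangent to the foliation.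
\<close>

definition green_leaf :: "nat \<Rightarrow> (C2 \<Rightarrow> C2) \<Rightarrow> C2 \<Rightarrow> C2 set" where
  "green_leaf d H p =
     {q. \<exists>\<gamma> :: real \<Rightarrow> C2. \<gamma> C1_differentiable_on {0..1} \<and> \<gamma> 0 = p \<and> \<gamma> 1 = q \<and>
           \<gamma> ` {0..1} \<subseteq> U_plus H \<and>
           (\<forall>t\<in>{0..1}. del_form (green_plus d H) (\<gamma> t) (vector_derivative \<gamma> (at t)) = 0)}"

definition leaves_plus :: "nat \<Rightarrow> (C2 \<Rightarrow> C2) \<Rightarrow> C2 set set" where
  "leaves_plus d H = W_stable H ` Julia H \<union> green_leaf d H ` U_plus H"


section \<open>The solenoidal map\<close>

definition Sigma_plus :: "nat \<Rightarrow> (int \<Rightarrow> complex) set" where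
  "Sigma_plus d = {z. \<forall>t. z t \<notin> cball 0 1 \<and> z (t + 1) = z t ^ d}"

definition V_plus :: "real \<Rightarrow> C2 set" where
  "V_plus R = {(x, y). cmod y \<ge> cmod x \<and> cmod y \<ge> R}"

text \<open>
  \<open>\<phi>\<^sup>+\<close> on \<open>V\<^sup>+\<close>. "The root is chosen to approximate \<open>y\<close>" means: \<open>(\<pi>\<^sub>y H\<^sup>n)\<close> to the power
  \<open>1/d\<^sup>n\<close> is the continuous branch on \<open>V\<^sup>+\<close> that is asymptotic to \<open>y\<close> at infinity. (It is not
  in general the root nearest to \<open>y\<close>, as the roots become dense on a circle when \<open>n\<close> grows.)
\<close>

definition phi_plus_on_V :: "nat \<Rightarrow> (C2 \<Rightarrow> C2) \<Rightarrow> real \<Rightarrow> (C2 \<Rightarrow> complex) \<Rightarrow> bool" where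
  "phi_plus_on_V d H R \<phi> \<longleftrightarrow>
     (\<exists>f :: nat \<Rightarrow> C2 \<Rightarrow> complex.
        (\<forall>n. continuous_on (V_plus R) (f n) \<and>
             (\<forall>p\<in>V_plus R. f n p ^ (d ^ n) = snd ((H ^^ n) p)) \<and>
             ((\<lambda>p. f n p / snd p) \<longlongrightarrow> 1) (inf at_infinity (principal (V_plus R)))) \<and>
        (\<forall>p\<in>V_plus R. (\<lambda>n. f n p) \<longlonglongrightarrow> \<phi> p))"

text \<open>
  \<open>\<phi>\<close> is the continuous extension of \<open>\<phi>\<^sup>+\<close> from \<open>J\<^sup>- \<inter> V\<^sup>+\<close> to \<open>J\<^sup>-\<^sub>+\<close> (values outside \<open>J\<^sup>-\<^sub>+\<close> are
  irrelevant); any \<open>R > 0\<close> with the two stated inclusions is large enough and gives the same \<open>\<phi>\<close>.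
\<close>

definition phi_plus_extension :: "nat \<Rightarrow> (C2 \<Rightarrow> C2) \<Rightarrow> (C2 \<Rightarrow> complex) \<Rightarrow> bool" where
  "phi_plus_extension d H \<phi> \<longleftrightarrow>
     (\<exists>R>0. V_plus R \<subseteq> U_plus H \<and> H ` V_plus R \<subseteq> V_plus R \<and>
        (\<exists>\<phi>\<^sub>V. phi_plus_on_V d H R \<phi>\<^sub>V \<and> (\<forall>p\<in>J_minus H \<inter> V_plus R. \<phi> p = \<phi>\<^sub>V p))) \<and>
     continuous_on (J_minus_plus H) \<phi> \<and>
     \<phi> ` J_minus_plus H \<subseteq> - cball 0 1 \<and>
     (\<forall>p\<in>J_minus_plus H. \<phi> (H p) = \<phi> p ^ d)"

definition int_iterate :: "('a \<Rightarrow> 'a) \<Rightarrow> int \<Rightarrow> 'a \<Rightarrow> 'a" where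
  "int_iterate H t = (if t \<ge> 0 then H ^^ nat t else inv H ^^ nat (- t))"

definition solenoidal_map :: "nat \<Rightarrow> (C2 \<Rightarrow> C2) \<Rightarrow> (C2 \<Rightarrow> int \<Rightarrow> complex) \<Rightarrow> bool" where
  "solenoidal_map d H \<Phi> \<longleftrightarrow>
     \<Phi> ` J_minus_plus H \<subseteq> Sigma_plus d \<and>
     (\<exists>\<phi>. phi_plus_extension d H \<phi> \<and>
        (\<forall>p\<in>J_minus_plus H. \<forall>t. \<Phi> p t = \<phi> (int_iterate H t p)))"


section \<open>Holomorphic motions and harmonic Beltrami coefficients\<close>

text \<open>Only motions of plane sets with finite values occur below.\<close>

definition holomorphic_motion ::
    "'p::complex_normed_vector set \<Rightarrow> complex set \<Rightarrow> ('p \<Rightarrow> complex \<Rightarrow> complex) \<Rightarrow> bool" where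
  "holomorphic_motion \<Delta> E \<alpha> \<longleftrightarrow>
     (\<forall>z\<in>E. \<alpha> 0 z = z) \<and> (\<forall>l\<in>\<Delta>. inj_on (\<alpha> l) E) \<and>
     (\<forall>z\<in>E. holomorphic_map_on (\<lambda>l. \<alpha> l z) \<Delta>)"

text \<open>The density of curvature \<open>-1\<close>, through the universal covering of each component of \<open>U\<close>.\<close>

definition hyperbolic_density :: "complex set \<Rightarrow> (complex \<Rightarrow> real) \<Rightarrow> bool" where
  "hyperbolic_density U \<rho> \<longleftrightarrow>
     (\<forall>z\<in>U. \<exists>\<pi>. \<pi> holomorphic_on ball 0 1 \<and>
        covering_space (ball 0 1) \<pi> (connected_component_set U z) \<and>
        \<pi> 0 = z \<and> \<rho> z = 2 / cmod (deriv \<pi> 0))"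

definition harmonic_beltrami :: "complex set \<Rightarrow> (complex \<Rightarrow> complex) \<Rightarrow> bool" where
  "harmonic_beltrami U \<mu> \<longleftrightarrow> open U \<and>
     (\<exists>\<nu> \<rho>. \<nu> holomorphic_on U \<and> hyperbolic_density U \<rho> \<and>
        (\<forall>z\<in>U. \<mu> z = cnj (\<nu> z) / complex_of_real ((\<rho> z)\<^sup>2)))"

definition d_z :: "(complex \<Rightarrow> complex) \<Rightarrow> complex \<Rightarrow> complex" where
  "d_z f z = (frechet_derivative f (at z) 1 - \<i> * frechet_derivative f (at z) \<i>) / 2"

definition d_zbar :: "(complex \<Rightarrow> complex) \<Rightarrow> complex \<Rightarrow> complex" where
  "d_zbar f z = (frechet_derivative f (at z) 1 + \<i> * frechet_derivative f (at z) \<i>) / 2"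

text \<open>
  \<open>\<mu>\<close> is the Beltrami coefficient of \<open>f\<close> on \<open>U\<close>. This is used only for maps \<open>f\<close> belonging to a
  holomorphic motion of the plane; they are quasiconformal, hence differentiable almost everywhere
  with \<open>f\<^sub>z \<noteq> 0\<close> almost everywhere, and their Beltrami coefficient is the quotient of the pointwise
  derivatives.
\<close>

definition has_beltrami_coeff_on ::
    "(complex \<Rightarrow> complex) \<Rightarrow> complex set \<Rightarrow> (complex \<Rightarrow> complex) \<Rightarrow> bool" where
  "has_beltrami_coeff_on f U \<mu> \<longleftrightarrow>
     (AE z in lborel. z \<in> U \<longrightarrow>
        f differentiable (at z) \<and> d_z f z \<noteq> 0 \<and> \<mu> z = d_zbar f z / d_z f z)"


section \<open>Families and the Buzzard--Verma motion\<close>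

definition polydisk :: "('n::finite \<Rightarrow> real) \<Rightarrow> (complex ^ 'n) set" where
  "polydisk r = {l. \<forall>i. cmod (l $ i) < r i}"

definition henon_family ::
    "nat \<Rightarrow> 'p::complex_normed_vector set \<Rightarrow> ('p \<Rightarrow> C2 \<Rightarrow> C2) \<Rightarrow> bool" where
  "henon_family d W H \<longleftrightarrow> open W \<and>
     (\<forall>l\<in>W. henon_map d (H l)) \<and>
     holomorphic_map_on (\<lambda>(l, p). H l p) (W \<times> UNIV)"

definition motion_domain :: "(C2 \<Rightarrow> C2) \<Rightarrow> C2 set" where
  "motion_domain H = J_plus H \<union> U_plus H \<union> J_minus H"

definition buzzard_verma_motion ::
    "nat \<Rightarrow> 'p::complex_normed_vector set \<Rightarrow> ('p \<Rightarrow> C2 \<Rightarrow> C2) \<Rightarrow> ('p \<Rightarrow> C2 \<Rightarrow> C2) \<Rightarrow> bool" where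
  "buzzard_verma_motion d \<Delta> H \<Psi> \<longleftrightarrow>
     (\<forall>p\<in>motion_domain (H 0). \<Psi> 0 p = p) \<and>
     (\<forall>l\<in>\<Delta>. \<exists>\<Psi>'. homeomorphism (motion_domain (H 0)) (motion_domain (H l)) (\<Psi> l) \<Psi>') \<and>
     (\<forall>p\<in>motion_domain (H 0). holomorphic_map_on (\<lambda>l. \<Psi> l p) \<Delta>) \<and>
     (\<forall>l\<in>\<Delta>. (\<forall>L\<in>leaves_J_minus (H 0). \<Psi> l ` L \<in> leaves_J_minus (H l)) \<and>
              (\<forall>L\<in>leaves_plus d (H 0). \<Psi> l ` L \<in> leaves_plus d (H l))) \<and>
     (\<forall>l\<in>\<Delta>. \<forall>p\<in>motion_domain (H 0). \<Psi> l (H 0 p) = H l (\<Psi> l p)) \<and>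
     (\<forall>p\<^sub>0\<in>Julia (H 0). \<forall>q\<^sub>0\<in>W_unstable (H 0) p\<^sub>0 - {p\<^sub>0}.
        \<exists>\<tau> :: 'p \<Rightarrow> complex \<Rightarrow> C2.
          (\<forall>l\<in>\<Delta>. unstable_param (H l) (\<Psi> l p\<^sub>0) (\<tau> l) \<and> \<tau> l 0 = \<Psi> l p\<^sub>0 \<and> \<tau> l 1 = \<Psi> l q\<^sub>0) \<and>
          holomorphic_map_on (\<lambda>(l, z). \<tau> l z) (\<Delta> \<times> UNIV) \<and>
          holomorphic_motion \<Delta> UNIV (\<lambda>l z. inv (\<tau> l) (\<Psi> l (\<tau> 0 z))) \<and>
          (\<forall>l\<in>\<Delta>. \<exists>\<mu>.
             has_beltrami_coeff_on (\<lambda>z. inv (\<tau> l) (\<Psi> l (\<tau> 0 z)))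
               (\<tau> 0 -` (W_unstable (H 0) p\<^sub>0 - Julia (H 0))) \<mu> \<and>
             harmonic_beltrami (\<tau> 0 -` (W_unstable (H 0) p\<^sub>0 - Julia (H 0))) \<mu>))"

end

theory Submission
 imports Defs "HOL-Complex_Analysis.Complex_Analysis"
begin


text \<open>
  Let \<open>G\<close> be the Green function of the forward escaping set and \<open>\<phi>\<close> the Boettcher coordinate near infinity,
  so that \<open>ln \<bar>\<phi>\<bar> = G\<close> and \<open>\<phi> \<circ> H = \<phi> ^ d\<close>. The proof shows that the motion \<open>\<Psi>\<close> preserves \<open>G\<close> and \<open>\<phi>\<close>.

  \<^emph>\<open>Levels of the Green function.\<close> A leaf of the foliation given by \<open>\<partial>G\<close> is dense in its level set of \<open>G\<close>,
  and \<open>\<Psi>\<close> maps leaves to leaves. Hence \<open>\<Psi>\<close> maps levels to levels (\<open>green_eq_iff\<close>). On a disk of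
  parameters \<open>\<zeta>\<close>, the Green function at the moving point is harmonic in \<open>\<zeta>\<close>; it is the real part of a
  holomorphic function \<open>A x \<zeta>\<close> that depends on the level \<open>x\<close> of the initial point only. Comparison of
  moduli gives, near infinity, \<open>\<phi> (\<Psi> p) = \<phi> p * exp (A x \<zeta> - x)\<close> (\<open>exp_A\<close>). Moreover \<open>A (d x) \<zeta> = d (A x \<zeta>)\<close> by
  conjugacy, and \<open>A\<close> is Lipschitz in \<open>x\<close> by a Harnack estimate.

  \<^emph>\<open>Rigidity.\<close> Unstable connectedness provides a simply connected component of an unstable manifold in
  \<open>U\<^sup>+\<close>. On it \<open>\<phi>\<close> has a logarithm \<open>X\<close>, with \<open>Re X = G\<close>, in which the motion is \<open>X \<mapsto> X + A (Re X) - Re X\<close>.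
  With \<open>m = (A' - 1) / (A' + 1)\<close> its Beltrami coefficient is \<open>m (Re X)\<close> times the quotient of the
  conjugate of \<open>X'\<close> by \<open>X'\<close>. If this is harmonic, given by a holomorphic \<open>\<nu>\<close>, then the argument of \<open>\<nu> / X'\<^sup>2\<close>
  depends on \<open>Re X\<close> only, which forces \<open>\<nu> / X'\<^sup>2 = c exp (\<i> a X)\<close> with \<open>a\<close> real. Since \<open>m (d x) = m x\<close>, it follows that
  \<open>a = 0\<close>, then \<open>m x = O(x\<^sup>2)\<close> by the Schwarz lemma, and then \<open>m = 0\<close> by invariance again. So \<open>A' = 1\<close> almost
  everywhere, and \<open>A x = x\<close> (\<open>radial_identity\<close>, \<open>unstable_rigidity\<close>).

  \<^emph>\<open>The solenoidal maps.\<close> Now \<open>\<Psi>\<close> preserves \<open>\<phi>\<close> near infinity, so the continuous extensions of \<open>\<phi>\<close> to \<open>J\<^sup>-\<^sub>+\<close>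
  agree along the motion up to a locally constant root of unity. It equals 1 far out, and the set where
  it differs from 1 would contain a point of locally maximal norm in \<open>J\<^sup>-\<close>; the maximum principle
  excludes this (\<open>J_minus_no_norm_max\<close>, \<open>locally_constant_root_eq_1\<close>). Finally, on a leaf the motion is a
  continuous injective lift of a holomorphic map through a holomorphic map, hence is itself
  holomorphic (\<open>holomorphic_lift\<close>).
\<close>

section \<open>Holomorphic maps between complex normed spaces\<close>

abbreviation "hmap \<equiv> holomorphic_map_on"

lemma hmap_subset:
 "hmap f T ==> S \<subseteq> T ==> hmap f S" unfolding holomorphic_map_on_def by blast

lemma hmap_continuous_on:
 "hmap f S ==> continuous_on S f" unfolding holomorphic_map_on_def continuous_on_eq_continuous_within
 by (meson continuous_at_imp_continuous_within has_derivative_continuous)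

lemma hmap_cong:
 assumes "hmap f S" "open S" "\<And>z. z \<in> S ==> f z = g z"
 shows "hmap g S" using assms unfolding holomorphic_map_on_def by (metis has_derivative_transform_within_open)

lemma hmap_compose:
 assumes "hmap f S" "hmap g T" "f ` S \<subseteq> T"
 shows "hmap (\<lambda>z. g (f z)) S" unfolding holomorphic_map_on_def
proof
 fix z assume z: "z \<in> S"
 obtain f' where f': "(f has_derivative f') (at z)" "\<And>c v. f' (c *\<^sub>C v) = c *\<^sub>C f' v"
  using assms(1) z unfolding holomorphic_map_on_def by blast
 obtain g' where g': "(g has_derivative g') (at (f z))" "\<And>c v. g' (c *\<^sub>C v) = c *\<^sub>C g' v"
  using assms(2,3) z unfolding holomorphic_map_on_def by blast
 have "((\<lambda>z. g (f z)) has_derivative (\<lambda>v. g' (f' v))) (at z)" by (rule has_derivative_compose[OF f'(1) g'(1)])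
 thus "\<exists>h'. ((\<lambda>z. g (f z)) has_derivative h') (at z) & (\<forall>c v. h' (c *\<^sub>C v) = c *\<^sub>C h' v)"
  by (intro exI[of _ "\<lambda>v. g' (f' v)"]) (simp add: f'(2) g'(2))
qed

lemma hmap_complex:
 fixes f :: "complex => complex"
 assumes "open S"
 shows "hmap f S \<longleftrightarrow> f holomorphic_on S"
proof
 assume h: "hmap f S"
 show "f holomorphic_on S" unfolding holomorphic_on_open[OF assms]
 proof
  fix z assume "z \<in> S"
  then obtain f' where f': "(f has_derivative f') (at z)" "\<And>c v. f' (c *\<^sub>C v) = c *\<^sub>C f' v"
   using h unfolding holomorphic_map_on_def by blast
  have "f' c = f' 1 * c" for c using f'(2)[of c 1] by (simp add: scaleC_complex_def mult.commute)
  hence "f' = (*) (f' 1)" by (rule ext)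
  with f'(1) have "(f has_field_derivative f' 1) (at z)" unfolding has_field_derivative_def by simp
  thus "\<exists>D. (f has_field_derivative D) (at z)" ..
 qed
next
 assume h: "f holomorphic_on S"
 show "hmap f S" unfolding holomorphic_map_on_def
 proof
  fix z assume "z \<in> S"
  then obtain D where "(f has_field_derivative D) (at z)" using h unfolding holomorphic_on_open[OF assms] by blast
  thus "\<exists>f'. (f has_derivative f') (at z) & (\<forall>c v. f' (c *\<^sub>C v) = c *\<^sub>C f' v)"
   unfolding has_field_derivative_def by (auto simp: scaleC_complex_def)
 qed
qed

lemma hmap_Pair:
 assumes "hmap f S" "hmap g S"
 shows "hmap (\<lambda>z. (f z, g z)) S" unfolding holomorphic_map_on_def
proof
 fix z assume z: "z \<in> S"
 obtain f' where f': "(f has_derivative f') (at z)" "\<And>c v. f' (c *\<^sub>C v) = c *\<^sub>C f' v"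
  using assms(1) z unfolding holomorphic_map_on_def by blast
 obtain g' where g': "(g has_derivative g') (at z)" "\<And>c v. g' (c *\<^sub>C v) = c *\<^sub>C g' v"
  using assms(2) z unfolding holomorphic_map_on_def by blast
 have "((\<lambda>z. (f z, g z)) has_derivative (\<lambda>v. (f' v, g' v))) (at z)" by (rule has_derivative_Pair[OF f'(1) g'(1)])
 thus "\<exists>h'. ((\<lambda>z. (f z, g z)) has_derivative h') (at z) & (\<forall>c v. h' (c *\<^sub>C v) = c *\<^sub>C h' v)"
  by (intro exI[of _ "\<lambda>v. (f' v, g' v)"]) (simp add: scaleC_prod_def f'(2) g'(2))
qed

lemma hmap_fst: "hmap fst S" unfolding holomorphic_map_on_def
 by (auto intro!: exI[of _ fst] derivative_eq_intros simp: scaleC_prod_def)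

lemma hmap_snd: "hmap snd S" unfolding holomorphic_map_on_def
 by (auto intro!: exI[of _ snd] derivative_eq_intros simp: scaleC_prod_def)

lemma hmap_id: "hmap (\<lambda>z. z) S" unfolding holomorphic_map_on_def
 by (auto intro!: exI[of _ "\<lambda>v. v"] derivative_eq_intros)

lemma scaleC_zero_right [simp]: "c *\<^sub>C (0::'a::complex_normed_vector) = 0"
 by (metis add_cancel_right_right scaleC_add_right)

lemma hmap_funpow:
 fixes F :: "'a::complex_normed_vector => 'a"
 assumes "hmap F UNIV" shows "hmap (F ^^ n) UNIV"
proof (induction n)
 case 0
 thus ?case using hmap_id[of UNIV] by (simp add: id_def)
next
 case (Suc n)
 thus ?case using hmap_compose[OF Suc assms] by (simp add: o_def)
qed

lemma hmap_const: "hmap (\<lambda>z. c) S" unfolding holomorphic_map_on_def by (auto intro!: exI[of _ "\<lambda>v. 0"])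

lemma scaleC_zero_left [simp]: "0 *\<^sub>C (x::'a::complex_normed_vector) = 0"
 by (metis add_cancel_right_right scaleC_add_left)

lemma scaleC_one [simp]: "1 *\<^sub>C (x::'a::complex_normed_vector) = x" using scaleR_scaleC[of 1 x] by simp

lemma scaleC_minus_right: "a *\<^sub>C (- x) = - (a *\<^sub>C (x::'a::complex_normed_vector))"
 by (metis add.right_inverse add_eq_0_iff scaleC_add_right scaleC_zero_right)

lemma scaleC_diff_right: "a *\<^sub>C (x - y) = a *\<^sub>C x - a *\<^sub>C (y::'a::complex_normed_vector)"
 using scaleC_add_right[of a x "- y"] by (simp add: scaleC_minus_right)

lemma bounded_linear_scaleC_left: "bounded_linear (\<lambda>\<zeta>. \<zeta> *\<^sub>C (v::'a::complex_normed_vector))"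
proof (rule bounded_linear_intro[where K = "norm v"])
 fix r :: real and x :: complex
 show "(r *\<^sub>R x) *\<^sub>C v = r *\<^sub>R (x *\<^sub>C v)"
  using scaleC_scaleC[of "complex_of_real r" x v] by (simp add: scaleR_scaleC scaleC_complex_def)
qed (auto simp: scaleC_add_left norm_scaleC)

lemma has_derivative_complex_line:
 "((\<lambda>\<zeta>. p + \<zeta> *\<^sub>C v) has_derivative (\<lambda>\<zeta>. \<zeta> *\<^sub>C v)) (at z)" for p v :: "'a::complex_normed_vector"
 by (auto intro!: derivative_eq_intros bounded_linear.has_derivative[OF bounded_linear_scaleC_left])

lemma hmap_complex_line:
 "hmap (\<lambda>\<zeta>. p + \<zeta> *\<^sub>C v) S" for p v :: "'a::complex_normed_vector" unfolding holomorphic_map_on_def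
 by (auto intro!: exI[of _ "\<lambda>\<zeta>. \<zeta> *\<^sub>C v"] has_derivative_complex_line
   simp: scaleC_scaleC scaleC_complex_def)

lemma holomorphic_on_complex_line:
 fixes f :: "'a::complex_normed_vector => complex"
 assumes "hmap f S" "open T" "\<And>\<zeta>. \<zeta> \<in> T ==> p + \<zeta> *\<^sub>C v \<in> S"
 shows "(\<lambda>\<zeta>. f (p + \<zeta> *\<^sub>C v)) holomorphic_on T" unfolding hmap_complex[OF assms(2), symmetric]
 by (rule hmap_compose[OF hmap_complex_line assms(1)])
   (use assms(3) in auto)

lemma hmap_poly:
 fixes P :: "complex poly"
 assumes "hmap f S"
 shows "hmap (\<lambda>z. poly P (f z)) S"
proof -
 have "\<exists>D. (poly P has_field_derivative D) (at z)" for z using poly_DERIV by blast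
 hence "hmap (poly P) UNIV" by (simp add: hmap_complex holomorphic_on_open)
 from hmap_compose[OF assms this] show ?thesis by simp
qed

lemma hmap_add:
 assumes "hmap f S" "hmap g S"
 shows "hmap (\<lambda>z. f z + g z) S"
proof -
 have "hmap (\<lambda>p::'b::complex_normed_vector \<times> 'b. fst p + snd p) UNIV" unfolding holomorphic_map_on_def
  by (auto intro!: exI[of _ "\<lambda>v. fst v + snd v"] derivative_eq_intros simp: scaleC_prod_def scaleC_add_right)
 from hmap_compose[OF hmap_Pair[OF assms] this] show ?thesis by simp
qed

lemma hmap_diff:
 assumes "hmap f S" "hmap g S"
 shows "hmap (\<lambda>z. f z - g z) S"
proof -
 have "hmap (\<lambda>p::'b::complex_normed_vector \<times> 'b. fst p - snd p) UNIV" unfolding holomorphic_map_on_def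
  by (auto intro!: exI[of _ "\<lambda>v. fst v - snd v"] derivative_eq_intros simp: scaleC_prod_def scaleC_diff_right)
 from hmap_compose[OF hmap_Pair[OF assms] this] show ?thesis by simp
qed

lemma hmap_mult:
 fixes f g :: "'a::complex_normed_vector => complex"
 assumes "hmap f S" "hmap g S"
 shows "hmap (\<lambda>z. f z * g z) S"
proof -
 have "hmap (\<lambda>p::C2. fst p * snd p) UNIV" unfolding holomorphic_map_on_def
 proof
  fix p :: C2
  show "\<exists>h'. ((\<lambda>p. fst p * snd p) has_derivative h') (at p) & (\<forall>c v. h' (c *\<^sub>C v) = c *\<^sub>C h' v)"
   by (intro exI[of _ "\<lambda>v. fst p * snd v + fst v * snd p"])
     (auto intro!: derivative_eq_intros simp: scaleC_prod_def scaleC_complex_def algebra_simps)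
 qed
 from hmap_compose[OF hmap_Pair[OF assms] this] show ?thesis by simp
qed

lemma ball_subset_double: "q \<in> cball p r ==> ball q r \<subseteq> ball (p::'a::metric_space) (2 * r)"
 using dist_triangle_less_add by (auto simp: subset_iff) (smt (verit) dist_commute dist_triangle)

text \<open>Cauchy's estimate along the complex line through \<open>p\<close> in direction \<open>h\<close>.\<close>

lemma hmap_derivative_bound:
 fixes f :: "'a::complex_normed_vector => complex"
 assumes hol: "hmap f (ball p r)" and "r > 0"
  and bnd: "\<And>q. q \<in> ball p r ==> cmod (f q) <= B"
  and der: "(f has_derivative f') (at p)"
 shows "cmod (f' h) <= 2 * B / r * norm h"
proof (cases "h = 0")
 case True
 have "linear f'" using der has_derivative_linear by blast
 thus ?thesis using True by (simp add: linear_0)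
next
 case False
 define s where "s = r / (2 * norm h)"
 have s: "s > 0" using False \<open>r > 0\<close> by (simp add: s_def)
 define g where "g = (\<lambda>\<zeta>. f (p + \<zeta> *\<^sub>C h))"
 have in_ball: "p + \<zeta> *\<^sub>C h \<in> ball p r" if "cmod \<zeta> < 2 * s" for \<zeta>
 proof -
  have "cmod \<zeta> * norm h < 2 * s * norm h" using that False by simp
  also have "... = r" using False by (simp add: s_def)
  finally show ?thesis by (simp add: dist_norm norm_scaleC)
 qed
 have g: "g holomorphic_on ball 0 (2 * s)"
  unfolding g_def by (rule holomorphic_on_complex_line[OF hol]) (use in_ball in auto)
 have "norm ((deriv ^^ 1) g 0) <= fact 1 * B / s ^ 1"
 proof (rule Cauchy_inequality)
  show "g holomorphic_on ball 0 s" using g by (rule holomorphic_on_subset) (use s in auto)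
  show "continuous_on (cball 0 s) g"
   using holomorphic_on_imp_continuous_on[OF g] by (rule continuous_on_subset) (use s in auto)
  show "norm (g x) <= B" if "norm (0 - x) = s" for x unfolding g_def using that s in_ball[of x] bnd by auto
 qed (use s in auto)
 moreover have "(g has_derivative (\<lambda>\<zeta>. f' (\<zeta> *\<^sub>C h))) (at 0)" unfolding g_def
  by (rule has_derivative_compose[OF has_derivative_complex_line]) (use der in simp)
 moreover have "(g has_derivative (*) (deriv g 0)) (at 0)"
  using holomorphic_derivI[OF g, of 0] s by (simp add: has_field_derivative_def)
 ultimately have "(\<lambda>\<zeta>. f' (\<zeta> *\<^sub>C h)) = (*) (deriv g 0)" and *: "norm (deriv g 0) <= B / s"
  using has_derivative_unique by auto
 from fun_cong[OF this(1), of 1] have "norm (f' h) <= B / s" using * by simp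
 also have "... = 2 * B / r * norm h" by (simp add: s_def)
 finally show ?thesis .
qed

text \<open>Cauchy's estimate turns the summable bound on the terms into one on their derivatives.\<close>

lemma hmap_suminf:
 fixes f :: "nat => 'a::complex_normed_vector => complex"
 assumes "open S" and hol: "\<And>n. hmap (f n) S"
  and bnd: "\<And>n p. p \<in> S ==> cmod (f n p) <= c n" and c: "summable c"
 shows "hmap (\<lambda>p. \<Sum>n. f n p) S" unfolding holomorphic_map_on_def
proof
 fix p assume p: "p \<in> S"
 then obtain e where e: "e > 0" "ball p e \<subseteq> S" using \<open>open S\<close> open_contains_ball by blast
 define r where "r = e / 2"
 have r: "r > 0" using e by (simp add: r_def)
 have inS: "ball q r \<subseteq> S" if "q \<in> ball p r" for q using ball_subset_double[of q p r] that e(2) by (auto simp: r_def)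
 have cS: "q \<in> S" if "q \<in> ball p r" for q using inS[OF that] r by (meson centre_in_ball subsetD)
 define D where "D n q = (SOME f'. (f n has_derivative f') (at q) & (\<forall>c v. f' (c *\<^sub>C v) = c *\<^sub>C f' v))" for n q
 have D: "(f n has_derivative D n q) (at q)" "D n q (c *\<^sub>C v) = c *\<^sub>C D n q v" if "q \<in> S" for n q c v
 proof -
  have "\<exists>f'. (f n has_derivative f') (at q) & (\<forall>c v. f' (c *\<^sub>C v) = c *\<^sub>C f' v)"
   using hol that unfolding holomorphic_map_on_def by blast
  from someI_ex[OF this] show "(f n has_derivative D n q) (at q)" "D n q (c *\<^sub>C v) = c *\<^sub>C D n q v"
   unfolding D_def by blast+
 qed
 define c' where "c' n = 2 * c n / r" for n
 have c': "summable c'" unfolding c'_def using c by (intro summable_divide summable_mult)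
 have Dbnd: "cmod (D n q h) <= c' n * norm h" if "q \<in> ball p r" for n q h unfolding c'_def
 proof (rule hmap_derivative_bound)
  show "hmap (f n) (ball q r)" using hol inS[OF that] by (rule hmap_subset)
  show "(f n has_derivative D n q) (at q)" by (rule D(1)[OF cS[OF that]])
  show "cmod (f n q') <= c n" if "q' \<in> ball q r" for q' using bnd[of q' n] inS[OF \<open>q \<in> ball p r\<close>] that by (meson subsetD)
 qed (use r in auto)
 define g' where "g' q h = (\<Sum>n. D n q h)" for q h :: "'a"
 have sD: "summable (\<lambda>n. D n q h)" if "q \<in> ball p r" for q h
  by (rule summable_comparison_test'[where g = "\<lambda>n. c' n * norm h" and N = 0])
    (simp add: summable_mult2[OF c'], rule Dbnd[OF that])
 have "\<exists>g. \<forall>x\<in>ball p r. (\<lambda>n. f n x) sums (g x) & (g has_derivative g' x) (at x within ball p r)"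
 proof (rule has_derivative_series)
  show "(f n has_derivative D n x) (at x within ball p r)" if "x \<in> ball p r" for n x
   by (rule has_derivative_at_withinI[OF D(1)[OF cS[OF that]]])
  show "\<forall>\<^sub>F n in sequentially. \<forall>x\<in>ball p r. \<forall>h. cmod ((\<Sum>i<n. D i x h) - g' x h) <= \<epsilon> * norm h" if "\<epsilon> > 0" for \<epsilon>
  proof -
   have "(\<lambda>n. \<Sum>i. c' (i + n)) \<longlonglongrightarrow> 0" using suminf_exist_split2[OF c'] .
   hence "\<forall>\<^sub>F n in sequentially. (\<Sum>i. c' (i + n)) < \<epsilon>" using that order_tendstoD(2) by blast
   thus ?thesis
   proof eventually_elim
    case (elim n)
    show ?case
    proof (intro ballI allI)
     fix x h :: 'a assume x: "x \<in> ball p r"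
     have sc0: "summable (\<lambda>i. c' (i + n))" using c' by (simp only: summable_iff_shift)
     have sc: "summable (\<lambda>i. c' (i + n) * norm h)" using sc0 by (rule summable_mult2)
     have "g' x h - (\<Sum>i<n. D i x h) = (\<Sum>i. D (i + n) x h)"
      unfolding g'_def using suminf_minus_initial_segment[OF sD[OF x], of n] by simp
     hence "cmod ((\<Sum>i<n. D i x h) - g' x h) = cmod (\<Sum>i. D (i + n) x h)" by (metis norm_minus_commute)
     also have "... <= (\<Sum>i. c' (i + n) * norm h)" by (rule norm_suminf_le[OF Dbnd[OF x] sc])
     also have "... = (\<Sum>i. c' (i + n)) * norm h" by (rule suminf_mult2[OF sc0, symmetric])
     also have "... <= \<epsilon> * norm h" using elim by (intro mult_right_mono) simp_all
     finally show "cmod ((\<Sum>i<n. D i x h) - g' x h) <= \<epsilon> * norm h" .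
    qed
   qed
  qed
  show "(\<lambda>n. f n p) sums (\<Sum>n. f n p)"
   by (rule summable_sums, rule summable_comparison_test'[OF c, where N = 0]) (rule bnd[OF p])
 qed (use r in simp_all)
 then obtain g where g: "\<And>x. x \<in> ball p r ==> (\<lambda>n. f n x) sums (g x)"
   "\<And>x. x \<in> ball p r ==> (g has_derivative g' x) (at x within ball p r)" by blast
 have "(g has_derivative g' p) (at p)" using g(2)[of p] r at_within_open[of p "ball p r"] by simp
 hence der: "((\<lambda>p. \<Sum>n. f n p) has_derivative g' p) (at p)"
 proof (rule has_derivative_transform_within_open[where s = "ball p r"])
  show "g x = (\<Sum>n. f n x)" if "x \<in> ball p r" for x by (rule sums_unique[OF g(1)[OF that]])
 qed (use r in simp_all)
 have "g' p (c *\<^sub>C v) = c *\<^sub>C g' p v" for c :: complex and v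
 proof -
  have "g' p (c *\<^sub>C v) = (\<Sum>n. c * D n p v)" unfolding g'_def D(2)[OF p] scaleC_complex_def ..
  also have "... = c * g' p v" unfolding g'_def by (rule suminf_mult[OF sD]) (use r in simp)
  finally show ?thesis unfolding scaleC_complex_def .
 qed
 with der show "\<exists>f'. ((\<lambda>p. \<Sum>n. f n p) has_derivative f') (at p) & (\<forall>c v. f' (c *\<^sub>C v) = c *\<^sub>C f' v)"
  by (intro exI[of _ "g' p"] conjI allI)
qed


section \<open>Growth of H\'enon maps and the filtration\<close>

definition size_max :: "C2 => real" where
 "size_max p = max 1 (max (cmod (fst p)) (cmod (snd p)))"

text \<open>
  \<open>F\<close> agrees with \<open>(x, y) \<mapsto> (0, c y\<^sup>e)\<close> up to the next lower power of the size. This is stable under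
  composition, holds for a H\'enon map and, with the coordinates exchanged, for its inverse, and
  yields all escape estimates.
\<close>

definition leading_power :: "complex => nat => real => (C2 => C2) => bool" where
 "leading_power c e M F \<longleftrightarrow>
   (\<forall>p. cmod (snd (F p) - c * snd p ^ e) <= M * size_max p ^ (e - 1) \<and>
     cmod (fst (F p)) <= M * size_max p ^ (e - 1))"

lemma size_max_ge: "1 <= size_max p" "cmod (fst p) <= size_max p" "cmod (snd p) <= size_max p" by (auto simp: size_max_def)

lemma leading_power_mono: "leading_power c e M F ==> M <= M' ==> leading_power c e M' F" unfolding leading_power_def
 by (meson mult_right_mono order_trans size_max_ge(1) zero_le_one zero_le_power)

lemma norm_power_diff_le:
 fixes a b :: complex
 assumes "cmod a <= R" "cmod b <= R"
 shows "cmod (a ^ e - b ^ e) <= real e * cmod (a - b) * R ^ (e - 1)"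
proof (induction e)
 case (Suc e)
 have R: "0 <= R" using assms(1) norm_ge_zero order_trans by blast
 have "a ^ Suc e - b ^ Suc e = a * (a ^ e - b ^ e) + (a - b) * b ^ e" by (simp add: algebra_simps)
 hence "cmod (a ^ Suc e - b ^ Suc e) <= cmod a * cmod (a ^ e - b ^ e) + cmod (a - b) * cmod b ^ e"
  by (metis norm_mult norm_power norm_triangle_ineq)
 also have "... <= R * (real e * cmod (a - b) * R ^ (e - 1)) + cmod (a - b) * R ^ e"
  using assms R Suc.IH by (intro add_mono mult_mono power_mono) auto
 also have "... = real (Suc e) * cmod (a - b) * R ^ (Suc e - 1)" by (cases e) (auto simp: algebra_simps)
 finally show ?case .
qed auto

lemma leading_power_compose:
 assumes F: "leading_power c e M F" and G: "leading_power c' e' M' G" and e: "e >= 1" "e' >= 1"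
 shows "\<exists>N. leading_power (c * c' ^ e) (e * e') N (F \<circ> G)"
proof -
 have nonneg: "0 <= m" if "leading_power c e m f" for c e m f
 proof -
  have "0 <= m * size_max (0, 0) ^ (e - 1)" using that norm_ge_zero order_trans unfolding leading_power_def by blast
  thus ?thesis by (simp add: size_max_def)
 qed
 have M: "0 <= M" and M': "0 <= M'" using nonneg F G by blast+
 define K where "K = max 1 (M' + cmod c')"
 have K: "K >= 1" by (simp add: K_def)
 define N where "N = M * K ^ (e - 1) + cmod c * (real e * M' * K ^ (e - 1))"
 have "cmod (snd (F (G p)) - c * c' ^ e * snd p ^ (e * e')) <= N * size_max p ^ (e * e' - 1) \<and>
    cmod (fst (F (G p))) <= N * size_max p ^ (e * e' - 1)" for p
 proof -
  define s where "s = size_max p"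
  have s: "s >= 1" "cmod (snd p) <= s" using size_max_ge by (auto simp: s_def)
  have G1: "cmod (snd (G p) - c' * snd p ^ e') <= M' * s ^ (e' - 1)"
   and G2: "cmod (fst (G p)) <= M' * s ^ (e' - 1)" using G unfolding leading_power_def s_def by blast+
  have se: "s ^ (e' - 1) <= s ^ e'" using s by (intro power_increasing) auto
  have c's: "cmod (c' * snd p ^ e') <= cmod c' * s ^ e'"
   using s by (auto simp: norm_mult norm_power intro!: mult_left_mono power_mono)
  have "cmod (snd (G p)) <= cmod (snd (G p) - c' * snd p ^ e') + cmod (c' * snd p ^ e')"
   by (metis add.commute norm_triangle_sub)
  also have "... <= M' * s ^ e' + cmod c' * s ^ e'" using G1 c's mult_left_mono[OF se M'] by linarith
  also have "... = (M' + cmod c') * s ^ e'" by (simp add: algebra_simps)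
  also have "... <= K * s ^ e'" using s by (intro mult_right_mono) (auto simp: K_def)
  finally have Y: "cmod (snd (G p)) <= K * s ^ e'" .
  have "M' * s ^ e' <= K * s ^ e'" "cmod c' * s ^ e' <= K * s ^ e'"
   using s M' by (auto simp: K_def le_max_iff_disj intro!: mult_right_mono)
  moreover have "1 * 1 <= K * s ^ e'" using s K by (intro mult_mono) auto
  ultimately have X: "cmod (fst (G p)) <= K * s ^ e'" and cY: "cmod (c' * snd p ^ e') <= K * s ^ e'"
   and one: "1 <= K * s ^ e'" using G2 c's mult_left_mono[OF se M'] by linarith+
  have S: "size_max (G p) <= K * s ^ e'" "0 <= size_max (G p)"
   using X Y one size_max_ge[of "G p"] by (auto simp: size_max_def)
  have exp1: "(s ^ e') ^ (e - 1) <= s ^ (e * e' - 1)"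
  proof -
   have "e' * (e - 1) <= e * e' - 1" using e by (cases e; cases e') (auto simp: algebra_simps)
   thus ?thesis using s by (simp add: power_increasing flip: power_mult)
  qed
  have exp2: "s ^ (e' - 1) * (s ^ e') ^ (e - 1) = s ^ (e * e' - 1)"
  proof -
   have "e' - 1 + e' * (e - 1) = e * e' - 1" using e by (cases e; cases e') (auto simp: algebra_simps)
   thus ?thesis by (simp flip: power_mult power_add)
  qed
  have Spow: "M * size_max (G p) ^ (e - 1) <= M * K ^ (e - 1) * s ^ (e * e' - 1)"
  proof -
   have "size_max (G p) ^ (e - 1) <= (K * s ^ e') ^ (e - 1)" using S by (intro power_mono)
   also have "... <= K ^ (e - 1) * s ^ (e * e' - 1)" using exp1 K by (simp add: power_mult_distrib)
   finally show ?thesis using M by (simp add: mult.assoc mult_left_mono)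
  qed
  have F1: "cmod (snd (F (G p)) - c * snd (G p) ^ e) <= M * K ^ (e - 1) * s ^ (e * e' - 1)"
   and F2: "cmod (fst (F (G p))) <= M * K ^ (e - 1) * s ^ (e * e' - 1)"
   using F Spow unfolding leading_power_def by (meson order_trans)+
  have "cmod (snd (G p) ^ e - (c' * snd p ^ e') ^ e)
    <= real e * cmod (snd (G p) - c' * snd p ^ e') * (K * s ^ e') ^ (e - 1)" by (rule norm_power_diff_le[OF Y cY])
  also have "... <= real e * (M' * s ^ (e' - 1)) * (K * s ^ e') ^ (e - 1)"
   using G1 one by (intro mult_right_mono mult_left_mono) auto
  also have "... = real e * M' * K ^ (e - 1) * s ^ (e * e' - 1)"
   unfolding exp2[symmetric] power_mult_distrib by (simp only: mult_ac)
  finally have P: "cmod (snd (G p) ^ e - (c' * snd p ^ e') ^ e) <= real e * M' * K ^ (e - 1) * s ^ (e * e' - 1)" .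
  have "(c' * snd p ^ e') ^ e = c' ^ e * snd p ^ (e * e')"
   by (simp add: power_mult_distrib mult.commute flip: power_mult)
  hence "snd (F (G p)) - c * c' ^ e * snd p ^ (e * e') =
    (snd (F (G p)) - c * snd (G p) ^ e) + c * (snd (G p) ^ e - (c' * snd p ^ e') ^ e)" by (simp add: right_diff_distrib)
  hence "cmod (snd (F (G p)) - c * c' ^ e * snd p ^ (e * e'))
    <= cmod (snd (F (G p)) - c * snd (G p) ^ e) + cmod c * cmod (snd (G p) ^ e - (c' * snd p ^ e') ^ e)"
   by (metis norm_mult norm_triangle_ineq)
  also have "... <= M * K ^ (e - 1) * s ^ (e * e' - 1) + cmod c * (real e * M' * K ^ (e - 1) * s ^ (e * e' - 1))"
   by (rule add_mono[OF F1 mult_left_mono[OF P norm_ge_zero]])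
  also have "... = N * s ^ (e * e' - 1)" by (simp add: N_def algebra_simps)
  finally have A: "cmod (snd (F (G p)) - c * c' ^ e * snd p ^ (e * e')) <= N * s ^ (e * e' - 1)" .
  have "M * K ^ (e - 1) <= N" using M' K by (simp add: N_def)
  hence "M * K ^ (e - 1) * s ^ (e * e' - 1) <= N * s ^ (e * e' - 1)" using s by (intro mult_right_mono) auto
  with F2 have "cmod (fst (F (G p))) <= N * s ^ (e * e' - 1)" by linarith
  with A show ?thesis by (simp add: s_def)
 qed
 thus ?thesis unfolding leading_power_def o_def by blast
qed

lemma poly_leading_term_bound:
 fixes P :: "complex poly"
 assumes "degree P >= 1"
 shows "\<exists>M\<ge>0. \<forall>y s. cmod y <= s --> 1 <= s -->
      cmod (poly P y - lead_coeff P * y ^ degree P) <= M * s ^ (degree P - 1)"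
proof (intro exI[of _ "\<Sum>i<degree P. cmod (coeff P i)"] conjI allI impI)
 fix y :: complex and s :: real assume y: "cmod y <= s" and s: "1 <= s"
 have "poly P y - lead_coeff P * y ^ degree P = (\<Sum>i<degree P. coeff P i * y ^ i)"
  unfolding poly_altdef by (simp flip: lessThan_Suc_atMost)
 also have "cmod ... <= (\<Sum>i<degree P. cmod (coeff P i) * s ^ (degree P - 1))"
 proof (rule sum_norm_le)
  fix i assume "i \<in> {..<degree P}"
  hence "cmod y ^ i <= s ^ (degree P - 1)" using y s by (intro order_trans[OF power_mono power_increasing]) auto
  thus "cmod (coeff P i * y ^ i) <= cmod (coeff P i) * s ^ (degree P - 1)"
   by (simp add: norm_mult norm_power mult_left_mono)
 qed
 finally show "cmod (poly P y - lead_coeff P * y ^ degree P) \<le>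
   (\<Sum>i<degree P. cmod (coeff P i)) * s ^ (degree P - 1)" by (simp add: sum_distrib_right)
qed (auto intro: sum_nonneg)

lemma leading_power_factor:
 fixes P :: "complex poly"
 assumes "degree P >= 2"
 shows "\<exists>M. leading_power (lead_coeff P) (degree P) M (\<lambda>(x, y). (y, poly P y + a * x))"
proof -
 obtain M where M: "M >= 0" "\<And>y s. cmod y <= s ==> 1 <= s ==>
      cmod (poly P y - lead_coeff P * y ^ degree P) <= M * s ^ (degree P - 1)"
  using poly_leading_term_bound[of P] assms by force
 have "leading_power (lead_coeff P) (degree P) (M + cmod a + 1) (\<lambda>(x, y). (y, poly P y + a * x))"
  unfolding leading_power_def
 proof (intro allI conjI)
  fix p :: C2
  obtain x y where p: "p = (x, y)" by (cases p)
  define s where "s = size_max p"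
  have s: "1 <= s" "cmod x <= s" "cmod y <= s" using size_max_ge[of p] by (auto simp: s_def p)
  have ss: "s <= s ^ (degree P - 1)" using s assms self_le_power[of s "degree P - 1"] by auto
  have "cmod (poly P y + a * x - lead_coeff P * y ^ degree P)
    <= cmod (poly P y - lead_coeff P * y ^ degree P) + cmod a * cmod x"
   by (metis add_diff_eq diff_add_eq norm_mult norm_triangle_ineq)
  also have "... <= M * s ^ (degree P - 1) + cmod a * s ^ (degree P - 1)"
   using M(2)[OF s(3,1)] s ss by (intro add_mono mult_left_mono) auto
  also have "... <= (M + cmod a + 1) * s ^ (degree P - 1)" using s by (simp add: algebra_simps)
  finally show "cmod (snd (case p of (x, y) => (y, poly P y + a * x)) - lead_coeff P * snd p ^ degree P)
    <= (M + cmod a + 1) * size_max p ^ (degree P - 1)" by (simp add: p s_def)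
  have "cmod y <= 1 * s ^ (degree P - 1)" using s ss by simp
  also have "... <= (M + cmod a + 1) * s ^ (degree P - 1)" using M s by (intro mult_right_mono) auto
  finally show "cmod (fst (case p of (x, y) => (y, poly P y + a * x)))
    <= (M + cmod a + 1) * size_max p ^ (degree P - 1)" by (simp add: p s_def)
 qed
 thus ?thesis by blast
qed

definition henon_factor_inv :: "complex poly => complex => C2 => C2" where
 "henon_factor_inv P b = (\<lambda>(x, y). ((poly P x - y) / b, x))"

lemma henon_factor_inverse:
 assumes "b ~= 0"
 shows "henon_factor_inv P b (henon_factor P b p) = p" "henon_factor P b (henon_factor_inv P b p) = p"
 using assms by (auto simp: henon_factor_def henon_factor_inv_def split: prod.splits)

lemma holomorphic_henon_factor: "hmap (henon_factor P b) UNIV"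
proof -
 have "henon_factor P b = (\<lambda>p. (snd p, poly P (snd p) + (- b) * fst p))" by (auto simp: henon_factor_def)
 thus ?thesis by (simp only:) (intro hmap_Pair hmap_add hmap_mult
    hmap_poly hmap_fst hmap_snd hmap_const)
qed

lemma holomorphic_henon_factor_inv: "hmap (henon_factor_inv P b) UNIV"
proof -
 have "henon_factor_inv P b = (\<lambda>p. ((1 / b) * (poly P (fst p) + (- 1) * snd p), fst p))"
  by (auto simp: henon_factor_inv_def)
 thus ?thesis by (simp only:) (intro hmap_Pair hmap_add hmap_mult
    hmap_poly hmap_fst hmap_snd hmap_const)
qed

lemma henon_map_induct [consumes 1, case_names factor compose]:
 assumes "henon_map d H"
  and "\<And>P b. lead_coeff P = 1 ==> degree P >= 2 ==> b ~= 0 ==> Q (degree P) (henon_factor P b)"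
  and "\<And>P b d H. lead_coeff P = 1 ==> degree P >= 2 ==> b ~= 0 ==> henon_map d H ==> Q d H ==>
      Q (degree P * d) (henon_factor P b \<circ> H)"
 shows "Q d H"
proof -
 obtain Fs where Fs: "Fs ~= []" "\<forall>(P, b)\<in>set Fs. lead_coeff P = 1 & degree P >= 2 & b ~= 0"
   "H = foldr (\<lambda>(P, b) G. henon_factor P b \<circ> G) Fs id" "d = (\<Prod>(P, b)\<leftarrow>Fs. degree P)"
  using assms(1) unfolding henon_map_def by blast
 thus ?thesis
 proof (induction Fs arbitrary: d H rule: list_nonempty_induct)
  case (single Pb)
  thus ?case using assms(2) by (auto split: prod.splits)
 next
  case (cons Pb Fs)
  obtain P b where Pb: "Pb = (P, b)" by (cases Pb)
  define H' where "H' = foldr (\<lambda>(P, b) G. henon_factor P b \<circ> G) Fs id"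
  define d' where "d' = (\<Prod>(P, b)\<leftarrow>Fs. degree P)"
  have "henon_map d' H'" unfolding henon_map_def using cons.hyps cons.prems(1)
   by (intro exI[of _ Fs] conjI H'_def d'_def) simp_all
  moreover have "Q d' H'" by (rule cons.IH[OF _ H'_def d'_def]) (use cons.prems(1) in simp)
  ultimately have "Q (degree P * d') (henon_factor P b \<circ> H')" by (intro assms(3)) (use cons.prems in \<open>simp_all add: Pb\<close>)
  moreover have "H = henon_factor P b \<circ> H'" "d = degree P * d'"
   using cons.prems(2,3) by (simp_all add: Pb H'_def d'_def o_def id_def)
  ultimately show ?case by (simp only:)
 qed
qed

lemma henon_map_degree: "henon_map d H ==> d >= 2"
proof (induction rule: henon_map_induct)
 case (compose P b d H)
 have "2 * 1 <= degree P * d" using compose by (intro mult_mono) auto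
 thus ?case by simp
qed auto

definition swap2 :: "C2 => C2" where "swap2 p = (snd p, fst p)"

lemma henon_factor_leading_power:
 fixes P :: "complex poly"
 assumes "lead_coeff P = 1" "degree P >= 2" "b ~= 0"
 shows "\<exists>M. leading_power 1 (degree P) M (henon_factor P b)"
  and "\<exists>M. leading_power (1 / b) (degree P) M (swap2 \<circ> henon_factor_inv P b \<circ> swap2)"
proof -
 define Q where "Q = smult (1 / b) P"
 have Q: "degree Q = degree P" "lead_coeff Q = 1 / b" using assms by (auto simp: Q_def)
 have 1: "henon_factor P b = (\<lambda>(x, y). (y, poly P y + (- b) * x))" by (auto simp: henon_factor_def)
 have 2: "swap2 \<circ> henon_factor_inv P b \<circ> swap2 = (\<lambda>(x, y). (y, poly Q y + (- 1 / b) * x))"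
  by (auto simp: henon_factor_inv_def swap2_def Q_def divide_simps)
 show "\<exists>M. leading_power 1 (degree P) M (henon_factor P b)"
  using leading_power_factor[of P "- b"] assms unfolding 1 by auto
 show "\<exists>M. leading_power (1 / b) (degree P) M (swap2 \<circ> henon_factor_inv P b \<circ> swap2)"
  using leading_power_factor[of Q "- 1 / b"] assms Q unfolding 2 by auto
qed

lemma henon_map_structure:
 assumes "henon_map d H"
 shows "\<exists>H' c. (\<forall>p. H' (H p) = p) & (\<forall>p. H (H' p) = p) \<and>
      hmap H UNIV & hmap H' UNIV \<and>
      (\<exists>M. leading_power 1 d M H) & c ~= 0 & (\<exists>M. leading_power c d M (swap2 \<circ> H' \<circ> swap2))" using assms
proof (induction rule: henon_map_induct)
 case (factor P b)
 note 34 = henon_factor_leading_power[OF factor]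
 show ?case by (intro exI[of _ "henon_factor_inv P b"] exI[of _ "1 / b"] conjI 34
    holomorphic_henon_factor holomorphic_henon_factor_inv)
    (use factor in \<open>simp_all add: henon_factor_inverse\<close>)
next
 case (compose P b d H)
 then obtain H' c M M' where H': "\<And>p. H' (H p) = p" "\<And>p. H (H' p) = p"
   "hmap H UNIV" "hmap H' UNIV"
   "leading_power 1 d M H" "c ~= 0" "leading_power c d M' (swap2 \<circ> H' \<circ> swap2)" by blast
 have d: "d >= 2" using compose henon_map_degree by blast
 obtain N N' where N: "leading_power 1 (degree P) N (henon_factor P b)"
  and N': "leading_power (1 / b) (degree P) N' (swap2 \<circ> henon_factor_inv P b \<circ> swap2)"
  using henon_factor_leading_power[of P b] compose by blast
 have 3: "\<exists>M. leading_power 1 (degree P * d) M (henon_factor P b \<circ> H)"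
  using leading_power_compose[OF N H'(5)] compose(2) d by simp
 have 4: "swap2 \<circ> (H' \<circ> henon_factor_inv P b) \<circ> swap2 =
   (swap2 \<circ> H' \<circ> swap2) \<circ> (swap2 \<circ> henon_factor_inv P b \<circ> swap2)" by (auto simp: swap2_def)
 have 5: "\<exists>M. leading_power (c * (1 / b) ^ d) (degree P * d) M (swap2 \<circ> (H' \<circ> henon_factor_inv P b) \<circ> swap2)"
  unfolding 4 using leading_power_compose[OF H'(7) N'] compose(2) d by (simp add: mult.commute)
 have 6: "c * (1 / b) ^ d ~= 0" using H' compose by simp
 have 7: "hmap (henon_factor P b \<circ> H) UNIV" "hmap (H' \<circ> henon_factor_inv P b) UNIV" unfolding o_def
  by (rule hmap_compose[OF H'(3) holomorphic_henon_factor], simp)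
    (rule hmap_compose[OF holomorphic_henon_factor_inv H'(4)], simp)
 show ?case by (intro exI[of _ "H' \<circ> henon_factor_inv P b"] exI[of _ "c * (1 / b) ^ d"] conjI 3 5 6 7)
    (use compose henon_factor_inverse H' in simp_all)
qed


text \<open>
  For a map with known degree, Liouville's theorem turns \<^emph>\<open>some\<close> polynomial growth bound into one whose
  constant is the supremum over the unit bidisk. Hence the constants below are locally uniform in
  a family, although the number and the degrees of the factors may vary with the parameter.
\<close>

lemma entire_growth_from_unit_circle:
 fixes f :: "complex => complex"
 assumes hol: "f holomorphic_on UNIV"
  and growth: "\<And>z. 1 <= cmod z ==> cmod (f z) <= C * cmod z ^ n"
  and bnd: "\<And>z. cmod z = 1 ==> cmod (f z) <= B" and z: "1 <= cmod z"
 shows "cmod (f z) <= (real n + 1) * B * cmod z ^ n"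
proof -
 have B: "0 <= B" by (rule order_trans[OF norm_ge_zero bnd[of 1]]) simp
 have coeff: "cmod ((deriv ^^ k) f 0 / fact k) <= B" for k
 proof -
  have "norm ((deriv ^^ k) f 0) <= fact k * B / 1 ^ k" by (rule Cauchy_inequality)
     (use hol bnd in \<open>auto intro: holomorphic_on_subset holomorphic_on_imp_continuous_on\<close>)
  thus ?thesis by (simp add: norm_divide divide_simps mult.commute)
 qed
 have "f z = (\<Sum>k\<le>n. (deriv ^^ k) f 0 / fact k * z ^ k)" by (rule Liouville_polynomial[OF hol growth])
 also have "cmod ... <= (\<Sum>k\<le>n. B * cmod z ^ n)"
 proof (rule sum_norm_le)
  fix k assume "k \<in> {..n}"
  hence "cmod z ^ k <= cmod z ^ n" using z by (intro power_increasing) auto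
  thus "cmod ((deriv ^^ k) f 0 / fact k * z ^ k) <= B * cmod z ^ n"
   unfolding norm_mult norm_power using coeff B by (intro mult_mono) auto
 qed
 finally show ?thesis by (simp add: algebra_simps)
qed

lemma leading_power_of_bidisk_bound:
 fixes F :: "C2 => C2"
 assumes hol: "hmap F UNIV" and lead: "leading_power c d M F" and d: "d >= 1"
  and bnd: "\<And>p. size_max p <= 1 ==> cmod (fst (F p)) <= B & cmod (snd (F p) - c * snd p ^ d) <= B"
 shows "leading_power c d (real d * B) F" unfolding leading_power_def
proof
 fix p :: C2
 define s where "s = size_max p"
 have s: "s >= 1" "cmod (fst p) <= s" "cmod (snd p) <= s" using size_max_ge[of p] by (auto simp: s_def)
 define q where "q = (fst p / of_real s, snd p / of_real s)"
 have q: "cmod (fst q) <= 1" "cmod (snd q) <= 1" using s by (auto simp: q_def norm_divide)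
 have size_q: "size_max (z *\<^sub>C q) <= cmod z" if "1 <= cmod z" for z
  using that q by (auto simp: size_max_def scaleC_prod_def scaleC_complex_def norm_mult mult_left_le)
 have pq: "p = of_real s *\<^sub>C q" using s by (cases p) (auto simp: q_def scaleC_prod_def scaleC_complex_def)
 have M: "0 <= M"
 proof -
  have "0 <= M * size_max (0, 0) ^ (d - 1)" using lead norm_ge_zero order_trans unfolding leading_power_def by blast
  thus ?thesis by (simp add: size_max_def)
 qed
 have line: "hmap (\<lambda>z. F (0 + z *\<^sub>C q)) UNIV" by (rule hmap_compose[OF hmap_complex_line hol]) simp
 have hf: "(\<lambda>z. fst (F (z *\<^sub>C q))) holomorphic_on UNIV"
  and hs: "(\<lambda>z. snd (F (z *\<^sub>C q))) holomorphic_on UNIV" using hmap_compose[OF line hmap_fst[of UNIV]]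
   hmap_compose[OF line hmap_snd[of UNIV]] by (auto simp: hmap_complex)
 have Fz: "cmod (snd (F (z *\<^sub>C q)) - c * (z * snd q) ^ d) <= M * cmod z ^ (d - 1)"
   "cmod (fst (F (z *\<^sub>C q))) <= M * cmod z ^ (d - 1)" if "1 <= cmod z" for z
 proof -
  have "M * size_max (z *\<^sub>C q) ^ (d - 1) <= M * cmod z ^ (d - 1)"
   using size_q[OF that] size_max_ge(1)[of "z *\<^sub>C q"] M by (intro mult_left_mono power_mono) auto
  moreover have "snd (z *\<^sub>C q) = z * snd q" by (simp add: scaleC_prod_def scaleC_complex_def)
  ultimately show "cmod (snd (F (z *\<^sub>C q)) - c * (z * snd q) ^ d) <= M * cmod z ^ (d - 1)"
   "cmod (fst (F (z *\<^sub>C q))) <= M * cmod z ^ (d - 1)" using lead unfolding leading_power_def by (metis order_trans)+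
 qed
 have unit: "cmod (snd (F (z *\<^sub>C q)) - c * (z * snd q) ^ d) <= B" "cmod (fst (F (z *\<^sub>C q))) <= B" if "cmod z = 1" for z
  using bnd[of "z *\<^sub>C q"] size_q[of z] that by (auto simp: scaleC_prod_def scaleC_complex_def)
 have d1: "real (d - 1) + 1 = real d" using d by simp
 have cs: "cmod (complex_of_real s) = s" using s by simp
 have "cmod (snd (F (of_real s *\<^sub>C q)) - c * (of_real s * snd q) ^ d) <= (real (d - 1) + 1) * B * cmod (of_real s) ^ (d - 1)"
  by (rule entire_growth_from_unit_circle[where f = "\<lambda>z. snd (F (z *\<^sub>C q)) - c * (z * snd q) ^ d", OF _ Fz(1) unit(1)])
    (use hs s in \<open>auto intro!: holomorphic_intros\<close>)
 moreover have "cmod (fst (F (of_real s *\<^sub>C q))) <= (real (d - 1) + 1) * B * cmod (of_real s) ^ (d - 1)"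
  by (rule entire_growth_from_unit_circle[where f = "\<lambda>z. fst (F (z *\<^sub>C q))", OF hf Fz(2) unit(2)])
    (use s in auto)
 moreover have "complex_of_real s * snd q = snd p" using s by (auto simp: q_def)
 ultimately show "cmod (snd (F p) - c * snd p ^ d) <= real d * B * size_max p ^ (d - 1) \<and>
   cmod (fst (F p)) <= real d * B * size_max p ^ (d - 1)" unfolding s_def[symmetric] by (simp only: pq[symmetric] d1 cs)
qed

lemma funpow_cancel:
 fixes f g :: "'a => 'a"
 assumes "\<And>p. g (f p) = p" shows "(g ^^ n) ((f ^^ n) p) = p"
proof (induction n)
 case (Suc n)
 thus ?case unfolding funpow_Suc_right[of n g] funpow.simps(2)[of n f] o_apply assms .
qed simp

text \<open>
  The escape dichotomy for \<open>H\<close> and \<open>H\<^sup>-\<^sup>1\<close> at once: \<open>a\<close> and \<open>b\<close> are the moduli of the two coordinates,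
  in the order that fits the direction of iteration.
\<close>

locale filtration =
 fixes T T' :: "C2 => C2" and a b :: "C2 => real" and R :: real
 assumes T'T: "T' (T p) = p" and TT': "T (T' p) = p"
  and contT: "continuous_on UNIV T" and contT': "continuous_on UNIV T'"
  and conta: "continuous_on UNIV a" and contb: "continuous_on UNIV b"
  and a_le: "a p <= norm p" and b_le: "b p <= norm p" and norm_le: "norm p <= a p + b p"
  and R: "R > 0"
  and fwd: "b p <= a p ==> R <= a p ==> b (T p) < a (T p) & 2 * a p <= a (T p)"
  and bwd: "a p <= b p ==> R <= b p ==> a (T' p) < b (T' p) & 2 * b p <= b (T' p)"
begin

definition K where "K = {p. bounded (range (\<lambda>n. (T ^^ n) p))}"

lemma iterate_cancel: "(T' ^^ n) ((T ^^ n) p) = p" "(T ^^ n) ((T' ^^ n) p) = p"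
 using funpow_cancel[of T' T] funpow_cancel[of T T'] T'T TT' by blast+

lemma cont_iterate: "continuous_on UNIV (T ^^ n)"
 by (induction n) (auto simp: o_def intro: continuous_on_compose2[OF contT] continuous_on_id)

lemma forward_growth:
 assumes "b p <= a p" "R <= a p"
 shows "b ((T ^^ n) p) <= a ((T ^^ n) p) & 2 ^ n * a p <= a ((T ^^ n) p)"
proof (induction n)
 case (Suc n)
 have "R * 1 <= a p * 2 ^ n" using assms R by (intro mult_mono) auto
 hence "R <= a ((T ^^ n) p)" using Suc by (simp add: mult.commute)
 thus ?case using fwd[of "(T ^^ n) p"] Suc by auto
qed (use assms in auto)

lemma backward_growth:
 assumes "a p <= b p" "R <= b p"
 shows "a ((T' ^^ n) p) <= b ((T' ^^ n) p) & 2 ^ n * b p <= b ((T' ^^ n) p)"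
proof (induction n)
 case (Suc n)
 have "R * 1 <= b p * 2 ^ n" using assms R by (intro mult_mono) auto
 hence "R <= b ((T' ^^ n) p)" using Suc by (simp add: mult.commute)
 thus ?case using bwd[of "(T' ^^ n) p"] Suc by auto
qed (use assms in auto)

lemma escapes:
 assumes "b p <= a p" "R <= a p"
 shows "\<forall>\<^sub>F n in sequentially. B < a ((T ^^ n) p)"
proof -
 have "\<forall>\<^sub>F n in sequentially. nat \<lceil>\<bar>B\<bar> / R\<rceil> < n" by (rule eventually_gt_at_top)
 thus ?thesis
 proof eventually_elim
  case (elim n)
  hence "\<bar>B\<bar> / R < real n" by linarith
  hence "\<bar>B\<bar> < real n * R" using R by (simp add: divide_simps)
  also have "... <= 2 ^ n * a p" using of_nat_less_two_power[of n, where 'a = real] assms R by (intro mult_mono) auto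
  finally show ?case using forward_growth[OF assms, of n] by linarith
 qed
qed

lemma escapes_notin_K:
 assumes "b p <= a p" "R <= a p" shows "p \<notin> K"
proof
 assume "p \<in> K"
 then obtain B where B: "\<And>n. norm ((T ^^ n) p) <= B" unfolding K_def bounded_iff by auto
 obtain n where "B < a ((T ^^ n) p)" using eventually_happens'[OF _ escapes[OF assms, of B]] by auto
 thus False using B[of n] a_le[of "(T ^^ n) p"] by linarith
qed

lemma invariant_K: "(T ^^ n) p \<in> K \<longleftrightarrow> p \<in> K"
proof -
 have "range (\<lambda>k. (T ^^ k) p) \<subseteq> (\<lambda>k. (T ^^ k) p) ` {..<n} \<union> range (\<lambda>k. (T ^^ k) ((T ^^ n) p))"
 proof
  fix x assume "x \<in> range (\<lambda>k. (T ^^ k) p)"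
  then obtain k where k: "x = (T ^^ k) p" by auto
  show "x \<in> (\<lambda>k. (T ^^ k) p) ` {..<n} \<union> range (\<lambda>k. (T ^^ k) ((T ^^ n) p))"
  proof (cases "k < n")
   case False
   hence "x = (T ^^ (k - n)) ((T ^^ n) p)" using k by (simp flip: funpow_add[THEN fun_cong, unfolded o_apply])
   thus ?thesis by blast
  qed (use k in auto)
 qed
 moreover have "range (\<lambda>k. (T ^^ k) ((T ^^ n) p)) \<subseteq> range (\<lambda>k. (T ^^ k) p)"
  by (auto simp flip: funpow_add[THEN fun_cong, unfolded o_apply])
 moreover have "bounded ((\<lambda>k. (T ^^ k) p) ` {..<n})" by (intro finite_imp_bounded) simp
 ultimately show ?thesis unfolding K_def mem_Collect_eq by (meson bounded_Un bounded_subset)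
qed

lemma in_K_iterate_notin_V:
 assumes "p \<in> K" shows "\<not> (b ((T ^^ n) p) <= a ((T ^^ n) p) & R <= a ((T ^^ n) p))"
 using assms escapes_notin_K invariant_K by blast

text \<open>Where \<open>b\<close> dominates, backward steps double it, so forward steps that do not escape halve it.\<close>

lemma iterate_bound_if_never_escapes:
 assumes "\<And>k. k <= n ==> \<not> (b ((T ^^ k) p) <= a ((T ^^ k) p) & R <= a ((T ^^ k) p))"
 shows "norm ((T ^^ n) p) <= 2 * max R (b p)"
proof -
 define q where "q = (T ^^ n) p"
 have b: "b q <= max R (b p)"
 proof (cases "R < b q")
  case True
  hence "a q <= b q" using assms[of n] by (fastforce simp: q_def)
  hence "2 ^ n * b q <= b p" using backward_growth[of q n] True by (simp add: q_def iterate_cancel)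
  moreover have "1 * b q <= 2 ^ n * b q" using True R by (intro mult_right_mono) auto
  ultimately show ?thesis by simp
 qed auto
 moreover have "a q <= max R (b q)" using assms[of n] by (auto simp: q_def)
 ultimately show ?thesis using norm_le[of q] by (simp add: q_def)
qed

lemma K_orbit_bound: "p \<in> K ==> norm ((T ^^ n) p) <= 2 * max R (norm p)"
 using iterate_bound_if_never_escapes[of n p] in_K_iterate_notin_V[of p] b_le[of p] by fastforce

lemma notin_K_eventually:
 assumes "p \<notin> K"
 shows "\<forall>\<^sub>F n in sequentially. b ((T ^^ n) p) < a ((T ^^ n) p) & B < a ((T ^^ n) p)"
proof -
 obtain k where k: "b ((T ^^ k) p) <= a ((T ^^ k) p) & R <= a ((T ^^ k) p)"
 proof (rule ccontr)
  assume "\<not> thesis"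
  with that have "\<And>k. \<not> (b ((T ^^ k) p) <= a ((T ^^ k) p) & R <= a ((T ^^ k) p))" by blast
  hence "norm ((T ^^ n) p) <= 2 * max R (b p)" for n using iterate_bound_if_never_escapes by blast
  hence "p \<in> K" unfolding K_def bounded_iff by auto
  with assms show False ..
 qed
 have "\<forall>\<^sub>F n in sequentially. b ((T ^^ n) ((T ^^ k) p)) < a ((T ^^ n) ((T ^^ k) p)) & B < a ((T ^^ n) ((T ^^ k) p))"
  using escapes[OF k[THEN conjunct1] k[THEN conjunct2], of B] eventually_gt_at_top[of 0]
 proof eventually_elim
  case (elim n)
  then obtain m where m: "n = Suc m" by (cases n) auto
  define q where "q = (T ^^ m) ((T ^^ k) p)"
  have "R * 1 <= a ((T ^^ k) p) * 2 ^ m" using k R by (intro mult_mono) auto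
  hence "b q <= a q" "R <= a q" using forward_growth[of "(T ^^ k) p" m] k by (auto simp: q_def mult.commute)
  hence "b (T q) < a (T q)" using fwd by blast
  thus ?case using elim by (simp add: m q_def)
 qed
 hence "\<forall>\<^sub>F n in sequentially. b ((T ^^ (n + k)) p) < a ((T ^^ (n + k)) p) & B < a ((T ^^ (n + k)) p)"
  by (simp add: funpow_add)
 thus ?thesis using eventually_sequentially_seg[of "\<lambda>n. b ((T ^^ n) p) < a ((T ^^ n) p) & B < a ((T ^^ n) p)" k] by simp
qed

lemma closed_K: "closed K"
proof -
 define V where "V = {p. b p < a p & R < a p}"
 have "open V" unfolding V_def using conta contb by (auto intro!: open_Collect_conj open_Collect_less continuous_intros)
 have "- K = (\<Union>n. (T ^^ n) -` V)"
 proof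
  show "- K \<subseteq> (\<Union>n. (T ^^ n) -` V)"
  proof
   fix p assume "p \<in> - K"
   then obtain n where "b ((T ^^ n) p) < a ((T ^^ n) p) & R < a ((T ^^ n) p)"
    using eventually_happens'[OF _ notin_K_eventually[of p R]] by auto
   thus "p \<in> (\<Union>n. (T ^^ n) -` V)" by (auto simp: V_def)
  qed
  show "(\<Union>n. (T ^^ n) -` V) \<subseteq> - K"
  proof
   fix p assume "p \<in> (\<Union>n. (T ^^ n) -` V)"
   then obtain n where "b ((T ^^ n) p) < a ((T ^^ n) p)" "R < a ((T ^^ n) p)" by (auto simp: V_def)
   thus "p \<in> - K" using in_K_iterate_notin_V[of p n] by auto
  qed
 qed
 moreover have "open ((T ^^ n) -` V)" for n using open_vimage[OF \<open>open V\<close> cont_iterate] .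
 ultimately show ?thesis unfolding closed_def by (simp only: open_UN ball_UNIV) blast
qed

end


section \<open>The Boettcher coordinate\<close>

definition Vo :: "real => C2 set" where
 "Vo R = {p. cmod (fst p) < cmod (snd p) & R < cmod (snd p)}"

lemma open_Vo: "open (Vo R)" unfolding Vo_def by (auto intro!: open_Collect_conj open_Collect_less continuous_intros)

lemma Vo_mono: "R <= R' ==> Vo R' \<subseteq> Vo R" by (auto simp: Vo_def)

lemma norm_exp_minus_one_le:
 fixes z :: complex
 assumes "cmod z <= 1 / 2" shows "cmod (exp z - 1) <= 2 * cmod z"
proof -
 have "cmod (exp z - exp 0) <= 2 * cmod (z - 0)"
 proof (rule field_differentiable_bound[where f' = exp and S = "cball 0 (1 / 2)"])
  show "cmod (exp w) <= 2" if "w \<in> cball 0 (1 / 2)" for w :: complex using exp_bound_lemma[of w] that by auto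
 qed (use assms in \<open>auto intro: DERIV_exp[THEN DERIV_subset]\<close>)
 thus ?thesis by simp
qed

locale henon_growth =
 fixes d :: nat and M :: real and H H' :: "C2 => C2"
 assumes d: "d >= 2" and M: "M >= 1" and lead: "leading_power 1 d M H"
  and hol: "hmap H UNIV" and hol': "hmap H' UNIV"
  and H'H: "H' (H p) = p" and HH': "H (H' p) = p"
begin

text \<open>
  The constant 400 only has to be large: it makes the relative error \<open>M / \<bar>y\<bar>\<close> of \<open>y \<mapsto> y ^ d\<close> small enough
  for principal logarithms, and makes the image of a point much closer to the vertical axis.
\<close>

abbreviation "V \<equiv> Vo (400 * M)"

lemma step:
 assumes "cmod (fst p) <= cmod (snd p)" "400 * M <= cmod (snd p)"
 shows "cmod (snd (H p) / snd p ^ d - 1) <= M / cmod (snd p)"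
  and "M / cmod (snd p) <= 1 / 400"
  and "2 * cmod (snd p) <= cmod (snd (H p))"
  and "300 * cmod (fst (H p)) <= cmod (snd (H p))"
  and "H p \<in> V"
proof -
 define y where "y = snd p"
 have y: "cmod y >= 400 * M" "cmod y >= 400" "y ~= 0" using assms M by (auto simp: y_def)
 have s: "size_max p = cmod y" using assms y by (auto simp: size_max_def y_def)
 have A: "cmod (snd (H p) - y ^ d) <= M * cmod y ^ (d - 1)" "cmod (fst (H p)) <= M * cmod y ^ (d - 1)"
  using lead[unfolded leading_power_def, rule_format, of p] unfolding s y_def[symmetric] by simp_all
 have yd: "cmod y ^ d = cmod y * cmod y ^ (d - 1)" using d by (cases d) auto
 have "snd (H p) / y ^ d - 1 = (snd (H p) - y ^ d) / y ^ d" using y by (simp add: diff_divide_distrib)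
 hence "cmod (snd (H p) / y ^ d - 1) = cmod (snd (H p) - y ^ d) / cmod y ^ d" by (simp add: norm_divide norm_power)
 also have "... <= M * cmod y ^ (d - 1) / cmod y ^ d" using A y by (intro divide_right_mono) auto
 also have "... = M / cmod y" using y by (simp add: yd)
 finally show "cmod (snd (H p) / snd p ^ d - 1) <= M / cmod (snd p)" by (simp add: y_def)
 show "M / cmod (snd p) <= 1 / 400" using y by (simp add: y_def[symmetric] divide_simps)
 have Q: "cmod y ^ (d - 1) >= cmod y" using d y by (intro self_le_power) auto
 have "cmod (y ^ d) <= cmod (snd (H p)) + cmod (snd (H p) - y ^ d)"
  by (metis norm_minus_commute norm_triangle_sub add.commute)
 hence B: "(cmod y - M) * cmod y ^ (d - 1) <= cmod (snd (H p))" using A(1) by (simp add: norm_power yd algebra_simps)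
 have "2 * cmod y <= (cmod y - M) * cmod y ^ (d - 1)" using Q y M by (intro mult_mono) auto
 thus C: "2 * cmod (snd p) <= cmod (snd (H p))" using B by (simp add: y_def)
 have "300 * (M * cmod y ^ (d - 1)) <= (cmod y - M) * cmod y ^ (d - 1)"
  unfolding mult.assoc[symmetric] using y M by (intro mult_right_mono) auto
 thus D: "300 * cmod (fst (H p)) <= cmod (snd (H p))" using A(2) B by linarith
 have "cmod (fst (H p)) < cmod (snd (H p))"
 proof -
  have "0 < cmod (snd (H p))" using C y by (auto simp: y_def)
  thus ?thesis using D norm_ge_zero[of "fst (H p)"] by linarith
 qed
 moreover have "400 * M < cmod (snd (H p))" using C y M by (auto simp: y_def)
 ultimately show "H p \<in> V" by (simp add: Vo_def)
qed

lemma VoD: "p \<in> V ==> cmod (fst p) <= cmod (snd p)" "p \<in> V ==> 400 * M <= cmod (snd p)" by (auto simp: Vo_def)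

lemma H_Vo: assumes "p \<in> Vo R" "400 * M <= R" shows "H p \<in> Vo R"
proof -
 have p: "cmod (fst p) <= cmod (snd p)" "400 * M <= cmod (snd p)" using assms by (auto simp: Vo_def)
 have "H p \<in> V" "2 * cmod (snd p) <= cmod (snd (H p))" using step[OF p] by auto
 thus ?thesis using assms M by (auto simp: Vo_def)
qed

lemma iterate_Vo: "p \<in> Vo R ==> 400 * M <= R ==> (H ^^ n) p \<in> Vo R" by (induction n) (auto intro: H_Vo)

lemma iterate_V: "p \<in> V ==> (H ^^ n) p \<in> V" by (rule iterate_Vo) auto

lemma iterate_later: "(H ^^ n) p \<in> V ==> n <= m ==> (H ^^ m) p \<in> V"
 using iterate_V[of "(H ^^ n) p" "m - n"] by (simp flip: funpow_add[THEN fun_cong, unfolded o_apply])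

lemma iterate_growth: "p \<in> V ==> 2 ^ n * cmod (snd p) <= cmod (snd ((H ^^ n) p))"
proof (induction n)
 case (Suc n)
 have "2 * cmod (snd ((H ^^ n) p)) <= cmod (snd (H ((H ^^ n) p)))" using step(3) VoD[OF iterate_V[OF Suc.prems]] by blast
 thus ?case using Suc by simp
qed simp

lemma snd_nz: "p \<in> V ==> snd p ~= 0" using VoD(2)[of p] M by auto

lemma holomorphic_iterate: "hmap (H ^^ n) UNIV" "hmap (H' ^^ n) UNIV"
 by (rule hmap_funpow[OF hol]) (rule hmap_funpow[OF hol'])

lemma cont_iterate: "continuous_on S (H ^^ n)" "continuous_on S (H' ^^ n)"
 using holomorphic_iterate[THEN hmap_continuous_on] by (auto intro: continuous_on_subset)

text \<open>
  \<open>phi\<close> is the telescoping product for \<open>\<phi>\<^sup>+\<close>: the factor \<open>exp (btm k p)\<close> is the root of order \<open>d ^ (k + 1)\<close>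
  of \<open>y' / y ^ d\<close>, where \<open>y\<close> and \<open>y'\<close> are the second coordinates of the iterates \<open>k\<close> and \<open>k + 1\<close>.
\<close>

definition btm :: "nat => C2 => complex" where
 "btm k p = Ln (snd (H ((H ^^ k) p)) / snd ((H ^^ k) p) ^ d) / of_nat d ^ (k + 1)"

definition log_ratio :: "C2 => complex" where "log_ratio p = (\<Sum>k. btm k p)"

definition phi :: "C2 => complex" where "phi p = snd p * exp (log_ratio p)"

lemma btm_arg:
 assumes "p \<in> V"
 shows "cmod (snd (H ((H ^^ k) p)) / snd ((H ^^ k) p) ^ d - 1) <= M / cmod (snd p)"
  "M / cmod (snd p) <= 1 / 400"
proof -
 define q where "q = (H ^^ k) p"
 have q: "q \<in> V" using assms iterate_V by (simp add: q_def)
 have "1 * cmod (snd p) <= 2 ^ k * cmod (snd p)" by (intro mult_right_mono) auto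
 hence "cmod (snd p) <= cmod (snd q)" using iterate_growth[OF assms, of k] by (simp add: q_def)
 hence "M / cmod (snd q) <= M / cmod (snd p)"
  using M snd_nz[OF assms] by (intro divide_left_mono mult_pos_pos) (auto intro: less_le_trans)
 thus "cmod (snd (H ((H ^^ k) p)) / snd ((H ^^ k) p) ^ d - 1) <= M / cmod (snd p)"
  using step(1)[of q] VoD[OF q] by (simp add: q_def)
 show "M / cmod (snd p) <= 1 / 400" using step(2)[of p] VoD[OF assms] by blast
qed

lemma btm_bound:
 assumes "p \<in> V" shows "cmod (btm k p) <= 2 * (M / cmod (snd p)) * (1 / 2) ^ (k + 1)"
proof -
 define w where "w = snd (H ((H ^^ k) p)) / snd ((H ^^ k) p) ^ d - 1"
 have w: "cmod w <= M / cmod (snd p)" "cmod w < 1 / 2"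
  using btm_arg(1)[OF assms, of k] btm_arg(2)[OF assms] unfolding w_def[symmetric] by linarith+
 have "cmod (Ln (1 + w)) <= 2 * cmod w" using w by (intro norm_Ln_le) auto
 hence L: "cmod (Ln (1 + w)) <= 2 * (M / cmod (snd p))" using w by linarith
 have "cmod (btm k p) = cmod (Ln (1 + w)) / real d ^ (k + 1)"
  by (simp add: btm_def w_def norm_divide norm_mult norm_power)
 also have "... <= (2 * (M / cmod (snd p))) / 2 ^ (k + 1)" using L d M by (intro frac_le power_mono) auto
 finally show ?thesis by (simp add: power_divide field_simps)
qed

lemma half_sums: "(\<lambda>k. c * (1 / 2) ^ (k + 1)) sums (c::real)" using sums_mult[OF power_half_series, of c] by simp

lemma btm_summable: "p \<in> V ==> summable (\<lambda>k. btm k p)"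
 by (rule summable_comparison_test'[OF sums_summable[OF half_sums]]) (rule btm_bound)

lemma log_ratio_bound:
 assumes "p \<in> V" shows "cmod (log_ratio p) <= 2 * (M / cmod (snd p))"
proof -
 have "cmod (log_ratio p) <= (\<Sum>k. 2 * (M / cmod (snd p)) * (1 / 2) ^ (k + 1))"
  unfolding log_ratio_def by (rule norm_suminf_le[OF btm_bound[OF assms] sums_summable[OF half_sums]])
 also have "... = 2 * (M / cmod (snd p))" by (rule sums_unique[OF half_sums, symmetric])
 finally show ?thesis .
qed

lemma log_ratio_partial_bound:
 assumes "p \<in> V" shows "cmod (\<Sum>k<n. btm k p) <= 2 * (M / cmod (snd p))"
proof -
 have "cmod (\<Sum>k<n. btm k p) <= (\<Sum>k<n. 2 * (M / cmod (snd p)) * (1 / 2) ^ (k + 1))"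
  by (rule sum_norm_le) (rule btm_bound[OF assms])
 also have "... <= (\<Sum>k. 2 * (M / cmod (snd p)) * (1 / 2) ^ (k + 1))"
  by (rule sum_le_suminf[OF sums_summable[OF half_sums]]) (use M in auto)
 also have "... = 2 * (M / cmod (snd p))" by (rule sums_unique[OF half_sums, symmetric])
 finally show ?thesis .
qed

lemma btm_holomorphic: "hmap (btm k) V"
proof -
 define num where "num = (\<lambda>p. snd (H ((H ^^ k) p)) * inverse (snd ((H ^^ k) p) ^ d))"
 have y: "hmap (\<lambda>p. snd ((H ^^ j) p)) V" for j by (rule hmap_compose[OF _ hmap_snd[of UNIV]])
    (auto intro: hmap_subset[OF holomorphic_iterate(1)])
 have i: "hmap (\<lambda>z::complex. inverse (z ^ d)) (- {0})" by (subst hmap_complex) (auto intro!: holomorphic_intros)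
 have "(\<lambda>p. snd ((H ^^ k) p)) ` V \<subseteq> - {0}"
 proof (rule image_subsetI)
  fix p assume "p \<in> V"
  thus "snd ((H ^^ k) p) \<in> - {0}" using snd_nz[OF iterate_V] by simp
 qed
 hence "hmap num V" unfolding num_def using y[of "Suc k"] hmap_compose[OF y[of k] i] by (intro hmap_mult) simp_all
 moreover have "hmap (\<lambda>z. Ln z / of_nat d ^ (k + 1)) (- \<real>\<^sub>\<le>\<^sub>0)"
  by (subst hmap_complex) (use d in \<open>auto intro!: holomorphic_intros\<close>)
 moreover have "num ` V \<subseteq> - \<real>\<^sub>\<le>\<^sub>0"
 proof
  fix z assume "z \<in> num ` V"
  then obtain p where p: "p \<in> V" "z = num p" by auto
  have "z = snd (H ((H ^^ k) p)) / snd ((H ^^ k) p) ^ d" by (simp only: p num_def divide_inverse)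
  hence "cmod (z - 1) <= 1 / 400" using order_trans[OF btm_arg(1)[OF p(1), of k] btm_arg(2)[OF p(1)]] by (simp only:)
  hence "Re z > 0" using abs_Re_le_cmod[of "z - 1"] by auto
  thus "z \<in> - \<real>\<^sub>\<le>\<^sub>0" by (auto simp: complex_nonpos_Reals_iff)
 qed
 ultimately have "hmap (\<lambda>p. Ln (num p) / of_nat d ^ (k + 1)) V" by (rule hmap_compose)
 thus ?thesis by (rule hmap_cong[OF _ open_Vo]) (simp add: btm_def num_def divide_inverse)
qed

lemma log_ratio_holomorphic: "hmap log_ratio V"
proof -
 have "hmap (\<lambda>p. \<Sum>k. btm k p) V"
 proof (rule hmap_suminf[OF open_Vo btm_holomorphic])
  show "cmod (btm k p) <= 1 * (1 / 2) ^ (k + 1)" if "p \<in> V" for k p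
  proof -
   have "2 * (M / cmod (snd p)) * (1 / 2) ^ (k + 1) <= 1 * (1 / 2) ^ (k + 1)"
   proof (rule mult_right_mono)
    show "2 * (M / cmod (snd p)) <= 1" using btm_arg(2)[OF that] by linarith
   qed simp
   thus ?thesis using btm_bound[OF that, of k] by linarith
  qed
 qed (rule sums_summable[OF half_sums])
 thus ?thesis by (rule hmap_cong[OF _ open_Vo]) (simp add: log_ratio_def)
qed

lemma phi_holomorphic: "hmap phi V"
proof -
 have e: "hmap (exp :: complex => complex) UNIV" by (simp add: hmap_complex holomorphic_on_exp)
 have "hmap (\<lambda>p. snd p * exp (log_ratio p)) V"
  by (intro hmap_mult hmap_snd hmap_compose[OF log_ratio_holomorphic e]) auto
 thus ?thesis by (rule hmap_cong[OF _ open_Vo]) (simp add: phi_def)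
qed

lemma phi_nz: "p \<in> V ==> phi p ~= 0" using snd_nz by (simp add: phi_def)

lemma phi_approx:
 assumes "p \<in> V" shows "cmod (phi p - snd p) <= 4 * M"
proof -
 have l: "cmod (log_ratio p) <= 2 * (M / cmod (snd p))" "cmod (log_ratio p) <= 1 / 2"
  using log_ratio_bound[OF assms] btm_arg(2)[OF assms] by linarith+
 have "cmod (exp (log_ratio p) - 1) <= 2 * cmod (log_ratio p)" using l(2) by (rule norm_exp_minus_one_le)
 also have "... <= 4 * (M / cmod (snd p))" using l by linarith
 finally have "cmod (snd p) * cmod (exp (log_ratio p) - 1) <= cmod (snd p) * (4 * (M / cmod (snd p)))"
  by (intro mult_left_mono) auto
 thus ?thesis using snd_nz[OF assms] by (simp add: phi_def right_diff_distrib flip: norm_mult)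
qed

lemma phi_step:
 assumes p: "p \<in> V" shows "phi (H p) = phi p ^ d"
proof -
 have Hp: "H p \<in> V" using iterate_V[OF p, of 1] by simp
 have d0: "of_nat d ~= (0::complex)" using d by simp
 have b: "of_nat d * btm (Suc k) p = btm k (H p)" for k using d0 by (simp add: btm_def funpow_swap1)
 have "log_ratio p = btm 0 p + (\<Sum>k. btm (Suc k) p)"
  unfolding log_ratio_def using suminf_split_head[OF btm_summable[OF p]] by simp
 moreover have "of_nat d * (\<Sum>k. btm (Suc k) p) = log_ratio (H p)" unfolding log_ratio_def b[symmetric]
  by (rule suminf_mult[symmetric]) (rule summable_Suc_iff[THEN iffD2, OF btm_summable[OF p]])
 ultimately have "of_nat d * log_ratio p = of_nat d * btm 0 p + log_ratio (H p)" by (simp add: algebra_simps)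
 moreover have "of_nat d * btm 0 p = Ln (snd (H p) / snd p ^ d)" using d0 by (simp add: btm_def)
 ultimately have "exp (of_nat d * log_ratio p) = snd (H p) / snd p ^ d * exp (log_ratio (H p))"
  using snd_nz[OF p] snd_nz[OF Hp] by (simp add: exp_add)
 thus ?thesis using snd_nz[OF p] by (simp add: phi_def power_mult_distrib exp_of_nat_mult[symmetric])
qed

lemma phi_iterate: "p \<in> V ==> phi ((H ^^ n) p) = phi p ^ (d ^ n)"
proof (induction n)
 case (Suc n)
 have "phi (H ((H ^^ n) p)) = phi ((H ^^ n) p) ^ d" by (rule phi_step[OF iterate_V[OF Suc.prems]])
 thus ?case using Suc by (simp add: mult.commute flip: power_mult)
qed simp

lemma partial_branch:
 assumes p: "p \<in> V"
 shows "(snd p * exp (\<Sum>k<n. btm k p)) ^ (d ^ n) = snd ((H ^^ n) p)"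
proof (induction n)
 case (Suc n)
 define q where "q = (H ^^ n) p"
 have q: "q \<in> V" "H q \<in> V" using p iterate_V[of p n] iterate_V[of p "Suc n"] by (auto simp: q_def)
 have "(snd p * exp (\<Sum>k<Suc n. btm k p)) ^ (d ^ Suc n) =
   ((snd p * exp (\<Sum>k<n. btm k p)) ^ (d ^ n)) ^ d * exp (btm n p) ^ (d ^ Suc n)"
  by (simp add: exp_add power_mult_distrib power_mult[symmetric] mult.commute[of d])
 also have "exp (btm n p) ^ (d ^ Suc n) = exp (of_nat (d ^ Suc n) * btm n p)" by (rule exp_of_nat_mult[symmetric])
 also have "of_nat (d ^ Suc n) * btm n p = Ln (snd (H q) / snd q ^ d)" using d by (simp add: btm_def q_def)
 also have "exp ... = snd (H q) / snd q ^ d" using snd_nz[OF q(1)] snd_nz[OF q(2)] by simp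
 finally show ?case using Suc.IH snd_nz[OF q(1)] by (simp add: q_def)
qed simp

text \<open>
  Two branches of a root of the second coordinate of \<open>H ^^ n\<close> differ by a root of unity. Along the ray
  through \<open>p\<close> it is constant by continuity, and it tends to 1 at infinity.
\<close>

lemma phi_unique:
 assumes R1: "R1 > 0" and V1: "phi_plus_on_V d H R1 f" and p: "p \<in> Vo (max R1 (400 * M))"
 shows "f p = phi p"
proof -
 obtain g where g: "\<And>n. continuous_on (V_plus R1) (g n)"
   "\<And>n q. q \<in> V_plus R1 ==> g n q ^ (d ^ n) = snd ((H ^^ n) q)"
   "\<And>n. ((\<lambda>q. g n q / snd q) \<longlongrightarrow> 1) (inf at_infinity (principal (V_plus R1)))"
   "\<And>q. q \<in> V_plus R1 ==> (\<lambda>n. g n q) \<longlonglongrightarrow> f q" using V1 unfolding phi_plus_on_V_def by blast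
 have pV: "p \<in> V" using p by (auto simp: Vo_def)
 have ray: "t *\<^sub>R p \<in> V_plus R1" "t *\<^sub>R p \<in> V" if "t >= 1" for t
 proof -
  have "1 * cmod (snd p) <= t * cmod (snd p)" using that by (intro mult_right_mono) auto
  moreover have "t * cmod (fst p) < t * cmod (snd p)" using that p by (intro mult_strict_left_mono) (auto simp: Vo_def)
  ultimately show "t *\<^sub>R p \<in> V_plus R1" "t *\<^sub>R p \<in> V" using p that by (cases p, auto simp: Vo_def V_plus_def)+
 qed
 have gn: "g n p = snd p * exp (\<Sum>k<n. btm k p)" for n
 proof -
  define h where "h q = snd q * exp (\<Sum>k<n. btm k q)" for q
  define \<rho> where "\<rho> t = g n (t *\<^sub>R p) / h (t *\<^sub>R p)" for t
  have hnz: "h q ~= 0" if "q \<in> V" for q using snd_nz[OF that] by (simp add: h_def)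
  have conth: "continuous_on V h" unfolding h_def by (intro continuous_intros continuous_on_exp continuous_on_sum
     hmap_continuous_on[OF btm_holomorphic])
  have ct: "continuous_on {1..} (\<lambda>t. t *\<^sub>R p)" by (intro continuous_intros)
  have cont: "continuous_on {1..} \<rho>" unfolding \<rho>_def
   by (intro continuous_on_divide continuous_on_compose2[OF g(1) ct] continuous_on_compose2[OF conth ct])
     (use ray hnz in auto)
  have root: "\<rho> t ^ (d ^ n) = 1" if "t >= 1" for t
  proof -
   have "snd ((H ^^ n) (t *\<^sub>R p)) ~= 0" using snd_nz[OF iterate_V[OF ray(2)[OF that]]] .
   thus ?thesis using g(2)[OF ray(1)[OF that], of n] partial_branch[OF ray(2)[OF that], of n]
    by (simp add: \<rho>_def h_def power_divide)
  qed
  have "finite {z::complex. z ^ (d ^ n) = 1}" by (rule finite_roots_unity) (use d in auto)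
  hence "finite (\<rho> ` {1..})" by (rule finite_subset[rotated]) (use root in auto)
  moreover have "connected {1::real..}" by simp
  ultimately have const: "\<rho> constant_on {1..}" using continuous_finite_range_constant[OF _ cont] by blast
  have lim1: "((\<lambda>t. g n (t *\<^sub>R p) / snd (t *\<^sub>R p)) \<longlongrightarrow> 1) at_top"
  proof (rule filterlim_compose[OF g(3)[of n]])
   have "p ~= 0" using snd_nz[OF pV] by auto
   hence "filterlim (\<lambda>t. norm (t *\<^sub>R p)) at_top at_top"
    by (simp, intro filterlim_at_top_mult_tendsto_pos[OF tendsto_const] filterlim_abs_real) 
      (auto intro: filterlim_ident)
   hence "filterlim (\<lambda>t. t *\<^sub>R p) at_infinity at_top" by (simp only: filterlim_at_infinity_conv_norm_at_top)
   moreover have "filterlim (\<lambda>t. t *\<^sub>R p) (principal (V_plus R1)) at_top"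
    unfolding filterlim_principal using ray(1) by (auto simp: eventually_at_top_linorder)
   ultimately show "filterlim (\<lambda>t. t *\<^sub>R p) (inf at_infinity (principal (V_plus R1))) at_top"
    by (simp add: filterlim_inf)
  qed
  have "((\<lambda>t. \<Sum>k<n. btm k (t *\<^sub>R p)) \<longlongrightarrow> 0) at_top"
  proof (rule Lim_null_comparison)
   show "\<forall>\<^sub>F t in at_top. cmod (\<Sum>k<n. btm k (t *\<^sub>R p)) <= 2 * M / cmod (snd p) / t" using eventually_ge_at_top[of 1]
   proof eventually_elim
    case (elim t)
    have "2 * (M / cmod (snd (t *\<^sub>R p))) = 2 * M / cmod (snd p) / t" using elim by simp
    thus ?case using log_ratio_partial_bound[OF ray(2)[OF elim], of n] by linarith
   qed
   show "((\<lambda>t. 2 * M / cmod (snd p) / t) \<longlongrightarrow> 0) at_top"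
    by (rule tendsto_divide_0[OF tendsto_const filterlim_at_top_imp_at_infinity[OF filterlim_ident]])
  qed
  hence lim2: "((\<lambda>t. exp (\<Sum>k<n. btm k (t *\<^sub>R p))) \<longlongrightarrow> exp 0) at_top" by (rule tendsto_exp)
  have "((\<lambda>t. (g n (t *\<^sub>R p) / snd (t *\<^sub>R p)) / exp (\<Sum>k<n. btm k (t *\<^sub>R p))) \<longlongrightarrow> 1 / exp 0) at_top"
   by (intro tendsto_divide lim1 lim2) auto
  hence lim: "(\<rho> \<longlongrightarrow> 1) at_top" unfolding \<rho>_def h_def divide_divide_eq_left exp_zero div_by_1 .
  obtain c where c: "\<And>t. t >= 1 ==> \<rho> t = c" using const unfolding constant_on_def by auto
  have "(\<rho> \<longlongrightarrow> c) at_top" by (rule tendsto_eventually) (use c in \<open>auto simp: eventually_at_top_linorder\<close>)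
  hence "c = 1" using tendsto_unique[OF _ _ lim] by auto
  hence "\<rho> 1 = 1" using c by auto
  thus ?thesis using hnz[OF pV] by (simp add: \<rho>_def h_def)
 qed
 have "(\<lambda>n. snd p * exp (\<Sum>k<n. btm k p)) \<longlonglongrightarrow> phi p" unfolding phi_def log_ratio_def
  by (intro tendsto_mult tendsto_const tendsto_exp summable_LIMSEQ btm_summable pV)
 moreover have "(\<lambda>n. g n p) \<longlonglongrightarrow> f p" using g(4) ray(1)[of 1] by simp
 ultimately show ?thesis unfolding gn using LIMSEQ_unique by blast
qed

end


section \<open>The Green function and the leaves of its foliation\<close>

lemma has_derivative_ln_cmod:
 assumes f: "(f has_derivative f') (at p)" and nz: "f p ~= (0::complex)"
 shows "((\<lambda>q. ln (cmod (f q))) has_derivative (\<lambda>v. Re (f' v / f p))) (at p)"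
proof -
 have "((\<lambda>q. f q / f p) has_derivative (\<lambda>v. f' v / f p)) (at p)"
  by (rule bounded_linear.has_derivative[OF bounded_linear_divide f])
 moreover have "(Ln has_derivative (\<lambda>h. inverse (f p / f p) * h)) (at (f p / f p))"
  by (rule has_field_derivative_Ln[unfolded has_field_derivative_def]) (use nz in simp)
 ultimately have "((\<lambda>q. Ln (f q / f p)) has_derivative (\<lambda>v. inverse (f p / f p) * (f' v / f p))) (at p)"
  by (rule has_derivative_compose)
 hence "((\<lambda>q. Re (Ln (f q / f p)) + ln (cmod (f p))) has_derivative (\<lambda>v. Re (inverse (f p / f p) * (f' v / f p)) + 0)) (at p)"
  by (intro has_derivative_add has_derivative_Re has_derivative_const)
 hence D: "((\<lambda>q. Re (Ln (f q / f p)) + ln (cmod (f p))) has_derivative (\<lambda>v. Re (f' v / f p))) (at p)" using nz by simp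
 have "\<forall>\<^sub>F q in at p. f q ~= 0" using has_derivative_continuous[OF f] nz unfolding isCont_def
  by (auto intro: tendsto_imp_eventually_ne)
 hence "\<forall>\<^sub>F q in at p. Re (Ln (f q / f p)) + ln (cmod (f p)) = ln (cmod (f q))"
  by eventually_elim (use nz in \<open>simp add: norm_divide ln_div\<close>)
 thus ?thesis by (rule has_derivative_transform_eventually[OF D]) (use nz in auto)
qed

locale henon_dyn = henon_growth +
 assumes U_eq: "U_plus H = {p. \<exists>n. (H ^^ n) p \<in> Vo (400 * M)}"
begin

lemma U_iff: "p \<in> U_plus H \<longleftrightarrow> (\<exists>n. (H ^^ n) p \<in> V)" using U_eq by auto

lemma H_U: "H p \<in> U_plus H \<longleftrightarrow> p \<in> U_plus H"
proof
 assume "H p \<in> U_plus H"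
 then obtain n where "(H ^^ n) (H p) \<in> V" unfolding U_iff by blast
 hence "(H ^^ Suc n) p \<in> V" by (simp add: funpow_swap1)
 thus "p \<in> U_plus H" unfolding U_iff by blast
next
 assume "p \<in> U_plus H"
 then obtain n where "(H ^^ n) p \<in> V" unfolding U_iff by blast
 hence "(H ^^ n) (H p) \<in> V" using iterate_V[of "(H ^^ n) p" 1] by (simp add: funpow_swap1)
 thus "H p \<in> U_plus H" unfolding U_iff by blast
qed

lemma iterate_U: "(H ^^ n) p \<in> U_plus H \<longleftrightarrow> p \<in> U_plus H" by (induction n) (auto simp: H_U)

definition E :: "nat => C2 set" where "E n = (H ^^ n) -` V"

lemma open_E: "open (E n)" unfolding E_def by (rule open_vimage[OF open_Vo cont_iterate(1)])

lemma E_mono: "n <= m ==> E n \<subseteq> E m" unfolding E_def vimage_def using iterate_later by blast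

lemma U_eq_E: "U_plus H = (\<Union>n. E n)" unfolding E_def set_eq_iff U_iff by blast

lemma open_U: "open (U_plus H)" unfolding U_eq_E using open_E by blast

text \<open>
  \<open>Lam n\<close> continues \<open>phi ^ (d ^ n)\<close> to \<open>E n\<close>. These sets exhaust \<open>U\<^sup>+\<close>, to which \<open>phi\<close> itself has no
  single-valued continuation.
\<close>

definition Lam :: "nat => C2 => complex" where "Lam n p = phi ((H ^^ n) p)"

lemma Lam_holomorphic: "hmap (Lam n) (E n)" unfolding Lam_def by (rule hmap_compose[OF _ phi_holomorphic])
   (auto simp: E_def intro: hmap_subset[OF holomorphic_iterate(1)])

lemma Lam_nz: "p \<in> E n ==> Lam n p ~= 0" using phi_nz by (simp add: E_def Lam_def)

lemma Lam_add: "p \<in> E n ==> Lam (m + n) p = Lam n p ^ (d ^ m)"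
 using phi_iterate[of "(H ^^ n) p" m] by (simp add: E_def Lam_def funpow_add)

lemma green_eq:
 assumes p: "p \<in> E n"
 shows "(\<lambda>k. max 0 (ln (norm ((H ^^ k) p))) / real d ^ k) \<longlonglongrightarrow> ln (cmod (Lam n p)) / real d ^ n"
  and "green_plus d H p = ln (cmod (Lam n p)) / real d ^ n"
proof -
 define q where "q = (H ^^ n) p"
 have q: "q \<in> V" using p by (simp add: q_def E_def)
 have d0: "real d > 1" using d by simp
 have near: "\<bar>max 0 (ln (norm ((H ^^ m) q))) - ln (cmod (phi q)) * real d ^ m\<bar> <= 2" for m
 proof -
  define y where "y = (H ^^ m) q"
  have y: "y \<in> V" using iterate_V[OF q] by (simp add: y_def)
  have s: "cmod (snd y) >= 400" using VoD(2)[OF y] M by simp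
  have n1: "cmod (snd y) <= norm y" using norm_snd_le[of "snd y" "fst y"] by simp
  have n2: "norm y <= 2 * cmod (snd y)" using norm_Pair_le[of "fst y" "snd y"] VoD(1)[OF y] by simp
  have "ln (norm y) <= ln (2 * cmod (snd y))" using n2 n1 s by (intro ln_mono) auto
  also have "... = ln 2 + ln (cmod (snd y))" using s by (subst ln_mult) auto
  finally have l1: "ln (norm y) <= 1 + ln (cmod (snd y))" using ln_2_less_1 by linarith
  have l2: "ln (cmod (snd y)) <= ln (norm y)" using n1 s by (intro ln_mono) auto
  have l3: "ln (cmod (snd y)) >= 0" using s by simp
  have "ln (cmod (phi y)) = ln (cmod (snd y)) + Re (log_ratio y)"
   using snd_nz[OF y] by (simp add: phi_def norm_mult ln_mult)
  moreover have "\<bar>Re (log_ratio y)\<bar> <= 1"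
   using log_ratio_bound[OF y] btm_arg(2)[OF y] abs_Re_le_cmod[of "log_ratio y"] by linarith
  moreover have "ln (cmod (phi y)) = ln (cmod (phi q)) * real d ^ m"
   using phi_nz[OF q] by (simp add: y_def phi_iterate[OF q] norm_power ln_realpow mult.commute)
  ultimately show ?thesis using l1 l2 l3 unfolding y_def[symmetric] by (simp add: abs_le_iff)
 qed
 have "(\<lambda>m. max 0 (ln (norm ((H ^^ m) q))) / real d ^ m - ln (cmod (phi q))) \<longlonglongrightarrow> 0"
 proof (rule tendsto_norm_zero_cancel, rule tendsto_sandwich[OF _ _ tendsto_const])
  show "\<forall>\<^sub>F m in sequentially. 0 <= norm (max 0 (ln (norm ((H ^^ m) q))) / real d ^ m - ln (cmod (phi q)))" by simp
  show "\<forall>\<^sub>F m in sequentially. norm (max 0 (ln (norm ((H ^^ m) q))) / real d ^ m - ln (cmod (phi q))) <= 2 * (1 / real d) ^ m"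
  proof (intro always_eventually allI)
   fix m
   have dm: "real d ^ m > 0" using d0 by simp
   have "max 0 (ln (norm ((H ^^ m) q))) / real d ^ m - ln (cmod (phi q)) =
     (max 0 (ln (norm ((H ^^ m) q))) - ln (cmod (phi q)) * real d ^ m) / real d ^ m"
    using dm by (simp add: diff_divide_distrib)
   hence "norm (max 0 (ln (norm ((H ^^ m) q))) / real d ^ m - ln (cmod (phi q))) =
     \<bar>max 0 (ln (norm ((H ^^ m) q))) - ln (cmod (phi q)) * real d ^ m\<bar> / real d ^ m"
    using dm by (simp only: real_norm_def abs_divide abs_of_pos)
   also have "... <= 2 / real d ^ m" using near dm by (intro divide_right_mono) auto
   finally show "norm (max 0 (ln (norm ((H ^^ m) q))) / real d ^ m - ln (cmod (phi q))) <= 2 * (1 / real d) ^ m"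
    by (simp add: power_divide)
  qed
  show "(\<lambda>m. 2 * (1 / real d) ^ m) \<longlonglongrightarrow> 0" using d0 by (intro tendsto_mult_right_zero LIMSEQ_realpow_zero) auto
 qed
 hence "(\<lambda>m. max 0 (ln (norm ((H ^^ m) q))) / real d ^ m) \<longlonglongrightarrow> ln (cmod (phi q))" by (rule LIM_zero_cancel)
 hence "(\<lambda>m. max 0 (ln (norm ((H ^^ m) q))) / real d ^ m / real d ^ n) \<longlonglongrightarrow> ln (cmod (phi q)) / real d ^ n"
  by (intro tendsto_divide tendsto_const) (use d0 in auto)
 hence "(\<lambda>m. max 0 (ln (norm ((H ^^ (m + n)) p))) / real d ^ (m + n)) \<longlonglongrightarrow> ln (cmod (Lam n p)) / real d ^ n"
  by (simp add: q_def funpow_add power_add Lam_def divide_divide_eq_left)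
 thus L: "(\<lambda>k. max 0 (ln (norm ((H ^^ k) p))) / real d ^ k) \<longlonglongrightarrow> ln (cmod (Lam n p)) / real d ^ n" by (rule LIMSEQ_offset)
 show "green_plus d H p = ln (cmod (Lam n p)) / real d ^ n" unfolding green_plus_def using L by (rule limI)
qed

lemma green_H: assumes "p \<in> U_plus H" shows "green_plus d H (H p) = real d * green_plus d H p"
proof -
 obtain n where n: "(H ^^ n) (H p) \<in> V" using assms H_U U_iff by blast
 hence "H p \<in> E n" "p \<in> E (Suc n)" by (auto simp: E_def funpow_swap1)
 thus ?thesis using d by (simp add: green_eq(2) Lam_def funpow_swap1)
qed

lemma cmod_Lam: assumes "p \<in> E n" shows "cmod (Lam n p) = exp (real d ^ n * green_plus d H p)"
 using Lam_nz[OF assms] d by (simp add: green_eq(2)[OF assms])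

lemma phi_gt_1: assumes "p \<in> V" shows "1 < cmod (phi p)"
proof -
 have "cmod (snd p) <= cmod (phi p) + 4 * M"
  using phi_approx[OF assms] norm_triangle_sub[of "snd p" "phi p"] norm_minus_commute[of "phi p" "snd p"] by linarith
 thus ?thesis using VoD(2)[OF assms] M by linarith
qed

lemma green_pos: assumes "p \<in> U_plus H" shows "0 < green_plus d H p"
proof -
 obtain n where "p \<in> E n" using assms unfolding U_eq_E by blast
 hence n: "p \<in> E n" .
 have "1 < cmod (Lam n p)" unfolding Lam_def by (rule phi_gt_1) (use n in \<open>simp add: E_def\<close>)
 moreover have "0 < real d ^ n" using d by simp
 ultimately show ?thesis unfolding green_eq(2)[OF n] by (intro divide_pos_pos ln_gt_zero)
qed

lemma green_derivative:
 assumes p: "p \<in> E n" and D: "(Lam n has_derivative L) (at p)" and lin: "\<And>c v. L (c *\<^sub>C v) = c *\<^sub>C L v"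
 shows "(green_plus d H has_derivative (\<lambda>v. Re (L v / Lam n p) / real d ^ n)) (at p)"
  and "del_form (green_plus d H) p v = L v / (2 * Lam n p * of_nat d ^ n)"
proof -
 have "((\<lambda>q. ln (cmod (Lam n q)) / real d ^ n) has_derivative (\<lambda>v. Re (L v / Lam n p) / real d ^ n)) (at p)"
  by (rule bounded_linear.has_derivative[OF bounded_linear_divide has_derivative_ln_cmod[OF D Lam_nz[OF p]]])
 thus G: "(green_plus d H has_derivative (\<lambda>v. Re (L v / Lam n p) / real d ^ n)) (at p)"
  by (rule has_derivative_transform_within_open[OF _ open_E p]) (simp add: green_eq(2))
 have F: "frechet_derivative (green_plus d H) (at p) = (\<lambda>v. Re (L v / Lam n p) / real d ^ n)"
  using frechet_derivative_at[OF G] by simp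
 have i: "Re (\<i> * z) = - Im z" for z by simp
 define z where "z = L v / Lam n p"
 have "L (\<i> *\<^sub>C v) / Lam n p = \<i> * z" by (simp add: lin scaleC_complex_def z_def)
 hence "del_form (green_plus d H) p v = (of_real (Re z / real d ^ n) - \<i> * of_real (- Im z / real d ^ n)) / 2"
  unfolding del_form_def F z_def[symmetric] by (simp only: i)
 also have "complex_of_real (Re z / real d ^ n) - \<i> * of_real (- Im z / real d ^ n) =
   (of_real (Re z) + \<i> * of_real (Im z)) / of_nat d ^ n" by (simp add: add_divide_distrib)
 also have "of_real (Re z) + \<i> * of_real (Im z) = L v / Lam n p" unfolding complex_eq[symmetric] by (rule z_def)
 finally show "del_form (green_plus d H) p v = L v / (2 * Lam n p * of_nat d ^ n)"
  by (simp only: divide_divide_eq_left mult_ac)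
qed

lemma Lam_derivative:
 assumes "p \<in> E n"
 shows "\<exists>L. (Lam n has_derivative L) (at p) & (\<forall>c v. L (c *\<^sub>C v) = c *\<^sub>C L v)"
 using Lam_holomorphic assms unfolding holomorphic_map_on_def by blast

lemma green_continuous: "continuous_on (U_plus H) (green_plus d H)" unfolding continuous_on_eq_continuous_at[OF open_U]
proof
 fix p assume "p \<in> U_plus H"
 then obtain n where n: "p \<in> E n" unfolding U_eq_E by blast
 then obtain L where "(Lam n has_derivative L) (at p)" "\<And>c v. L (c *\<^sub>C v) = c *\<^sub>C L v" using Lam_derivative by blast
 from has_derivative_continuous[OF green_derivative(1)[OF n this]]
 show "isCont (green_plus d H) p" .
qed

text \<open>Along a path in a leaf \<open>\<partial>G\<close> vanishes, hence so does the full derivative of the real function \<open>G\<close>.\<close>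

lemma leaf_green:
 assumes q: "q \<in> green_leaf d H p"
 shows "q \<in> U_plus H" "green_plus d H q = green_plus d H p"
proof -
 obtain \<gamma> where \<gamma>: "\<gamma> C1_differentiable_on {0..1}" "\<gamma> 0 = p" "\<gamma> 1 = q" "\<gamma> ` {0..1} \<subseteq> U_plus H"
   "\<forall>t\<in>{0..1}. del_form (green_plus d H) (\<gamma> t) (vector_derivative \<gamma> (at t)) = 0"
  using q unfolding green_leaf_def by blast
 obtain D where D: "\<And>t. t \<in> {0..1} ==> (\<gamma> has_vector_derivative D t) (at t)"
  using \<gamma>(1) unfolding C1_differentiable_on_def by blast
 have \<gamma>U: "\<gamma> t \<in> U_plus H" if "t \<in> {0..1}" for t by (rule subsetD[OF \<gamma>(4) imageI[OF that]])
 show "q \<in> U_plus H" using \<gamma>U[of 1] \<gamma>(3) by simp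
 have "((\<lambda>t. green_plus d H (\<gamma> t)) has_vector_derivative 0) (at t within {0..1})" if t: "t \<in> {0..1}" for t
 proof -
  obtain n where n: "\<gamma> t \<in> E n" using \<gamma>U[OF t] unfolding U_eq_E by (rule UN_E)
  obtain L where L: "(Lam n has_derivative L) (at (\<gamma> t))" and lin: "\<forall>c v. L (c *\<^sub>C v) = c *\<^sub>C L v"
   using Lam_derivative[OF n] by (elim exE conjE)
  have "del_form (green_plus d H) (\<gamma> t) (D t) = 0" using bspec[OF \<gamma>(5) t] vector_derivative_at[OF D[OF t]] by simp
  hence L0: "L (D t) = 0" using green_derivative(2)[OF n L lin[rule_format]] Lam_nz[OF n] d by simp
  have "((\<lambda>t. green_plus d H (\<gamma> t)) has_derivative (\<lambda>h. Re (L (h *\<^sub>R D t) / Lam n (\<gamma> t)) / real d ^ n)) (at t)"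
   using D[OF t] green_derivative(1)[OF n L lin[rule_format]] unfolding has_vector_derivative_def
   by (rule has_derivative_compose)
  moreover have "L (h *\<^sub>R D t) = 0" for h using linear_scale[OF has_derivative_linear[OF L], of h "D t"] L0 by simp
  ultimately show ?thesis unfolding has_vector_derivative_def by (simp add: has_derivative_at_withinI)
 qed
 then obtain c where c: "\<And>t. t \<in> {0..1} ==> green_plus d H (\<gamma> t) = c"
  using has_vector_derivative_zero_constant[of "{0..1::real}" "\<lambda>t. green_plus d H (\<gamma> t)"] by auto
 show "green_plus d H q = green_plus d H p" using c[of 0] c[of 1] \<gamma>(2,3) by simp
qed

end


lemma hmap_vector_derivative:
 fixes F :: "complex => C2"
 assumes F: "hmap F S" and S: "open S" and t: "of_real t \<in> S"
 shows "((\<lambda>t. F (of_real t)) has_vector_derivative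
      (deriv (\<lambda>z. fst (F z)) (of_real t), deriv (\<lambda>z. snd (F z)) (of_real t))) (at t)"
proof -
 have 1: "(\<lambda>z. fst (F z)) holomorphic_on S" "(\<lambda>z. snd (F z)) holomorphic_on S"
  using hmap_compose[OF F hmap_fst[of UNIV]]
   hmap_compose[OF F hmap_snd[of UNIV]] S by (auto simp: hmap_complex)
 have "((\<lambda>t. (fst (F (of_real t)), snd (F (of_real t)))) has_vector_derivative
      (deriv (\<lambda>z. fst (F z)) (of_real t), deriv (\<lambda>z. snd (F z)) (of_real t))) (at t)"
  by (intro has_vector_derivative_Pair has_vector_derivative_real_field holomorphic_derivI[OF _ S t] 1)
 thus ?thesis by simp
qed

context henon_dyn
begin

lemma iterate_cancel: "(H' ^^ n) ((H ^^ n) p) = p" "(H ^^ n) ((H' ^^ n) p) = p"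
 using funpow_cancel[of H' H] funpow_cancel[of H H'] H'H HH' by blast+

text \<open>
  For fixed \<open>x\<close>, the function \<open>y \<mapsto> \<phi>(x, y) - y\<close> is bounded by \<open>4 M\<close> on a disk whose radius is a large
  multiple of \<open>M\<close>; by Cauchy's estimate it is a contraction on a smaller disk.
\<close>

lemma phi_vertical_contraction:
 assumes B: "\<And>y. y \<in> ball w (2 * r) ==> (x, y) \<in> V" and r: "r >= 32 * M"
  and y: "y \<in> cball w r" "y' \<in> cball w r"
 shows "cmod ((phi (x, y) - y) - (phi (x, y') - y')) <= 1 / 2 * cmod (y - y')"
proof -
 have r0: "r > 0" using r M by simp
 define f where "f y = phi (x, y) - y" for y
 have "hmap (\<lambda>y. (x, y)) (ball w (2 * r))" by (intro hmap_Pair hmap_const hmap_id)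
 hence "hmap (\<lambda>y. phi (x, y)) (ball w (2 * r))" by (rule hmap_compose[OF _ phi_holomorphic]) (use B in blast)
 hence hol: "f holomorphic_on ball w (2 * r)"
  unfolding f_def by (simp add: hmap_complex holomorphic_on_diff holomorphic_on_ident)
 have bnd: "cmod (deriv f z) <= 1 / 2" if z: "z \<in> cball w r" for z
 proof -
  note sub = ball_subset_double[OF z]
  have "cmod (deriv f z * 1) <= 2 * (4 * M) / r * cmod 1"
  proof (rule hmap_derivative_bound)
   show "hmap f (ball z r)" using hol sub by (simp add: hmap_complex holomorphic_on_subset)
   show "cmod (f u) <= 4 * M" if "u \<in> ball z r" for u
   proof -
    have "(x, u) \<in> V" using B sub that by blast
    from phi_approx[OF this] show ?thesis by (simp add: f_def)
   qed
   have "z \<in> ball w (2 * r)" using sub r0 by (meson centre_in_ball subsetD)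
   from holomorphic_derivI[OF hol open_ball this]
   show "(f has_derivative (*) (deriv f z)) (at z)" by (simp add: has_field_derivative_def)
  qed (rule r0)
  also have "2 * (4 * M) / r * cmod 1 <= 1 / 2" using r M r0 by (simp add: divide_simps)
  finally show ?thesis by simp
 qed
 have "cmod (f y - f y') <= 1 / 2 * cmod (y - y')"
 proof (rule field_differentiable_bound[OF convex_cball _ bnd])
  fix z assume "z \<in> cball w r"
  hence "z \<in> ball w (2 * r)" using r0 by auto
  from holomorphic_derivI[OF hol open_ball this]
  show "(f has_field_derivative deriv f z) (at z within cball w r)" by (rule has_field_derivative_at_within)
 qed (use y in auto)
 thus ?thesis by (simp add: f_def)
qed

text \<open>
  The fibre of \<open>phi\<close> over \<open>w\<close> is a graph over the first coordinate: \<open>y \<mapsto> w - (phi (x, y) - y)\<close> contracts a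
  disk about \<open>w\<close>, and its fixed point depends holomorphically on \<open>x\<close>. The part of the graph over the
  line through the first coordinates of \<open>a\<close> and \<open>b\<close> joins the two points.
\<close>

lemma fibre_graph:
 assumes a: "a \<in> V" "300 * cmod (fst a) <= cmod (snd a)" "1600 * M <= cmod (snd a)"
  and b: "b \<in> V" "300 * cmod (fst b) <= cmod (snd b)" "1600 * M <= cmod (snd b)"
  and ab: "phi a = w" "phi b = w"
 shows "\<exists>F :: complex => C2. hmap F (ball 0 2) & F 0 = a & F 1 = b \<and>
      (\<forall>\<xi>\<in>ball 0 2. F \<xi> \<in> V & phi (F \<xi>) = w)"
proof -
 \<comment> \<open>Small enough for the disk of radius \<open>2 * r\<close> to stay in \<open>V\<close>, large enough to dominate \<open>M\<close>.\<close>
 define r where "r = cmod w / 4"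
 have wa: "cmod (w - snd a) <= 4 * M" and wb: "cmod (w - snd b) <= 4 * M"
  using phi_approx[OF a(1)] phi_approx[OF b(1)] ab by auto
 have sa: "cmod (snd a) <= cmod w + 4 * M" "cmod w >= cmod (snd a) - 4 * M"
  and sb: "cmod (snd b) <= cmod w + 4 * M" using wa wb norm_triangle_sub[of "snd a" w] norm_triangle_sub[of "snd b" w]
  by (simp_all add: norm_minus_commute)
 have w: "cmod w >= 1596 * M" using sa a by linarith
 have r: "r >= 32 * M" "r > 0" "4 * M <= r" using w M by (auto simp: r_def)
 define X where "X \<xi> = fst a + \<xi> * (fst b - fst a)" for \<xi>
 have X: "cmod (X \<xi>) <= cmod w / 50" if "\<xi> \<in> ball 0 2" for \<xi>
 proof -
  have "cmod (X \<xi>) <= cmod (fst a) + cmod \<xi> * cmod (fst b - fst a)"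
   unfolding X_def by (metis norm_mult norm_triangle_ineq)
  also have "... <= cmod (fst a) + 2 * (cmod (fst b) + cmod (fst a))"
   using that by (intro add_left_mono mult_mono norm_triangle_ineq4) auto
  finally have "300 * cmod (X \<xi>) <= 900 * cmod (fst a) + 600 * cmod (fst b)" by simp
  also have "... <= 3 * cmod (snd a) + 2 * cmod (snd b)" using a(2) b(2) by simp
  also have "... <= 5 * cmod w + 20 * M" using sa sb by simp
  also have "... <= 6 * cmod w" using w M by simp
  finally show ?thesis by simp
 qed
 have inV: "(X \<xi>, y) \<in> V" if "\<xi> \<in> ball 0 2" "y \<in> ball w (2 * r)" for \<xi> y
 proof -
  have "cmod w - cmod y < cmod w / 2" using that(2) norm_triangle_sub[of w y] by (simp add: dist_norm r_def)
  thus ?thesis using X[OF that(1)] w M by (auto simp: Vo_def)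
 qed
 have inV': "(X \<xi>, y) \<in> V" if "\<xi> \<in> ball 0 2" "y \<in> cball w r" for \<xi> y using inV[OF that(1)] that(2) r by auto
 have contr: "cmod ((phi (X \<xi>, y) - y) - (phi (X \<xi>, y') - y')) <= 1 / 2 * cmod (y - y')"
  if "\<xi> \<in> ball 0 2" "y \<in> cball w r" "y' \<in> cball w r" for \<xi> y y'
  using phi_vertical_contraction[OF inV[OF that(1)] r(1) that(2,3)] .
 have near: "cmod (phi (X \<xi>, y) - y) <= 4 * M" if "\<xi> \<in> ball 0 2" "y \<in> cball w r" for \<xi> y
  using phi_approx[OF inV'[OF that]] by simp
 define Y where "Y k \<xi> = ((\<lambda>y. w - (phi (X \<xi>, y) - y)) ^^ k) w" for k \<xi>
 have Y0: "Y 0 \<xi> = w" and YS: "Y (Suc k) \<xi> = w - (phi (X \<xi>, Y k \<xi>) - Y k \<xi>)" for k \<xi> by (auto simp: Y_def)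
 have Yin: "Y k \<xi> \<in> cball w r" if "\<xi> \<in> ball 0 2" for k \<xi>
 proof (induction k)
  case 0
  thus ?case using r by (simp add: Y0)
 next
  case (Suc k)
  thus ?case using near[OF that Suc] r by (simp add: YS dist_norm)
 qed
 have Ystep: "cmod (Y (Suc k) \<xi> - Y k \<xi>) <= 8 * M * (1 / 2) ^ (k + 1)" if "\<xi> \<in> ball 0 2" for k \<xi>
 proof (induction k)
  case 0
  have "cmod (Y (Suc 0) \<xi> - Y 0 \<xi>) = cmod (phi (X \<xi>, w) - w)" unfolding YS Y0 by (simp add: norm_minus_commute)
  thus ?case using near[OF that, of w] r by simp
 next
  case (Suc k)
  have "Y (Suc (Suc k)) \<xi> - Y (Suc k) \<xi> =
    - ((phi (X \<xi>, Y (Suc k) \<xi>) - Y (Suc k) \<xi>) - (phi (X \<xi>, Y k \<xi>) - Y k \<xi>))" unfolding YS[of "Suc k"] YS[of k] by simp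
  hence "cmod (Y (Suc (Suc k)) \<xi> - Y (Suc k) \<xi>) <= 1 / 2 * cmod (Y (Suc k) \<xi> - Y k \<xi>)"
   using contr[OF that Yin[OF that] Yin[OF that], of "Suc k" k] by (simp only: norm_minus_cancel)
  also have "... <= 1 / 2 * (8 * M * (1 / 2) ^ (k + 1))" using Suc by (intro mult_left_mono) auto
  finally show ?case by simp
 qed
 have Xhol: "hmap X (ball 0 2)" unfolding X_def by (simp add: hmap_complex) (intro holomorphic_intros)
 have Yhol: "hmap (Y k) (ball 0 2)" for k
 proof (induction k)
  case 0
  thus ?case using hmap_const[of w "ball 0 2"] by (simp add: Y0[abs_def])
 next
  case (Suc k)
  have "hmap (\<lambda>\<xi>. phi (X \<xi>, Y k \<xi>)) (ball 0 2)" by (rule hmap_compose[OF hmap_Pair[OF Xhol Suc] phi_holomorphic])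
     (use inV' Yin in blast)
  with Suc show ?case unfolding YS[abs_def] by (auto simp: hmap_complex intro!: holomorphic_intros)
 qed
 define Z where "Z \<xi> = w + (\<Sum>k. Y (Suc k) \<xi> - Y k \<xi>)" for \<xi>
 have "hmap (\<lambda>\<xi>. \<Sum>k. Y (Suc k) \<xi> - Y k \<xi>) (ball 0 2)"
 proof (rule hmap_suminf[OF open_ball])
  show "summable (\<lambda>k. 8 * M * (1 / 2) ^ (k + 1))" by (rule sums_summable[OF half_sums])
  show "cmod (Y (Suc k) \<xi> - Y k \<xi>) <= 8 * M * (1 / 2) ^ (k + 1)" if "\<xi> \<in> ball 0 2" for k \<xi> by (rule Ystep[OF that])
  show "hmap (\<lambda>\<xi>. Y (Suc k) \<xi> - Y k \<xi>) (ball 0 2)" for k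
   using Yhol[of k] Yhol[of "Suc k"] by (auto simp: hmap_complex intro!: holomorphic_intros)
 qed
 hence Zhol: "hmap Z (ball 0 2)" unfolding Z_def by (auto simp: hmap_complex intro!: holomorphic_intros)
 have lim: "(\<lambda>k. Y k \<xi>) \<longlonglongrightarrow> Z \<xi>" if "\<xi> \<in> ball 0 2" for \<xi>
 proof -
  have "summable (\<lambda>k. Y (Suc k) \<xi> - Y k \<xi>)"
   by (rule summable_comparison_test'[OF sums_summable[OF half_sums]]) (rule Ystep[OF that])
  hence "(\<lambda>n. \<Sum>k<n. Y (Suc k) \<xi> - Y k \<xi>) \<longlonglongrightarrow> (\<Sum>k. Y (Suc k) \<xi> - Y k \<xi>)" by (rule summable_LIMSEQ)
  hence "(\<lambda>n. Y n \<xi> - Y 0 \<xi>) \<longlonglongrightarrow> (\<Sum>k. Y (Suc k) \<xi> - Y k \<xi>)" by (simp only: sum_lessThan_telescope[of "\<lambda>k. Y k \<xi>"])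
  from tendsto_add[OF tendsto_const[of w] this] show ?thesis by (simp add: Z_def Y0)
 qed
 have Zin: "Z \<xi> \<in> cball w r" if "\<xi> \<in> ball 0 2" for \<xi>
  using closed_sequentially[OF closed_cball Yin[OF that] lim[OF that]] .
 have Zphi: "phi (X \<xi>, Z \<xi>) = w" if \<xi>: "\<xi> \<in> ball 0 2" for \<xi>
 proof -
  have "isCont phi (X \<xi>, Z \<xi>)" using hmap_continuous_on[OF phi_holomorphic] inV'[OF \<xi> Zin[OF \<xi>]] open_Vo
   by (simp add: continuous_on_eq_continuous_at)
  hence "(\<lambda>k. phi (X \<xi>, Y k \<xi>)) \<longlonglongrightarrow> phi (X \<xi>, Z \<xi>)"
   by (rule isCont_tendsto_compose) (intro tendsto_Pair tendsto_const lim[OF \<xi>])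
  hence "(\<lambda>k. Y (Suc k) \<xi>) \<longlonglongrightarrow> w - (phi (X \<xi>, Z \<xi>) - Z \<xi>)" unfolding YS by (intro tendsto_diff tendsto_const lim[OF \<xi>])
  hence "w - (phi (X \<xi>, Z \<xi>) - Z \<xi>) = Z \<xi>" using LIMSEQ_unique LIMSEQ_Suc[OF lim[OF \<xi>]] by blast
  thus ?thesis by (simp add: algebra_simps)
 qed
 have uniq: "y = Z \<xi>" if \<xi>: "\<xi> \<in> ball 0 2" and y: "y \<in> cball w r" "phi (X \<xi>, y) = w" for \<xi> y
 proof -
  have "cmod (Z \<xi> - y) <= 1 / 2 * cmod (y - Z \<xi>)" using contr[OF \<xi> y(1) Zin[OF \<xi>]] Zphi[OF \<xi>] y(2) by simp
  thus ?thesis by (simp add: norm_minus_commute)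
 qed
 have "X 0 = fst a" "X 1 = fst b" by (auto simp: X_def)
 moreover have "Z 0 = snd a" by (rule uniq[symmetric]) (use wa r ab \<open>X 0 = fst a\<close> in \<open>auto simp: dist_norm\<close>)
 moreover have "Z 1 = snd b" by (rule uniq[symmetric]) (use wb r ab \<open>X 1 = fst b\<close> in \<open>auto simp: dist_norm\<close>)
 ultimately have "(X 0, Z 0) = a" "(X 1, Z 1) = b" by auto
 moreover have "\<forall>\<xi>\<in>ball 0 2. (X \<xi>, Z \<xi>) \<in> V & phi (X \<xi>, Z \<xi>) = w" using inV' Zin Zphi by blast
 ultimately show ?thesis using hmap_Pair[OF Xhol Zhol] by (intro exI[of _ "\<lambda>\<xi>. (X \<xi>, Z \<xi>)"]) simp
qed

text \<open>Three more iterates take both points to where fibres are graphs; the inverse takes the joining disk back.\<close>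

lemma same_phi_imp_leaf:
 assumes p: "p \<in> E N" and q: "q \<in> E N" and eq: "Lam N p = Lam N q"
 shows "q \<in> green_leaf d H p"
proof -
 define n where "n = Suc (Suc (Suc N))"
 have deep: "(H ^^ n) x \<in> V" "300 * cmod (fst ((H ^^ n) x)) <= cmod (snd ((H ^^ n) x))"
   "1600 * M <= cmod (snd ((H ^^ n) x))" "x \<in> E n" "Lam n x = Lam N x ^ d ^ 3" if x: "x \<in> E N" for x
 proof -
  define y where "y = (H ^^ N) x"
  have y: "y \<in> V" using x by (simp add: E_def y_def)
  have nx: "(H ^^ n) x = (H ^^ 3) y" "(H ^^ n) x = H ((H ^^ 2) y)" by (simp_all add: n_def y_def numeral_eq_Suc)
  show "(H ^^ n) x \<in> V" unfolding nx(1) by (rule iterate_V[OF y])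
  thus "x \<in> E n" by (simp add: E_def)
  show "300 * cmod (fst ((H ^^ n) x)) <= cmod (snd ((H ^^ n) x))"
   unfolding nx(2) using step(4) VoD[OF iterate_V[OF y]] by blast
  show "1600 * M <= cmod (snd ((H ^^ n) x))" unfolding nx(1) using iterate_growth[OF y, of 3] VoD(2)[OF y] M by simp
  show "Lam n x = Lam N x ^ d ^ 3" using phi_iterate[OF y, of 3] by (simp only: Lam_def nx(1)) (simp add: y_def)
 qed
 define w where "w = Lam n p"
 have wq: "Lam n q = w" using deep(5)[OF p] deep(5)[OF q] eq by (simp add: w_def)
 obtain F :: "complex => C2" where F: "hmap F (ball 0 2)" "F 0 = (H ^^ n) p" "F 1 = (H ^^ n) q"
   "\<And>\<xi>. \<xi> \<in> ball 0 2 ==> F \<xi> \<in> V" "\<And>\<xi>. \<xi> \<in> ball 0 2 ==> phi (F \<xi>) = w"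
  using fibre_graph[OF deep(1-3)[OF p] deep(1-3)[OF q], of w] wq unfolding w_def Lam_def by auto
 define g where "g \<xi> = (H' ^^ n) (F \<xi>)" for \<xi>
 have g: "hmap g (ball 0 2)" unfolding g_def by (rule hmap_compose[OF F(1) holomorphic_iterate(2)]) simp
 have gE: "g \<xi> \<in> E n" "Lam n (g \<xi>) = w" if "\<xi> \<in> ball 0 2" for \<xi>
  using F(4,5)[OF that] by (simp_all add: E_def g_def iterate_cancel Lam_def)
 define \<gamma> where "\<gamma> t = g (complex_of_real t)" for t
 define D where "D t = (deriv (\<lambda>z. fst (g z)) (complex_of_real t), deriv (\<lambda>z. snd (g z)) (complex_of_real t))" for t
 have D: "(\<gamma> has_vector_derivative D t) (at t)" if "\<bar>t\<bar> < 2" for t unfolding \<gamma>_def D_def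
  by (rule hmap_vector_derivative[OF g open_ball]) (use that in simp)
 have hol: "(\<lambda>z. fst (g z)) holomorphic_on ball 0 2" "(\<lambda>z. snd (g z)) holomorphic_on ball 0 2"
  using hmap_compose[OF g hmap_fst[of UNIV]]
   hmap_compose[OF g hmap_snd[of UNIV]] by (auto simp: hmap_complex)
 have contD: "continuous_on {0..1} D" unfolding D_def
  by (intro continuous_on_Pair continuous_on_compose2[OF holomorphic_on_imp_continuous_on[OF holomorphic_deriv[OF hol(1) open_ball]]]
   continuous_on_compose2[OF holomorphic_on_imp_continuous_on[OF holomorphic_deriv[OF hol(2) open_ball]]] continuous_intros) auto
 have "\<gamma> C1_differentiable_on {0..1}" unfolding C1_differentiable_on_def by (intro exI[of _ D] conjI ballI contD D) auto
 moreover have "\<gamma> 0 = p" "\<gamma> 1 = q" using F(2,3) by (simp_all add: \<gamma>_def g_def iterate_cancel)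
 moreover have \<gamma>E: "\<gamma> t \<in> E n" "Lam n (\<gamma> t) = w" if "\<bar>t\<bar> < 2" for t
  using gE[of "complex_of_real t"] that by (auto simp: \<gamma>_def)
 have "\<gamma> ` {0..1} \<subseteq> U_plus H"
 proof (rule image_subsetI)
  fix t :: real assume "t \<in> {0..1}"
  thus "\<gamma> t \<in> U_plus H" using \<gamma>E(1)[of t] unfolding U_eq_E by auto
 qed
 moreover have "del_form (green_plus d H) (\<gamma> t) (vector_derivative \<gamma> (at t)) = 0" if t: "t \<in> {0..1}" for t
 proof -
  have t2: "\<bar>t\<bar> < 2" using t by auto
  obtain L where L: "(Lam n has_derivative L) (at (\<gamma> t))" and lin: "\<forall>c v. L (c *\<^sub>C v) = c *\<^sub>C L v"
   using Lam_derivative[OF \<gamma>E(1)[OF t2]] by (elim exE conjE)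
  have "((\<lambda>s. Lam n (\<gamma> s)) has_derivative (\<lambda>h. L (h *\<^sub>R D t))) (at t)"
   using D[OF t2] L unfolding has_vector_derivative_def by (rule has_derivative_compose)
  moreover have "((\<lambda>s. Lam n (\<gamma> s)) has_derivative (\<lambda>h. 0)) (at t)"
   by (rule has_derivative_transform_within_open[where f = "\<lambda>s. w" and s = "{-2<..<2}"])
     (use t \<gamma>E(2) in auto)
  ultimately have "(\<lambda>h. L (h *\<^sub>R D t)) = (\<lambda>h. 0)" by (rule has_derivative_unique)
  from fun_cong[OF this, of 1] have "L (D t) = 0" by simp
  thus ?thesis using green_derivative(2)[OF \<gamma>E(1)[OF t2] L lin[rule_format]] vector_derivative_at[OF D[OF t2]] by simp
 qed
 ultimately show ?thesis unfolding green_leaf_def by blast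
qed

lemma leaf_refl: assumes "p \<in> U_plus H" shows "p \<in> green_leaf d H p"
proof -
 obtain n where "p \<in> E n" using assms unfolding U_eq_E by (rule UN_E)
 thus ?thesis by (intro same_phi_imp_leaf[OF _ _ refl])
qed

section \<open>Leaves are dense in the level sets of the Green function\<close>

lemma roots_of_unity_dense:
 assumes c: "cmod c = 1" and d2: "2 <= (b::nat)" and e: "e > 0"
 shows "\<exists>\<zeta> k. \<zeta> ^ (b ^ k) = 1 & cmod (\<zeta> - c) < e"
proof -
 define \<theta> where "\<theta> = Arg c / (2 * pi)"
 have cexp: "c = exp (\<i> * of_real (2 * pi * \<theta>))" using Arg_eq[of c] c by (cases "c = 0") (auto simp: \<theta>_def)
 define x where "x k = of_int \<lfloor>\<theta> * real b ^ k\<rfloor> / real b ^ k" for k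
 have b1: "real b > 1" using d2 by simp
 have "(\<lambda>k. x k - \<theta>) \<longlonglongrightarrow> 0"
 proof (rule Lim_null_comparison)
  show "\<forall>\<^sub>F k in sequentially. norm (x k - \<theta>) <= (1 / real b) ^ k"
  proof (intro always_eventually allI)
   fix k
   have bk: "real b ^ k > 0" using b1 by simp
   have "x k - \<theta> = (of_int \<lfloor>\<theta> * real b ^ k\<rfloor> - \<theta> * real b ^ k) / real b ^ k"
    using bk by (simp add: x_def diff_divide_distrib)
   also have "\<bar>\<dots>\<bar> <= 1 / real b ^ k"
   proof -
    have "\<bar>of_int \<lfloor>y\<rfloor> - y\<bar> <= 1" for y :: real by linarith
    thus ?thesis unfolding abs_divide using bk by (intro frac_le) simp_all
   qed
   finally show "norm (x k - \<theta>) <= (1 / real b) ^ k" by (simp add: power_divide)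
  qed
  show "(\<lambda>k. (1 / real b) ^ k) \<longlonglongrightarrow> 0" using b1 by (intro LIMSEQ_realpow_zero) auto
 qed
 hence "x \<longlonglongrightarrow> \<theta>" by (rule LIM_zero_cancel)
 hence "(\<lambda>k. exp (\<i> * of_real (2 * pi * x k))) \<longlonglongrightarrow> exp (\<i> * of_real (2 * pi * \<theta>))" by (intro tendsto_intros)
 hence "\<forall>\<^sub>F k in sequentially. dist (exp (\<i> * of_real (2 * pi * x k))) c < e"
  unfolding cexp[symmetric] using e by (rule tendstoD)
 then obtain k where k: "cmod (exp (\<i> * of_real (2 * pi * x k)) - c) < e"
  using eventually_happens'[OF sequentially_bot] by (auto simp: dist_norm)
 have "exp (\<i> * of_real (2 * pi * x k)) ^ (b ^ k) = exp (of_nat (b ^ k) * (\<i> * of_real (2 * pi * x k)))"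
  by (rule exp_of_nat_mult[symmetric])
 also have "of_nat (b ^ k) * (\<i> * complex_of_real (2 * pi * x k)) = of_int (2 * \<lfloor>\<theta> * real b ^ k\<rfloor>) * of_real pi * \<i>"
 proof -
  have "real b ^ k * x k = of_int \<lfloor>\<theta> * real b ^ k\<rfloor>" using b1 by (simp add: x_def)
  hence "of_real (real b ^ k) * of_real (x k) = complex_of_real (of_int \<lfloor>\<theta> * real b ^ k\<rfloor>)"
   by (simp only: of_real_mult[symmetric])
  hence *: "of_nat (b ^ k) * complex_of_real (x k) = of_int \<lfloor>\<theta> * real b ^ k\<rfloor>" by simp
  have "of_nat (b ^ k) * (\<i> * complex_of_real (2 * pi * x k)) =
    2 * (of_nat (b ^ k) * complex_of_real (x k)) * of_real pi * \<i>" by (simp only: of_real_mult of_real_numeral mult_ac)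
  thus ?thesis unfolding * by simp
 qed
 also have "exp ... = 1" by (simp add: exp_eq_1)
 finally show ?thesis using k by blast
qed

text \<open>
  A leaf contains all points at which some \<open>Lam n\<close> takes the same value as at \<open>p\<close>, so on a vertical
  disk near \<open>q\<close> it suffices to hit a value \<open>\<zeta> * Lam n p\<close> with \<open>\<zeta> ^ (d ^ k) = 1\<close>; these are dense in a circle.
\<close>

lemma leaf_dense_in_level:
 assumes p: "p \<in> U_plus H" and q: "q \<in> U_plus H" and eq: "green_plus d H p = green_plus d H q"
  and Oq: "open S" "q \<in> S"
 shows "\<exists>q'\<in>S. q' \<in> green_leaf d H p"
proof -
 obtain n0 where n0: "p \<in> E n0" "q \<in> E n0"
 proof -
  obtain i j where "p \<in> E i" "q \<in> E j" using p q unfolding U_eq_E by blast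
  thus ?thesis using that[of "max i j"] E_mono[of i "max i j"] E_mono[of j "max i j"] by auto
 qed
 define n where "n = Suc (n0)"
 have n: "p \<in> E n" "q \<in> E n" using n0 E_mono[of n0 n] by (auto simp: n_def)
 define b where "b = (H ^^ n) q"
 have b0: "(H ^^ n0) q \<in> V" using n0 by (simp add: E_def)
 have b: "b \<in> V" "300 * cmod (fst b) <= cmod (snd b)" "800 * M <= cmod (snd b)"
  using n step(3,4)[OF VoD(1)[OF b0] VoD(2)[OF b0]] VoD(2)[OF b0] by (auto simp: b_def n_def E_def)
 define r where "r = cmod (snd b) / 8"
 have r: "r > 0" "r >= 32 * M" using b M by (auto simp: r_def)
 have inV: "(fst b, y) \<in> V" if "y \<in> ball (snd b) (2 * r)" for y
 proof -
  have "cmod (snd b) - cmod y < cmod (snd b) / 4"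
   using that norm_triangle_sub[of "snd b" y] by (simp add: dist_norm r_def)
  thus ?thesis using b M by (auto simp: Vo_def)
 qed
 define h where "h y = phi (fst b, y)" for y
 define B where "B = ball (snd b) r \<inter> (\<lambda>y. (H' ^^ n) (fst b, y)) -` S"
 have inj: "inj_on h B"
 proof (rule inj_onI)
  fix y y' assume y: "y \<in> B" "y' \<in> B" "h y = h y'"
  have "cmod ((phi (fst b, y) - y) - (phi (fst b, y') - y')) <= 1 / 2 * cmod (y - y')"
   by (rule phi_vertical_contraction[OF inV r(2)]) (use y in \<open>auto simp: B_def\<close>)
  thus "y = y'" using y(3) by (simp add: h_def norm_minus_commute)
 qed
 have openB: "open B" unfolding B_def
  by (intro open_Int open_ball open_vimage[OF Oq(1)] continuous_on_compose2[OF cont_iterate(2)[of UNIV n]] continuous_intros) auto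
 have "hmap (\<lambda>y. (fst b, y)) B" by (intro hmap_Pair hmap_const hmap_id)
 hence "hmap h B" unfolding h_def
 proof (rule hmap_compose[OF _ phi_holomorphic])
  show "(\<lambda>y. (fst b, y)) ` B \<subseteq> V" by (rule image_subsetI) (rule inV, use r in \<open>auto simp: B_def\<close>)
 qed
 hence "h holomorphic_on B" using openB by (simp add: hmap_complex)
 hence "open (h ` B)" using openB inj by (rule open_mapping_thm3)
 moreover have "snd b \<in> B" using Oq r by (simp add: B_def b_def iterate_cancel)
 hence "phi b \<in> h ` B" by (force simp: h_def)
 ultimately obtain e where e: "e > 0" "ball (phi b) e \<subseteq> h ` B" using open_contains_ball by blast
 define w where "w = Lam n p"
 have w0: "w ~= 0" using Lam_nz n by (simp add: w_def)
 have bw: "cmod (phi b) = cmod w" using cmod_Lam[OF n(1)] cmod_Lam[OF n(2)] eq by (simp add: w_def Lam_def b_def)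
 obtain \<zeta> k where \<zeta>: "\<zeta> ^ (d ^ k) = 1" "cmod (\<zeta> - phi b / w) < e / cmod w"
  using roots_of_unity_dense[of "phi b / w" d "e / cmod w"] bw w0 e d by (auto simp: norm_divide)
 have "cmod (\<zeta> - phi b / w) * cmod w < e" using \<zeta>(2) w0 by (simp add: pos_less_divide_eq)
 hence "cmod (\<zeta> * w - phi b) < e" using w0 by (simp add: left_diff_distrib flip: norm_mult)
 hence "\<zeta> * w \<in> ball (phi b) e" by (simp add: dist_norm norm_minus_commute)
 then obtain y where y: "y \<in> B" "h y = \<zeta> * w" using e by auto
 define q' where "q' = (H' ^^ n) (fst b, y)"
 have Hq': "(H ^^ n) q' = (fst b, y)" by (simp add: q'_def iterate_cancel)
 have q'E: "q' \<in> E n" unfolding E_def vimage_def mem_Collect_eq Hq' by (rule inV) (use y r in \<open>auto simp: B_def\<close>)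
 have "Lam n q' = \<zeta> * w" using y(2) by (simp add: Lam_def Hq' h_def)
 hence "Lam (k + n) q' = Lam (k + n) p"
  using \<zeta>(1) by (simp add: Lam_add[OF q'E] Lam_add[OF n(1)] power_mult_distrib w_def)
 hence "q' \<in> green_leaf d H p" using same_phi_imp_leaf[of p "k + n" q'] E_mono[of n "k + n"] n q'E by auto
 moreover have "q' \<in> S" using y by (simp add: B_def q'_def)
 ultimately show ?thesis by blast
qed

lemma size_max_H: "size_max (H p) <= (M + 1) * size_max p ^ d"
proof -
 define s where "s = size_max p"
 have s: "s >= 1" "cmod (snd p) <= s" using size_max_ge by (auto simp: s_def)
 have A: "cmod (snd (H p) - snd p ^ d) <= M * s ^ (d - 1)" "cmod (fst (H p)) <= M * s ^ (d - 1)"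
  using lead[unfolded leading_power_def, rule_format, of p] by (simp_all add: s_def)
 have m: "M * s ^ (d - 1) <= M * s ^ d" using s M by (intro mult_left_mono power_increasing) auto
 have "cmod (snd p ^ d) <= s ^ d" unfolding norm_power using s by (intro power_mono) auto
 hence 1: "cmod (snd (H p)) <= (M + 1) * s ^ d"
  using A(1) m norm_triangle_sub[of "snd (H p)" "snd p ^ d"] by (simp add: algebra_simps)
 have "1 * 1 <= (M + 1) * s ^ d" using s M by (intro mult_mono) auto
 moreover have "M * s ^ d <= (M + 1) * s ^ d" using s by (intro mult_right_mono) auto
 hence "cmod (fst (H p)) <= (M + 1) * s ^ d" using A(2) m by linarith
 ultimately show ?thesis using 1 by (simp add: size_max_def[of "H p"] s_def)
qed

lemma green_upper: assumes "p \<in> U_plus H" shows "green_plus d H p <= ln (size_max p) + ln (M + 1) + 1"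
proof -
 define L where "L = ln (M + 1)"
 have L: "L >= 0" using M by (simp add: L_def)
 have rec: "ln (size_max ((H ^^ k) p)) + L <= real d ^ k * (ln (size_max p) + L)" for k
 proof (induction k)
  case (Suc k)
  define s where "s = size_max ((H ^^ k) p)"
  have s: "s >= 1" using size_max_ge by (simp add: s_def)
  have "ln (size_max ((H ^^ Suc k) p)) <= ln ((M + 1) * s ^ d)"
   using size_max_H[of "(H ^^ k) p"] size_max_ge(1)[of "(H ^^ Suc k) p"] by (intro ln_mono) (auto simp: s_def)
  also have "... = L + real d * ln s" using M s by (simp add: ln_mult ln_realpow L_def)
  finally have "ln (size_max ((H ^^ Suc k) p)) + L <= 2 * L + real d * ln s" by simp
  also have "... <= real d * L + real d * ln s" using d L by (intro add_right_mono mult_right_mono) auto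
  also have "... = real d * (ln s + L)" by (simp add: algebra_simps)
  also have "... <= real d * (real d ^ k * (ln (size_max p) + L))" using Suc by (intro mult_left_mono) (auto simp: s_def)
  finally show ?case by (simp add: mult.assoc)
 qed simp
 obtain n where n: "p \<in> E n" using assms unfolding U_eq_E by blast
 define y where "y = (H ^^ n) p"
 have y: "y \<in> V" using n by (simp add: E_def y_def)
 have sy: "cmod (snd y) > 0" using snd_nz[OF y] by simp
 have "cmod (phi y) <= cmod (snd y) + 4 * M" using phi_approx[OF y] norm_triangle_sub[of "phi y" "snd y"] by linarith
 also have "... <= 2 * cmod (snd y)" using VoD(2)[OF y] M by linarith
 also have "... <= 2 * size_max y" using size_max_ge(3) by simp
 finally have "ln (cmod (phi y)) <= ln (2 * size_max y)" using phi_nz[OF y] by (intro ln_mono) auto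
 also have "... = ln 2 + ln (size_max y)" using size_max_ge(1)[of y] by (subst ln_mult) auto
 also have "... <= 1 + ln (size_max y)" using ln_2_less_1 by simp
 also have "... <= 1 + real d ^ n * (ln (size_max p) + L)" using rec[of n] L by (simp add: y_def)
 finally have "ln (cmod (phi y)) / real d ^ n <= (1 + real d ^ n * (ln (size_max p) + L)) / real d ^ n"
  using d by (intro divide_right_mono) auto
 also have "... = 1 / real d ^ n + (ln (size_max p) + L)" using d by (simp add: add_divide_distrib)
 also have "... <= 1 + (ln (size_max p) + L)" using d by simp
 finally show ?thesis using green_eq(2)[OF n] by (simp add: Lam_def y_def L_def)
qed

lemma green_iterate: "p \<in> U_plus H ==> green_plus d H ((H ^^ n) p) = real d ^ n * green_plus d H p"
 by (induction n) (simp_all add: green_H iterate_U)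

text \<open>Iterates of a neighbourhood of \<open>p\<close> stay bounded for a long time, and pulling \<open>G\<close> back by \<open>H ^^ n\<close> divides it by \<open>d ^ n\<close>.\<close>

lemma green_small_near_K:
 assumes p: "p \<notin> U_plus H" and e: "e > 0"
 shows "\<forall>\<^sub>F q in nhds p. q \<in> U_plus H --> green_plus d H q < e"
proof -
 have "bounded (range (\<lambda>n. (H ^^ n) p))" using p by (simp add: U_plus_def K_plus_def)
 then obtain B where B: "\<And>n. norm ((H ^^ n) p) <= B" unfolding bounded_iff by auto
 have B0: "0 <= B" using B[of 0] norm_ge_zero order_trans by blast
 define C where "C = ln (B + 2) + ln (M + 1) + 1"
 have "(\<lambda>m. C * (1 / real d) ^ m) \<longlonglongrightarrow> 0" using d by (intro tendsto_mult_right_zero LIMSEQ_realpow_zero) auto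
 hence "\<forall>\<^sub>F m in sequentially. C * (1 / real d) ^ m < e" using e by (rule order_tendstoD(2))
 then obtain m where "C * (1 / real d) ^ m < e" using eventually_happens'[OF sequentially_bot] by auto
 hence m: "C / real d ^ m < e" by (simp add: power_divide)
 have "isCont (H ^^ m) p" using cont_iterate(1)[of UNIV m] continuous_on_eq_continuous_at[OF open_UNIV] by blast
 hence "((H ^^ m) \<longlongrightarrow> (H ^^ m) p) (nhds p)" by (simp add: isCont_def tendsto_at_iff_tendsto_nhds)
 hence "\<forall>\<^sub>F q in nhds p. dist ((H ^^ m) q) ((H ^^ m) p) < 1" by (rule tendstoD) simp
 thus ?thesis
 proof eventually_elim
  case (elim q)
  show ?case
  proof
   assume q: "q \<in> U_plus H"
   have "norm ((H ^^ m) q) <= norm ((H ^^ m) p) + norm ((H ^^ m) q - (H ^^ m) p)" by (rule norm_triangle_sub)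
   hence "norm ((H ^^ m) q) <= B + 1" using elim B[of m] by (simp add: dist_norm)
   hence "size_max ((H ^^ m) q) <= B + 2"
    using norm_fst_le[of "fst ((H ^^ m) q)" "snd ((H ^^ m) q)"] norm_snd_le[of "snd ((H ^^ m) q)" "fst ((H ^^ m) q)"] B0
    by (simp add: size_max_def)
   hence "ln (size_max ((H ^^ m) q)) <= ln (B + 2)" using size_max_ge(1)[of "(H ^^ m) q"] by (intro ln_mono) auto
   hence "real d ^ m * green_plus d H q <= C"
    using green_upper[of "(H ^^ m) q"] q by (simp add: iterate_U green_iterate C_def)
   hence "green_plus d H q <= C / real d ^ m" using d by (simp add: pos_le_divide_eq mult.commute)
   thus "green_plus d H q < e" using m by simp
  qed
 qed
qed

end


section \<open>The invariant sets of a H\'enon map\<close>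

lemma power_ge_linear:
 fixes t :: real
 assumes "t >= 1" "d >= 2" shows "t <= t ^ (d - 1)" "t ^ d = t * t ^ (d - 1)"
 using assms self_le_power[of t "d - 1"] by (auto simp: power_eq_if)

lemma leading_power_growth:
 assumes lead: "leading_power c d M F" and c: "c ~= 0" and d: "d >= 2"
  and p: "cmod (fst p) <= cmod (snd p)" "1 <= cmod (snd p)" "2 * M + 2 <= cmod c * cmod (snd p)"
 shows "cmod (fst (F p)) < cmod (snd (F p)) & 2 * cmod (snd p) <= cmod (snd (F p))"
proof -
 define y where "y = snd p"
 have s: "size_max p = cmod y" using p by (auto simp: size_max_def y_def)
 have A: "cmod (snd (F p) - c * y ^ d) <= M * cmod y ^ (d - 1)" "cmod (fst (F p)) <= M * cmod y ^ (d - 1)"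
  using lead[unfolded leading_power_def, rule_format, of p] unfolding s y_def[symmetric] by simp_all
 have y1: "1 <= cmod y" using p by (simp add: y_def)
 have yd: "cmod y <= cmod y ^ (d - 1)" "cmod y ^ d = cmod y * cmod y ^ (d - 1)" by (rule power_ge_linear[OF y1 d])+
 have M0: "0 <= M * cmod y ^ (d - 1)" using A(2) norm_ge_zero order_trans by blast
 have P: "0 < cmod y ^ (d - 1)" using y1 by (intro zero_less_power) linarith
 have M: "0 <= M" using M0 P zero_le_mult_iff[of M "cmod y ^ (d - 1)"] by linarith
 have "cmod (c * y ^ d) <= cmod (snd (F p)) + cmod (snd (F p) - c * y ^ d)"
  by (metis norm_minus_commute norm_triangle_sub)
 hence "cmod c * cmod y * cmod y ^ (d - 1) - M * cmod y ^ (d - 1) <= cmod (snd (F p))"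
  using A(1) by (simp add: norm_mult norm_power yd(2) mult.assoc)
 hence B: "(cmod c * cmod y - M) * cmod y ^ (d - 1) <= cmod (snd (F p))" by (simp add: left_diff_distrib)
 have "(M + 2) * cmod y ^ (d - 1) <= (cmod c * cmod y - M) * cmod y ^ (d - 1)"
  using p(3) P by (intro mult_right_mono) (auto simp: y_def)
 hence C: "M * cmod y ^ (d - 1) + 2 * cmod y ^ (d - 1) <= cmod (snd (F p))" using B by (simp add: distrib_right)
 show ?thesis using A(2) C P yd(1) M0 unfolding y_def[symmetric] by linarith
qed

lemma cmod_comp_norm:
 fixes p :: C2
 shows "cmod (fst p) <= norm p" "cmod (snd p) <= norm p" "norm p <= cmod (snd p) + cmod (fst p)"
 using norm_fst_le[of "fst p" "snd p"] norm_snd_le[of "snd p" "fst p"] norm_Pair_le[of "fst p" "snd p"] by auto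

lemma henon_inv:
 assumes "henon_map d H"
 shows "inv H (H p) = p" "H (inv H p) = p" "hmap H UNIV" "hmap (inv H) UNIV"
  "\<exists>M. leading_power 1 d M H" "\<exists>c M. c ~= 0 & leading_power c d M (swap2 \<circ> inv H \<circ> swap2)"
proof -
 obtain H' c where "(\<forall>p. H' (H p) = p) & (\<forall>p. H (H' p) = p) \<and>
   hmap H UNIV & hmap H' UNIV \<and>
   (\<exists>M. leading_power 1 d M H) & c ~= 0 & (\<exists>M. leading_power c d M (swap2 \<circ> H' \<circ> swap2))"
  using henon_map_structure[OF assms] by (elim exE)
 note H' = this
 have inv: "inv H = H'" by (rule inv_unique_comp) (use H' in \<open>auto simp: fun_eq_iff\<close>)
 show "inv H (H p) = p" "H (inv H p) = p" "hmap H UNIV" "hmap (inv H) UNIV"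
  "\<exists>M. leading_power 1 d M H" "\<exists>c M. c ~= 0 & leading_power c d M (swap2 \<circ> inv H \<circ> swap2)"
  unfolding inv using H' by (blast, blast, blast, blast, blast, metis)
qed

lemma henon_filtration_ex:
 assumes h: "henon_map d H"
 shows "\<exists>R. filtration H (inv H) (\<lambda>p. cmod (snd p)) (\<lambda>p. cmod (fst p)) R"
proof -
 obtain M where M: "leading_power 1 d M H" using henon_inv(5)[OF h] by blast
 obtain c M' where M': "c ~= 0" "leading_power c d M' (swap2 \<circ> inv H \<circ> swap2)" using henon_inv(6)[OF h] by blast
 have d: "d >= 2" by (rule henon_map_degree[OF h])
 define R where "R = max 1 (max (2 * M + 2) ((2 * M' + 2) / cmod c))"
 have "filtration H (inv H) (\<lambda>p. cmod (snd p)) (\<lambda>p. cmod (fst p)) R"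
 proof
  show "inv H (H p) = p" "H (inv H p) = p" for p using henon_inv[OF h] by auto
  show "continuous_on UNIV H" "continuous_on UNIV (inv H)" using henon_inv(3,4)[OF h] hmap_continuous_on by auto
  show "continuous_on UNIV (\<lambda>p::C2. cmod (snd p))" "continuous_on UNIV (\<lambda>p::C2. cmod (fst p))"
   by (intro continuous_intros)+
  show "cmod (snd p) <= norm p" "cmod (fst p) <= norm p" "norm p <= cmod (snd p) + cmod (fst p)" for p :: C2
   by (rule cmod_comp_norm)+
  show "0 < R" by (simp add: R_def)
  show "cmod (fst (H p)) < cmod (snd (H p)) & 2 * cmod (snd p) <= cmod (snd (H p))"
   if "cmod (fst p) <= cmod (snd p)" "R <= cmod (snd p)" for p
   by (rule leading_power_growth[OF M _ d]) (use that in \<open>auto simp: R_def\<close>)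
  show "cmod (snd (inv H p)) < cmod (fst (inv H p)) & 2 * cmod (fst p) <= cmod (fst (inv H p))"
   if "cmod (snd p) <= cmod (fst p)" "R <= cmod (fst p)" for p
  proof -
   have "(2 * M' + 2) / cmod c <= cmod (fst p)" using that by (simp add: R_def)
   hence "2 * M' + 2 <= cmod c * cmod (fst p)" using M' by (simp add: divide_le_eq mult.commute)
   thus ?thesis using leading_power_growth[OF M'(2,1) d, of "swap2 p"] that by (simp add: swap2_def R_def)
  qed
 qed
 thus ?thesis by blast
qed

lemma filtration_swap: "filtration T T' a b R ==> filtration T' T b a R"
 unfolding filtration_def by (auto simp: add.commute)

lemma henon_dynI:
 assumes h: "henon_map d H" and M: "M >= 1" "leading_power 1 d M H"
 shows "henon_dyn d M H (inv H)"
proof -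
 interpret henon_growth d M H "inv H" using henon_inv[OF h] henon_map_degree[OF h] M by unfold_locales auto
 obtain R where "filtration H (inv H) (\<lambda>p. cmod (snd p)) (\<lambda>p. cmod (fst p)) R" using henon_filtration_ex[OF h] by blast
 then interpret f: filtration H "inv H" "\<lambda>p. cmod (snd p)" "\<lambda>p. cmod (fst p)" R .
 have K: "K_plus H = f.K" unfolding K_plus_def f.K_def ..
 show ?thesis
 proof
  show "U_plus H = {p. \<exists>n. (H ^^ n) p \<in> V}"
  proof (intro set_eqI iffI)
   fix p assume "p \<in> U_plus H"
   hence "p \<notin> f.K" by (simp add: U_plus_def K)
   from f.notin_K_eventually[OF this, of "400 * M"] show "p \<in> {p. \<exists>n. (H ^^ n) p \<in> V}"
    unfolding Vo_def mem_Collect_eq by (rule eventually_happens'[OF sequentially_bot])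
  next
   fix p assume "p \<in> {p. \<exists>n. (H ^^ n) p \<in> V}"
   then obtain n where n: "(H ^^ n) p \<in> V" by blast
   have "p \<notin> f.K"
   proof
    assume "p \<in> f.K"
    hence "(H ^^ n) p \<in> f.K" by (simp only: f.invariant_K)
    then obtain B where B: "\<And>k. norm ((H ^^ k) ((H ^^ n) p)) <= B" unfolding f.K_def bounded_iff by auto
    obtain k where k: "B < 2 ^ k" using real_arch_pow[of 2 B] by auto
    have "1 <= cmod (snd ((H ^^ n) p))" using VoD(2)[OF n] M by linarith
    hence "2 ^ k * 1 <= 2 ^ k * cmod (snd ((H ^^ n) p))" by (intro mult_left_mono) auto
    also have "... <= cmod (snd ((H ^^ k) ((H ^^ n) p)))" by (rule iterate_growth[OF n])
    also have "... <= B" using B[of k] cmod_comp_norm(2) order_trans by blast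
    finally show False using k by simp
   qed
   thus "p \<in> U_plus H" by (simp add: U_plus_def K)
  qed
 qed
qed

locale henon =
 fixes d :: nat and H :: "C2 => C2"
 assumes henon: "henon_map d H"
begin

abbreviation "H' \<equiv> inv H"

definition Rf where "Rf = (SOME R. filtration H (inv H) (\<lambda>p. cmod (snd p)) (\<lambda>p. cmod (fst p)) R)"

sublocale fp: filtration H "inv H" "\<lambda>p. cmod (snd p)" "\<lambda>p. cmod (fst p)" Rf
 unfolding Rf_def by (rule someI_ex[OF henon_filtration_ex[OF henon]])

sublocale fm: filtration "inv H" H "\<lambda>p. cmod (fst p)" "\<lambda>p. cmod (snd p)" Rf
 by (rule filtration_swap) (rule fp.filtration_axioms)

lemma K_plus_eq: "K_plus H = fp.K" unfolding K_plus_def fp.K_def ..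
lemma K_minus_eq: "K_minus H = fm.K" unfolding K_minus_def fm.K_def ..

lemma closed_K_plus: "closed (K_plus H)" unfolding K_plus_eq by (rule fp.closed_K)
lemma closed_K_minus: "closed (K_minus H)" unfolding K_minus_eq by (rule fm.closed_K)

lemma J_plus_iff: "p \<in> J_plus H \<longleftrightarrow> p \<in> K_plus H & p \<notin> interior (K_plus H)"
 unfolding J_plus_def frontier_def using closed_K_plus by (simp add: closure_closed)

lemma J_minus_iff: "p \<in> J_minus H \<longleftrightarrow> p \<in> K_minus H & p \<notin> interior (K_minus H)"
 unfolding J_minus_def frontier_def using closed_K_minus by (simp add: closure_closed)

lemma K_plus_inv: "H p \<in> K_plus H \<longleftrightarrow> p \<in> K_plus H" unfolding K_plus_eq using fp.invariant_K[of 1 p] by simp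

lemma K_minus_inv: "H p \<in> K_minus H \<longleftrightarrow> p \<in> K_minus H"
 unfolding K_minus_eq using fm.invariant_K[of 1 "H p"] by (simp add: fp.T'T)

lemma interior_inv:
 assumes "\<And>p. H p \<in> K \<longleftrightarrow> p \<in> K"
 shows "H p \<in> interior K \<longleftrightarrow> p \<in> interior K"
proof -
 have *: "F p \<in> interior K" if F: "continuous_on UNIV F'" "\<And>p. F' (F p) = p" "\<And>p. F (F' p) = p" "\<And>p. F p \<in> K \<longleftrightarrow> p \<in> K"
  and p: "p \<in> interior K" for F F' :: "C2 => C2" and p
 proof (rule interiorI)
  show "open (F' -` interior K)" by (rule open_vimage[OF open_interior F(1)])
  show "F p \<in> F' -` interior K" using F(2) p by simp
  show "F' -` interior K \<subseteq> K"
  proof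
   fix q assume "q \<in> F' -` interior K"
   hence "F' q \<in> K" using interior_subset by auto
   thus "q \<in> K" using F(3,4) by metis
  qed
 qed
 have inv: "H' p \<in> K \<longleftrightarrow> p \<in> K" for p using assms[of "H' p"] by (simp add: fp.TT')
 show ?thesis using *[of "H'" H p, OF fp.contT' fp.T'T fp.TT' assms] *[of H "H'" "H p", OF fp.contT fp.TT' fp.T'T inv]
  by (auto simp: fp.T'T)
qed

lemma J_plus_inv: "H p \<in> J_plus H \<longleftrightarrow> p \<in> J_plus H"
 unfolding J_plus_iff using K_plus_inv interior_inv[OF K_plus_inv] by blast

lemma J_minus_inv: "H p \<in> J_minus H \<longleftrightarrow> p \<in> J_minus H"
 unfolding J_minus_iff using K_minus_inv interior_inv[OF K_minus_inv] by blast

lemma U_plus_inv: "H p \<in> U_plus H \<longleftrightarrow> p \<in> U_plus H" by (simp add: U_plus_def K_plus_inv)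

lemma backward_invariant:
 assumes "\<And>p. H p \<in> S \<longleftrightarrow> p \<in> S"
 shows "(H ^^ n) p \<in> S \<longleftrightarrow> p \<in> S" "(H' ^^ n) p \<in> S \<longleftrightarrow> p \<in> S"
proof -
 show *: "(H ^^ n) p \<in> S \<longleftrightarrow> p \<in> S" for p using assms by (induction n) auto
 show "(H' ^^ n) p \<in> S \<longleftrightarrow> p \<in> S" using *[of "(H' ^^ n) p"] by (simp add: fp.iterate_cancel)
qed

lemma Julia_inv: "H p \<in> Julia H \<longleftrightarrow> p \<in> Julia H" by (simp add: Julia_def J_plus_inv J_minus_inv)

lemma K_Int_bound: "p \<in> K_plus H ==> p \<in> K_minus H ==> norm p <= 2 * Rf"
 using fp.in_K_iterate_notin_V[of p 0] fm.in_K_iterate_notin_V[of p 0] cmod_comp_norm(3)[of p]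
 unfolding K_plus_eq K_minus_eq by fastforce

lemma compact_Julia: "compact (Julia H)"
proof -
 have "closed (Julia H)" unfolding Julia_def J_plus_def J_minus_def by (intro closed_Int frontier_closed)
 moreover have "bounded (Julia H)"
  unfolding bounded_iff using K_Int_bound by (intro exI[of _ "2 * Rf"]) (auto simp: Julia_def J_plus_iff J_minus_iff)
 ultimately show ?thesis by (simp add: compact_eq_bounded_closed)
qed

lemma hol: "hmap H UNIV" and hol': "hmap (H') UNIV" using henon_inv[OF henon] by auto

lemma holomorphic_iterate: "hmap (H ^^ n) UNIV" "hmap (H' ^^ n) UNIV"
 by (rule hmap_funpow[OF hol]) (rule hmap_funpow[OF hol'])

lemma cont_iterate: "continuous_on S (H ^^ n)" "continuous_on S (H' ^^ n)"
 using holomorphic_iterate[THEN hmap_continuous_on] by (auto intro: continuous_on_subset)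

lemma K_minus_bound: "p \<in> K_minus H ==> norm ((H' ^^ n) p) <= 2 * max Rf (norm p)"
 unfolding K_minus_eq by (rule fm.K_orbit_bound)

lemma K_plus_bound: "p \<in> K_plus H ==> norm ((H ^^ n) p) <= 2 * max Rf (norm p)"
 unfolding K_plus_eq by (rule fp.K_orbit_bound)

end


section \<open>Hyperbolicity and the topology of unstable manifolds\<close>

lemma hmap_has_derivative:
 assumes "hmap F S" "p \<in> S"
 shows "(F has_derivative frechet_derivative F (at p)) (at p)"
  and "frechet_derivative F (at p) (c *\<^sub>C v) = c *\<^sub>C frechet_derivative F (at p) v"
proof -
 obtain f' where f': "(F has_derivative f') (at p)" "\<forall>c v. f' (c *\<^sub>C v) = c *\<^sub>C f' v"
  using assms unfolding holomorphic_map_on_def by blast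
 have "frechet_derivative F (at p) = f'" using frechet_derivative_at[OF f'(1)] by simp
 thus "(F has_derivative frechet_derivative F (at p)) (at p)"
  "frechet_derivative F (at p) (c *\<^sub>C v) = c *\<^sub>C frechet_derivative F (at p) v" using f' by auto
qed

lemma hmap_derivative_bound_C2:
 fixes F :: "'a::complex_normed_vector => C2"
 assumes hol: "hmap F (ball p r)" and r: "r > 0"
  and bnd: "\<And>q. q \<in> ball p r ==> norm (F q) <= B"
  and der: "(F has_derivative F') (at p)"
 shows "norm (F' h) <= 4 * B / r * norm h"
proof -
 have c: "cmod (T (F' h)) <= 2 * B / r * norm h"
  if T: "hmap T UNIV" "bounded_linear T" "\<And>q. cmod (T q) <= norm q" for T :: "C2 => complex"
 proof (rule hmap_derivative_bound[OF _ r _ bounded_linear.has_derivative[OF T(2) der]])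
  show "hmap (\<lambda>q. T (F q)) (ball p r)" using hmap_compose[OF hol T(1)] by simp
  show "cmod (T (F q)) <= B" if "q \<in> ball p r" for q by (rule order_trans[OF T(3) bnd[OF that]])
 qed
 have 1: "cmod (fst (F' h)) <= 2 * B / r * norm h" by (rule c[OF hmap_fst bounded_linear_fst cmod_comp_norm(1)])
 have 2: "cmod (snd (F' h)) <= 2 * B / r * norm h" by (rule c[OF hmap_snd bounded_linear_snd cmod_comp_norm(2)])
 have "norm (F' h) <= cmod (snd (F' h)) + cmod (fst (F' h))" by (rule cmod_comp_norm(3))
 also have "... <= 2 * B / r * norm h + 2 * B / r * norm h" using 1 2 by linarith
 also have "... = 4 * B / r * norm h" by simp
 finally show ?thesis .
qed

lemma uniform_linearization:
 fixes F :: "C2 => C2"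
 assumes hol: "hmap F UNIV" and K: "compact K" and e: "e > 0"
 shows "\<exists>\<delta>>0. \<forall>x\<in>K. \<forall>q1\<in>ball x \<delta>. \<forall>q2\<in>ball x \<delta>.
      norm (F q1 - F q2 - frechet_derivative F (at x) (q1 - q2)) <= e * norm (q1 - q2)"
proof -
 let ?D = "\<lambda>p. frechet_derivative F (at p)"
 have der: "(F has_derivative ?D p) (at p)" for p by (rule hmap_has_derivative(1)[OF hol UNIV_I])
 define K2 where "K2 = {x + y | x y. x \<in> K & y \<in> cball 0 2}"
 have "compact K2" unfolding K2_def by (rule compact_sums[OF K compact_cball])
 hence "uniformly_continuous_on K2 F"
  using hmap_continuous_on[OF hol] by (meson compact_uniformly_continuous continuous_on_subset subset_UNIV)
 then obtain \<delta>0 where \<delta>0: "\<delta>0 > 0" "\<And>p q. p \<in> K2 ==> q \<in> K2 ==> dist p q < \<delta>0 ==> dist (F p) (F q) < e / 4"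
  unfolding uniformly_continuous_on_def using e by (metis divide_pos_pos zero_less_numeral)
 define \<delta> where "\<delta> = min 1 \<delta>0"
 have inK2: "p \<in> K2" if "x \<in> K" "dist x p <= 2" for x p
  unfolding K2_def using that by (intro CollectI exI[of _ x] exI[of _ "p - x"]) (auto simp: dist_norm norm_minus_commute)
 have Ddiff: "norm (?D q h - ?D x h) <= e * norm h" if x: "x \<in> K" and q: "q \<in> ball x \<delta>" for x q h
 proof -
  define u where "u = q - x"
  have u: "norm u < 1" "norm u < \<delta>0" using q by (auto simp: u_def \<delta>_def dist_norm norm_minus_commute)
  have "norm (?D q h - ?D x h) <= 4 * (e / 4) / 1 * norm h"
  proof (rule hmap_derivative_bound_C2[where F = "\<lambda>p. F (p + u) - F p" and p = x])
   have t: "hmap (\<lambda>p. p + u) (ball x 1)" by (intro hmap_add hmap_id hmap_const)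
   show "hmap (\<lambda>p. F (p + u) - F p) (ball x 1)" by (intro hmap_diff hmap_compose[OF t hol] hmap_subset[OF hol]) auto
   show "norm (F (p + u) - F p) <= e / 4" if "p \<in> ball x 1" for p
   proof -
    have "dist x p <= 2" "dist x (p + u) <= 2"
     using that u norm_triangle_ineq4[of "x - p" u] by (auto simp: dist_norm algebra_simps)
    hence "dist (F (p + u)) (F p) < e / 4"
     using \<delta>0(2)[OF inK2[OF x] inK2[OF x], of "p + u" p] u by (auto simp: dist_norm)
    thus ?thesis by (simp add: dist_norm)
   qed
   have "(F has_derivative ?D q) (at (x + u))" using der[of q] by (simp add: u_def)
   hence "((\<lambda>p. F (p + u)) has_derivative (\<lambda>h. ?D q h)) (at x)"
    by (rule has_derivative_compose[rotated]) (auto intro!: derivative_eq_intros)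
   thus "((\<lambda>p. F (p + u) - F p) has_derivative (\<lambda>h. ?D q h - ?D x h)) (at x)" by (intro has_derivative_diff der)
  qed simp
  thus ?thesis by simp
 qed
 show ?thesis
 proof (intro exI[of _ \<delta>] conjI ballI)
  show "\<delta> > 0" using \<delta>0 by (simp add: \<delta>_def)
  fix x q1 q2 assume x: "x \<in> K" and q: "q1 \<in> ball x \<delta>" "q2 \<in> ball x \<delta>"
  have lin: "linear (?D x)" using der has_derivative_linear by blast
  have "norm ((F q1 - ?D x q1) - (F q2 - ?D x q2)) <= e * norm (q1 - q2)"
  proof (rule differentiable_bound[OF convex_ball _ _ q(1) q(2)])
   fix q assume q: "q \<in> ball x \<delta>"
   have "((\<lambda>q. F q - ?D x q) has_derivative (\<lambda>h. ?D q h - ?D x h)) (at q)"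
    by (intro has_derivative_diff der linear_imp_has_derivative lin)
   thus "((\<lambda>q. F q - ?D x q) has_derivative (\<lambda>h. ?D q h - ?D x h)) (at q within ball x \<delta>)"
    by (rule has_derivative_at_withinI)
   show "onorm (\<lambda>h. ?D q h - ?D x h) <= e" by (rule onorm_le) (rule Ddiff[OF x q])
  qed
  thus "norm (F q1 - F q2 - ?D x (q1 - q2)) <= e * norm (q1 - q2)" by (simp add: linear_diff[OF lin] algebra_simps)
 qed
qed

lemma csubspace_add: "csubspace S ==> x \<in> S ==> y \<in> S ==> x + y \<in> S" by (simp add: csubspace_def)

lemma csubspace_scale: "csubspace S ==> x \<in> S ==> c *\<^sub>C x \<in> S" by (simp add: csubspace_def)

context henon
begin

abbreviation "DH n p \<equiv> frechet_derivative (H ^^ n) (at p)"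
abbreviation "DH' n p \<equiv> frechet_derivative (H' ^^ n) (at p)"

lemma DH: "((H ^^ n) has_derivative DH n p) (at p)" "((H' ^^ n) has_derivative DH' n p) (at p)"
 using hmap_has_derivative(1)[OF holomorphic_iterate(1) UNIV_I]
  hmap_has_derivative(1)[OF holomorphic_iterate(2) UNIV_I] .

lemma DH_Suc: "DH (Suc n) p v = DH n (H p) (frechet_derivative H (at p) v)"
proof -
 have 1: "(H has_derivative frechet_derivative H (at p)) (at p)" by (rule hmap_has_derivative(1)[OF hol UNIV_I])
 have "((\<lambda>p. (H ^^ n) (H p)) has_derivative (\<lambda>v. DH n (H p) (frechet_derivative H (at p) v))) (at p)"
  by (rule has_derivative_compose[OF 1 DH(1)])
 moreover have "(\<lambda>p. (H ^^ n) (H p)) = H ^^ Suc n" unfolding funpow_Suc_right o_def ..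
 ultimately have "((H ^^ Suc n) has_derivative (\<lambda>v. DH n (H p) (frechet_derivative H (at p) v))) (at p)" by (simp only:)
 hence "DH (Suc n) p = (\<lambda>v. DH n (H p) (frechet_derivative H (at p) v))" using DH(1) has_derivative_unique by blast
 thus ?thesis by simp
qed

lemma DH_0: "DH 0 p v = v"
 using has_derivative_unique[OF DH(1)[of 0 p]] has_derivative_id[of "at p"] by (simp add: id_def eq_id_iff)

lemma Julia_iterate: "(H ^^ n) p \<in> Julia H \<longleftrightarrow> p \<in> Julia H" "(H' ^^ n) p \<in> Julia H \<longleftrightarrow> p \<in> Julia H"
 using backward_invariant[of "Julia H", OF Julia_inv] by auto

lemma DH'_DH: "DH' n ((H ^^ n) p) (DH n p v) = v"
proof -
 have "((\<lambda>p. (H' ^^ n) ((H ^^ n) p)) has_derivative (\<lambda>v. DH' n ((H ^^ n) p) (DH n p v))) (at p)"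
  by (rule has_derivative_compose[OF DH(1) DH(2)])
 hence "((\<lambda>p. p) has_derivative (\<lambda>v. DH' n ((H ^^ n) p) (DH n p v))) (at p)" by (simp only: fp.iterate_cancel)
 from has_derivative_unique[OF this has_derivative_ident] show ?thesis by (rule fun_cong)
qed

end

locale hyperbolic_henon = henon +
 fixes Es Eu :: "C2 => C2 set" and C \<kappa> :: real
 assumes C: "C > 0" and \<kappa>: "0 < \<kappa>" "\<kappa> < 1"
  and Es: "p \<in> Julia H ==> csubspace (Es p)" and Eu: "p \<in> Julia H ==> csubspace (Eu p)"
  and splitting: "p \<in> Julia H ==> \<exists>u\<in>Es p. \<exists>v\<in>Eu p. w = u + v"
  and Es_inv: "p \<in> Julia H ==> frechet_derivative H (at p) ` Es p = Es (H p)"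
  and Eu_inv: "p \<in> Julia H ==> frechet_derivative H (at p) ` Eu p = Eu (H p)"
  and contr_s: "p \<in> Julia H ==> v \<in> Es p ==> norm (frechet_derivative (H ^^ n) (at p) v) <= C * \<kappa> ^ n * norm v"
  and contr_u: "p \<in> Julia H ==> v \<in> Eu p ==> norm (frechet_derivative (H' ^^ n) (at p) v) <= C * \<kappa> ^ n * norm v"
begin

lemma DH_image: "p \<in> Julia H ==> DH n p ` Es p = Es ((H ^^ n) p) & DH n p ` Eu p = Eu ((H ^^ n) p)"
proof (induction n arbitrary: p)
 case 0
 thus ?case by (simp add: DH_0)
next
 case (Suc n)
 have Hp: "H p \<in> Julia H" using Suc.prems by (simp add: Julia_inv)
 have im: "DH (Suc n) p ` S = DH n (H p) ` (frechet_derivative H (at p) ` S)" for S unfolding image_image DH_Suc ..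
 have e: "(H ^^ Suc n) p = (H ^^ n) (H p)" by (simp add: funpow_swap1)
 show ?case using Suc.IH[OF Hp] by (simp only: im e Es_inv[OF Suc.prems] Eu_inv[OF Suc.prems])
qed

lemma backward_Es:
 assumes x: "x \<in> Julia H" and v: "v \<in> Es x"
 shows "DH' n x v \<in> Es ((H' ^^ n) x)" "norm v <= C * \<kappa> ^ n * norm (DH' n x v)"
proof -
 define y where "y = (H' ^^ n) x"
 have y: "y \<in> Julia H" "(H ^^ n) y = x" using x by (simp_all add: y_def Julia_iterate fp.iterate_cancel)
 have "v \<in> DH n y ` Es y" using DH_image[OF y(1), of n] v y(2) by simp
 then obtain w where w: "v = DH n y w" "w \<in> Es y" by (rule imageE)
 have "DH' n x v = w" using DH'_DH[of n y w] by (simp add: y(2) w(1))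
 thus "DH' n x v \<in> Es ((H' ^^ n) x)" "norm v <= C * \<kappa> ^ n * norm (DH' n x v)"
  using w contr_s[OF y(1) w(2), of n] by (simp_all add: y_def)
qed

lemma backward_Eu:
 assumes x: "x \<in> Julia H" and v: "v \<in> Eu x"
 shows "DH' n x v \<in> Eu ((H' ^^ n) x)"
proof -
 define y where "y = (H' ^^ n) x"
 have y: "y \<in> Julia H" "(H ^^ n) y = x" using x by (simp_all add: y_def Julia_iterate fp.iterate_cancel)
 have "v \<in> DH n y ` Eu y" using DH_image[OF y(1), of n] v y(2) by simp
 then obtain w where w: "v = DH n y w" "w \<in> Eu y" by (rule imageE)
 have "DH' n x v = w" using DH'_DH[of n y w] by (simp add: y(2) w(1))
 thus ?thesis using w by (simp add: y_def)
qed

lemma contraction_small: "e > 0 ==> \<forall>\<^sub>F n in sequentially. C * \<kappa> ^ n < e"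
 by (rule order_tendstoD(2)[OF tendsto_mult_right_zero[OF LIMSEQ_realpow_zero]]) (use \<kappa> in auto)

text \<open>
  The angle between \<open>E\<^sup>s\<close> and \<open>E\<^sup>u\<close> is bounded below because some iterate contracts the one and expands
  the other, while its derivative is bounded on \<open>J\<close>.
\<close>

lemma splitting_bound:
 "\<exists>L\<ge>1. \<forall>x\<in>Julia H. \<forall>u\<in>Es x. \<forall>v\<in>Eu x. norm u <= L * norm (u + v) & norm v <= L * norm (u + v)"
proof -
 have "\<forall>\<^sub>F n in sequentially. C * \<kappa> ^ n < 1 / 2" by (rule contraction_small) simp
 then obtain n where n: "C * \<kappa> ^ n < 1 / 2" using eventually_happens'[OF sequentially_bot] by auto
 define c where "c = C * \<kappa> ^ n"
 have c0: "c > 0" "c < 1 / 2" using C \<kappa> n by (auto simp: c_def)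
 have c: "c > 0" "c * c < 1 / 2" using c0 mult_strict_mono[of c "1 / 2" c "1 / 2"] by auto
 obtain B where B: "\<And>x v. x \<in> Julia H ==> norm (DH n x v) <= B * norm v" "B >= 0"
 proof -
  define K2 where "K2 = {x + y | x y. x \<in> Julia H & y \<in> cball (0::C2) 1}"
  have "compact K2" unfolding K2_def by (rule compact_sums[OF compact_Julia compact_cball])
  hence "bounded ((H ^^ n) ` K2)" by (intro compact_imp_bounded compact_continuous_image cont_iterate)
  then obtain b where b: "\<And>q. q \<in> K2 ==> norm ((H ^^ n) q) <= b" unfolding bounded_iff by auto
  have "norm (DH n x v) <= 4 * (max b 0) / 1 * norm v" if x: "x \<in> Julia H" for x v
  proof (rule hmap_derivative_bound_C2[OF _ _ _ DH(1)])
   fix q assume "q \<in> ball x 1"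
   hence "q \<in> K2" unfolding K2_def using x
    by (intro CollectI exI[of _ x] exI[of _ "q - x"]) (auto simp: dist_norm norm_minus_commute)
   from b[OF this] show "norm ((H ^^ n) q) <= max b 0" by simp
  qed (auto intro: hmap_subset[OF holomorphic_iterate(1)])
  thus ?thesis using that[of "4 * max b 0"] by simp
 qed
 define L where "L = 2 * c * B + 2"
 have "norm u <= L * norm (u + v) & norm v <= L * norm (u + v)"
  if x: "x \<in> Julia H" and u: "u \<in> Es x" and v: "v \<in> Eu x" for x u v
 proof -
  define w where "w = u + v"
  have xn: "(H ^^ n) x \<in> Julia H" using x by (simp add: Julia_iterate)
  have "DH n x v \<in> Eu ((H ^^ n) x)" using DH_image[OF x, of n] v by blast
  from contr_u[OF xn this, of n] have v1: "norm v <= c * norm (DH n x v)" by (simp add: DH'_DH c_def)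
  have "DH n x v = DH n x w - DH n x u"
   using linear_diff[OF has_derivative_linear[OF DH(1)], of n x w u] by (simp add: w_def)
  hence "norm (DH n x v) <= norm (DH n x w) + norm (DH n x u)" by (simp add: norm_triangle_ineq4)
  also have "... <= B * norm w + c * norm u" using B(1)[OF x, of w] contr_s[OF x u, of n] by (simp add: c_def)
  also have "norm u <= norm w + norm v" using norm_triangle_ineq4[of w v] by (simp add: w_def)
  finally have "norm (DH n x v) <= B * norm w + c * (norm w + norm v)" using c by simp
  hence "c * norm (DH n x v) <= c * (B * norm w + c * (norm w + norm v))" using c by simp
  hence "norm v <= c * B * norm w + (c * c) * (norm w + norm v)" using v1 by (simp add: algebra_simps)
  also have "... <= c * B * norm w + (1 / 2) * (norm w + norm v)" using c by (intro add_left_mono mult_right_mono) auto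
  finally have "norm v <= c * B * norm w + (1 / 2) * (norm w + norm v)" .
  moreover define X where "X = c * B * norm w"
  ultimately have "norm v <= 2 * X + norm w" by (simp add: field_simps)
  hence "norm v <= 2 * (c * B * norm w) + norm w" by (simp add: X_def)
  also have "... = (2 * c * B + 1) * norm w" by (simp add: algebra_simps)
  finally have vb: "norm v <= (2 * c * B + 1) * norm w" .
  have Lw: "L * norm w = (2 * c * B + 1) * norm w + norm w" by (simp add: L_def algebra_simps)
  have "norm v <= L * norm w" using vb Lw norm_ge_zero[of w] by linarith
  moreover have "norm u <= L * norm w" using vb Lw \<open>norm u <= norm w + norm v\<close> by linarith
  ultimately show ?thesis by (simp add: w_def)
 qed
 moreover have "L >= 1" using c B by (simp add: L_def)
 ultimately show ?thesis by blast
qed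

text \<open>
  Cone argument: if two backward orbits stay close to the backward orbit of \<open>x \<in> J\<close>, their difference
  cannot lie in the stable cone, where the inverse map expands.
\<close>

lemma backward_close_cone:
 "\<exists>\<epsilon>>0. \<forall>x\<in>Julia H. \<forall>q1 q2. \<forall>u\<in>Es x. \<forall>v\<in>Eu x.
   (\<forall>n. dist ((H' ^^ n) x) ((H' ^^ n) q1) < \<epsilon> & dist ((H' ^^ n) x) ((H' ^^ n) q2) < \<epsilon>) -->
   q1 - q2 = u + v --> norm v <= norm u --> q1 = q2"
proof -
 obtain L where L1: "L >= 1" and LL: "\<forall>x\<in>Julia H. \<forall>u\<in>Es x. \<forall>v\<in>Eu x. norm u <= L * norm (u + v) & norm v <= L * norm (u + v)"
  using splitting_bound by (elim exE conjE)
 have L: "L >= 1" "norm u <= L * norm (u + v)" "norm v <= L * norm (u + v)"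
  if "x \<in> Julia H" "u \<in> Es x" "v \<in> Eu x" for x u v using L1 LL that by simp_all
 have "\<forall>\<^sub>F n in sequentially. C * \<kappa> ^ n < 1 / 4" by (rule contraction_small) simp
 then obtain N where N: "C * \<kappa> ^ N < 1 / 4" using eventually_happens'[OF sequentially_bot] by auto
 define g where "g = H' ^^ N"
 define Dg where "Dg x = frechet_derivative g (at x)" for x
 have Dg: "(g has_derivative Dg x) (at x)" for x unfolding g_def Dg_def by (rule DH(2))
 have s: "Dg x v \<in> Es (g x)" "4 * norm v <= norm (Dg x v)" if x: "x \<in> Julia H" and v: "v \<in> Es x" for x v
 proof -
  show "Dg x v \<in> Es (g x)" unfolding Dg_def g_def by (rule backward_Es[OF x v])
  have "norm v <= C * \<kappa> ^ N * norm (Dg x v)" unfolding Dg_def g_def by (rule backward_Es[OF x v])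
  also have "... <= 1 / 4 * norm (Dg x v)" using N by (intro mult_right_mono) auto
  finally show "4 * norm v <= norm (Dg x v)" by simp
 qed
 have u: "Dg x v \<in> Eu (g x)" "norm (Dg x v) <= 1 / 4 * norm v" if x: "x \<in> Julia H" and v: "v \<in> Eu x" for x v
 proof -
  show "Dg x v \<in> Eu (g x)" unfolding Dg_def g_def by (rule backward_Eu[OF x v])
  have "norm (Dg x v) <= C * \<kappa> ^ N * norm v" unfolding Dg_def g_def by (rule contr_u[OF x v])
  also have "... <= 1 / 4 * norm v" using N by (intro mult_right_mono) auto
  finally show "norm (Dg x v) <= 1 / 4 * norm v" .
 qed
 have gJ: "(g ^^ n) x \<in> Julia H" if "x \<in> Julia H" for n x using that by (induction n) (auto simp: g_def Julia_iterate)
 define e where "e = 1 / (4 * L)"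
 have e: "e > 0" "L * e = 1 / 4" using L1 by (auto simp: e_def)
 obtain \<epsilon> where \<epsilon>0: "\<epsilon> > 0" and lin: "\<forall>x\<in>Julia H. \<forall>q1\<in>ball x \<epsilon>. \<forall>q2\<in>ball x \<epsilon>.
   norm (g q1 - g q2 - Dg x (q1 - q2)) <= e * norm (q1 - q2)"
  using uniform_linearization[OF holomorphic_iterate(2)[of N] compact_Julia e(1)]
  unfolding g_def[symmetric] Dg_def[symmetric] by (elim exE conjE)
 have "q1 = q2" if x: "x \<in> Julia H" and u0: "u0 \<in> Es x" and v0: "v0 \<in> Eu x"
  and close: "\<And>n. dist ((H' ^^ n) x) ((H' ^^ n) q1) < \<epsilon>" "\<And>n. dist ((H' ^^ n) x) ((H' ^^ n) q2) < \<epsilon>"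
  and diff: "q1 - q2 = u0 + v0" and cone: "norm v0 <= norm u0" for x q1 q2 u0 v0
 proof (rule ccontr)
  assume "q1 ~= q2"
  hence "u0 + v0 ~= 0" using diff by auto
  hence u0pos: "norm u0 > 0" using cone by auto
  have gp: "(g ^^ n) y = (H' ^^ (N * n)) y" for n y unfolding g_def by (simp add: funpow_mult)
  have cl: "(g ^^ n) q1 \<in> ball ((g ^^ n) x) \<epsilon>" "(g ^^ n) q2 \<in> ball ((g ^^ n) x) \<epsilon>" for n
   using close by (simp_all add: gp)
  have cones: "\<exists>un\<in>Es ((g ^^ n) x). \<exists>vn\<in>Eu ((g ^^ n) x). (g ^^ n) q1 - (g ^^ n) q2 = un + vn \<and>
      norm vn <= norm un & 2 ^ n * norm u0 <= norm un" for n
  proof (induction n)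
   case 0
   thus ?case using u0 v0 diff cone by auto
  next
   case (Suc n)
   define y where "y = (g ^^ n) x"
   define w where "w = (g ^^ n) q1 - (g ^^ n) q2"
   have y: "y \<in> Julia H" "g y \<in> Julia H" using gJ[OF x, of n] gJ[OF x, of "Suc n"] by (auto simp: y_def)
   obtain un vn where un: "un \<in> Es y" "vn \<in> Eu y" "w = un + vn" "norm vn <= norm un" "2 ^ n * norm u0 <= norm un"
    using Suc by (auto simp: y_def w_def)
   define err where "err = g ((g ^^ n) q1) - g ((g ^^ n) q2) - Dg y w"
   have "norm err <= e * norm w" unfolding err_def w_def
    by (rule lin[rule_format, OF y(1)]) (use cl[of n] in \<open>simp_all add: y_def\<close>)
   moreover have "norm w <= 2 * norm un" using un(4) norm_triangle_ineq[of un vn] by (simp add: un(3))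
   hence "e * norm w <= e * (2 * norm un)" by (rule mult_left_mono) (use e in simp)
   ultimately have err: "norm err <= e * (2 * norm un)" by (rule order_trans)
   obtain es eu where es: "es \<in> Es (g y)" "eu \<in> Eu (g y)" "err = es + eu" using splitting[OF y(2), of err] by (elim bexE)
   have "L * norm err <= L * (e * (2 * norm un))" by (rule mult_left_mono[OF err]) (use L1 in simp)
   also have "... = (L * e) * (2 * norm un)" by simp
   also have "... = norm un / 2" using e by simp
   finally have "L * norm err <= norm un / 2" .
   hence esb: "norm es <= norm un / 2" "norm eu <= norm un / 2" using L(2,3)[OF y(2) es(1,2)] es(3) by auto
   define un' where "un' = Dg y un + es"
   define vn' where "vn' = Dg y vn + eu"
   have "un' \<in> Es (g y)" unfolding un'_def by (rule csubspace_add[OF Es[OF y(2)] s(1)[OF y(1) un(1)] es(1)])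
   moreover have "vn' \<in> Eu (g y)" unfolding vn'_def by (rule csubspace_add[OF Eu[OF y(2)] u(1)[OF y(1) un(2)] es(2)])
   moreover have "(g ^^ Suc n) q1 - (g ^^ Suc n) q2 = un' + vn'"
   proof -
    have "Dg y w = Dg y un + Dg y vn" unfolding un(3) by (rule linear_add[OF has_derivative_linear[OF Dg]])
    hence "g ((g ^^ n) q1) - g ((g ^^ n) q2) = (Dg y un + Dg y vn) + (es + eu)"
     using es(3) unfolding err_def by (metis add.commute diff_add_cancel)
    thus ?thesis by (simp add: un'_def vn'_def)
   qed
   moreover have "norm un' >= 2 * norm un"
    using s(2)[OF y(1) un(1)] esb(1) norm_triangle_ineq4[of un' es] norm_ge_zero[of un]
    unfolding un'_def add_diff_cancel_right' by linarith
   moreover have "norm vn' <= norm un"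
    using u(2)[OF y(1) un(2)] esb(2) un(4) norm_triangle_ineq[of "Dg y vn" eu] norm_ge_zero[of un]
    unfolding vn'_def by linarith
   moreover from calculation(4,5) have "norm vn' <= norm un'" using norm_ge_zero[of un] by linarith
   ultimately show ?case using un(5) by - (rule bexI[of _ un'], rule bexI[of _ vn'], simp_all add: y_def)
  qed
  have grow: "2 ^ n * norm u0 <= L * (2 * \<epsilon>)" for n
  proof -
   obtain un vn where un: "un \<in> Es ((g ^^ n) x)" "vn \<in> Eu ((g ^^ n) x)" "(g ^^ n) q1 - (g ^^ n) q2 = un + vn"
    "2 ^ n * norm u0 <= norm un" using cones[of n] by (elim bexE conjE) (rule that; assumption)
   have "norm ((g ^^ n) q1 - (g ^^ n) q2) <= 2 * \<epsilon>"
    using cl[of n] dist_triangle2[of "(g ^^ n) q1" "(g ^^ n) q2" "(g ^^ n) x"]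
    by (auto simp: dist_norm norm_minus_commute)
   hence "L * norm (un + vn) <= L * (2 * \<epsilon>)" using L1 by (simp add: un(3))
   thus ?thesis using L(2)[OF gJ[OF x] un(1,2)] un(4) by linarith
  qed
  obtain n where "L * (2 * \<epsilon>) / norm u0 < 2 ^ n" using real_arch_pow[of 2 "L * (2 * \<epsilon>) / norm u0"] by auto
  hence "L * (2 * \<epsilon>) < 2 ^ n * norm u0" using u0pos by (simp add: divide_less_eq)
  with grow[of n] show False by simp
 qed
 with \<epsilon>0 show ?thesis by metis
qed

end


lemma holomorphic_map_Lipschitz:
 fixes F :: "'a::complex_normed_vector => C2"
 assumes hol: "hmap F (ball p (2 * r))" and r: "r > 0"
  and bnd: "\<And>q. q \<in> ball p (2 * r) ==> norm (F q) <= B"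
  and q: "q1 \<in> ball p r" "q2 \<in> ball p r"
 shows "norm (F q1 - F q2) <= 4 * B / r * norm (q1 - q2)"
proof (rule differentiable_bound[OF convex_ball _ _ q])
 fix q assume q: "q \<in> ball p r"
 have sub: "ball q r \<subseteq> ball p (2 * r)" by (rule ball_subset_double) (use q in simp)
 hence qin: "q \<in> ball p (2 * r)" using r by (meson centre_in_ball subsetD)
 note D = hmap_has_derivative(1)[OF hol qin]
 show "(F has_derivative frechet_derivative F (at q)) (at q within ball p r)"
  using D by (rule has_derivative_at_withinI)
 show "onorm (frechet_derivative F (at q)) <= 4 * B / r"
 proof (rule onorm_bound)
  have "0 <= B" using bnd[of p] r norm_ge_zero[of "F p"] by (simp add: order_trans[OF norm_ge_zero])
  thus "0 <= 4 * B / r" using r by simp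
  fix h
  show "norm (frechet_derivative F (at q) h) <= 4 * B / r * norm h"
   by (rule hmap_derivative_bound_C2[OF hmap_subset[OF hol sub] r _ D])
     (use bnd sub in blast)
 qed
qed

context henon
begin

lemma funpow_periodic_range:
 assumes n: "n > 0" "(F ^^ n) p = p" shows "finite (range (\<lambda>k. (F ^^ k) p))"
proof (rule finite_subset)
 show "range (\<lambda>k. (F ^^ k) p) \<subseteq> (\<lambda>k. (F ^^ k) p) ` {..<n}"
 proof (rule image_subsetI)
  fix k
  have "(F ^^ k) p = (F ^^ (k mod n)) p" using funpow_mod_eq[OF n(2)] by simp
  thus "(F ^^ k) p \<in> (\<lambda>k. (F ^^ k) p) ` {..<n}" using n(1) by (intro image_eqI[of _ _ "k mod n"]) auto
 qed
qed simp

lemma DH_add: "DH (m + n) p v = DH m ((H ^^ n) p) (DH n p v)"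
proof -
 have "((\<lambda>p. (H ^^ m) ((H ^^ n) p)) has_derivative (\<lambda>v. DH m ((H ^^ n) p) (DH n p v))) (at p)"
  by (rule has_derivative_compose[OF DH(1) DH(1)])
 moreover have "(\<lambda>p. (H ^^ m) ((H ^^ n) p)) = H ^^ (m + n)" unfolding funpow_add o_def ..
 ultimately have "((H ^^ (m + n)) has_derivative (\<lambda>v. DH m ((H ^^ n) p) (DH n p v))) (at p)" by (simp only:)
 from has_derivative_unique[OF DH(1) this] show ?thesis by (rule fun_cong)
qed

lemma K_minus_uniform_bound:
 assumes "ball p r \<subseteq> K_minus H" "q \<in> ball p r"
 shows "norm ((H' ^^ n) q) <= 2 * max Rf (norm p + r)"
proof -
 have "norm q <= norm p + r" using assms(2) norm_triangle_sub[of q p] by (auto simp: dist_norm norm_minus_commute)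
 hence "max Rf (norm q) <= max Rf (norm p + r)" by (intro max.mono) simp_all
 hence "2 * max Rf (norm q) <= 2 * max Rf (norm p + r)" by simp
 moreover have "norm ((H' ^^ n) q) <= 2 * max Rf (norm q)" using assms by (intro K_minus_bound) blast
 ultimately show ?thesis by (rule order_trans[rotated])
qed

text \<open>
  A saddle lies in \<open>J\<^sup>-\<close> because the inverse iterates expand its stable direction, so that they
  violate Cauchy's estimate on any ball on which they are uniformly bounded.
\<close>

lemma saddle_in_Julia:
 assumes p: "saddle_periodic H p" and \<tau>: "unstable_param H p \<tau>" and U: "\<tau> z \<in> U_plus H"
 shows "p \<in> Julia H"
proof -
 obtain n \<alpha> v where n: "n > 0" "(H ^^ n) p = p" and \<alpha>: "cmod \<alpha> < 1" "v ~= 0" "DH n p v = \<alpha> *\<^sub>C v"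
  using p unfolding saddle_periodic_def by blast
 have n': "(H' ^^ n) p = p" using n(2) fp.iterate_cancel(1)[of n p] by simp
 have Kp: "p \<in> K_plus H" unfolding K_plus_def using funpow_periodic_range[OF n] finite_imp_bounded by blast
 have Km: "p \<in> K_minus H" unfolding K_minus_def using funpow_periodic_range[OF n(1) n'] finite_imp_bounded by blast
 have per: "(H' ^^ (n * m)) p = p" "(H ^^ (n * m)) p = p" for m
  using n(2) n' by (induction m) (simp_all add: funpow_add)
 have "p \<notin> interior (K_plus H)"
 proof
  assume "p \<in> interior (K_plus H)"
  then obtain e where e: "e > 0" "ball p e \<subseteq> K_plus H" by (auto simp: mem_interior)
  have "(\<lambda>k. dist ((H' ^^ k) (\<tau> z)) ((H' ^^ k) p)) \<longlonglongrightarrow> 0" using \<tau> unfolding unstable_param_def W_unstable_def by auto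
  then obtain k where k: "\<And>j. j >= k ==> dist ((H' ^^ j) (\<tau> z)) ((H' ^^ j) p) < e" using e(1) by (auto simp: LIMSEQ_def)
  have "k <= n * k" using n(1) by simp
  from k[OF this] have "(H' ^^ (n * k)) (\<tau> z) \<in> ball p e" by (simp add: per dist_commute)
  hence "(H' ^^ (n * k)) (\<tau> z) \<in> K_plus H" using e(2) by blast
  hence "\<tau> z \<in> K_plus H" by (simp only: backward_invariant(2)[OF K_plus_inv])
  thus False using U by (simp add: U_plus_def)
 qed
 moreover have "p \<notin> interior (K_minus H)"
 proof
  assume "p \<in> interior (K_minus H)"
  then obtain r where r: "r > 0" "ball p r \<subseteq> K_minus H" by (auto simp: mem_interior)
  define B where "B = 2 * max Rf (norm p + r)"
  have bnd: "norm (DH' m p h) <= 4 * B / r * norm h" for m h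
   by (rule hmap_derivative_bound_C2[OF hmap_subset[OF holomorphic_iterate(2)] r(1) _ DH(2)])
     (use K_minus_uniform_bound[OF r(2)] in \<open>auto simp: B_def\<close>)
  have A: "DH (n * m) p v = \<alpha> ^ m *\<^sub>C v" for m
  proof (induction m)
   case 0
   thus ?case by (simp add: DH_0)
  next
   case (Suc m)
   have "DH (n * Suc m) p v = DH (n * m) p (\<alpha> *\<^sub>C v)"
    using DH_add[of "n * m" n p v] by (simp add: n(2) \<alpha>(3) add.commute)
   also have "... = \<alpha> *\<^sub>C DH (n * m) p v" by (rule hmap_has_derivative(2)[OF holomorphic_iterate(1) UNIV_I])
   finally show ?case by (simp add: Suc scaleC_scaleC)
  qed
  have "norm v <= cmod \<alpha> ^ m * (4 * B / r * norm v)" for m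
  proof -
   have "v = DH' (n * m) p (\<alpha> ^ m *\<^sub>C v)" using DH'_DH[of "n * m" p v] by (simp add: per A)
   also have "... = \<alpha> ^ m *\<^sub>C DH' (n * m) p v" by (rule hmap_has_derivative(2)[OF holomorphic_iterate(2) UNIV_I])
   finally have v: "v = \<alpha> ^ m *\<^sub>C DH' (n * m) p v" .
   from arg_cong[OF v, of norm] have "norm v = cmod \<alpha> ^ m * norm (DH' (n * m) p v)"
    by (simp only: norm_scaleC norm_power)
   also have "... <= cmod \<alpha> ^ m * (4 * B / r * norm v)" by (rule mult_left_mono[OF bnd]) simp
   finally show ?thesis .
  qed
  moreover have "(\<lambda>m. cmod \<alpha> ^ m * (4 * B / r * norm v)) \<longlonglongrightarrow> 0"
   using \<alpha>(1) by (intro tendsto_mult_left_zero LIMSEQ_realpow_zero) auto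
  ultimately have "norm v <= 0" by (meson LIMSEQ_le_const)
  thus False using \<alpha>(2) by simp
 qed
 ultimately show ?thesis by (simp add: Julia_def J_plus_iff J_minus_iff Kp Km)
qed

lemma unstable_in_K_minus:
 assumes x: "x \<in> K_minus H" and q: "q \<in> W_unstable H x" shows "q \<in> K_minus H"
proof -
 have "(\<lambda>n. dist ((H' ^^ n) q) ((H' ^^ n) x)) \<longlonglongrightarrow> 0" using q by (simp add: W_unstable_def)
 hence "Bseq (\<lambda>n. dist ((H' ^^ n) q) ((H' ^^ n) x))" by (rule convergent_imp_Bseq[OF convergentI])
 then obtain b where b: "\<And>n. dist ((H' ^^ n) q) ((H' ^^ n) x) <= b" unfolding Bseq_def by auto
 have "norm ((H' ^^ n) q) <= b + 2 * max Rf (norm x)" for n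
  using b[of n] K_minus_bound[OF x, of n] norm_triangle_sub[of "(H' ^^ n) q" "(H' ^^ n) x"] by (simp add: dist_norm)
 thus ?thesis unfolding K_minus_def bounded_iff by auto
qed

text \<open>
  Pointwise convergence of the backward orbits along an entire curve is locally uniform, since the
  backward iterates are uniformly bounded and hence equicontinuous on disks.
\<close>

lemma unstable_uniform:
 assumes x: "x \<in> K_minus H" and hol: "hmap \<tau> UNIV" and \<tau>: "\<And>z::complex. \<tau> z \<in> W_unstable H x"
  and r: "r > 0" and e: "e > 0"
 shows "\<exists>n0. \<forall>n\<ge>n0. \<forall>z\<in>cball \<xi> r. dist ((H' ^^ n) (\<tau> z)) ((H' ^^ n) x) < e"
proof -
 have "bounded (\<tau> ` cball \<xi> (4 * r))" using hmap_continuous_on[OF hol]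
  by (intro compact_imp_bounded compact_continuous_image) (auto intro: continuous_on_subset)
 then obtain b where b0: "\<forall>y\<in>\<tau> ` cball \<xi> (4 * r). norm y <= b" unfolding bounded_iff by (elim exE)
 have b: "norm (\<tau> z) <= b" if "z \<in> cball \<xi> (4 * r)" for z by (rule bspec[OF b0 imageI[OF that]])
 define B where "B = 2 * max Rf b"
 have B: "B > 0" using fp.R by (simp add: B_def)
 define L where "L = 4 * B / (2 * r)"
 have L: "L > 0" using B r by (simp add: L_def)
 have Lip: "dist ((H' ^^ n) (\<tau> z)) ((H' ^^ n) (\<tau> w)) <= L * dist z w"
  if "z \<in> ball \<xi> (2 * r)" "w \<in> ball \<xi> (2 * r)" for n z w unfolding dist_norm L_def
 proof (rule holomorphic_map_Lipschitz[OF _ _ _ that])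
  show "hmap (\<lambda>z. (H' ^^ n) (\<tau> z)) (ball \<xi> (2 * (2 * r)))"
   by (rule hmap_compose[OF hmap_subset[OF hol] holomorphic_iterate(2)]) auto
  show "norm ((H' ^^ n) (\<tau> q)) <= B" if "q \<in> ball \<xi> (2 * (2 * r))" for q
   using K_minus_bound[OF unstable_in_K_minus[OF x \<tau>[of q]], of n] b[of q] that by (auto simp: B_def)
 qed (use r in simp)
 define \<delta> where "\<delta> = min r (e / (2 * L))"
 have \<delta>: "\<delta> > 0" using r e L by (simp add: \<delta>_def)
 have cover: "cball \<xi> r \<subseteq> (\<Union>c\<in>cball \<xi> r. ball c \<delta>)" using \<delta> by auto
 obtain T where T: "T \<subseteq> cball \<xi> r" "finite T" "cball \<xi> r \<subseteq> (\<Union>c\<in>T. ball c \<delta>)"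
  by (rule compactE_image[OF compact_cball open_ball cover])
 have "\<forall>\<^sub>F n in sequentially. \<forall>c\<in>T. dist ((H' ^^ n) (\<tau> c)) ((H' ^^ n) x) < e / 2"
 proof (rule eventually_ball_finite[OF T(2)], rule ballI)
  fix c assume "c \<in> T"
  have "(\<lambda>n. dist ((H' ^^ n) (\<tau> c)) ((H' ^^ n) x)) \<longlonglongrightarrow> 0" using \<tau>[of c] by (simp add: W_unstable_def)
  thus "\<forall>\<^sub>F n in sequentially. dist ((H' ^^ n) (\<tau> c)) ((H' ^^ n) x) < e / 2" by (rule order_tendstoD) (use e in simp)
 qed
 then obtain n0 where n0: "\<And>n c. n >= n0 ==> c \<in> T ==> dist ((H' ^^ n) (\<tau> c)) ((H' ^^ n) x) < e / 2"
  unfolding eventually_sequentially by blast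
 show ?thesis
 proof (intro exI[of _ n0] allI impI ballI)
  fix n z assume n: "n0 <= n" and z: "z \<in> cball \<xi> r"
  then obtain c where c: "c \<in> T" "dist c z < \<delta>" using T(3) by auto
  have "c \<in> ball \<xi> (2 * r)" "z \<in> ball \<xi> (2 * r)" using c(1) T(1) z r by auto
  from Lip[OF this(2,1), of n] have "dist ((H' ^^ n) (\<tau> z)) ((H' ^^ n) (\<tau> c)) <= L * dist z c" .
  also have "... <= L * (e / (2 * L))" using c(2) L by (intro mult_left_mono) (auto simp: \<delta>_def dist_commute)
  also have "... = e / 2" using L by simp
  finally show "dist ((H' ^^ n) (\<tau> z)) ((H' ^^ n) x) < e"
   using n0[OF n c(1)] dist_triangle[of "(H' ^^ n) (\<tau> z)" "(H' ^^ n) x" "(H' ^^ n) (\<tau> c)"] by linarith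
 qed
qed

end

context hyperbolic_henon
begin

text \<open>The local unstable manifold of size \<open>\<epsilon>\<close>, in terms of backward orbits only.\<close>

definition Wloc :: "real => C2 => C2 set" where
 "Wloc \<epsilon> x = {q. \<forall>n. dist ((H' ^^ n) x) ((H' ^^ n) q) < \<epsilon>}"

text \<open>
  If \<open>E\<^sup>s x = 0\<close>, then the inverse iterates contract a ball about \<open>x\<close>, which therefore lies in \<open>K\<^sup>-\<close>;
  but \<open>x\<close> is a boundary point of \<open>K\<^sup>-\<close>.
\<close>

lemma Es_nontrivial:
 assumes x: "x \<in> Julia H" shows "\<exists>e\<in>Es x. e ~= 0"
proof (rule ccontr)
 assume "\<not> ?thesis"
 hence triv: "\<And>v. v \<in> Es x ==> v = 0" by blast
 define y where "y n = (H' ^^ n) x" for n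
 have yJ: "y n \<in> Julia H" for n using x by (simp add: y_def Julia_iterate)
 have Eu_all: "w \<in> Eu (y n)" for n w
 proof -
  obtain u v where uv: "u \<in> Es (y n)" "v \<in> Eu (y n)" "w = u + v" using splitting[OF yJ[of n], of w] by (elim bexE)
  have "DH n (y n) u \<in> Es ((H ^^ n) (y n))" using DH_image[OF yJ[of n], of n] uv(1) by (metis imageI)
  hence "DH n (y n) u = 0" using triv by (simp add: y_def fp.iterate_cancel)
  hence "u = DH' n ((H ^^ n) (y n)) 0" using DH'_DH[of n "y n" u] by simp
  also have "... = 0" by (rule linear_0[OF has_derivative_linear[OF DH(2)]])
  finally show ?thesis using uv by simp
 qed
 have "\<forall>\<^sub>F n in sequentially. C * \<kappa> ^ n < 1 / 4" by (rule contraction_small) simp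
 hence "\<forall>\<^sub>F n in sequentially. C * \<kappa> ^ n < 1 / 4 & 0 < n" using eventually_gt_at_top by (rule eventually_conj)
 then obtain N where N: "C * \<kappa> ^ N < 1 / 4" "0 < N" using eventually_happens'[OF sequentially_bot] by auto
 obtain \<epsilon> where \<epsilon>: "\<epsilon> > 0" and lin: "\<forall>x\<in>Julia H. \<forall>q1\<in>ball x \<epsilon>. \<forall>q2\<in>ball x \<epsilon>.
   norm ((H' ^^ N) q1 - (H' ^^ N) q2 - DH' N x (q1 - q2)) <= (1 / 4) * norm (q1 - q2)"
  using uniform_linearization[OF holomorphic_iterate(2)[of N] compact_Julia, of "1 / 4"] by auto
 have "ball x \<epsilon> \<subseteq> K_minus H"
 proof
  fix q assume q: "q \<in> ball x \<epsilon>"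
  have yS: "y (N * Suc n) = (H' ^^ N) (y (N * n))" for n by (simp add: y_def funpow_add)
  have close: "(H' ^^ (N * n)) q \<in> ball (y (N * n)) \<epsilon>" for n
  proof (induction n)
   case 0
   thus ?case using q by (simp add: y_def)
  next
   case (Suc n)
   define a b where "a = (H' ^^ (N * n)) q" and "b = y (N * n)"
   have aS: "(H' ^^ (N * Suc n)) q = (H' ^^ N) a" by (simp add: a_def funpow_add)
   have 1: "norm ((H' ^^ N) a - (H' ^^ N) b - DH' N b (a - b)) <= (1 / 4) * norm (a - b)"
    by (rule lin[rule_format]) (use yJ Suc \<epsilon> in \<open>simp_all add: a_def b_def\<close>)
   have "norm (DH' N b (a - b)) <= C * \<kappa> ^ N * norm (a - b)" unfolding b_def by (rule contr_u[OF yJ Eu_all])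
   also have "... <= (1 / 4) * norm (a - b)" using N by (intro mult_right_mono) auto
   finally have "norm ((H' ^^ N) a - (H' ^^ N) b) <= (1 / 2) * norm (a - b)"
    using 1 norm_triangle_sub[of "(H' ^^ N) a - (H' ^^ N) b" "DH' N b (a - b)"] by linarith
   moreover have "norm (a - b) < \<epsilon>" using Suc by (simp add: a_def b_def dist_norm norm_minus_commute)
   ultimately have "norm ((H' ^^ N) a - (H' ^^ N) b) < \<epsilon>" using norm_ge_zero[of "a - b"] by linarith
   thus ?case unfolding aS yS b_def[symmetric] by (simp add: dist_norm norm_minus_commute)
  qed
  show "q \<in> K_minus H"
  proof (rule ccontr)
   assume "q \<notin> K_minus H"
   hence "\<forall>\<^sub>F n in sequentially. cmod (snd ((H' ^^ n) q)) < cmod (fst ((H' ^^ n) q)) \<and>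
     2 * Rf + \<epsilon> < cmod (fst ((H' ^^ n) q))" unfolding K_minus_eq by (rule fm.notin_K_eventually)
   then obtain k where k: "\<And>n. n >= k ==> 2 * Rf + \<epsilon> < cmod (fst ((H' ^^ n) q))" unfolding eventually_sequentially by blast
   have kN: "k <= N * k" using N(2) by simp
   have "norm (y (N * k)) <= 2 * Rf" using yJ[of "N * k"] K_Int_bound by (simp add: Julia_def J_plus_iff J_minus_iff)
   moreover have "norm ((H' ^^ (N * k)) q) <= norm (y (N * k)) + \<epsilon>"
    using close[of k] norm_triangle_sub[of "(H' ^^ (N * k)) q" "y (N * k)"] by (simp add: dist_norm norm_minus_commute)
   ultimately show False using k[OF kN] cmod_comp_norm(1)[of "(H' ^^ (N * k)) q"] by linarith
  qed
 qed
 hence "x \<in> interior (K_minus H)" using \<epsilon> by (auto simp: mem_interior)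
 thus False using x by (simp add: Julia_def J_minus_iff)
qed

abbreviation separated :: "real => C2 => C2 => bool" where
 "separated \<epsilon> x e \<equiv> \<forall>q1\<in>Wloc \<epsilon> x. \<forall>q2\<in>Wloc \<epsilon> x.
  fst (q1 - q2) * snd e = snd (q1 - q2) * fst e --> q1 = q2"

text \<open>
  By the cone argument no difference of distinct points of the local unstable manifold is stable,
  so the functional \<open>q \<mapsto> det (q, e)\<close> with \<open>e\<close> stable is injective on it.
\<close>

lemma local_functional:
 "\<exists>\<epsilon>>0. \<forall>x\<in>Julia H. \<exists>e. e ~= 0 & separated \<epsilon> x e"
proof -
 obtain \<epsilon> where \<epsilon>: "\<epsilon> > 0" and cone: "\<forall>x\<in>Julia H. \<forall>q1 q2. \<forall>u\<in>Es x. \<forall>v\<in>Eu x.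
   (\<forall>n. dist ((H' ^^ n) x) ((H' ^^ n) q1) < \<epsilon> & dist ((H' ^^ n) x) ((H' ^^ n) q2) < \<epsilon>) -->
   q1 - q2 = u + v --> norm v <= norm u --> q1 = q2" using backward_close_cone by (elim exE conjE)
 show ?thesis
 proof (intro exI[of _ \<epsilon>] conjI \<epsilon> ballI)
  fix x assume x: "x \<in> Julia H"
  obtain e where e: "e \<in> Es x" "e ~= 0" using Es_nontrivial[OF x] by (elim bexE)
  have "q1 = q2" if q: "q1 \<in> Wloc \<epsilon> x" "q2 \<in> Wloc \<epsilon> x"
   and det: "fst (q1 - q2) * snd e = snd (q1 - q2) * fst e" for q1 q2
  proof -
   define c where "c = (if fst e ~= 0 then fst (q1 - q2) / fst e else snd (q1 - q2) / snd e)"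
   have "fst e ~= 0 \<or> snd e ~= 0" using e(2) by (simp add: prod_eq_iff)
   hence "q1 - q2 = c *\<^sub>C e" using det by (auto simp: c_def prod_eq_iff scaleC_prod_def scaleC_complex_def divide_simps)
   hence diff: "q1 - q2 = c *\<^sub>C e + 0" by simp
   have 0: "0 \<in> Eu x" using Eu[OF x] by (simp add: csubspace_def)
   show ?thesis by (rule cone[rule_format, OF x csubspace_scale[OF Es[OF x] e(1)] 0 _ diff])
      (use q in \<open>simp_all add: Wloc_def\<close>)
  qed
  thus "\<exists>e. e ~= 0 & separated \<epsilon> x e" by (intro exI[of _ e] conjI e(2) ballI impI)
 qed
qed

text \<open>
  If \<open>q\<close> were interior to \<open>K\<^sup>-\<close>, then some inverse iterate would map a neighbourhood of \<open>q\<close> into a local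
  unstable manifold, on which a linear functional is injective. None is injective on an open set.
\<close>

lemma unstable_in_J_minus:
 assumes x: "x \<in> Julia H" and q: "q \<in> W_unstable H x" shows "q \<in> J_minus H"
proof -
 have xK: "x \<in> K_minus H" using x by (simp add: Julia_def J_minus_iff)
 have "q \<notin> interior (K_minus H)"
 proof
  assume "q \<in> interior (K_minus H)"
  then obtain r0 where r0: "r0 > 0" "ball q r0 \<subseteq> K_minus H" by (auto simp: mem_interior)
  define r where "r = r0 / 2"
  have r: "r > 0" "ball q (2 * r) \<subseteq> K_minus H" using r0 by (auto simp: r_def)
  define B where "B = 2 * max Rf (norm q + 2 * r)"
  have B: "B > 0" using fp.R by (simp add: B_def)
  have Lip: "norm ((H' ^^ m) a - (H' ^^ m) b) <= 4 * B / r * norm (a - b)" if "a \<in> ball q r" "b \<in> ball q r" for a b m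
   by (rule holomorphic_map_Lipschitz[OF hmap_subset[OF holomorphic_iterate(2)] r(1) _ that])
     (use K_minus_uniform_bound[OF r(2)] in \<open>auto simp: B_def\<close>)
  obtain \<epsilon> where \<epsilon>: "\<epsilon> > 0" and loc: "\<forall>x\<in>Julia H. \<exists>e. e ~= 0 & separated \<epsilon> x e"
   using local_functional by (elim exE conjE)
  define r' where "r' = min r (\<epsilon> * r / (8 * B))"
  have r': "r' > 0" "r' <= r" "4 * B / r * r' <= \<epsilon> / 2"
  proof -
   show "r' > 0" "r' <= r" using r \<epsilon> B by (auto simp: r'_def)
   have "4 * B / r * r' <= 4 * B / r * (\<epsilon> * r / (8 * B))" using B r by (intro mult_left_mono) (auto simp: r'_def)
   also have "... = \<epsilon> / 2" using B r by (simp add: field_simps)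
   finally show "4 * B / r * r' <= \<epsilon> / 2" .
  qed
  have "(\<lambda>n. dist ((H' ^^ n) q) ((H' ^^ n) x)) \<longlonglongrightarrow> 0" using q by (simp add: W_unstable_def)
  hence "\<forall>\<^sub>F n in sequentially. dist ((H' ^^ n) q) ((H' ^^ n) x) < \<epsilon> / 2" by (rule order_tendstoD) (use \<epsilon> in simp)
  then obtain n0 where n0: "\<And>n. n >= n0 ==> dist ((H' ^^ n) q) ((H' ^^ n) x) < \<epsilon> / 2"
   unfolding eventually_sequentially by blast
  define x1 where "x1 = (H' ^^ n0) x"
  have x1: "x1 \<in> Julia H" using x by (simp add: x1_def Julia_iterate)
  define S where "S = (H ^^ n0) -` ball q r'"
  have "open S" unfolding S_def by (rule open_vimage[OF open_ball cont_iterate(1)])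
  have SW: "p \<in> Wloc \<epsilon> x1" if "p \<in> S" for p unfolding Wloc_def mem_Collect_eq
  proof
   fix n
   define a where "a = (H ^^ n0) p"
   have a: "dist q a < r'" using that by (simp add: S_def a_def)
   have pa: "(H' ^^ n) p = (H' ^^ (n + n0)) a" by (simp add: a_def funpow_add fp.iterate_cancel)
   have xa: "(H' ^^ n) x1 = (H' ^^ (n + n0)) x" by (simp add: x1_def funpow_add)
   have "norm ((H' ^^ (n + n0)) a - (H' ^^ (n + n0)) q) <= 4 * B / r * norm (a - q)" by (rule Lip) (use a r r' in auto)
   also have "... <= 4 * B / r * r'" using a B r by (intro mult_left_mono) (auto simp: dist_norm norm_minus_commute)
   also have "... <= \<epsilon> / 2" by (rule r'(3))
   finally have "dist ((H' ^^ (n + n0)) a) ((H' ^^ (n + n0)) q) <= \<epsilon> / 2" by (simp add: dist_norm)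
   moreover have "dist ((H' ^^ (n + n0)) q) ((H' ^^ (n + n0)) x) < \<epsilon> / 2" by (rule n0) simp
   ultimately show "dist ((H' ^^ n) x1) ((H' ^^ n) p) < \<epsilon>"
    using dist_triangle[of "(H' ^^ (n + n0)) a" "(H' ^^ (n + n0)) x" "(H' ^^ (n + n0)) q"]
    unfolding pa xa by (simp add: dist_commute)
  qed
  define q1 where "q1 = (H' ^^ n0) q"
  have "q1 \<in> S" using r' by (simp add: S_def q1_def fp.iterate_cancel)
  then obtain \<delta> where \<delta>: "\<delta> > 0" "ball q1 \<delta> \<subseteq> S" using \<open>open S\<close> open_contains_ball by blast
  obtain e where e: "e ~= 0" and inj: "separated \<epsilon> x1 e" using bspec[OF loc x1] by (elim exE conjE)
  define t where "t = \<delta> / (2 * norm e)"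
  define q2 where "q2 = q1 + t *\<^sub>R e"
  have "q2 \<in> ball q1 \<delta>" using e \<delta> by (simp add: q2_def t_def dist_norm)
  hence "q1 = q2" using inj[rule_format, OF SW SW, of q1 q2] \<delta> \<open>q1 \<in> S\<close> by (auto simp: q2_def)
  thus False using e \<delta> by (simp add: q2_def t_def)
 qed
 moreover have "q \<in> K_minus H" by (rule unstable_in_K_minus[OF xK q])
 ultimately show ?thesis by (simp add: J_minus_iff)
qed

text \<open>
  An injectively immersed curve need not carry the subspace topology. For unstable manifolds, a
  continuous map into the curve whose backward orbits contract uniformly is nevertheless continuous
  in the parameter: far back in time both it and the curve live in one local unstable manifold, on
  which a linear functional is injective, and there the open mapping theorem applies.
\<close>

lemma continuous_into_unstable_param:
 fixes \<sigma> \<tau> :: "complex => C2"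
 assumes x: "x \<in> Julia H" and \<tau>: "hmap \<tau> UNIV" "inj \<tau>" "range \<tau> = W_unstable H x"
  and S: "open S" "continuous_on S \<sigma>" "\<And>z. z \<in> S ==> \<sigma> z \<in> W_unstable H x"
  and unif: "\<And>e. e > 0 ==> \<exists>n0. \<forall>n\<ge>n0. \<forall>z\<in>S. dist ((H' ^^ n) (\<sigma> z)) ((H' ^^ n) x) < e"
 shows "continuous_on S (\<lambda>z. inv \<tau> (\<sigma> z))" unfolding continuous_on_eq_continuous_at[OF S(1)] continuous_at_eps_delta
proof (intro ballI allI impI)
 fix z0 e0 assume z0: "z0 \<in> S" and e0: "(0::real) < e0"
 define r where "r = e0 / 2"
 have r: "r > 0" using e0 by (simp add: r_def)
 define \<xi>0 where "\<xi>0 = inv \<tau> (\<sigma> z0)"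
 have inv: "\<tau> (inv \<tau> (\<sigma> z)) = \<sigma> z" if "z \<in> S" for z using S(3)[OF that] \<tau>(3) by (metis f_inv_into_f)
 obtain \<epsilon> where \<epsilon>: "\<epsilon> > 0" and loc: "\<forall>x\<in>Julia H. \<exists>e. e ~= 0 & separated \<epsilon> x e" using local_functional by (elim exE conjE)
 have xK: "x \<in> K_minus H" using x by (simp add: Julia_def J_minus_iff)
 have \<tau>W: "\<tau> z \<in> W_unstable H x" for z using \<tau>(3) by blast
 obtain n1 where n1: "\<forall>n\<ge>n1. \<forall>z\<in>cball \<xi>0 r. dist ((H' ^^ n) (\<tau> z)) ((H' ^^ n) x) < \<epsilon>"
  using unstable_uniform[OF xK \<tau>(1) \<tau>W r \<epsilon>, of \<xi>0] by (elim exE)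
 obtain n2 where n2: "\<forall>n\<ge>n2. \<forall>z\<in>S. dist ((H' ^^ n) (\<sigma> z)) ((H' ^^ n) x) < \<epsilon>" using unif[OF \<epsilon>] by (elim exE)
 define n where "n = max n1 n2"
 define y where "y = (H' ^^ n) x"
 have y: "y \<in> Julia H" using x by (simp add: y_def Julia_iterate)
 obtain e where e: "e ~= 0" and inj: "separated \<epsilon> y e" using bspec[OF loc y] by (elim exE conjE)
 define c where "c q = fst q * snd e - snd q * fst e" for q
 have c_inj: "q1 = q2" if "q1 \<in> Wloc \<epsilon> y" "q2 \<in> Wloc \<epsilon> y" "c q1 = c q2" for q1 q2
  by (rule inj[rule_format, OF that(1,2)]) (use that(3) in \<open>simp add: c_def algebra_simps\<close>)
 have \<tau>loc: "(H' ^^ n) (\<tau> \<xi>) \<in> Wloc \<epsilon> y" if "\<xi> \<in> cball \<xi>0 r" for \<xi> unfolding Wloc_def mem_Collect_eq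
 proof
  fix k
  have "dist ((H' ^^ (k + n)) (\<tau> \<xi>)) ((H' ^^ (k + n)) x) < \<epsilon>" by (rule n1[rule_format, OF _ that]) (simp add: n_def)
  thus "dist ((H' ^^ k) y) ((H' ^^ k) ((H' ^^ n) (\<tau> \<xi>))) < \<epsilon>" by (simp add: y_def funpow_add dist_commute)
 qed
 have \<sigma>loc: "(H' ^^ n) (\<sigma> z) \<in> Wloc \<epsilon> y" if "z \<in> S" for z unfolding Wloc_def mem_Collect_eq
 proof
  fix k
  have "dist ((H' ^^ (k + n)) (\<sigma> z)) ((H' ^^ (k + n)) x) < \<epsilon>" by (rule n2[rule_format, OF _ that]) (simp add: n_def)
  thus "dist ((H' ^^ k) y) ((H' ^^ k) ((H' ^^ n) (\<sigma> z))) < \<epsilon>" by (simp add: y_def funpow_add dist_commute)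
 qed
 have inv_inj: "p = q" if "(H' ^^ n) p = (H' ^^ n) q" for p q using that by (metis fp.iterate_cancel(2))
 define f where "f \<xi> = c ((H' ^^ n) (\<tau> \<xi>))" for \<xi>
 have comp: "hmap (\<lambda>\<xi>. (H' ^^ n) (\<tau> \<xi>)) UNIV" by (rule hmap_compose[OF \<tau>(1) holomorphic_iterate(2)]) simp
 have "hmap f UNIV" unfolding f_def c_def using hmap_compose[OF comp hmap_fst[of UNIV]]
   hmap_compose[OF comp hmap_snd[of UNIV]] by (intro hmap_diff hmap_mult hmap_const) auto
 hence "f holomorphic_on UNIV" by (simp add: hmap_complex)
 hence f: "f holomorphic_on ball \<xi>0 r" by (rule holomorphic_on_subset) simp
 have "inj_on f (ball \<xi>0 r)"
 proof (rule inj_onI)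
  fix a b assume ab: "a \<in> ball \<xi>0 r" "b \<in> ball \<xi>0 r" "f a = f b"
  have "(H' ^^ n) (\<tau> a) = (H' ^^ n) (\<tau> b)" by (rule c_inj[OF \<tau>loc \<tau>loc]) (use ab in \<open>auto simp: f_def\<close>)
  from injD[OF \<tau>(2) inv_inj[OF this]] show "a = b" .
 qed
 hence "open (f ` ball \<xi>0 r)" using open_mapping_thm3[OF f open_ball] by blast
 moreover have cont: "continuous_on S (\<lambda>z. c ((H' ^^ n) (\<sigma> z)))" unfolding c_def
  by (intro continuous_intros continuous_on_compose2[OF cont_iterate(2)[of UNIV n] S(2)]) auto
 moreover have "c ((H' ^^ n) (\<sigma> z0)) \<in> f ` ball \<xi>0 r"
  using inv[OF z0] r by (intro image_eqI[of _ _ \<xi>0]) (auto simp: f_def \<xi>0_def)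
 ultimately have O: "open (S \<inter> (\<lambda>z. c ((H' ^^ n) (\<sigma> z))) -` (f ` ball \<xi>0 r))"
  and z0O: "z0 \<in> S \<inter> (\<lambda>z. c ((H' ^^ n) (\<sigma> z))) -` (f ` ball \<xi>0 r)"
  using continuous_open_preimage[OF cont S(1)] z0 by simp_all
 obtain \<delta> where \<delta>: "\<delta> > 0" "ball z0 \<delta> \<subseteq> S \<inter> (\<lambda>z. c ((H' ^^ n) (\<sigma> z))) -` (f ` ball \<xi>0 r)" by (rule openE[OF O z0O])
 show "\<exists>\<delta>>0. \<forall>z. dist z z0 < \<delta> --> dist (inv \<tau> (\<sigma> z)) (inv \<tau> (\<sigma> z0)) < e0"
 proof (intro exI[of _ \<delta>] conjI \<delta>(1) allI impI)
  fix z assume "dist z z0 < \<delta>"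
  hence "z \<in> ball z0 \<delta>" by (simp add: dist_commute)
  hence "z \<in> S \<inter> (\<lambda>z. c ((H' ^^ n) (\<sigma> z))) -` (f ` ball \<xi>0 r)" by (rule subsetD[OF \<delta>(2)])
  hence z: "z \<in> S" "c ((H' ^^ n) (\<sigma> z)) \<in> f ` ball \<xi>0 r" by simp_all
  obtain \<xi> where \<xi>: "c ((H' ^^ n) (\<sigma> z)) = f \<xi>" "\<xi> \<in> ball \<xi>0 r" using z(2) by (rule imageE)
  have "(H' ^^ n) (\<sigma> z) = (H' ^^ n) (\<tau> \<xi>)" by (rule c_inj[OF \<sigma>loc[OF z(1)] \<tau>loc]) (use \<xi> in \<open>auto simp: f_def\<close>)
  hence "\<sigma> z = \<tau> \<xi>" by (rule inv_inj)
  hence "inv \<tau> (\<sigma> z) = \<xi>" using \<tau>(2) by simp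
  thus "dist (inv \<tau> (\<sigma> z)) (inv \<tau> (\<sigma> z0)) < e0" using \<xi>(2) e0 by (simp add: \<xi>0_def r_def dist_commute)
 qed
qed

end

lemma hyperbolic_henonI:
 assumes "henon_map d H" "hyperbolic H"
 shows "\<exists>Es Eu C \<kappa>. hyperbolic_henon d H Es Eu C \<kappa>"
proof -
 from assms(2) obtain Es Eu C \<kappa> where "C > 0" "0 < \<kappa>" "\<kappa> < 1" "\<forall>p\<in>Julia H.
      csubspace (Es p) & csubspace (Eu p) \<and>
      Es p \<inter> Eu p = {0} & (\<forall>w. \<exists>u\<in>Es p. \<exists>v\<in>Eu p. w = u + v) \<and>
      frechet_derivative H (at p) ` Es p = Es (H p) \<and>
      frechet_derivative H (at p) ` Eu p = Eu (H p) \<and>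
      (\<forall>n. \<forall>v\<in>Es p. norm (frechet_derivative (H ^^ n) (at p) v) <= C * \<kappa> ^ n * norm v) \<and>
      (\<forall>n. \<forall>v\<in>Eu p. norm (frechet_derivative (inv H ^^ n) (at p) v) <= C * \<kappa> ^ n * norm v)"
  unfolding hyperbolic_def by (elim exE conjE)
 hence "hyperbolic_henon d H Es Eu C \<kappa>"
  unfolding hyperbolic_henon_def hyperbolic_henon_axioms_def henon_def using assms(1) by blast
 thus ?thesis by (intro exI)
qed


section \<open>The local maximum principle on \<open>J\<^sup>-\<close>\<close>

lemma (in filtration) uniform_escape:
 assumes S: "compact S" "S \<inter> K = {}"
 shows "\<exists>n. \<forall>q\<in>S. B < a ((T ^^ n) q)"
proof -
 define V where "V = {p. b p < a p & max B R < a p}"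
 have openV: "open V" unfolding V_def
  using conta contb by (auto intro!: open_Collect_conj open_Collect_less continuous_intros)
 have TV: "T p \<in> V" if "p \<in> V" for p using fwd[of p] that R unfolding V_def by auto
 have mono: "(T ^^ m) p \<in> V" if "(T ^^ n) p \<in> V" "n <= m" for n m p
  using that(2,1) by (induction rule: dec_induct) (auto intro: TV)
 have cover: "S \<subseteq> (\<Union>n\<in>UNIV. (T ^^ n) -` V)"
 proof
  fix q assume "q \<in> S"
  hence "q \<notin> K" using S by blast
  then obtain n where "b ((T ^^ n) q) < a ((T ^^ n) q)" "max B R < a ((T ^^ n) q)"
   using eventually_happens'[OF sequentially_bot notin_K_eventually[of q "max B R"]] by blast
  thus "q \<in> (\<Union>n\<in>UNIV. (T ^^ n) -` V)" by (auto simp: V_def)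
 qed
 have op: "open ((T ^^ n) -` V)" for n by (rule open_vimage[OF openV cont_iterate])
 obtain I where I: "finite I" "S \<subseteq> (\<Union>n\<in>I. (T ^^ n) -` V)" by (rule compactE_image[OF S(1) op cover])
 define N where "N = Max (insert 0 I)"
 show ?thesis
 proof (intro exI[of _ N] ballI)
  fix q assume "q \<in> S"
  then obtain i where i: "i \<in> I" "(T ^^ i) q \<in> V" using I by blast
  hence "i <= N" using I by (simp add: N_def)
  from mono[OF i(2) this] show "B < a ((T ^^ N) q)" by (simp add: V_def)
 qed
qed

lemma min_modulus_disk:
 fixes f :: "complex => complex"
 assumes f: "f holomorphic_on UNIV" and r: "r > 0" and B: "B > 0"
  and bd: "\<And>z. cmod z = r ==> B <= cmod (f z)" and nz: "\<And>z. cmod z <= r ==> f z ~= 0"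
  and z: "cmod z <= r"
 shows "B <= cmod (f z)"
proof -
 have "cmod (inverse (f z)) <= 1 / B"
 proof (rule maximum_modulus_frontier[of "\<lambda>z. inverse (f z)" "cball 0 r"])
  have h: "(\<lambda>z. inverse (f z)) holomorphic_on cball 0 r"
   by (intro holomorphic_intros holomorphic_on_subset[OF f]) (use nz in auto)
  show "(\<lambda>z. inverse (f z)) holomorphic_on interior (cball 0 r)" by (rule holomorphic_on_subset[OF h interior_subset])
  show "continuous_on (closure (cball 0 r)) (\<lambda>z. inverse (f z))" using holomorphic_on_imp_continuous_on[OF h] by simp
  show "cmod (inverse (f w)) <= 1 / B" if "w \<in> frontier (cball 0 r)" for w
  proof -
   have "B <= cmod (f w)" using bd that by (simp add: frontier_cball)
   hence "1 / cmod (f w) <= 1 / B" using B by (intro frac_le) auto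
   thus ?thesis unfolding norm_inverse by (simp add: inverse_eq_divide)
  qed
 qed (use z in auto)
 hence "1 / cmod (f z) <= 1 / B" unfolding norm_inverse by (simp add: inverse_eq_divide)
 thus ?thesis using B nz[OF z] by (simp add: divide_le_eq pos_le_divide_eq)
qed

text \<open>
  Small disks parallel to the complex tangent line of the sphere at \<open>p\<close>, and not inside the sphere,
  miss \<open>J\<^sup>-\<close> except at \<open>p\<close>. Either they lie outside \<open>K\<^sup>-\<close>: then a coordinate of an inverse iterate is large
  on the boundaries of the disks and on the outermost disk, and by the minimum principle and continuity
  on all of them, although the backward orbit of \<open>p\<close> is bounded. Or they lie in \<open>K\<^sup>-\<close>: then the maximum
  principle on parallel disks bounds the backward orbits near \<open>p\<close>, so \<open>p\<close> is interior to \<open>K\<^sup>-\<close>.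
\<close>

lemma (in henon) J_minus_no_norm_max:
 assumes p: "p \<in> J_minus H" "p ~= 0" and \<delta>: "\<delta> > 0"
  and max: "\<And>q. q \<in> J_minus H ==> dist p q < \<delta> ==> norm q <= norm p"
 shows False
proof -
 have Kp: "p \<in> K_minus H" "p \<notin> interior (K_minus H)" using p(1) by (auto simp: J_minus_iff)
 \<comment> \<open>\<open>v\<close> spans the complex tangent line of the sphere through \<open>p\<close>.\<close>
 define v :: C2 where "v = (cnj (snd p), - cnj (fst p))"
 define D :: "real \<times> complex => C2" where "D = (\<lambda>(s, \<zeta>). (1 + s) *\<^sub>R p + \<zeta> *\<^sub>C v)"
 have D: "D (s, \<zeta>) = (1 + s) *\<^sub>R p + \<zeta> *\<^sub>C v" for s \<zeta> by (simp add: D_def)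
 have nv: "norm v = norm p" by (simp add: v_def norm_prod_def add.commute)
 have normD: "(norm (D (s, \<zeta>)))\<^sup>2 = ((1 + s)\<^sup>2 + (cmod \<zeta>)\<^sup>2) * (norm p)\<^sup>2" for s \<zeta>
 proof -
  have n2: "(norm z)\<^sup>2 = (cmod (fst z))\<^sup>2 + (cmod (snd z))\<^sup>2" for z :: C2 by (simp add: norm_prod_def)
  obtain x y where xy: "p = (x, y)" by (cases p)
  have "fst (D (s, \<zeta>)) = (1 + s) * x + \<zeta> * cnj y" "snd (D (s, \<zeta>)) = (1 + s) * y - \<zeta> * cnj x"
   by (simp_all add: D v_def xy scaleC_prod_def scaleC_complex_def scaleR_conv_of_real)
  thus ?thesis unfolding n2 by (simp add: xy cmod_power2) (simp add: power2_eq_square algebra_simps)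
 qed
 have np: "norm p > 0" using p by simp
 define \<rho> where "\<rho> = min 1 (\<delta> / (4 * norm p))"
 have \<rho>: "\<rho> > 0" "\<rho> * norm p <= \<delta> / 4"
 proof -
  show "\<rho> > 0" using \<delta> np by (simp add: \<rho>_def)
  have "\<rho> * norm p <= \<delta> / (4 * norm p) * norm p" using np by (intro mult_right_mono) (auto simp: \<rho>_def)
  thus "\<rho> * norm p <= \<delta> / 4" using np by simp
 qed
 have near: "dist p (D (s, \<zeta>)) < \<delta>" if "0 <= s" "s <= \<rho>" "cmod \<zeta> <= \<rho>" for s \<zeta>
 proof -
  have "D (s, \<zeta>) - p = s *\<^sub>R p + \<zeta> *\<^sub>C v" by (simp add: D algebra_simps)
  hence "dist p (D (s, \<zeta>)) = norm (s *\<^sub>R p + \<zeta> *\<^sub>C v)" by (metis dist_commute dist_norm)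
  also have "... <= s * norm p + cmod \<zeta> * norm p"
   using norm_triangle_ineq[of "s *\<^sub>R p" "\<zeta> *\<^sub>C v"] that by (simp add: norm_scaleC nv)
  also have "... <= \<rho> * norm p + \<rho> * norm p" using that by (intro add_mono mult_right_mono) auto
  finally show ?thesis using \<rho> \<delta> by linarith
 qed
 have notJ: "D (s, \<zeta>) \<notin> J_minus H" if s: "0 <= s" "s <= \<rho>" "cmod \<zeta> <= \<rho>" and nz: "(s, \<zeta>) ~= (0, 0)" for s \<zeta>
 proof
  assume "D (s, \<zeta>) \<in> J_minus H"
  from max[OF this near[OF s]] have "(norm (D (s, \<zeta>)))\<^sup>2 <= (norm p)\<^sup>2" by (intro power_mono) auto
  hence "((1 + s)\<^sup>2 + (cmod \<zeta>)\<^sup>2) * (norm p)\<^sup>2 <= 1 * (norm p)\<^sup>2" by (simp only: normD mult_1)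
  hence "(1 + s)\<^sup>2 + (cmod \<zeta>)\<^sup>2 <= 1" using np by (simp add: mult_le_cancel_right)
  moreover have "(1 + s)\<^sup>2 = 1 + 2 * s + s\<^sup>2" by (simp add: power2_eq_square algebra_simps)
  ultimately have "2 * s + s\<^sup>2 + (cmod \<zeta>)\<^sup>2 <= 0" by linarith
  hence "s = 0" "(cmod \<zeta>)\<^sup>2 = 0" using s(1) zero_le_power2[of s] zero_le_power2[of "cmod \<zeta>"] by linarith+
  thus False using nz by simp
 qed
 have contD: "continuous_on X D" for X
 proof -
  have c2: "continuous_on X (\<lambda>z. snd z *\<^sub>C v)"
   using bounded_linear.continuous_on[OF bounded_linear_scaleC_left[of v] continuous_on_snd[OF continuous_on_id]] .
  show ?thesis unfolding D_def case_prod_beta by (intro continuous_intros c2)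
 qed
 define A where "A = ({0..\<rho>} \<times> cball 0 \<rho>) - {(0::real, 0::complex)}"
 have "connected A"
 proof (rule connected_intermediate_closure)
  show "connected ({0<..\<rho>} \<times> cball (0::complex) \<rho>)" by (intro connected_Times) auto
  show "{0<..\<rho>} \<times> cball 0 \<rho> \<subseteq> A" by (auto simp: A_def)
  have "closure {0<..\<rho>} = {0..\<rho>}" using \<rho> by simp
  thus "A \<subseteq> closure ({0<..\<rho>} \<times> cball 0 \<rho>)" by (auto simp: A_def closure_Times)
 qed
 hence conn: "connected (D ` A)" by (rule connected_continuous_image[OF contD])
 have AJ: "D ` A \<inter> frontier (K_minus H) = {}" using notJ unfolding A_def J_minus_def[symmetric] by fastforce
 have dichotomy: "D ` A \<inter> K_minus H = {} \<or> D ` A \<subseteq> K_minus H"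
  using connected_Int_frontier[OF conn, of "K_minus H"] AJ by blast
 have lineF: "hmap (\<lambda>\<zeta>. (H' ^^ n) (q + \<zeta> *\<^sub>C v)) UNIV" for n q
  by (rule hmap_compose[OF hmap_complex_line holomorphic_iterate(2)]) simp
 have holf: "(\<lambda>\<zeta>. fst ((H' ^^ n) (q + \<zeta> *\<^sub>C v))) holomorphic_on UNIV"
  and hols: "(\<lambda>\<zeta>. snd ((H' ^^ n) (q + \<zeta> *\<^sub>C v))) holomorphic_on UNIV" for n q
  using hmap_compose[OF lineF hmap_fst[of UNIV]]
   hmap_compose[OF lineF hmap_snd[of UNIV]] by (auto simp: hmap_complex)
 from dichotomy show False
 proof
  assume out: "D ` A \<inter> K_minus H = {}"
  define S where "S = D ` ({0..\<rho>} \<times> sphere 0 \<rho>) \<union> D ` ({\<rho>} \<times> cball 0 \<rho>)"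
  have "compact S" unfolding S_def by (intro compact_Un compact_continuous_image contD compact_Times) auto
  moreover have "S \<inter> K_minus H = {}"
  proof -
   have "S \<subseteq> D ` A" unfolding S_def A_def image_Un[symmetric] by (intro image_mono) (use \<rho> in auto)
   thus ?thesis using out by blast
  qed
  ultimately obtain n where n: "\<And>q. q \<in> S ==> 2 * max Rf (norm p) + 1 < cmod (fst ((H' ^^ n) q))"
   using fm.uniform_escape[of S "2 * max Rf (norm p) + 1"] unfolding K_minus_eq by blast
  define B where "B = 2 * max Rf (norm p) + 1"
  have B: "B > 0" using fp.R by (simp add: B_def)
  define F where "F = (\<lambda>z. fst ((H' ^^ n) (D z)))"
  have Fhol: "(\<lambda>\<zeta>. F (s, \<zeta>)) holomorphic_on UNIV" for s unfolding F_def D by (rule holf)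
  have contF: "continuous_on X F" for X unfolding F_def
   by (intro continuous_on_fst continuous_on_compose2[OF cont_iterate(2)[of UNIV n] contD]) auto
  define I where "I = {0..\<rho>}"
  define Z where "Z = fst ` (I \<times> cball 0 \<rho> \<inter> F -` {0})"
  define G where "G = {s\<in>I. \<forall>\<zeta>\<in>cball 0 \<rho>. B <= cmod (F (s, \<zeta>))}"
  have "closed (I \<times> cball 0 \<rho> \<inter> F -` {0})"
   by (rule continuous_closed_preimage[OF contF]) (auto simp: I_def intro: closed_Times)
  hence "compact ((I \<times> cball 0 \<rho>) \<inter> (I \<times> cball 0 \<rho> \<inter> F -` {0}))"
   by (intro compact_Int_closed compact_Times) (auto simp: I_def)
  hence "compact (I \<times> cball 0 \<rho> \<inter> F -` {0})" by (simp add: Int_absorb2)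
  hence "compact Z" unfolding Z_def by (intro compact_continuous_image continuous_intros)
  hence Zc: "closed Z" by (rule compact_imp_closed)
  have G_eq: "G = I \<inter> (\<Inter>\<zeta>\<in>cball 0 \<rho>. I \<inter> (\<lambda>s. cmod (F (s, \<zeta>))) -` {B..})" by (auto simp: G_def)
  have "closed (I \<inter> (\<lambda>s. cmod (F (s, \<zeta>))) -` {B..})" for \<zeta>
  proof (rule continuous_closed_preimage)
   show "continuous_on I (\<lambda>s. cmod (F (s, \<zeta>)))"
    by (intro continuous_on_norm continuous_on_compose2[OF contF[of UNIV]] continuous_intros) auto
  qed (auto simp: I_def)
  moreover have "closed I" by (simp add: I_def)
  ultimately have Gc: "closed G" unfolding G_eq by (rule closed_Int[rotated, OF closed_INT[OF ballI]])
  have cov: "I \<subseteq> Z \<union> G"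
  proof
   fix s assume s: "s \<in> I"
   show "s \<in> Z \<union> G"
   proof (cases "s \<in> Z")
    case False
    hence nz: "F (s, \<zeta>) ~= 0" if "cmod \<zeta> <= \<rho>" for \<zeta> using that s by (force simp: Z_def)
    have bd: "B <= cmod (F (s, \<zeta>))" if "cmod \<zeta> = \<rho>" for \<zeta>
    proof -
     have "D (s, \<zeta>) \<in> S" unfolding S_def using s that by (auto simp: I_def)
     from n[OF this] show ?thesis by (simp add: F_def B_def)
    qed
    have "B <= cmod (F (s, \<zeta>))" if "\<zeta> \<in> cball 0 \<rho>" for \<zeta>
     by (rule min_modulus_disk[OF Fhol \<rho>(1) B bd nz]) (use that in simp_all)
    hence "s \<in> G" unfolding G_def using s by simp
    thus ?thesis by simp
   qed simp
  qed
  have disj: "Z \<inter> G = {}"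
  proof (rule equals0I)
   fix s assume "s \<in> Z \<inter> G"
   then obtain \<zeta> where "\<zeta> \<in> cball 0 \<rho>" "F (s, \<zeta>) = 0" "\<forall>\<zeta>\<in>cball 0 \<rho>. B <= cmod (F (s, \<zeta>))" unfolding Z_def G_def by auto
   thus False using B by force
  qed
  have "\<rho> \<in> G"
  proof -
   have "B <= cmod (F (\<rho>, \<zeta>))" if "\<zeta> \<in> cball 0 \<rho>" for \<zeta>
   proof -
    have "D (\<rho>, \<zeta>) \<in> S" unfolding S_def using that by blast
    from n[OF this] show ?thesis by (simp add: F_def B_def)
   qed
   thus ?thesis unfolding G_def using \<rho> by (simp add: I_def)
  qed
  moreover have "connected I" by (simp add: I_def)
  moreover have "\<rho> \<in> I" "0 \<in> I" using \<rho> by (simp_all add: I_def)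
  ultimately have "Z \<inter> I = {}" using connected_closedD[of I Z G] cov disj Zc Gc by blast
  hence "0 \<in> G" using cov \<open>0 \<in> I\<close> by blast
  hence "B <= cmod (F (0, 0))" unfolding G_def using \<rho> by simp
  hence "B <= cmod (fst ((H' ^^ n) p))" by (simp add: F_def D)
  thus False using K_minus_bound[OF Kp(1), of n] cmod_comp_norm(1)[of "(H' ^^ n) p"] unfolding B_def by linarith
 next
  assume ins: "D ` A \<subseteq> K_minus H"
  define S where "S = D ` ({0} \<times> sphere 0 \<rho>)"
  have S: "S \<subseteq> D ` A" unfolding S_def A_def by (intro image_mono) (use \<rho> in auto)
  have "compact S" unfolding S_def by (intro compact_continuous_image contD compact_Times) auto
  moreover have "S \<subseteq> interior (K_minus H)" using S ins AJ closure_subset[of "K_minus H"] unfolding frontier_def by blast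
  ultimately obtain \<eta> where \<eta>: "\<eta> > 0" and cov: "(\<Union>w\<in>S. ball w \<eta>) \<subseteq> interior (K_minus H)"
   by (rule compact_subset_open_imp_ball_epsilon_subset[OF _ open_interior])
  have "ball p \<eta> \<subseteq> K_minus H"
  proof
   fix q assume q: "q \<in> ball p \<eta>"
   define B where "B = 2 * max Rf (norm q + norm v)"
   have bnd: "norm ((H' ^^ n) (q + \<zeta> *\<^sub>C v)) <= B" if "cmod \<zeta> = \<rho>" for n \<zeta>
   proof -
    have "D (0, \<zeta>) \<in> S" unfolding S_def using that by auto
    moreover have "q + \<zeta> *\<^sub>C v \<in> ball (D (0, \<zeta>)) \<eta>" using q by (simp add: D dist_norm)
    ultimately have "q + \<zeta> *\<^sub>C v \<in> interior (K_minus H)" by (intro subsetD[OF cov] UN_I)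
    hence "q + \<zeta> *\<^sub>C v \<in> K_minus H" by (rule subsetD[OF interior_subset])
    from K_minus_bound[OF this] have 1: "norm ((H' ^^ n) (q + \<zeta> *\<^sub>C v)) <= 2 * max Rf (norm (q + \<zeta> *\<^sub>C v))" .
    have "cmod \<zeta> * norm v <= 1 * norm v" using that by (intro mult_right_mono) (auto simp: \<rho>_def)
    hence "norm (q + \<zeta> *\<^sub>C v) <= norm q + norm v" using norm_triangle_ineq[of q "\<zeta> *\<^sub>C v"] by (simp add: norm_scaleC)
    hence "max Rf (norm (q + \<zeta> *\<^sub>C v)) <= max Rf (norm q + norm v)" by (intro max.mono) auto
    hence "2 * max Rf (norm (q + \<zeta> *\<^sub>C v)) <= B" unfolding B_def by (rule mult_left_mono) simp
    with 1 show ?thesis by (rule order_trans)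
   qed
   have mm: "cmod (F 0) <= B" if FH: "F holomorphic_on UNIV" and FB: "\<And>\<zeta>. cmod \<zeta> = \<rho> ==> cmod (F \<zeta>) <= B" for F
   proof (rule maximum_modulus_frontier[of F "cball 0 \<rho>"])
    show "F holomorphic_on interior (cball 0 \<rho>)" by (rule holomorphic_on_subset[OF FH subset_UNIV])
    show "continuous_on (closure (cball 0 \<rho>)) F"
     by (rule continuous_on_subset[OF holomorphic_on_imp_continuous_on[OF FH] subset_UNIV])
    show "cmod (F w) <= B" if "w \<in> frontier (cball 0 \<rho>)" for w by (rule FB) (use that \<rho> in \<open>simp add: frontier_cball\<close>)
   qed (use \<rho> in simp_all)
   have "norm ((H' ^^ n) q) <= 2 * B" for n
   proof -
    have "cmod (fst ((H' ^^ n) (q + 0 *\<^sub>C v))) <= B" by (rule mm[OF holf]) (rule order_trans[OF cmod_comp_norm(1) bnd])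
    moreover have "cmod (snd ((H' ^^ n) (q + 0 *\<^sub>C v))) <= B"
     by (rule mm[OF hols]) (rule order_trans[OF cmod_comp_norm(2) bnd])
    ultimately show ?thesis using cmod_comp_norm(3)[of "(H' ^^ n) q"] by simp
   qed
   thus "q \<in> K_minus H" unfolding K_minus_def bounded_iff by auto
  qed
  hence "p \<in> interior (K_minus H)" unfolding mem_interior using \<eta> by (intro exI[of _ \<eta>] conjI)
  with Kp show False by blast
 qed
qed

context henon
begin

lemma J_minus_plus_inv: "H p \<in> J_minus_plus H \<longleftrightarrow> p \<in> J_minus_plus H"
 by (simp add: J_minus_plus_def J_minus_inv U_plus_inv)

lemma J_minus_plus_iterate:
 "(H ^^ n) p \<in> J_minus_plus H \<longleftrightarrow> p \<in> J_minus_plus H"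
 "(H' ^^ n) p \<in> J_minus_plus H \<longleftrightarrow> p \<in> J_minus_plus H"
 using backward_invariant[of "J_minus_plus H", OF J_minus_plus_inv] by auto

text \<open>
  Uniqueness of continuous extensions to \<open>J\<^sup>-\<^sub>+\<close>: the quotient of two of them is a locally constant
  function \<open>u\<close> of the following kind. It equals 1 far out in \<open>V\<^sup>+\<close>, and the set where it differs from 1
  would contain a point of locally maximal norm.
\<close>

lemma locally_constant_root_eq_1:
 fixes u :: "C2 => complex"
 assumes loc: "\<And>p. p \<in> J_minus_plus H ==> \<exists>\<delta>>0. \<forall>q\<in>J_minus_plus H. dist p q < \<delta> --> u q = u p"
  and u_H: "\<And>p. p \<in> J_minus_plus H ==> u (H p) = u p ^ d"
  and root: "\<And>p. p \<in> J_minus_plus H ==> \<exists>N. u p ^ (d ^ N) = 1"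
  and p1: "p1 \<in> J_minus_plus H"
 shows "u p1 = 1"
proof (rule ccontr)
 assume up1: "u p1 ~= 1"
 define V where "V = {p. cmod (fst p) <= cmod (snd p) & Rf <= cmod (snd p)}"
 have closedV: "closed V" unfolding V_def by (intro closed_Collect_conj closed_Collect_le continuous_intros)
 have VU: "p \<in> U_plus H" if "p \<in> V" for p using fp.escapes_notin_K[of p] that by (simp add: V_def U_plus_def K_plus_eq)
 have closedJ: "closed (J_minus H)" unfolding J_minus_def by (rule frontier_closed)
 have JK: "p \<in> K_minus H" if "p \<in> J_minus H" for p using that by (simp add: J_minus_iff)
 have notVm: "\<not> (cmod (snd p) <= cmod (fst p) & Rf <= cmod (fst p))" if "p \<in> K_minus H" for p
  using fm.in_K_iterate_notin_V[of p 0] that by (simp add: K_minus_eq)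
 have box: "norm p <= 2 * Rf" if "p \<in> K_minus H" "p \<notin> V" for p
  using notVm[OF that(1)] that(2) cmod_comp_norm(3)[of p] unfolding V_def by fastforce
 have u_iter: "u ((H ^^ n) p) = u p ^ (d ^ n)" if "p \<in> J_minus_plus H" for n p
 proof (induction n)
  case (Suc n)
  have "u (H ((H ^^ n) p)) = u ((H ^^ n) p) ^ d" using u_H that by (simp add: J_minus_plus_iterate)
  thus ?case by (simp add: Suc mult.commute flip: power_mult)
 qed simp
 \<comment> \<open>Every point of \<open>J\<^sup>-\<close> far out in \<open>V\<close> is an iterate of a point of the compact set \<open>Q0\<close>, at which \<open>V\<close> is entered.\<close>
 define Q0 where "Q0 = J_minus H \<inter> V \<inter> H ` cball 0 (2 * Rf)"
 have compQ0: "compact Q0" unfolding Q0_def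
  by (intro closed_Int_compact closed_Int closedJ closedV compact_continuous_image
    continuous_on_subset[OF fp.contT]) auto
 have Q0J: "q \<in> J_minus_plus H" if "q \<in> Q0" for q using that VU by (simp add: Q0_def J_minus_plus_def)
 have "\<exists>N. \<forall>q\<in>Q0. u q ^ (d ^ N) = 1"
 proof -
  have "\<exists>\<delta> N. \<delta> > 0 & (\<forall>q\<in>J_minus_plus H. dist p q < \<delta> --> u q ^ (d ^ N) = 1)" if "p \<in> Q0" for p
   using loc[OF Q0J[OF that]] root[OF Q0J[OF that]] by metis
  then obtain \<delta> N where \<delta>N: "\<And>p. p \<in> Q0 ==> \<delta> p > 0"
    "\<And>p q. p \<in> Q0 ==> q \<in> J_minus_plus H ==> dist p q < \<delta> p ==> u q ^ (d ^ N p) = 1" by metis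
  have cover: "Q0 \<subseteq> (\<Union>p\<in>Q0. ball p (\<delta> p))" using \<delta>N(1) by force
  obtain T where T: "T \<subseteq> Q0" "finite T" "Q0 \<subseteq> (\<Union>p\<in>T. ball p (\<delta> p))" by (rule compactE_image[OF compQ0 open_ball cover])
  define N0 where "N0 = Max (insert 0 (N ` T))"
  have "u q ^ (d ^ N0) = 1" if "q \<in> Q0" for q
  proof -
   have "q \<in> (\<Union>p\<in>T. ball p (\<delta> p))" using T(3) that by (rule subsetD)
   then obtain p where p: "p \<in> T" "q \<in> ball p (\<delta> p)" by (rule UN_E)
   hence p2: "dist p q < \<delta> p" by simp
   have "u q ^ (d ^ N p) = 1" by (rule \<delta>N(2)[OF subsetD[OF T(1) p(1)] Q0J[OF that] p2])
   moreover have "N p <= N0" using p T(2) by (simp add: N0_def)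
   ultimately show ?thesis by (metis le_Suc_ex power_add power_mult power_one)
  qed
  thus ?thesis by blast
 qed
 then obtain N where N: "\<And>q. q \<in> Q0 ==> u q ^ (d ^ N) = 1" by blast
 have bddQ: "bounded (\<Union>k<N. (H ^^ k) ` Q0)"
  by (intro bounded_UN finite_lessThan ballI compact_imp_bounded compact_continuous_image compQ0 cont_iterate)
 then obtain R1 where "\<forall>x\<in>(\<Union>k<N. (H ^^ k) ` Q0). norm x <= R1" unfolding bounded_iff by (elim exE)
 hence R1: "norm ((H ^^ k) q) <= R1" if "k < N" "q \<in> Q0" for k q
  by (rule bspec) (use that in \<open>intro UN_I[of k] imageI, simp_all only: lessThan_iff\<close>)
 have deep1: "u p = 1" if p: "p \<in> J_minus H" "p \<in> V" "norm p > R1" for p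
 proof -
  have "\<exists>k. (H' ^^ k) p \<notin> V"
  proof (rule ccontr)
   assume "\<nexists>k. (H' ^^ k) p \<notin> V"
   hence all: "(H' ^^ k) p \<in> V" for k by blast
   have "2 ^ k * Rf <= cmod (snd p)" for k
   proof -
    have "2 ^ k * cmod (snd ((H' ^^ k) p)) <= cmod (snd p)"
     using fp.forward_growth[of "(H' ^^ k) p" k] all[of k] by (simp add: V_def fp.iterate_cancel)
    moreover have "2 ^ k * Rf <= 2 ^ k * cmod (snd ((H' ^^ k) p))" using all[of k] by (simp add: V_def)
    ultimately show ?thesis by linarith
   qed
   moreover obtain k where "cmod (snd p) / Rf < 2 ^ k" using real_arch_pow[of 2 "cmod (snd p) / Rf"] by auto
   hence "cmod (snd p) < 2 ^ k * Rf" using fp.R by (simp add: divide_less_eq)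
   ultimately show False by (meson not_less)
  qed
  then obtain k0 where k0: "(H' ^^ k0) p \<notin> V" "\<And>j. j < k0 ==> (H' ^^ j) p \<in> V"
   using exists_least_iff[of "\<lambda>k. (H' ^^ k) p \<notin> V"] by auto
  have "k0 ~= 0" using k0(1) p(2) by (intro notI) simp
  then obtain k where k: "k0 = Suc k" using not0_implies_Suc by blast
  define q where "q = (H' ^^ k) p"
  have qJ: "q \<in> J_minus H" using p(1) backward_invariant(2)[OF J_minus_inv] by (simp add: q_def)
  have "H' q \<notin> V" using k0(1) by (simp add: k q_def)
  moreover have "H' q \<in> K_minus H" using JK[OF qJ] K_minus_inv[of "H' q"] by (simp add: fp.TT')
  ultimately have "norm (H' q) <= 2 * Rf" by (intro box)
  hence "q \<in> H ` cball 0 (2 * Rf)" by (intro image_eqI[of _ _ "H' q"]) (simp_all add: fp.TT')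
  hence qQ: "q \<in> Q0" using qJ k0(2)[of k] by (simp add: Q0_def q_def k)
  have pq: "p = (H ^^ k) q" by (simp add: q_def fp.iterate_cancel)
  have "N <= k" using R1[OF _ qQ, of k] p(3) pq by force
  then obtain j where "k = N + j" using le_Suc_ex by blast
  thus ?thesis using N[OF qQ] u_iter[OF Q0J[OF qQ], of k] by (simp add: pq power_add power_mult)
 qed
 have "p1 \<notin> fp.K" using p1 by (simp add: J_minus_plus_def U_plus_def K_plus_eq)
 from fp.notin_K_eventually[OF this, of "2 * Rf"] obtain j
  where j: "cmod (fst ((H ^^ j) p1)) < cmod (snd ((H ^^ j) p1))" "2 * Rf < cmod (snd ((H ^^ j) p1))"
  using eventually_happens'[OF sequentially_bot] by blast
 define p' where "p' = (H ^^ j) p1"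
 \<comment> \<open>The shift by \<open>j\<close> iterates makes \<open>T\<close> contain a point so far out that a point of maximal norm is interior to \<open>V\<close>.\<close>
 define T where "T = {p \<in> J_minus H. p \<in> V & u ((H' ^^ j) p) ~= 1}"
 have p'T: "p' \<in> T" unfolding T_def p'_def using p1 j up1 fp.R J_minus_plus_iterate(1)[of j p1]
  by (simp add: J_minus_plus_def V_def fp.iterate_cancel)
 have TJ: "p \<in> J_minus_plus H" "(H' ^^ j) p \<in> J_minus_plus H" if "p \<in> J_minus H" "p \<in> V" for p
  using that VU by (simp_all add: J_minus_plus_iterate) (simp_all add: J_minus_plus_def)
 have Tloc: "\<exists>\<delta>>0. \<forall>q. q \<in> J_minus H --> q \<in> V --> dist p q < \<delta> -->
   u ((H' ^^ j) q) = u ((H' ^^ j) p)" if p: "p \<in> J_minus H" "p \<in> V" for p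
 proof -
  obtain \<delta> where \<delta>: "\<delta> > 0" "\<And>q. q \<in> J_minus_plus H ==> dist ((H' ^^ j) p) q < \<delta> ==> u q = u ((H' ^^ j) p)"
   using loc[OF TJ(2)[OF p]] by blast
  have "continuous (at p) (H' ^^ j)"
   using cont_iterate(2)[of UNIV j] continuous_on_eq_continuous_at[OF open_UNIV] by blast
  then obtain \<delta>' where \<delta>': "\<delta>' > 0" "\<And>q. dist q p < \<delta>' ==> dist ((H' ^^ j) q) ((H' ^^ j) p) < \<delta>"
   using \<delta>(1) unfolding continuous_at_eps_delta by blast
  show ?thesis using \<delta>' \<delta>(2) TJ(2) by (intro exI[of _ \<delta>']) (simp add: dist_commute)
 qed
 have "closed T" unfolding closed_sequential_limits
 proof (intro allI impI)
  fix x l assume xl: "(\<forall>n. x n \<in> T) & x \<longlonglongrightarrow> l"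
  hence l: "l \<in> J_minus H" "l \<in> V"
   using closed_sequentially[OF closedJ] closed_sequentially[OF closedV] unfolding T_def by blast+
  obtain \<delta> where \<delta>: "\<delta> > 0" "\<And>q. q \<in> J_minus H ==> q \<in> V ==> dist l q < \<delta> ==>
    u ((H' ^^ j) q) = u ((H' ^^ j) l)" using Tloc[OF l] by blast
  obtain n where "dist (x n) l < \<delta>" using xl \<delta>(1) unfolding lim_sequentially by blast
  hence "u ((H' ^^ j) (x n)) = u ((H' ^^ j) l)" using xl by (intro \<delta>(2)) (auto simp: T_def dist_commute)
  moreover have "u ((H' ^^ j) (x n)) ~= 1" using xl by (simp add: T_def)
  ultimately show "l \<in> T" using l by (simp add: T_def)
 qed
 moreover have "bounded T"
 proof -
  have "T \<subseteq> (H ^^ j) ` cball 0 (max R1 (2 * Rf))"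
  proof
   fix p assume p: "p \<in> T"
   define q where "q = (H' ^^ j) p"
   have qJ: "q \<in> J_minus H" using p backward_invariant(2)[OF J_minus_inv] by (simp add: T_def q_def)
   have "norm q <= max R1 (2 * Rf)"
   proof (rule ccontr)
    assume "\<not> norm q <= max R1 (2 * Rf)"
    hence "R1 < norm q" "2 * Rf < norm q" by auto
    hence "q \<in> V" using box[OF JK[OF qJ]] by force
    hence "u q = 1" using deep1[OF qJ] \<open>R1 < norm q\<close> by blast
    thus False using p by (simp add: T_def q_def)
   qed
   thus "p \<in> (H ^^ j) ` cball 0 (max R1 (2 * Rf))"
    by (intro image_eqI[of _ _ q]) (simp_all add: q_def fp.iterate_cancel)
  qed
  moreover have "bounded ((H ^^ j) ` cball 0 (max R1 (2 * Rf)))"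
   by (intro compact_imp_bounded compact_continuous_image cont_iterate) auto
  ultimately show ?thesis by (rule bounded_subset[rotated])
 qed
 ultimately have "compact T" by (simp add: compact_eq_bounded_closed)
 moreover have "T ~= {}" using p'T by blast
 ultimately have "\<exists>x\<in>T. \<forall>y\<in>T. norm y <= norm x" by (rule continuous_attains_sup[OF _ _ continuous_on_norm_id])
 then obtain p where p1: "p \<in> T" "\<forall>y\<in>T. norm y <= norm p" by (rule bexE)
 note p = p1(1) bspec[OF p1(2)]
 have pJ: "p \<in> J_minus H" "p \<in> V" "u ((H' ^^ j) p) ~= 1" using p(1) unfolding T_def by simp_all
 have "2 * Rf < cmod (snd p')" using j(2) by (simp add: p'_def)
 also have "... <= norm p" using p(2)[OF p'T] cmod_comp_norm(2)[of p'] by linarith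
 also have "... <= cmod (snd p) + cmod (fst p)" by (rule cmod_comp_norm(3))
 finally have sp: "Rf < cmod (snd p)" using pJ(2) by (simp add: V_def)
 have fps: "cmod (fst p) < cmod (snd p)" using notVm[OF JK[OF pJ(1)]] pJ(2) sp by (force simp: V_def)
 have "open {q::C2. cmod (fst q) < cmod (snd q) & Rf < cmod (snd q)}"
  by (intro open_Collect_conj open_Collect_less continuous_intros)
 moreover have "p \<in> {q. cmod (fst q) < cmod (snd q) & Rf < cmod (snd q)}" using sp fps by simp
 ultimately obtain \<delta>1 where \<delta>1: "\<delta>1 > 0" "ball p \<delta>1 \<subseteq> {q. cmod (fst q) < cmod (snd q) & Rf < cmod (snd q)}"
  by (rule openE)
 obtain \<delta>2 where \<delta>2: "\<delta>2 > 0" "\<And>q. q \<in> J_minus H ==> q \<in> V ==> dist p q < \<delta>2 ==>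
   u ((H' ^^ j) q) = u ((H' ^^ j) p)" using Tloc[OF pJ(1,2)] by blast
 show False
 proof (rule J_minus_no_norm_max[OF pJ(1)])
  show "p ~= 0"
  proof
   assume "p = 0"
   hence "Rf < 0" using sp by simp
   thus False using fp.R by linarith
  qed
  show "0 < min \<delta>1 \<delta>2" using \<delta>1 \<delta>2 by simp
  fix q assume q: "q \<in> J_minus H" "dist p q < min \<delta>1 \<delta>2"
  hence "q \<in> {q. cmod (fst q) < cmod (snd q) & Rf < cmod (snd q)}" by (intro subsetD[OF \<delta>1(2)]) simp
  hence "q \<in> V" by (simp add: V_def)
  moreover have "u ((H' ^^ j) q) ~= 1" using \<delta>2(2)[OF q(1) \<open>q \<in> V\<close>] q(2) pJ(3) by simp
  ultimately show "norm q <= norm p" using q(1) by (intro p(2)) (simp add: T_def)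
 qed
qed

end


section \<open>Conjugacies between motion domains\<close>

context henon
begin

lemma motion_domain_eq: "motion_domain H = - interior (K_plus H) \<union> J_minus H"
proof -
 have "J_plus H \<union> U_plus H = - interior (K_plus H)"
  unfolding set_eq_iff by (simp add: J_plus_iff U_plus_def) (meson interior_subset subsetD)
 thus ?thesis by (simp add: motion_domain_def)
qed

lemma closed_motion_domain: "closed (motion_domain H)"
 unfolding motion_domain_eq J_minus_def by (intro closed_Un frontier_closed closed_Compl open_interior)

lemma motion_domain_inv: "H p \<in> motion_domain H \<longleftrightarrow> p \<in> motion_domain H"
 unfolding motion_domain_def by (simp add: J_plus_inv J_minus_inv U_plus_inv)

lemma motion_domain_iterate:
 "(H ^^ n) p \<in> motion_domain H \<longleftrightarrow> p \<in> motion_domain H"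
 "(inv H ^^ n) p \<in> motion_domain H \<longleftrightarrow> p \<in> motion_domain H"
 using backward_invariant[of "motion_domain H", OF motion_domain_inv] by auto

lemma U_plus_motion_domain: "U_plus H \<subseteq> motion_domain H" by (auto simp: motion_domain_def)

lemma open_U_plus: "open (U_plus H)" unfolding U_plus_def by (rule open_Compl[OF closed_K_plus])

lemma W_unstable_eq:
 assumes "q \<in> W_unstable H p" shows "W_unstable H q = W_unstable H p"
proof -
 have 1: "(\<lambda>n. dist ((inv H ^^ n) q) ((inv H ^^ n) p)) \<longlonglongrightarrow> 0" using assms by (simp add: W_unstable_def)
 have tri: "(\<lambda>n. dist (a n) (c n)) \<longlonglongrightarrow> 0"
  if "(\<lambda>n. dist (a n) (b n)) \<longlonglongrightarrow> 0" "(\<lambda>n. dist (b n) (c n)) \<longlonglongrightarrow> 0" for a b c :: "nat => C2"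
 proof (rule Lim_null_comparison)
  show "(\<lambda>n. dist (a n) (b n) + dist (b n) (c n)) \<longlonglongrightarrow> 0" using tendsto_add[OF that] by simp
  show "\<forall>\<^sub>F n in sequentially. norm (dist (a n) (c n)) <= dist (a n) (b n) + dist (b n) (c n)"
   by (intro always_eventually allI) (simp add: dist_triangle)
 qed
 have 2: "(\<lambda>n. dist ((inv H ^^ n) p) ((inv H ^^ n) q)) \<longlonglongrightarrow> 0" using 1 by (simp add: dist_commute)
 show ?thesis unfolding W_unstable_def by (intro Collect_cong iffI) (erule tri[OF _ 1], erule tri[OF _ 2])
qed

lemma W_unstable_refl: "p \<in> W_unstable H p" by (simp add: W_unstable_def)

lemma W_stable_in_K_plus:
 assumes p: "p \<in> K_plus H" and q: "q \<in> W_stable H p" shows "q \<in> K_plus H"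
proof -
 have "(\<lambda>n. dist ((H ^^ n) q) ((H ^^ n) p)) \<longlonglongrightarrow> 0" using q by (simp add: W_stable_def)
 hence "Bseq (\<lambda>n. dist ((H ^^ n) q) ((H ^^ n) p))" by (intro convergent_imp_Bseq convergentI)
 then obtain B where B: "\<And>n. norm (dist ((H ^^ n) q) ((H ^^ n) p)) <= B" by (rule BseqE) blast
 have "norm ((H ^^ n) q) <= B + 2 * max Rf (norm p)" for n
 proof -
  have "norm ((H ^^ n) q) <= norm ((H ^^ n) q - (H ^^ n) p) + norm ((H ^^ n) p)"
   by (rule order_trans[OF _ norm_triangle_ineq]) simp
  moreover have "norm ((H ^^ n) q - (H ^^ n) p) <= B" using B[of n] by (simp add: dist_norm)
  ultimately show ?thesis using K_plus_bound[OF p, of n] by linarith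
 qed
 thus ?thesis unfolding K_plus_def bounded_iff by blast
qed

end

locale henon_conj = h0: henon d H0 + h1: henon d H1 for d H0 H1 +
 fixes f f' :: "C2 => C2"
 assumes homeo: "homeomorphism (motion_domain H0) (motion_domain H1) f f'"
  and conj: "p \<in> motion_domain H0 ==> f (H0 p) = H1 (f p)"
begin

lemma f_in: "p \<in> motion_domain H0 ==> f p \<in> motion_domain H1"
 and f'_in: "q \<in> motion_domain H1 ==> f' q \<in> motion_domain H0"
 and f'f: "p \<in> motion_domain H0 ==> f' (f p) = p"
 and ff': "q \<in> motion_domain H1 ==> f (f' q) = q"
 and contf: "continuous_on (motion_domain H0) f"
 and contf': "continuous_on (motion_domain H1) f'" using homeo unfolding homeomorphism_def by blast+

lemma f_eq_iff: "p \<in> motion_domain H0 ==> q \<in> motion_domain H0 ==> f p = f q \<longleftrightarrow> p = q" using f'f by metis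

lemma conj_iterate: "p \<in> motion_domain H0 ==> f ((H0 ^^ n) p) = (H1 ^^ n) (f p)"
 by (induction n) (simp_all add: conj h0.motion_domain_iterate)

lemma conj_inv_iterate:
 assumes "p \<in> motion_domain H0" shows "f ((inv H0 ^^ n) p) = (inv H1 ^^ n) (f p)"
proof -
 have "(H1 ^^ n) (f ((inv H0 ^^ n) p)) = f p" using conj_iterate[of "(inv H0 ^^ n) p" n] assms
  by (simp add: h0.motion_domain_iterate h0.fp.iterate_cancel)
 thus ?thesis using h1.fp.iterate_cancel by metis
qed

lemma sym: "henon_conj d H1 H0 f' f"
proof
 show "homeomorphism (motion_domain H1) (motion_domain H0) f' f" using homeo by (rule homeomorphism_symD)
 fix q assume q: "q \<in> motion_domain H1"
 have "f (H0 (f' q)) = H1 q" using conj[OF f'_in[OF q]] ff'[OF q] by simp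
 thus "f' (H1 q) = H0 (f' q)" using f'f[of "H0 (f' q)"] f'_in[OF q] h0.motion_domain_inv by metis
qed

lemma bounded_image:
 assumes "S \<subseteq> motion_domain H0" "bounded S" shows "bounded (f ` S)"
proof -
 have "closure S \<subseteq> motion_domain H0" using assms(1) h0.closed_motion_domain by (rule closure_minimal)
 moreover have "compact (closure S)" using assms(2) by simp
 ultimately have "compact (f ` closure S)" by (intro compact_continuous_image continuous_on_subset[OF contf])
 thus ?thesis using closure_subset by (meson bounded_subset compact_imp_bounded image_mono)
qed

lemma K_imp:
 assumes p: "p \<in> motion_domain H0"
 shows "p \<in> K_plus H0 ==> f p \<in> K_plus H1" "p \<in> K_minus H0 ==> f p \<in> K_minus H1"
proof -
 have 1: "f ` range (\<lambda>n. (H0 ^^ n) p) = range (\<lambda>n. (H1 ^^ n) (f p))"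
  unfolding image_image using conj_iterate[OF p] by (intro image_cong) auto
 have 2: "f ` range (\<lambda>n. (inv H0 ^^ n) p) = range (\<lambda>n. (inv H1 ^^ n) (f p))"
  unfolding image_image using conj_inv_iterate[OF p] by (intro image_cong) auto
 have 3: "range (\<lambda>n. (H0 ^^ n) p) \<subseteq> motion_domain H0" "range (\<lambda>n. (inv H0 ^^ n) p) \<subseteq> motion_domain H0"
  using p h0.motion_domain_iterate by blast+
 show "p \<in> K_plus H0 ==> f p \<in> K_plus H1" using bounded_image[OF 3(1)] unfolding 1 K_plus_def by blast
 show "p \<in> K_minus H0 ==> f p \<in> K_minus H1" using bounded_image[OF 3(2)] unfolding 2 K_minus_def by blast
qed

end

context henon_conj
begin

lemma K_iff:
 assumes p: "p \<in> motion_domain H0"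
 shows "f p \<in> K_plus H1 \<longleftrightarrow> p \<in> K_plus H0" "f p \<in> K_minus H1 \<longleftrightarrow> p \<in> K_minus H0"
 using K_imp[OF p] henon_conj.K_imp[OF sym f_in[OF p]] unfolding f'f[OF p] by blast+

lemma U_iff: "p \<in> motion_domain H0 ==> f p \<in> U_plus H1 \<longleftrightarrow> p \<in> U_plus H0" by (simp add: U_plus_def K_iff)

lemma f_U: "p \<in> U_plus H0 ==> f p \<in> U_plus H1" using U_iff h0.U_plus_motion_domain by blast

lemma f'_U: "q \<in> U_plus H1 ==> f' q \<in> U_plus H0" by (rule henon_conj.f_U[OF sym])

lemma open_image:
 assumes "open S" "S \<subseteq> U_plus H0" shows "open (f ` S)"
proof -
 have eq: "f ` S = U_plus H1 \<inter> f' -` S"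
 proof (intro set_eqI iffI)
  fix q assume "q \<in> f ` S"
  then obtain p where p: "p \<in> S" "q = f p" by (elim imageE)
  have pU: "p \<in> U_plus H0" by (rule subsetD[OF assms(2) p(1)])
  show "q \<in> U_plus H1 \<inter> f' -` S" using p f_U[OF pU] f'f[OF subsetD[OF h0.U_plus_motion_domain pU]] by simp
 next
  fix q assume "q \<in> U_plus H1 \<inter> f' -` S"
  thus "q \<in> f ` S" using ff'[OF subsetD[OF h1.U_plus_motion_domain], of q] by (intro image_eqI[of _ _ "f' q"]) auto
 qed
 show ?thesis unfolding eq
  by (rule continuous_open_preimage[OF continuous_on_subset[OF contf' h1.U_plus_motion_domain] h1.open_U_plus assms(1)])
qed

lemma interior_K_minus:
 assumes p: "p \<in> U_plus H0" "p \<in> interior (K_minus H0)" shows "f p \<in> interior (K_minus H1)"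
proof -
 have "open (f ` (U_plus H0 \<inter> interior (K_minus H0)))" by (rule open_image) (auto intro: h0.open_U_plus)
 moreover have "f ` (U_plus H0 \<inter> interior (K_minus H0)) \<subseteq> K_minus H1"
 proof (rule image_subsetI)
  fix q assume "q \<in> U_plus H0 \<inter> interior (K_minus H0)"
  thus "f q \<in> K_minus H1" using K_imp(2)[of q] h0.U_plus_motion_domain interior_subset by blast
 qed
 ultimately show ?thesis using p by (meson IntI imageI interiorI)
qed

lemma J_minus_plus_imp: assumes "p \<in> J_minus_plus H0" shows "f p \<in> J_minus_plus H1"
proof -
 have p: "p \<in> U_plus H0" "p \<in> K_minus H0" "p \<notin> interior (K_minus H0)" "p \<in> motion_domain H0"
  using assms h0.U_plus_motion_domain by (auto simp: J_minus_plus_def h0.J_minus_iff)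
 have "f p \<notin> interior (K_minus H1)"
  using henon_conj.interior_K_minus[OF sym f_U[OF p(1)]] p(3) unfolding f'f[OF p(4)] by blast
 thus ?thesis using p f_U K_iff by (simp add: J_minus_plus_def h1.J_minus_iff)
qed

lemma unstable_param_uniform:
 assumes x: "x \<in> K_minus H0" "x \<in> motion_domain H0" and hol: "hmap \<tau> UNIV"
  and \<tau>: "\<And>z::complex. \<tau> z \<in> W_unstable H0 x" "\<And>z. \<tau> z \<in> motion_domain H0"
  and x1: "f x \<in> W_unstable H1 x1" and r: "r > 0" and e: "e > 0"
 shows "\<exists>n0. \<forall>n\<ge>n0. \<forall>z\<in>cball \<xi> r. dist ((inv H1 ^^ n) (f (\<tau> z))) ((inv H1 ^^ n) x1) < e"
proof -
 have ct: "continuous_on UNIV \<tau>" by (rule hmap_continuous_on[OF hol])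
 have "compact (\<tau> ` cball \<xi> r)" by (intro compact_continuous_image continuous_on_subset[OF ct]) auto
 then obtain B where B: "\<forall>q\<in>\<tau> ` cball \<xi> r. norm q <= B" using compact_imp_bounded bounded_iff by metis
 define R where "R = 2 * max h0.Rf (max B (norm x))"
 define X where "X = motion_domain H0 \<inter> cball 0 R"
 have "compact X" unfolding X_def by (intro closed_Int_compact h0.closed_motion_domain compact_cball)
 hence "uniformly_continuous_on X f"
  by (intro compact_uniformly_continuous continuous_on_subset[OF contf]) (auto simp: X_def)
 then obtain \<delta> where \<delta>: "\<delta> > 0" "\<forall>a\<in>X. \<forall>b\<in>X. dist b a < \<delta> --> dist (f b) (f a) < e / 2"
  unfolding uniformly_continuous_on_def using half_gt_zero[OF e] by meson
 obtain n1 where n1: "\<forall>n\<ge>n1. \<forall>z\<in>cball \<xi> r. dist ((inv H0 ^^ n) (\<tau> z)) ((inv H0 ^^ n) x) < \<delta>"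
  using h0.unstable_uniform[OF x(1) hol \<tau>(1) r \<delta>(1), of \<xi>] by (elim exE)
 have "(\<lambda>n. dist ((inv H1 ^^ n) (f x)) ((inv H1 ^^ n) x1)) \<longlonglongrightarrow> 0" using x1 by (simp add: W_unstable_def)
 from order_tendstoD(2)[OF this half_gt_zero[OF e]]
 obtain n2 where n2: "\<forall>n\<ge>n2. dist ((inv H1 ^^ n) (f x)) ((inv H1 ^^ n) x1) < e / 2"
  unfolding eventually_sequentially by (elim exE)
 show ?thesis
 proof (intro exI[of _ "max n1 n2"] allI impI ballI)
  fix n z assume n: "max n1 n2 <= n" and z: "z \<in> cball \<xi> r"
  have Kz: "\<tau> z \<in> K_minus H0" by (rule h0.unstable_in_K_minus[OF x(1) \<tau>(1)])
  have Bz: "norm (\<tau> z) <= B" by (rule bspec[OF B imageI[OF z]])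
  have "max h0.Rf (norm (\<tau> z)) <= max h0.Rf (max B (norm x))" using Bz by (intro max.mono) auto
  hence "norm ((inv H0 ^^ n) (\<tau> z)) <= R" using h0.K_minus_bound[OF Kz, of n] unfolding R_def by linarith
  hence 1: "(inv H0 ^^ n) (\<tau> z) \<in> X" using \<tau>(2) by (simp add: X_def h0.motion_domain_iterate)
  have "max h0.Rf (norm x) <= max h0.Rf (max B (norm x))" by (intro max.mono) auto
  hence "norm ((inv H0 ^^ n) x) <= R" using h0.K_minus_bound[OF x(1), of n] unfolding R_def by linarith
  hence 2: "(inv H0 ^^ n) x \<in> X" using x(2) by (simp add: X_def h0.motion_domain_iterate)
  have "dist ((inv H0 ^^ n) (\<tau> z)) ((inv H0 ^^ n) x) < \<delta>" using n1 n z by (simp del: mem_cball)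
  hence "dist (f ((inv H0 ^^ n) (\<tau> z))) (f ((inv H0 ^^ n) x)) < e / 2" using \<delta>(2) 1 2 by blast
  hence "dist ((inv H1 ^^ n) (f (\<tau> z))) ((inv H1 ^^ n) (f x)) < e / 2" using x(2) \<tau>(2) by (simp add: conj_inv_iterate)
  moreover have "dist ((inv H1 ^^ n) (f x)) ((inv H1 ^^ n) x1) < e / 2" using n2 n by simp
  ultimately show "dist ((inv H1 ^^ n) (f (\<tau> z))) ((inv H1 ^^ n) x1) < e"
   using dist_triangle[of "(inv H1 ^^ n) (f (\<tau> z))" "(inv H1 ^^ n) x1" "(inv H1 ^^ n) (f x)"] by linarith
 qed
qed

text \<open>
  The conjugacy preserves uniform closeness of backward orbits over disks of the parameter, which is
  what continuity with respect to the parametrization in the range needs.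
\<close>

lemma continuous_transition:
 assumes hyp0: "hyperbolic H0" and hyp1: "hyperbolic H1" and x: "x \<in> Julia H0" and x1: "x1 \<in> Julia H1"
  and \<tau>: "unstable_param H0 x \<tau>" and \<tau>1: "unstable_param H1 x1 \<tau>1"
  and W: "f ` W_unstable H0 x \<subseteq> W_unstable H1 x1"
 shows "continuous_on UNIV (\<lambda>z. inv \<tau>1 (f (\<tau> z)))"
proof -
 obtain Es0 Eu0 C0 \<kappa>0 where hh0: "hyperbolic_henon d H0 Es0 Eu0 C0 \<kappa>0"
  using hyperbolic_henonI[OF h0.henon hyp0] by (elim exE)
 obtain Es Eu C \<kappa> where hh: "hyperbolic_henon d H1 Es Eu C \<kappa>" using hyperbolic_henonI[OF h1.henon hyp1] by (elim exE)
 have J: "W_unstable H0 x \<subseteq> motion_domain H0"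
  using hyperbolic_henon.unstable_in_J_minus[OF hh0 x] by (auto simp: motion_domain_def)
 have t: "hmap \<tau> UNIV" "\<And>z. \<tau> z \<in> W_unstable H0 x" using \<tau> by (auto simp: unstable_param_def)
 have t1: "hmap \<tau>1 UNIV" "inj \<tau>1" "range \<tau>1 = W_unstable H1 x1" using \<tau>1 by (auto simp: unstable_param_def)
 have td: "\<tau> z \<in> motion_domain H0" for z by (rule subsetD[OF J t(2)])
 have xK: "x \<in> K_minus H0" using x by (simp add: Julia_def h0.J_minus_iff)
 have xd: "x \<in> motion_domain H0" by (rule subsetD[OF J h0.W_unstable_refl])
 have fx: "f x \<in> W_unstable H1 x1" by (rule subsetD[OF W imageI[OF h0.W_unstable_refl]])
 have *: "continuous_on (ball \<xi> 1) (\<lambda>z. inv \<tau>1 (f (\<tau> z)))" for \<xi>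
 proof (rule hyperbolic_henon.continuous_into_unstable_param[OF hh x1 t1 open_ball])
  show "continuous_on (ball \<xi> 1) (\<lambda>z. f (\<tau> z))"
   using continuous_on_compose2[OF contf hmap_continuous_on[OF hmap_subset[OF t(1)]]] td by blast
  show "f (\<tau> z) \<in> W_unstable H1 x1" for z using t(2) by (intro subsetD[OF W] imageI)
  fix e :: real assume "e > 0"
  from unstable_param_uniform[OF xK xd t td fx zero_less_one this, of \<xi>]
  obtain n0 where n0: "\<forall>n\<ge>n0. \<forall>z\<in>cball \<xi> 1. dist ((inv H1 ^^ n) (f (\<tau> z))) ((inv H1 ^^ n) x1) < e" by (elim exE)
  show "\<exists>n0. \<forall>n\<ge>n0. \<forall>z\<in>ball \<xi> 1. dist ((inv H1 ^^ n) (f (\<tau> z))) ((inv H1 ^^ n) x1) < e"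
   using n0 by (intro exI[of _ n0] allI impI ballI) (meson ball_subset_cball subsetD)
 qed
 have "isCont (\<lambda>z. inv \<tau>1 (f (\<tau> z))) \<xi>" for \<xi> by (rule continuous_on_interior[OF *[of \<xi>]]) simp
 thus ?thesis by (simp add: continuous_at_imp_continuous_on)
qed

end

lemma henon_conj_id: "henon_map d H ==> henon_conj d H H id id" by unfold_locales (auto simp: homeomorphism_def)

locale henon_motion = henon_conj +
 assumes leaves_minus: "L \<in> leaves_J_minus H0 ==> f ` L \<in> leaves_J_minus H1"
  and leaves_plus: "L \<in> leaves_plus d H0 ==> f ` L \<in> leaves_plus d H1"
begin

lemma unstable_image:
 assumes x: "x \<in> Julia H0"
 shows "\<exists>x1\<in>Julia H1. f ` W_unstable H0 x = W_unstable H1 x1"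
proof -
 have "W_unstable H0 x \<in> leaves_J_minus H0" using x by (auto simp: leaves_J_minus_def)
 from leaves_minus[OF this] show ?thesis by (auto simp: leaves_J_minus_def)
qed

lemma dyn:
 obtains M0 M1 where "henon_dyn d M0 H0 (inv H0)" "henon_dyn d M1 H1 (inv H1)"
proof -
 have *: "\<exists>M. henon_dyn d M H (inv H)" if h: "henon_map d H" for H
 proof -
  obtain M where "leading_power 1 d M H" using henon_inv(5)[OF h] by (elim exE)
  hence "leading_power 1 d (max 1 M) H" by (rule leading_power_mono) simp
  from henon_dynI[OF h _ this] show ?thesis by (intro exI) simp
 qed
 show thesis using *[OF h0.henon] *[OF h1.henon] by (elim exE) (rule that)
qed

lemma green_leaf_image:
 assumes p: "p \<in> U_plus H0"
 shows "\<exists>q\<in>U_plus H1. green_plus d H1 q = green_plus d H1 (f p) & f ` green_leaf d H0 p = green_leaf d H1 q"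
proof -
 obtain M0 M1 where D: "henon_dyn d M0 H0 (inv H0)" "henon_dyn d M1 H1 (inv H1)" by (rule dyn)
 have "green_leaf d H0 p \<in> leaves_plus d H0" using p by (simp add: leaves_plus_def)
 from leaves_plus[OF this] have L: "f ` green_leaf d H0 p \<in> leaves_plus d H1" .
 have fp: "f p \<in> f ` green_leaf d H0 p" by (rule imageI[OF henon_dyn.leaf_refl[OF D(1) p]])
 show ?thesis
 proof (cases "\<exists>q\<in>Julia H1. f ` green_leaf d H0 p = W_stable H1 q")
  case True
  then obtain q where q: "q \<in> Julia H1" "f ` green_leaf d H0 p = W_stable H1 q" by (elim bexE)
  have "q \<in> K_plus H1" using q(1) by (simp add: Julia_def h1.J_plus_iff)
  hence "f p \<in> K_plus H1" using h1.W_stable_in_K_plus fp unfolding q(2) by blast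
  thus ?thesis using f_U[OF p] by (simp add: U_plus_def)
 next
  case False
  hence "\<exists>q\<in>U_plus H1. f ` green_leaf d H0 p = green_leaf d H1 q" using L unfolding leaves_plus_def by blast
  then obtain q where q: "q \<in> U_plus H1" "f ` green_leaf d H0 p = green_leaf d H1 q" by (elim bexE)
  show ?thesis using henon_dyn.leaf_green(2)[OF D(2), of "f p" q] fp q by (intro bexI[of _ q]) simp_all
 qed
qed

text \<open>A leaf is dense in the level set of \<open>G\<^sup>+\<close> that contains it, so maps of leaves are maps of level sets.\<close>

lemma green_eq_iff:
 assumes p: "p \<in> U_plus H0" and q: "q \<in> U_plus H0"
 shows "green_plus d H1 (f p) = green_plus d H1 (f q) \<longleftrightarrow> green_plus d H0 p = green_plus d H0 q"
proof -
 obtain M0 M1 where D: "henon_dyn d M0 H0 (inv H0)" "henon_dyn d M1 H1 (inv H1)" by (rule dyn)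
 obtain x where x: "x \<in> U_plus H1" "green_plus d H1 x = green_plus d H1 (f p)" "f ` green_leaf d H0 p = green_leaf d H1 x"
  using green_leaf_image[OF p] by (elim bexE conjE)
 have "green_plus d H1 (f p) = green_plus d H1 (f q)" if eq: "green_plus d H0 p = green_plus d H0 q"
 proof (rule ccontr)
  assume ne: "green_plus d H1 (f p) ~= green_plus d H1 (f q)"
  define S where "S = U_plus H0 \<inter> (\<lambda>x. green_plus d H1 (f x)) -` (- {green_plus d H1 (f p)})"
  have "continuous_on (U_plus H0) (\<lambda>x. green_plus d H1 (f x))"
   using continuous_on_compose2[OF henon_dyn.green_continuous[OF D(2)] continuous_on_subset[OF contf h0.U_plus_motion_domain]] f_U
   by blast
  hence "open S" unfolding S_def by (rule continuous_open_preimage[OF _ h0.open_U_plus]) auto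
  moreover have "q \<in> S" using q ne by (simp add: S_def)
  ultimately obtain q' where q': "q' \<in> S" "q' \<in> green_leaf d H0 p"
   using henon_dyn.leaf_dense_in_level[OF D(1) p q eq] by blast
  have "f q' \<in> green_leaf d H1 x" using imageI[OF q'(2), of f] unfolding x(3) .
  hence "green_plus d H1 (f q') = green_plus d H1 (f p)" unfolding x(2)[symmetric] by (rule henon_dyn.leaf_green(2)[OF D(2)])
  thus False using q'(1) by (simp add: S_def)
 qed
 moreover have "green_plus d H0 p = green_plus d H0 q" if eq: "green_plus d H1 (f p) = green_plus d H1 (f q)"
 proof (rule ccontr)
  assume ne: "green_plus d H0 p ~= green_plus d H0 q"
  define S where "S = U_plus H1 \<inter> (\<lambda>x. green_plus d H0 (f' x)) -` (- {green_plus d H0 p})"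
  have "continuous_on (U_plus H1) (\<lambda>x. green_plus d H0 (f' x))"
   using continuous_on_compose2[OF henon_dyn.green_continuous[OF D(1)] continuous_on_subset[OF contf' h1.U_plus_motion_domain]] f'_U
   by blast
  hence "open S" unfolding S_def by (rule continuous_open_preimage[OF _ h1.open_U_plus]) auto
  moreover have "f q \<in> S" using f_U[OF q] ne f'f[OF subsetD[OF h0.U_plus_motion_domain q]] by (simp add: S_def)
  ultimately obtain q1 where q1: "q1 \<in> S" "q1 \<in> green_leaf d H1 x"
   using henon_dyn.leaf_dense_in_level[OF D(2) x(1) f_U[OF q] eq[folded x(2)]] by blast
  hence "q1 \<in> f ` green_leaf d H0 p" by (simp only: x(3))
  then obtain q' where q': "q' \<in> green_leaf d H0 p" "q1 = f q'" by (elim imageE)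
  have "q' \<in> U_plus H0" "green_plus d H0 q' = green_plus d H0 p" using henon_dyn.leaf_green[OF D(1) q'(1)] by auto
  thus False using q1(1) f'f[OF subsetD[OF h0.U_plus_motion_domain]] by (simp add: S_def q'(2))
 qed
 ultimately show ?thesis by blast
qed

end


section \<open>The action of the motion on levels of the Green function\<close>

lemma continuous_countable_range_constant:
 fixes f :: "'a::topological_space => 'b::metric_space"
 assumes "connected S" "continuous_on S f" "countable (f ` S)" and x: "x \<in> S" "y \<in> S"
 shows "f x = f y"
proof (rule ccontr)
 assume "f x ~= f y"
 hence "uncountable (f ` S)"
  using connected_continuous_image[OF assms(2,1)] x by (intro connected_uncountable[of "f ` S" "f x" "f y"]) auto
 thus False using assms(3) by simp
qed

lemma Schwarz_right_half_plane:
 fixes Y :: "complex => complex"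
 assumes Y: "Y holomorphic_on ball 0 1" and pos: "\<And>z. z \<in> ball 0 1 ==> 0 < Re (Y z)"
 shows "cmod (deriv Y 0) <= 2 * Re (Y 0)"
  and "z \<in> ball 0 1 ==> cmod (Y z - Y 0) <= cmod z * cmod (Y z + cnj (Y 0))"
proof -
 define b where "b = Y 0"
 have b: "0 < Re b" using pos[of 0] by (simp add: b_def)
 have ne: "Y z + cnj b ~= 0" if "z \<in> ball 0 1" for z
 proof
  assume "Y z + cnj b = 0"
  hence "Re (Y z) + Re b = 0" by (metis complex_cnj(1) cnj.sel(1) plus_complex.sel(1) zero_complex.sel(1))
  thus False using pos[OF that] b by linarith
 qed
 define w where "w = (\<lambda>z. (Y z - b) / (Y z + cnj b))"
 have w: "w holomorphic_on ball 0 1" unfolding w_def by (intro holomorphic_intros Y ne)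
 have w1: "cmod (w z) < 1" if z: "cmod z < 1" for z
 proof -
  have p: "0 < Re (Y z)" using pos z by simp
  have "(cmod (Y z - b))\<^sup>2 < (cmod (Y z + cnj b))\<^sup>2"
   unfolding cmod_power2 using mult_pos_pos[OF p b] by (simp add: power2_eq_square algebra_simps)
  hence "cmod (Y z - b) < cmod (Y z + cnj b)" by (rule power2_less_imp_less) simp
  moreover have "cmod (Y z + cnj b) > 0" using ne[of z] z by simp
  ultimately show ?thesis by (simp add: w_def norm_divide)
 qed
 have w0: "w 0 = 0" by (simp add: w_def b_def)
 show "cmod (Y z - Y 0) <= cmod z * cmod (Y z + cnj (Y 0))" if z: "z \<in> ball 0 1"
  using Schwarz_Lemma(1)[OF w w0 w1, of z] ne[OF z] z by (simp add: w_def b_def norm_divide divide_le_eq)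
 have "cmod (deriv w 0) <= 1" by (rule Schwarz_Lemma(2)[OF w w0 w1, of 0]) simp_all
 moreover have "deriv w 0 = deriv Y 0 / (b + cnj b)"
 proof (rule DERIV_imp_deriv)
  have dY: "(Y has_field_derivative deriv Y 0) (at 0)" by (rule holomorphic_derivI[OF Y open_ball]) simp
  have nz: "b + cnj b ~= 0" using ne[of 0] by (simp add: b_def)
  show "(w has_field_derivative deriv Y 0 / (b + cnj b)) (at 0)"
   unfolding w_def by (rule derivative_eq_intros dY | use nz in \<open>simp add: b_def\<close>)+
 qed
 moreover have "cmod (b + cnj b) = 2 * Re b" using b by (simp add: complex_add_cnj)
 ultimately have "cmod (deriv Y 0) / (2 * Re b) <= 1" by (simp add: norm_divide)
 thus "cmod (deriv Y 0) <= 2 * Re (Y 0)" using b by (simp add: b_def divide_le_eq)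
qed

lemma positive_real_part_bound:
 fixes h :: "complex => complex"
 assumes h: "h holomorphic_on ball 0 r" and pos: "\<And>z. z \<in> ball 0 r ==> 0 < Re (h z)"
  and h0: "h 0 = of_real c" and r: "r > 1"
 shows "cmod (h 1) <= (r + 1) / (r - 1) * c"
proof -
 have c: "c > 0" using pos[of 0] h0 r by simp
 have mem: "of_real r * z \<in> ball 0 r" if "z \<in> ball 0 1" for z :: complex using that r by (simp add: norm_mult)
 have 1: "(\<lambda>z. of_real r * z) holomorphic_on ball 0 1" by (intro holomorphic_intros)
 have 2: "(\<lambda>z. of_real r * z) ` ball 0 1 \<subseteq> ball (0::complex) r" using mem by blast
 have "cmod (h 1 - c) <= 1 / r * cmod (h 1 + c)"
  using Schwarz_right_half_plane(2)[of "\<lambda>z. h (of_real r * z)" "1 / of_real r"] pos[OF mem] r h0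
   holomorphic_on_compose_gen[OF 1 h 2] by (simp add: o_def norm_divide)
 hence "r * cmod (h 1 - c) <= cmod (h 1 + c)" using r by (simp add: field_simps)
 moreover have "cmod (h 1 + c) <= cmod (h 1) + c" using norm_triangle_ineq[of "h 1" c] c by simp
 moreover have "cmod (h 1) - c <= cmod (h 1 - c)" using norm_triangle_ineq2[of "h 1" c] c by simp
 ultimately have "r * (cmod (h 1) - c) <= cmod (h 1) + c"
  using mult_left_mono[of "cmod (h 1) - c" "cmod (h 1 - c)" r] r by linarith
 hence "(r - 1) * cmod (h 1) <= (r + 1) * c" by (simp add: algebra_simps)
 thus ?thesis using r by (simp add: field_simps)
qed

lemma holomorphic_same_modulus:
 fixes f g :: "complex => complex"
 assumes D: "open D" "connected D" and f: "f holomorphic_on D" and g: "g holomorphic_on D"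
  and nz: "\<And>z. z \<in> D ==> g z ~= 0" and eq: "\<And>z. z \<in> D ==> cmod (f z) = cmod (g z)"
  and a: "a \<in> D" "f a = g a" and z: "z \<in> D"
 shows "f z = g z"
proof -
 have "(\<lambda>z. f z / g z) constant_on D"
 proof (rule maximum_modulus_principle[of _ D D a])
  show "(\<lambda>z. f z / g z) holomorphic_on D" by (intro holomorphic_intros f g nz)
  show "cmod (f z / g z) <= cmod (f a / g a)" if "z \<in> D" for z using that a eq nz by (simp add: norm_divide)
 qed (use D a in auto)
 hence "f z / g z = f a / g a" using z a unfolding constant_on_def by metis
 thus ?thesis using nz[OF z] nz[OF a(1)] a(2) by (simp add: divide_eq_eq)
qed

lemma holomorphic_eq_by_Re:
 fixes f g :: "complex => complex"
 assumes D: "open D" "connected D" and f: "f holomorphic_on D" and g: "g holomorphic_on D"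
  and eq: "\<And>z. z \<in> D ==> Re (f z) = Re (g z)" and a: "a \<in> D" "f a = g a" and z: "z \<in> D"
 shows "f z = g z"
proof -
 define h where "h = (\<lambda>z. 1 + (f z - g z))"
 have Re_h: "Re (h z) = 1" if "z \<in> D" for z using eq[OF that] by (simp add: h_def)
 have "(\<lambda>z. 1 / h z) constant_on D"
 proof (rule maximum_modulus_principle[of _ D D a])
  have "h z ~= 0" if "z \<in> D" for z using Re_h[OF that] by auto
  thus "(\<lambda>z. 1 / h z) holomorphic_on D" unfolding h_def by (intro holomorphic_intros f g)
  show "cmod (1 / h z) <= cmod (1 / h a)" if "z \<in> D" for z
   using abs_Re_le_cmod[of "h z"] Re_h[OF that] a(2) by (auto simp: h_def norm_divide divide_le_eq_1)
 qed (use D a in auto)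
 hence "1 / h z = 1 / h a" using z a unfolding constant_on_def by metis
 thus ?thesis using a(2) by (simp add: h_def)
qed

text \<open>The disk of parameters has radius greater than 1, so that interior estimates apply at the parameter 1.\<close>

locale disc_motion =
 fixes d :: nat and F :: "complex => C2 => C2" and P P' :: "complex => C2 => C2" and \<rho> M :: real
 assumes \<rho>: "\<rho> > 1" and M: "M >= 1"
  and motion: "\<zeta> \<in> cball 0 \<rho> ==> henon_motion d (F 0) (F \<zeta>) (P \<zeta>) (P' \<zeta>)"
  and lead: "\<zeta> \<in> cball 0 \<rho> ==> leading_power 1 d M (F \<zeta>)"
  and P0: "p \<in> motion_domain (F 0) ==> P 0 p = p"
  and contP: "p \<in> motion_domain (F 0) ==> continuous_on (cball 0 \<rho>) (\<lambda>\<zeta>. P \<zeta> p)"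
  and holP: "p \<in> motion_domain (F 0) ==> hmap (\<lambda>\<zeta>. P \<zeta> p) (ball 0 \<rho>)"
begin

abbreviation "V \<equiv> Vo (400 * M)"
abbreviation "D \<equiv> ball (0::complex) \<rho>"
abbreviation "U \<equiv> U_plus (F 0)"
abbreviation "G0 \<equiv> green_plus d (F 0)"
abbreviation "G \<zeta> p \<equiv> green_plus d (F \<zeta>) (P \<zeta> p)"
abbreviation "ph \<zeta> \<equiv> henon_growth.phi d (F \<zeta>)"

lemma D: "open D" "connected D" "0 \<in> D" "1 \<in> D" using \<rho> by auto

lemma D_cball: "\<zeta> \<in> D ==> \<zeta> \<in> cball 0 \<rho>" using ball_subset_cball by blast

lemma zero_cball: "0 \<in> cball (0::complex) \<rho>" using \<rho> by simp

lemma conj: "\<zeta> \<in> cball 0 \<rho> ==> henon_conj d (F 0) (F \<zeta>) (P \<zeta>) (P' \<zeta>)" using motion by (simp add: henon_motion_def)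

lemma henon: "\<zeta> \<in> cball 0 \<rho> ==> henon d (F \<zeta>)" using conj by (simp add: henon_conj_def)

lemma dyn: "\<zeta> \<in> cball 0 \<rho> ==> henon_dyn d M (F \<zeta>) (inv (F \<zeta>))" using henon_dynI[OF henon.henon[OF henon] M lead] by blast

lemmas growth = henon_dyn.axioms(1)[OF dyn]

lemma U_MD: "p \<in> U ==> p \<in> motion_domain (F 0)" by (auto simp: motion_domain_def)

lemma P_iterate: "\<zeta> \<in> cball 0 \<rho> ==> p \<in> motion_domain (F 0) ==> P \<zeta> ((F 0 ^^ n) p) = (F \<zeta> ^^ n) (P \<zeta> p)"
 by (rule henon_conj.conj_iterate[OF conj])

lemma MD_iterate: "p \<in> motion_domain (F 0) ==> (F 0 ^^ n) p \<in> motion_domain (F 0)"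
 using henon.motion_domain_iterate[OF henon[OF zero_cball]] by blast

text \<open>Compactness of the closed parameter disk makes the escape time uniform.\<close>

lemma eventually_in_V:
 assumes p: "p \<in> U"
 shows "\<exists>n. \<forall>\<zeta>\<in>cball 0 \<rho>. P \<zeta> ((F 0 ^^ n) p) \<in> V"
proof -
  have oin: "\<exists>T. open T & cball 0 \<rho> \<inter> (\<lambda>\<zeta>. P \<zeta> ((F 0 ^^ n) p)) -` V = cball 0 \<rho> \<inter> T" for n
   using continuous_openin_preimage_gen[OF contP[OF MD_iterate[OF U_MD[OF p]]] open_Vo] unfolding openin_open by blast
  then obtain T where T: "\<And>n. open (T n)"
    "\<And>n. cball 0 \<rho> \<inter> (\<lambda>\<zeta>. P \<zeta> ((F 0 ^^ n) p)) -` V = cball 0 \<rho> \<inter> T n" by metis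
  have cover: "cball 0 \<rho> \<subseteq> (\<Union>n\<in>UNIV. T n)"
  proof
   fix \<zeta> :: complex assume \<zeta>: "\<zeta> \<in> cball 0 \<rho>"
   have "P \<zeta> p \<in> U_plus (F \<zeta>)" by (rule henon_conj.f_U[OF conj[OF \<zeta>] p])
   then obtain n where "(F \<zeta> ^^ n) (P \<zeta> p) \<in> V" using henon_dyn.U_iff[OF dyn[OF \<zeta>]] by blast
   hence "\<zeta> \<in> cball 0 \<rho> \<inter> (\<lambda>\<zeta>. P \<zeta> ((F 0 ^^ n) p)) -` V"
    using \<zeta> by (simp add: P_iterate[OF \<zeta> U_MD[OF p]] del: mem_cball)
   hence "\<zeta> \<in> T n" unfolding T(2)[of n] by (rule IntD2)
   thus "\<zeta> \<in> (\<Union>n\<in>UNIV. T n)" by blast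
  qed
  obtain I where I: "finite I" "cball 0 \<rho> \<subseteq> (\<Union>n\<in>I. T n)" by (rule compactE_image[OF compact_cball T(1) cover])
  show ?thesis
  proof (intro exI[of _ "Max (insert 0 I)"] ballI)
   fix \<zeta> assume \<zeta>: "\<zeta> \<in> cball (0::complex) \<rho>"
   hence "\<zeta> \<in> (\<Union>n\<in>I. T n)" using I(2) by (rule subsetD[rotated])
   then obtain n where n: "n \<in> I" "\<zeta> \<in> T n" by (rule UN_E)
   have "\<zeta> \<in> cball 0 \<rho> \<inter> (\<lambda>\<zeta>. P \<zeta> ((F 0 ^^ n) p)) -` V" unfolding T(2)[of n] using \<zeta> n(2) by (rule IntI)
   hence "(F \<zeta> ^^ n) (P \<zeta> p) \<in> V" by (simp add: P_iterate[OF \<zeta> U_MD[OF p]])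
   moreover have "n <= Max (insert 0 I)" using n I(1) by simp
   ultimately have "(F \<zeta> ^^ Max (insert 0 I)) (P \<zeta> p) \<in> V" by (rule henon_growth.iterate_later[OF growth[OF \<zeta>]])
   thus "P \<zeta> ((F 0 ^^ Max (insert 0 I)) p) \<in> V" by (simp add: P_iterate[OF \<zeta> U_MD[OF p]])
  qed
qed

text \<open>The factors of the product for \<open>phi\<close> are holomorphic in the parameter, with bounds uniform in it.\<close>

lemma phi_motion_holomorphic:
 assumes q: "q \<in> motion_domain (F 0)" and V: "\<And>\<zeta>. \<zeta> \<in> cball 0 \<rho> ==> P \<zeta> q \<in> V"
 shows "(\<lambda>\<zeta>. ph \<zeta> (P \<zeta> q)) holomorphic_on D"
proof -
 define y where "y = (\<lambda>k \<zeta>. snd (P \<zeta> ((F 0 ^^ k) q)))"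
 have y: "snd ((F \<zeta> ^^ k) (P \<zeta> q)) = y k \<zeta>" if "\<zeta> \<in> D" for k \<zeta>
  using P_iterate[OF D_cball[OF that] q] by (simp add: y_def)
 have y': "snd (F \<zeta> ((F \<zeta> ^^ k) (P \<zeta> q))) = y (Suc k) \<zeta>" if "\<zeta> \<in> D" for k \<zeta> using y[OF that, of "Suc k"] by simp
 have yhol: "(y k) holomorphic_on D" for k using hmap_compose[OF holP[OF MD_iterate[OF q]] hmap_snd[of UNIV]]
  unfolding y_def by (simp add: hmap_complex D(1))
 have b: "henon_growth.btm d (F \<zeta>) k (P \<zeta> q) = Ln (y (Suc k) \<zeta> / y k \<zeta> ^ d) / of_nat d ^ (k + 1)" if "\<zeta> \<in> D" for k \<zeta>
  unfolding henon_growth.btm_def[OF growth[OF D_cball[OF that]]] y[OF that] y'[OF that] ..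
 have ynz: "y k \<zeta> ~= 0" if "\<zeta> \<in> D" for k \<zeta>
  using henon_growth.snd_nz[OF growth[OF D_cball[OF that]] henon_growth.iterate_V[OF growth[OF D_cball[OF that]] V[OF D_cball[OF that]]]]
  by (simp add: y[OF that])
 have arg: "cmod (y (Suc k) \<zeta> / y k \<zeta> ^ d - 1) <= 1 / 400" if z: "\<zeta> \<in> D" for k \<zeta>
  using henon_growth.btm_arg[OF growth[OF D_cball[OF z]] V[OF D_cball[OF z]]] unfolding y[OF z] y'[OF z]
  by (rule order_trans)
 have bhol: "hmap (\<lambda>\<zeta>. Ln (y (Suc k) \<zeta> / y k \<zeta> ^ d) / of_nat d ^ (k + 1)) D" for k unfolding hmap_complex[OF D(1)]
 proof (intro holomorphic_intros yhol)
  fix \<zeta> assume z: "\<zeta> \<in> D"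
  show "y k \<zeta> ^ d ~= 0" using ynz[OF z] by simp
  have "\<bar>Re (y (Suc k) \<zeta> / y k \<zeta> ^ d - 1)\<bar> <= 1 / 400" using abs_Re_le_cmod arg[OF z] by (rule order_trans)
  hence "\<bar>Re (y (Suc k) \<zeta> / y k \<zeta> ^ d) - 1\<bar> <= 1 / 400" by (simp only: minus_complex.sel one_complex.sel)
  hence "Re (y (Suc k) \<zeta> / y k \<zeta> ^ d) > 0" by linarith
  thus "y (Suc k) \<zeta> / y k \<zeta> ^ d \<notin> \<real>\<^sub>\<le>\<^sub>0" by (metis complex_nonpos_Reals_iff not_less)
 next
  have "d ~= 0" using henon_growth.d[OF growth[OF zero_cball]] by simp
  thus "of_nat d ^ (k + 1) ~= (0::complex)" by simp
 qed
 have "hmap (\<lambda>\<zeta>. \<Sum>k. Ln (y (Suc k) \<zeta> / y k \<zeta> ^ d) / of_nat d ^ (k + 1)) D"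
 proof (rule hmap_suminf[OF D(1) bhol])
  fix k \<zeta> assume z: "\<zeta> \<in> D"
  have "M / cmod (snd (P \<zeta> q)) <= 1 / 400"
   by (rule henon_growth.btm_arg(2)[OF growth[OF D_cball[OF z]] V[OF D_cball[OF z]]])
  hence "2 * (M / cmod (snd (P \<zeta> q))) * (1 / 2) ^ (k + 1) <= 1 * (1 / 2) ^ (k + 1)"
   by (intro mult_right_mono) (linarith, simp)
  thus "cmod (Ln (y (Suc k) \<zeta> / y k \<zeta> ^ d) / of_nat d ^ (k + 1)) <= 1 * (1 / 2) ^ (k + 1)"
   using henon_growth.btm_bound[OF growth[OF D_cball[OF z]] V[OF D_cball[OF z]], of k] unfolding b[OF z] by linarith
 next
  show "summable (\<lambda>k. 1 * (1 / 2 :: real) ^ (k + 1))"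
   by (intro summable_mult summable_ignore_initial_segment summable_geometric) simp
 qed
 hence s: "(\<lambda>\<zeta>. \<Sum>k. Ln (y (Suc k) \<zeta> / y k \<zeta> ^ d) / of_nat d ^ (k + 1)) holomorphic_on D"
  by (simp only: hmap_complex[OF D(1)])
 have "(\<lambda>\<zeta>. y 0 \<zeta> * exp (\<Sum>k. Ln (y (Suc k) \<zeta> / y k \<zeta> ^ d) / of_nat d ^ (k + 1))) holomorphic_on D"
  by (intro holomorphic_intros yhol s)
 moreover have "y 0 \<zeta> * exp (\<Sum>k. Ln (y (Suc k) \<zeta> / y k \<zeta> ^ d) / of_nat d ^ (k + 1)) = ph \<zeta> (P \<zeta> q)" if z: "\<zeta> \<in> D" for \<zeta>
  unfolding henon_growth.phi_def[OF growth[OF D_cball[OF z]]] henon_growth.log_ratio_def[OF growth[OF D_cball[OF z]]] b[OF z]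
  by (simp add: y_def)
 ultimately show ?thesis by (rule holomorphic_transform)
qed

lemma cmod_phi_motion:
 assumes p: "p \<in> U" and V: "P \<zeta> ((F 0 ^^ n) p) \<in> V" and z: "\<zeta> \<in> cball 0 \<rho>"
 shows "cmod (ph \<zeta> (P \<zeta> ((F 0 ^^ n) p))) = exp (real d ^ n * G \<zeta> p)"
proof -
 have "P \<zeta> p \<in> henon_dyn.E M (F \<zeta>) n" using V unfolding henon_dyn.E_def[OF dyn[OF z]] P_iterate[OF z U_MD[OF p]] by simp
 from henon_dyn.cmod_Lam[OF dyn[OF z] this] show ?thesis
  by (simp add: henon_dyn.Lam_def[OF dyn[OF z]] P_iterate[OF z U_MD[OF p]])
qed

lemma d_pos: "real d > 0" "d ~= 0" using henon_growth.d[OF growth[OF zero_cball]] by auto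

lemma G_0: "p \<in> U ==> G 0 p = G0 p" using P0[OF U_MD] by simp

text \<open>
  As a function of the parameter, \<open>G\<close> is the logarithm of the modulus of a zero-free holomorphic
  function, up to a factor, and the parameter disk is simply connected.
\<close>

lemma height_ext:
 assumes p: "p \<in> U"
 shows "\<exists>h. h holomorphic_on D & h 0 = of_real (G 0 p) & (\<forall>\<zeta>\<in>D. Re (h \<zeta>) = G \<zeta> p)"
proof -
 obtain n where "\<forall>\<zeta>\<in>cball 0 \<rho>. P \<zeta> ((F 0 ^^ n) p) \<in> V" using eventually_in_V[OF p] by (elim exE)
 note n = bspec[OF this]
 define g where "g = (\<lambda>\<zeta>. ph \<zeta> (P \<zeta> ((F 0 ^^ n) p)))"
 have g: "g holomorphic_on D" unfolding g_def by (rule phi_motion_holomorphic[OF MD_iterate[OF U_MD[OF p]] n])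
 have gnz: "g z ~= 0" if "z \<in> D" for z
  unfolding g_def using henon_growth.phi_nz[OF growth[OF D_cball[OF that]] n[OF D_cball[OF that]]] .
 obtain L where L: "L holomorphic_on D" "\<And>z. z \<in> D ==> g z = exp (L z)"
  using contractible_imp_holomorphic_log[OF g convex_imp_contractible[OF convex_ball] gnz] by blast
 have ReL: "Re (L \<zeta>) = real d ^ n * G \<zeta> p" if "\<zeta> \<in> D" for \<zeta>
 proof -
  have "exp (Re (L \<zeta>)) = exp (real d ^ n * G \<zeta> p)"
   using cmod_phi_motion[OF p n[OF D_cball[OF that]] D_cball[OF that]] L(2)[OF that] by (simp add: g_def)
  thus ?thesis by simp
 qed
 define h where "h = (\<lambda>\<zeta>. L \<zeta> / of_nat d ^ n - \<i> * of_real (Im (L 0 / of_nat d ^ n)))"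
 have "h holomorphic_on D" unfolding h_def by (intro holomorphic_intros L) (use d_pos in auto)
 moreover have Reh: "Re (h \<zeta>) = G \<zeta> p" if "\<zeta> \<in> D" for \<zeta>
 proof -
  have "L \<zeta> / of_nat d ^ n = L \<zeta> / of_real (real d ^ n)" by simp
  hence "Re (L \<zeta> / of_nat d ^ n) = Re (L \<zeta>) / real d ^ n" by (simp only: Re_divide_of_real)
  thus ?thesis using ReL[OF that] d_pos by (simp add: h_def)
 qed
 moreover have "h 0 = of_real (G 0 p)" by (rule complex_eqI) (use Reh[OF D(3)] in simp, simp add: h_def)
 ultimately show ?thesis by blast
qed

definition X where "X = G0 ` U"

definition height_fun :: "real => (complex => complex) => bool" where
 "height_fun x h \<longleftrightarrow> h holomorphic_on D & h 0 = of_real x \<and>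
   (\<forall>p\<in>U. G0 p = x --> (\<forall>\<zeta>\<in>D. Re (h \<zeta>) = G \<zeta> p))"

text \<open>
  The motion maps the level \<open>x\<close> of \<open>G\<close> to the level \<open>Re (A x \<zeta>)\<close>. The imaginary part of \<open>A x \<zeta>\<close> is the
  rotation of \<open>phi\<close> along this level, by the lemma \<open>exp_A\<close>.
\<close>

definition A :: "real => complex => complex" where
 "A x = (SOME h. height_fun x h)"

lemma A:
 assumes "x \<in> X" shows "height_fun x (A x)"
proof -
 obtain p where p: "p \<in> U" "x = G0 p" using assms unfolding X_def by (elim imageE)
 obtain h where h: "h holomorphic_on D" "h 0 = of_real (G 0 p)" "\<forall>\<zeta>\<in>D. Re (h \<zeta>) = G \<zeta> p"
  using height_ext[OF p(1)] by (elim exE conjE)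
 have "Re (h \<zeta>) = G \<zeta> q" if q: "q \<in> U" "G0 q = x" and z: "\<zeta> \<in> D" for q \<zeta>
  using h(3) henon_motion.green_eq_iff[OF motion[OF D_cball[OF z]] p(1) q(1)] p(2) q(2) z by simp
 note Re = this
 have h': "height_fun x h" unfolding height_fun_def
 proof (intro conjI ballI impI)
  show "h 0 = of_real x" unfolding h(2) G_0[OF p(1)] p(2) ..
 qed (rule h(1), rule Re)
 show ?thesis unfolding A_def by (rule someI[of "height_fun x", OF h'])
qed

lemma A_hol: "x \<in> X ==> A x holomorphic_on D" and A_0: "x \<in> X ==> A x 0 = of_real x"
 by (drule A, unfold height_fun_def, elim conjE, assumption)+

lemma Re_A:
 assumes "p \<in> U" "\<zeta> \<in> D" shows "Re (A (G0 p) \<zeta>) = G \<zeta> p"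
proof -
 have "G0 p \<in> X" using assms(1) by (simp add: X_def)
 from A[OF this] have "\<forall>p'\<in>U. G0 p' = G0 p -->
   (\<forall>\<zeta>\<in>D. Re (A (G0 p) \<zeta>) = G \<zeta> p')" unfolding height_fun_def by (elim conjE)
 from bspec[OF mp[OF bspec[OF this assms(1)] refl] assms(2)] show ?thesis .
qed

lemma A_d:
 assumes x: "x \<in> X" and z: "\<zeta> \<in> D"
 shows "real d * x \<in> X" "A (real d * x) \<zeta> = of_nat d * A x \<zeta>"
proof -
 obtain p where p: "p \<in> U" "x = G0 p" using x unfolding X_def by (elim imageE)
 have p': "F 0 p \<in> U" "G0 (F 0 p) = real d * x"
  using henon_dyn.H_U[OF dyn[OF zero_cball]] henon_dyn.green_H[OF dyn[OF zero_cball]] p by auto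
 show dx: "real d * x \<in> X" unfolding X_def p'(2)[symmetric] by (rule imageI[OF p'(1)])
 show "A (real d * x) \<zeta> = of_nat d * A x \<zeta>"
 proof (rule holomorphic_eq_by_Re[OF D(1,2) A_hol[OF dx] _ _ D(3) _ z])
  show "(\<lambda>\<zeta>. of_nat d * A x \<zeta>) holomorphic_on D" by (intro holomorphic_intros A_hol x)
  show "A (real d * x) 0 = of_nat d * A x 0" by (simp add: A_0 x dx)
  fix \<zeta> assume z: "\<zeta> \<in> D"
  have "G \<zeta> (F 0 p) = real d * G \<zeta> p"
   using henon_dyn.green_H[OF dyn[OF D_cball[OF z]] henon_conj.f_U[OF conj[OF D_cball[OF z]] p(1)]]
    henon_conj.conj[OF conj[OF D_cball[OF z]] U_MD[OF p(1)]] by simp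
  thus "Re (A (real d * x) \<zeta>) = Re (of_nat d * A x \<zeta>)" using Re_A[OF p(1) z] Re_A[OF p'(1) z] p p' by simp
 qed
qed

text \<open>Both sides are zero-free and holomorphic in \<open>\<zeta>\<close>, have the same modulus, and agree at 0.\<close>

lemma exp_A:
 assumes p: "p \<in> U" and x: "x = G0 p"
  and V: "\<And>\<zeta>. \<zeta> \<in> cball 0 \<rho> ==> P \<zeta> ((F 0 ^^ n) p) \<in> V" and z: "\<zeta> \<in> D"
 shows "ph \<zeta> (P \<zeta> ((F 0 ^^ n) p)) = ph 0 ((F 0 ^^ n) p) * exp (of_nat d ^ n * (A x \<zeta> - of_real x))"
proof -
 have xX: "x \<in> X" using p x by (simp add: X_def)
 have P0': "P 0 ((F 0 ^^ n) p) = (F 0 ^^ n) p" by (rule P0[OF MD_iterate[OF U_MD[OF p]]])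
 have nz0: "ph 0 ((F 0 ^^ n) p) ~= 0"
  using henon_growth.phi_nz[OF growth[OF zero_cball] V[OF zero_cball]] by (simp add: P0')
 show ?thesis
 proof (rule holomorphic_same_modulus[OF D(1,2) _ _ _ _ D(3) _ z])
  show "(\<lambda>\<zeta>. ph \<zeta> (P \<zeta> ((F 0 ^^ n) p))) holomorphic_on D"
   by (rule phi_motion_holomorphic[OF MD_iterate[OF U_MD[OF p]] V])
  show "(\<lambda>\<zeta>. ph 0 ((F 0 ^^ n) p) * exp (of_nat d ^ n * (A x \<zeta> - of_real x))) holomorphic_on D"
   by (intro holomorphic_intros A_hol xX)
  show "ph 0 ((F 0 ^^ n) p) * exp (of_nat d ^ n * (A x \<zeta> - of_real x)) ~= 0" for \<zeta> using nz0 by simp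
  show "ph 0 (P 0 ((F 0 ^^ n) p)) = ph 0 ((F 0 ^^ n) p) * exp (of_nat d ^ n * (A x 0 - of_real x))"
   by (simp add: P0' A_0 xX)
  fix \<zeta> assume z: "\<zeta> \<in> D"
  have r: "Re (of_nat d ^ n * (A x \<zeta> - of_real x)) = real d ^ n * (G \<zeta> p - x)"
  proof -
   have "of_nat d ^ n * (A x \<zeta> - of_real x) = of_real (real d ^ n) * (A x \<zeta> - of_real x)" by simp
   hence "Re (of_nat d ^ n * (A x \<zeta> - of_real x)) = real d ^ n * (Re (A x \<zeta>) - x)"
    by (simp only: Re_complex_of_real times_complex.sel Im_complex_of_real minus_complex.sel mult_zero_left diff_zero)
   thus ?thesis using Re_A[OF p z] x by simp
  qed
  have c0: "cmod (ph 0 ((F 0 ^^ n) p)) = exp (real d ^ n * x)"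
   using cmod_phi_motion[OF p V[OF zero_cball] zero_cball] G_0[OF p] P0' x by simp
  have "cmod (ph 0 ((F 0 ^^ n) p) * exp (of_nat d ^ n * (A x \<zeta> - of_real x)))
    = exp (real d ^ n * x + real d ^ n * (G \<zeta> p - x))" unfolding norm_mult norm_exp_eq_Re r exp_add c0 ..
  also have "real d ^ n * x + real d ^ n * (G \<zeta> p - x) = real d ^ n * G \<zeta> p" by (simp add: algebra_simps)
  finally show "cmod (ph \<zeta> (P \<zeta> ((F 0 ^^ n) p)))
    = cmod (ph 0 ((F 0 ^^ n) p) * exp (of_nat d ^ n * (A x \<zeta> - of_real x)))"
   unfolding cmod_phi_motion[OF p V[OF D_cball[OF z]] D_cball[OF z]] by (rule sym)
 qed
qed

text \<open>Distinct levels stay distinct during the motion.\<close>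

lemma A_mono:
 assumes x: "x \<in> X" "y \<in> X" "x < y" and z: "\<zeta> \<in> D"
 shows "Re (A x \<zeta>) < Re (A y \<zeta>)"
proof (rule ccontr)
 assume le: "\<not> Re (A x \<zeta>) < Re (A y \<zeta>)"
 obtain p where p: "p \<in> U" "x = G0 p" using x unfolding X_def by (elim imageE)
 obtain q where q: "q \<in> U" "y = G0 q" using x unfolding X_def by (elim imageE)
 define h where "h = (\<lambda>\<zeta>. Re (A y \<zeta>) - Re (A x \<zeta>))"
 have "continuous_on D h" unfolding h_def by (intro continuous_intros holomorphic_on_imp_continuous_on A_hol x)
 hence "connected (h ` D)" using D(2) by (rule connected_continuous_image)
 moreover have "h \<zeta> \<in> h ` D" "h 0 \<in> h ` D" using z D by auto
 moreover have "h \<zeta> <= 0" "0 <= h 0" using le x by (auto simp: h_def A_0)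
 ultimately have "0 \<in> h ` D" unfolding connected_iff_interval by blast
 then obtain \<xi> where xi': "0 = h \<xi>" "\<xi> \<in> D" by (rule imageE)
 hence xi: "\<xi> \<in> D" "h \<xi> = 0" by auto
 hence "G \<xi> p = G \<xi> q" using Re_A[OF p(1) xi(1)] Re_A[OF q(1) xi(1)] p q by (simp add: h_def)
 thus False using henon_motion.green_eq_iff[OF motion[OF D_cball[OF xi(1)]] p(1) q(1)] p q x by simp
qed

text \<open>By monotonicity \<open>A y - A x\<close> has positive real part, so its value at 1 is controlled by the one at 0.\<close>

lemma A_Lipschitz:
 assumes x: "x \<in> X" "y \<in> X"
 shows "cmod (A x 1 - A y 1) <= (\<rho> + 1) / (\<rho> - 1) * \<bar>x - y\<bar>"
proof -
 have *: "cmod (A y 1 - A x 1) <= (\<rho> + 1) / (\<rho> - 1) * (y - x)" if x: "x \<in> X" "y \<in> X" "x < y" for x y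
 proof (rule positive_real_part_bound[OF _ _ _ \<rho>, of "\<lambda>\<zeta>. A y \<zeta> - A x \<zeta>"])
  show "(\<lambda>\<zeta>. A y \<zeta> - A x \<zeta>) holomorphic_on D" by (intro holomorphic_intros A_hol x)
  show "0 < Re (A y z - A x z)" if "z \<in> D" for z using A_mono[OF x that] by simp
  show "A y 0 - A x 0 = of_real (y - x)" using x by (simp add: A_0)
 qed
 show ?thesis
  using *[of x y] *[of y x] x norm_minus_commute[of "A x 1" "A y 1"] by (cases x y rule: linorder_cases) auto
qed

end


section \<open>Null sets and holomorphic coordinates\<close>

text \<open>Sard's theorem on the line.\<close>

lemma negligible_critical_values:
 fixes f :: "real => real"
 assumes der: "\<And>x. x \<in> S ==> (f has_vector_derivative 0) (at x within S)"
 shows "negligible (f ` S)"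
proof -
 define T :: "(real^1) set" where "T = {v. v $ 1 \<in> S}"
 define F :: "real^1 => real^1" where "F = (\<lambda>v. vec (f (v $ 1)))"
 have "(F has_derivative (\<lambda>h. 0)) (at v within T)" if "v \<in> T" for v
 proof -
  have 1: "((\<lambda>v::real^1. v $ 1) has_derivative (\<lambda>v. v $ 1)) (at v within T)"
   by (intro bounded_linear_imp_has_derivative bounded_linear_vec_nth)
  have "(f has_derivative (\<lambda>h. 0)) (at (v $ 1) within S)"
   using der[of "v $ 1"] that by (simp add: T_def has_vector_derivative_def)
  hence 2: "(f has_derivative (\<lambda>h. 0)) (at (v $ 1) within (\<lambda>v. v $ 1) ` T)"
   by (rule has_derivative_subset) (auto simp: T_def)
  have 3: "bounded_linear (vec :: real => real^1)" by (intro linear_conv_bounded_linear[THEN iffD1] linear_vec) 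
  have 4: "vec 0 = (0 :: real^1)" by (simp add: vec_eq_iff)
  show ?thesis using bounded_linear.has_derivative[OF 3 has_derivative_in_compose[OF 1 2]] unfolding F_def 4 .
 qed
 hence "negligible (F ` T)"
 proof (rule baby_Sard[OF order_refl])
  have "matrix (\<lambda>h::real^1. 0 :: real^1) = 0" by (simp add: matrix_def vec_eq_iff)
  thus "rank (matrix (\<lambda>h::real^1. 0 :: real^1)) < CARD(1)" by (simp add: rank_0)
 qed
 hence "negligible ((\<lambda>v. v $ 1) ` F ` T)" by (rule negligible_differentiable_image_negligible[rotated])
    (auto intro!: linear_imp_differentiable_on bounded_linear.linear bounded_linear_vec_nth)
 moreover have "f ` S \<subseteq> (\<lambda>v. v $ 1) ` F ` T"
 proof
  fix y assume "y \<in> f ` S"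
  then obtain x where "x \<in> S" "y = f x" by blast
  thus "y \<in> (\<lambda>v. v $ 1) ` F ` T" by (intro image_eqI[of _ _ "F (vec x)"] imageI) (simp_all add: F_def T_def)
 qed
 ultimately show ?thesis by (rule negligible_subset)
qed

text \<open>
  The image of the interval under a coordinate of \<open>f\<close> is an interval, and it is negligible: off \<open>E\<close> by
  Sard's theorem, on \<open>E\<close> by the Lipschitz condition.
\<close>

lemma Lipschitz_zero_derivative_constant:
 fixes f :: "real => 'a::euclidean_space"
 assumes ab: "a <= b" and E: "negligible E"
  and Lip: "\<And>x y. x \<in> {a..b} ==> y \<in> {a..b} ==> norm (f x - f y) <= L * \<bar>x - y\<bar>"
  and der: "\<And>x. x \<in> {a..b} ==> x \<notin> E ==> (f has_vector_derivative 0) (at x within {a..b})"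
 shows "f a = f b"
proof (rule euclidean_eqI)
 fix i :: 'a assume i: "i \<in> Basis"
 define g where "g = (\<lambda>x. f x \<bullet> i)"
 have lip: "\<bar>g x - g y\<bar> <= L * \<bar>x - y\<bar>" if "x \<in> {a..b}" "y \<in> {a..b}" for x y
  using Basis_le_norm[OF i, of "f x - f y"] Lip[OF that] by (simp add: g_def inner_diff_left)
 have "negligible (g ` ({a..b} \<inter> E))" by (rule negligible_locally_Lipschitz_image[OF _ negligible_subset[OF E]])
    (auto intro!: exI[of _ UNIV] exI[of _ L] lip)
 moreover have "negligible (g ` ({a..b} - E))"
 proof (rule negligible_critical_values)
  fix x assume x: "x \<in> {a..b} - E"
  hence "(f has_derivative (\<lambda>h. 0)) (at x within {a..b} - E)"
   using der[of x] has_derivative_subset[of f _ x "{a..b}" "{a..b} - E"] by (simp add: has_vector_derivative_def)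
  from has_derivative_inner_left[OF this, of i]
  show "(g has_vector_derivative 0) (at x within {a..b} - E)" by (simp add: g_def has_vector_derivative_def)
 qed
 ultimately have N: "negligible (g ` {a..b})" by (rule negligible_subset[OF negligible_Un]) blast
 have "continuous_on {a..b} g"
  by (rule lipschitz_on_continuous_on[of "max L 0"]) (auto intro!: lipschitz_onI order_trans[OF lip] mult_right_mono simp: dist_real_def)
 hence "is_interval (g ` {a..b})" by (simp add: is_interval_connected_1 connected_continuous_image)
 hence "closed_segment (g a) (g b) \<subseteq> g ` {a..b}" using ab
  by (intro closed_segment_subset) (auto simp: is_interval_convex)
 hence "negligible (closed_segment (g a) (g b))" by (rule negligible_subset[OF N])
 thus "f a \<bullet> i = f b \<bullet> i" using negligible_interval(1)[of "g a" "g b"] negligible_interval(1)[of "g b" "g a"]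
  by (auto simp: closed_segment_eq_real_ivl g_def split: if_splits)
qed

lemma negligible_strip:
 fixes E :: "real set"
 assumes neg: "negligible {w::complex. Re w \<in> E & Im w \<in> {c<..<e}}" and ce: "c < e"
 shows "negligible E"
proof -
 define h where "h = (\<lambda>w::complex. (Re w, Im w))"
 have "linear h" unfolding h_def
  by (rule bounded_linear.linear) (intro bounded_linear_intros bounded_linear_Re bounded_linear_Im)
 hence "h differentiable_on S" for S by (rule linear_imp_differentiable_on)
 hence "negligible (h ` {w. Re w \<in> E & Im w \<in> {c<..<e}})" by (intro negligible_differentiable_image_negligible neg) auto
 moreover have "h ` {w. Re w \<in> E & Im w \<in> {c<..<e}} = E \<times> {c<..<e}"
 proof (intro equalityI subsetI)
  fix p assume "p \<in> E \<times> {c<..<e}"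
  thus "p \<in> h ` {w. Re w \<in> E & Im w \<in> {c<..<e}}"
   by (intro image_eqI[of _ _ "Complex (fst p) (snd p)"]) (auto simp: h_def)
 qed (auto simp: h_def)
 ultimately have "E \<times> {c<..<e} \<in> null_sets lebesgue" by (simp add: negligible_iff_null_sets)
 then obtain N where N: "N \<in> null_sets lborel" "E \<times> {c<..<e} \<subseteq> N" unfolding null_sets_completion_iff2 by blast
 have "AE p in lborel. p \<notin> N" using N(1) by (rule AE_not_in)
 hence "AE p in (lborel::real measure) \<Otimes>\<^sub>M (lborel::real measure). p \<notin> N" by (simp only: lborel_prod)
 hence "AE x in lborel. AE y in lborel. (x, y) \<notin> N"
  by (rule pair_sigma_finite.AE_pair[OF lborel_pair.pair_sigma_finite_axioms])
 hence "AE x in lborel. x \<notin> E"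
 proof (eventually_elim)
  fix x assume ae: "AE y in lborel. (x, y) \<notin> N"
  show "x \<notin> E"
  proof
   assume "x \<in> E"
   have "AE y in lborel. y \<notin> {c<..<e}" using ae by (rule eventually_mono) (use \<open>x \<in> E\<close> N(2) in blast)
   hence "{c<..<e} \<in> null_sets lborel" by (subst AE_iff_null_sets) auto
   thus False using ce by (simp add: null_sets_def)
  qed
 qed
 then obtain N' where "N' \<in> null_sets lborel" "{x. \<not> x \<notin> E} \<subseteq> N'" unfolding eventually_ae_filter by auto
 hence "E \<in> null_sets lebesgue" unfolding null_sets_completion_iff2 by auto
 thus ?thesis by (simp add: negligible_iff_null_sets)
qed

lemma open_fsigma: "open S ==> fsigma (S::complex set)"
proof -
 assume "open S"
 then obtain D :: "nat => complex set" where D: "\<And>n. compact (D n)" "(\<Union>n. D n) = S"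
  using open_Union_compact_subsets by metis
 have "fsigma (\<Union>n. D n)" by (rule fsigma.intros) (rule compact_imp_closed[OF D(1)])
 thus ?thesis unfolding D(2) .
qed

lemma holomorphic_countable_critical:
 fixes X :: "complex => complex"
 assumes C: "open C" "connected C" and X: "X holomorphic_on C" and nc: "\<not> X constant_on C"
 shows "countable {z\<in>C. deriv X z = 0}"
proof (cases "deriv X constant_on C")
 case True
 then obtain c where c: "\<And>z. z \<in> C ==> deriv X z = c" unfolding constant_on_def by blast
 have "c ~= 0"
 proof
  assume "c = 0"
  hence "(X has_field_derivative 0) (at z)" if "z \<in> C" for z using holomorphic_derivI[OF X C(1) that] c[OF that] by simp
  hence "X constant_on C"
   using DERIV_zero_connected_constant[OF C(2,1) finite.emptyI holomorphic_on_imp_continuous_on[OF X]]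
   unfolding constant_on_def by (metis DiffE)
  with nc show False ..
 qed
 hence "{z\<in>C. deriv X z = 0} = {}" using c by blast
 thus ?thesis by (simp only: countable_empty)
qed (rule holomorphic_countable_zeros[OF holomorphic_deriv[OF X C(1)] C open_fsigma[OF C(1)]])

text \<open>
  Where \<open>X\<close> is a local coordinate, each value of \<open>Re X\<close> is taken along a vertical segment, so a set of
  values of positive measure would need a set of points of positive area.
\<close>

lemma Re_values_off_negligible:
 fixes X :: "complex => complex"
 assumes C: "open C" "connected C" and X: "X holomorphic_on C" and nc: "\<not> X constant_on C"
  and B: "negligible B"
 shows "negligible {x \<in> (\<lambda>z. Re (X z)) ` C. \<forall>z\<in>C - B. deriv X z ~= 0 --> Re (X z) ~= x}"
  (is "negligible ?S")
proof -
 define Q where "Q = (\<lambda>x. \<exists>z\<in>C. deriv X z ~= 0 & Re (X z) = x)"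
 define S where "S = ?S"
 define S' where "S' = {x \<in> S. Q x}"
 have inS: "\<forall>z\<in>C - B. deriv X z ~= 0 --> Re (X z) ~= x" if "x \<in> S" for x using that unfolding S_def by (elim CollectE conjE)
 have "countable ((\<lambda>z. Re (X z)) ` {z\<in>C. deriv X z = 0})"
  by (intro countable_image holomorphic_countable_critical C X nc)
 hence 1: "negligible ((\<lambda>z. Re (X z)) ` {z\<in>C. deriv X z = 0})" 
  by (simp add: negligible_iff_null_sets null_sets_completionI countable_imp_null_set_lborel)
 have 2: "negligible S'"
 proof (rule locally_negligible_alt[THEN iffD2], rule ballI)
  fix x assume x: "x \<in> S'"
  hence "Q x" by (simp add: S'_def)
  then obtain z where z: "z \<in> C" "deriv X z ~= 0" "Re (X z) = x" unfolding Q_def by (elim bexE conjE)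
  obtain r where r: "r > 0" "ball z r \<subseteq> C" "inj_on X (ball z r)"
   by (rule has_complex_derivative_locally_injective[OF X z(1) C(1) z(2)])
  have Xr: "X holomorphic_on ball z r" by (rule holomorphic_on_subset[OF X r(2)])
  have "open (X ` ball z r)" by (rule open_mapping_thm3[OF Xr open_ball r(3)])
  moreover have "X z \<in> X ` ball z r" using r by simp
  ultimately obtain e where e: "e > 0" "ball (X z) e \<subseteq> X ` ball z r" by (rule openE)
  define J where "J = {x - e/2<..<x + e/2}"
  have "{w. Re w \<in> S' \<inter> J & Im w \<in> {Im (X z)<..<Im (X z) + e/2}} \<subseteq> X ` (B \<inter> ball z r)"
  proof
   fix w assume w: "w \<in> {w. Re w \<in> S' \<inter> J & Im w \<in> {Im (X z)<..<Im (X z) + e/2}}"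
   have "cmod (w - X z) <= \<bar>Re (w - X z)\<bar> + \<bar>Im (w - X z)\<bar>" by (rule cmod_le)
   also have "... < e" using w z(3) by (simp add: J_def abs_less_iff) linarith
   finally have "w \<in> ball (X z) e" by (simp add: dist_norm norm_minus_commute)
   then obtain z' where z': "z' \<in> ball z r" "w = X z'" using e(2) by blast
   have "deriv X z' ~= 0" by (rule holomorphic_injective_imp_regular[OF Xr open_ball r(3) z'(1)])
   moreover have "\<forall>z\<in>C - B. deriv X z ~= 0 --> Re (X z) ~= Re w" using w by (intro inS) (simp add: S'_def)
   ultimately have "z' \<in> B" using subsetD[OF r(2) z'(1)] z'(2) by (metis DiffI)
   thus "w \<in> X ` (B \<inter> ball z r)" using z' by blast
  qed
  moreover have "negligible (X ` (B \<inter> ball z r))"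
  proof (rule negligible_differentiable_image_negligible)
   show "negligible (B \<inter> ball z r)" using B by (rule negligible_subset) blast
   show "X differentiable_on B \<inter> ball z r"
    using Xr by (meson differentiable_on_subset holomorphic_on_imp_differentiable_on inf_le2)
  qed simp
  ultimately have "negligible {w. Re w \<in> S' \<inter> J & Im w \<in> {Im (X z)<..<Im (X z) + e/2}}"
   by (rule negligible_subset[rotated])
  hence "negligible (S' \<inter> J)" by (rule negligible_strip) (use e in simp)
  moreover have "openin (top_of_set S') (S' \<inter> J)" unfolding J_def by (intro openin_open_Int open_greaterThanLessThan)
  moreover have "x \<in> S' \<inter> J" using x e by (simp add: J_def)
  ultimately show "\<exists>U. openin (top_of_set S') U & x \<in> U & negligible U" by blast
 qed
 have "S \<subseteq> (\<lambda>z. Re (X z)) ` {z\<in>C. deriv X z = 0} \<union> S'"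
 proof
  fix x assume x: "x \<in> S"
  hence "x \<in> (\<lambda>z. Re (X z)) ` C" unfolding S_def by (elim CollectE conjE)
  then obtain z where "x = Re (X z)" "z \<in> C" by (rule imageE)
  thus "x \<in> (\<lambda>z. Re (X z)) ` {z\<in>C. deriv X z = 0} \<union> S'" using x by (cases "deriv X z = 0") (auto simp: S'_def Q_def)
 qed
 hence "negligible S" by (rule negligible_subset[OF negligible_Un[OF 1 2]])
 thus ?thesis unfolding S_def .
qed

text \<open>
  If in the coordinate \<open>X\<close> the argument of \<open>N\<close> depends on the real part only, then translating \<open>X\<close>
  vertically does not change it, so the logarithmic derivative of \<open>N\<close> with respect to \<open>X\<close> is imaginary.
\<close>

lemma log_derivative_imaginary:
 fixes X N :: "complex => complex" and \<theta> :: "real => complex"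
 assumes S: "open S" and X: "X holomorphic_on S" "inj_on X S" and N: "N holomorphic_on S"
  and B: "negligible B" and rel: "\<And>z. z \<in> S ==> z \<notin> B ==> \<exists>r::real. N z = of_real r * \<theta> (Re (X z))"
  and z0: "z0 \<in> S" "N z0 ~= 0"
 shows "Re (deriv N z0 / (N z0 * deriv X z0)) = 0"
proof -
 obtain g where g: "g holomorphic_on (X ` S)" "\<And>z. z \<in> S ==> deriv X z * deriv g (X z) = 1"
   "\<And>z. z \<in> S ==> g (X z) = z" using holomorphic_has_inverse[OF X(1) S X(2)] by blast
 define T where "T = X ` S"
 have T: "open T" unfolding T_def by (rule open_mapping_thm3[OF X(1) S X(2)])
 define n where "n = (\<lambda>w. N (g w))"
 have gT: "g w \<in> S" if "w \<in> T" for w using that g(3) unfolding T_def by auto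
 have Xg: "X (g w) = w" if "w \<in> T" for w using that g(3) unfolding T_def by auto
 have n: "n holomorphic_on T" using holomorphic_on_compose_gen[OF g(1) N] gT unfolding n_def T_def o_def by blast
 define w0 where "w0 = X z0"
 have w0: "w0 \<in> T" "g w0 = z0" using z0 g(3) by (auto simp: w0_def T_def)
 obtain e where e: "e > 0" "ball w0 e \<subseteq> T" using T w0(1) by (rule openE)
 define B1 where "B1 = X ` (B \<inter> S)"
 have B1: "negligible B1" unfolding B1_def
 proof (rule negligible_differentiable_image_negligible)
  show "negligible (B \<inter> S)" using B by (rule negligible_subset) blast
  show "X differentiable_on B \<inter> S"
   using X(1) S by (meson differentiable_on_subset holomorphic_on_imp_differentiable_on inf_le2)
 qed simp
 have nrel: "\<exists>r::real. n w = of_real r * \<theta> (Re w)" if "w \<in> T" "w \<notin> B1" for w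
 proof -
  have "g w \<notin> B" using that gT[OF that(1)] Xg[OF that(1)] unfolding B1_def by (metis IntI imageI)
  from rel[OF gT[OF that(1)] this] show ?thesis by (simp add: n_def Xg[OF that(1)])
 qed
 have real: "Im (n (w0 + of_real t * \<i>) * cnj (n w0)) = 0" if t: "\<bar>t\<bar> < e / 2" for t
 proof -
  define F where "F = (\<lambda>w. Im (n (w + of_real t * \<i>) * cnj (n w)))"
  have tin: "w + of_real t * \<i> \<in> T" "w \<in> T" if "w \<in> ball w0 (e / 2)" for w
  proof -
   have "dist w0 (w + of_real t * \<i>) <= dist w0 w + cmod (of_real t * \<i>)"
    by (metis add_diff_cancel_left' dist_norm dist_triangle norm_minus_commute)
   thus "w + of_real t * \<i> \<in> T" using that t by (intro subsetD[OF e(2)]) (simp add: norm_mult)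
   show "w \<in> T" using that e(1) by (intro subsetD[OF e(2)]) simp
  qed
  have cn: "continuous_on T n" by (rule holomorphic_on_imp_continuous_on[OF n])
  have c1: "continuous_on (ball w0 (e / 2)) (\<lambda>w. n (w + of_real t * \<i>))"
   by (rule continuous_on_compose2[OF cn]) (intro continuous_intros, use tin(1) in blast)
  have c2: "continuous_on (ball w0 (e / 2)) n" by (rule continuous_on_subset[OF cn]) (use tin(2) in blast)
  have "continuous_on (ball w0 (e / 2)) F" unfolding F_def by (intro continuous_intros c1 c2)
  hence op: "open (ball w0 (e / 2) \<inter> F -` (- {0}))" by (rule continuous_open_preimage) auto
  have "ball w0 (e / 2) \<inter> F -` (- {0}) \<subseteq> B1 \<union> (+) (- of_real t * \<i>) ` B1"
  proof
   fix w assume w: "w \<in> ball w0 (e / 2) \<inter> F -` (- {0})"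
   show "w \<in> B1 \<union> (+) (- of_real t * \<i>) ` B1"
   proof (rule ccontr)
    assume nb: "w \<notin> B1 \<union> (+) (- of_real t * \<i>) ` B1"
    hence "w + of_real t * \<i> \<notin> B1"
     by (metis UnI2 add_diff_cancel_left' image_eqI add.commute minus_mult_left uminus_add_conv_diff)
    then obtain r2 :: real where r2: "n (w + of_real t * \<i>) = of_real r2 * \<theta> (Re (w + of_real t * \<i>))"
     using nrel[OF tin(1)[OF IntD1[OF w]]] by blast
    have "w \<notin> B1" using nb by blast
    then obtain r1 :: real where r1: "n w = of_real r1 * \<theta> (Re w)" using nrel[OF tin(2)[OF IntD1[OF w]]] by blast
    note r = r1 r2
    have "n (w + of_real t * \<i>) * cnj (n w) = of_real (r2 * r1) * (\<theta> (Re w) * cnj (\<theta> (Re w)))" unfolding r by simp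
    also have "... = of_real (r2 * r1 * (cmod (\<theta> (Re w)))\<^sup>2)" by (simp only: complex_norm_square[symmetric] of_real_mult)
    finally have "F w = 0" unfolding F_def by (simp only: Im_complex_of_real)
    thus False using w by simp
   qed
  qed
  hence "negligible (ball w0 (e / 2) \<inter> F -` (- {0}))"
   by (rule negligible_subset[OF negligible_Un[OF B1 negligible_translation[OF B1]]])
  hence "ball w0 (e / 2) \<inter> F -` (- {0}) = {}" using open_not_negligible[OF op] by argo
  moreover have "w0 \<in> ball w0 (e / 2)" using e by simp
  ultimately have "w0 \<notin> F -` (- {0})" by blast
  hence "F w0 = 0" by simp
  thus ?thesis unfolding F_def .
 qed
 have dn: "(n has_field_derivative deriv n w0) (at w0)" by (rule holomorphic_derivI[OF n T w0(1)])
 have dline: "((\<lambda>t. w0 + of_real t * \<i>) has_vector_derivative \<i>) (at 0)"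
  by (auto intro!: derivative_eq_intros simp: has_vector_derivative_def scaleR_conv_of_real)
 have "((\<lambda>t. n (w0 + of_real t * \<i>)) has_vector_derivative \<i> * deriv n w0) (at 0)"
  using field_vector_diff_chain_at[OF dline, of n "deriv n w0"] dn by (simp add: o_def)
 hence "((\<lambda>t. n (w0 + of_real t * \<i>) * cnj (n w0)) has_vector_derivative \<i> * deriv n w0 * cnj (n w0)) (at 0)"
  by (rule has_vector_derivative_mult_left)
 hence "((\<lambda>t. Im (n (w0 + of_real t * \<i>) * cnj (n w0))) has_vector_derivative Im (\<i> * deriv n w0 * cnj (n w0))) (at 0)"
  by (rule bounded_linear.has_vector_derivative[OF bounded_linear_Im])
 hence "((\<lambda>t. Im (n (w0 + of_real t * \<i>) * cnj (n w0))) has_real_derivative Im (\<i> * deriv n w0 * cnj (n w0))) (at 0)"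
  by (simp add: has_real_derivative_iff_has_vector_derivative)
 hence "Im (\<i> * deriv n w0 * cnj (n w0)) = 0"
  by (rule DERIV_local_const[where d = "e / 2"]) (use e real in \<open>auto simp del: complex_cnj_add\<close>)
 hence R: "Re (deriv n w0 * cnj (n w0)) = 0" by (simp add: mult.assoc)
 have dg: "(g has_field_derivative deriv g w0) (at w0)"
  by (rule holomorphic_derivI[OF g(1)]) (use T w0(1) in \<open>simp_all only: T_def\<close>)
 have "(N has_field_derivative deriv N z0) (at (g w0))" by (subst w0(2)) (rule holomorphic_derivI[OF N S z0(1)])
 from DERIV_chain2[OF this dg] have dn_eq: "deriv n w0 = deriv N z0 * deriv g w0"
  unfolding n_def by (rule DERIV_imp_deriv)
 have "deriv X z0 * deriv g w0 = 1" using g(2)[OF z0(1)] by (simp add: w0_def)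
 hence "deriv g w0 = 1 / deriv X z0"  by (cases "deriv X z0 = 0") (simp_all add: field_simps)
 moreover have "n w0 = N z0" by (simp add: n_def w0(2))
 ultimately have eq: "deriv N z0 / (N z0 * deriv X z0) = deriv n w0 / n w0" by (simp add: dn_eq)
 have "deriv n w0 / n w0 = deriv n w0 * cnj (n w0) / of_real ((cmod (n w0))\<^sup>2)" by (rule complex_div_cnj)
 hence "Re (deriv n w0 / n w0) = Re (deriv n w0 * cnj (n w0)) / (cmod (n w0))\<^sup>2" by (simp only: Re_divide_of_real)
 thus ?thesis unfolding eq using R by simp
qed


section \<open>Rigidity of radial maps with harmonic Beltrami coefficient\<close>

text \<open>
  \<open>C\<close> is a simply connected piece of a leaf, \<open>X\<close> a logarithm of \<open>phi\<close> on it, and \<open>\<alpha> = (\<lambda>x. A x 1)\<close>. The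
  assumption on \<open>\<rho>\<close> is what remains of the hyperbolic density: a disk in \<open>C\<close> centred at \<open>z\<close> on which it
  is the density of the disk. In the coordinate \<open>X\<close> the motion is \<open>X \<mapsto> X + \<alpha> (Re X) - Re X\<close>; the
  assumption \<open>beltrami\<close> equates its Beltrami coefficient with a harmonic one.
\<close>

locale radial_beltrami =
 fixes C :: "complex set" and X \<nu> :: "complex => complex" and \<rho> :: "complex => real"
  and \<alpha> :: "real => complex" and d :: nat and \<Lambda> :: real
 assumes C: "open C" "connected C" and X: "X holomorphic_on C"
  and X_pos: "z \<in> C ==> 0 < Re (X z)" and X_small: "e > 0 ==> \<exists>z\<in>C. Re (X z) < e"
  and \<nu>: "\<nu> holomorphic_on C"
  and density: "z \<in> C ==> \<exists>\<pi>. \<pi> holomorphic_on ball 0 1 & \<pi> ` ball 0 1 \<subseteq> C & \<pi> 0 = z \<and>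
   deriv \<pi> 0 ~= 0 & \<rho> z = 2 / cmod (deriv \<pi> 0)"
  and beltrami: "negligible {z\<in>C. deriv X z ~= 0 & \<not> (\<exists>a. (\<alpha> has_vector_derivative a) (at (Re (X z))) \<and>
   a + 1 ~= 0 & cnj (\<nu> z) / of_real ((\<rho> z)\<^sup>2) = (a - 1) / (a + 1) * (cnj (deriv X z) / deriv X z))}"
  and d: "d >= 2" and \<Lambda>: "\<Lambda> >= 0"
  and Lip: "x \<in> (\<lambda>z. Re (X z)) ` C ==> y \<in> (\<lambda>z. Re (X z)) ` C ==> cmod (\<alpha> x - \<alpha> y) <= \<Lambda> * \<bar>x - y\<bar>"
  and scale: "x \<in> (\<lambda>z. Re (X z)) ` C ==> \<alpha> (real d * x) = of_nat d * \<alpha> x"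
begin

definition I where "I = (\<lambda>z. Re (X z)) ` C"
definition m where "m x = (vector_derivative \<alpha> (at x) - 1) / (vector_derivative \<alpha> (at x) + 1)"

definition good :: "complex => bool" where
 "good z \<longleftrightarrow> \<alpha> differentiable (at (Re (X z))) & vector_derivative \<alpha> (at (Re (X z))) + 1 ~= 0 \<and>
   cnj (\<nu> z) / of_real ((\<rho> z)\<^sup>2) = m (Re (X z)) * (cnj (deriv X z) / deriv X z)"

definition B where "B = {z\<in>C. deriv X z ~= 0 & \<not> good z}"

lemma B: "negligible B"
proof -
 have g: "good z" if a: "(\<alpha> has_vector_derivative a) (at (Re (X z)))" "a + 1 ~= 0"
   "cnj (\<nu> z) / of_real ((\<rho> z)\<^sup>2) = (a - 1) / (a + 1) * (cnj (deriv X z) / deriv X z)" for z a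
 proof -
  have "vector_derivative \<alpha> (at (Re (X z))) = a" by (rule vector_derivative_at[OF a(1)])
  thus ?thesis using a differentiableI_vector[OF a(1)] by (simp add: good_def m_def)
 qed
 show ?thesis using beltrami by (rule negligible_subset) (unfold B_def, use g in blast)
qed

lemma I_down: assumes "x \<in> I" "0 < y" "y <= x" shows "y \<in> I"
proof -
 obtain z where z: "z \<in> C" "Re (X z) < y" using X_small[OF assms(2)] by blast
 have "connected I" unfolding I_def
  by (intro connected_continuous_image C continuous_intros holomorphic_on_imp_continuous_on X)
 moreover have "Re (X z) \<in> I" using z by (simp add: I_def)
 ultimately show ?thesis using assms z(2) unfolding connected_iff_interval by (meson less_imp_le)
qed

lemma I_pos: "x \<in> I ==> 0 < x" using X_pos by (auto simp: I_def)

lemma I_d: "x \<in> I ==> x / real d ^ k \<in> I"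
 by (rule I_down[of x]) (use d I_pos[of x] in \<open>auto simp: divide_le_eq one_le_power\<close>)

lemma C_ne: "\<exists>z. z \<in> C" using X_small[of 1] by auto

lemma X_nonconstant: "\<not> X constant_on C"
proof
 assume "X constant_on C"
 then obtain c where c: "\<And>z. z \<in> C ==> X z = c" unfolding constant_on_def by blast
 obtain z where "z \<in> C" using C_ne by blast
 hence "0 < Re c" using X_pos[of z] c by simp
 thus False using X_small[of "Re c"] c by auto
qed

text \<open>The Schwarz lemma for \<open>X\<close> as a map of \<open>C\<close> to the right half-plane.\<close>

lemma density_bound:
 assumes z: "z \<in> C"
 shows "0 < \<rho> z" "cmod (deriv X z) <= \<rho> z * Re (X z)"
proof -
 obtain \<pi> where \<pi>: "\<pi> holomorphic_on ball 0 1" "\<pi> ` ball 0 1 \<subseteq> C" "\<pi> 0 = z"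
   "deriv \<pi> 0 ~= 0" "\<rho> z = 2 / cmod (deriv \<pi> 0)" using density[OF z] by (elim exE conjE)
 show "0 < \<rho> z" using \<pi>(4,5) by simp
 have Y: "(\<lambda>w. X (\<pi> w)) holomorphic_on ball 0 1" using holomorphic_on_compose_gen[OF \<pi>(1) X \<pi>(2)] by (simp add: o_def)
 have "cmod (deriv (\<lambda>w. X (\<pi> w)) 0) <= 2 * Re (X (\<pi> 0))"
  by (rule Schwarz_right_half_plane(1)[OF Y]) (use \<pi>(2) X_pos in blast)
 moreover have "deriv (\<lambda>w. X (\<pi> w)) 0 = deriv X z * deriv \<pi> 0"
 proof -
  have dX: "(X has_field_derivative deriv X z) (at (\<pi> 0))" using holomorphic_derivI[OF X C(1) z] \<pi>(3) by simp
  have "(\<pi> has_field_derivative deriv \<pi> 0) (at 0)" by (rule holomorphic_derivI[OF \<pi>(1) open_ball]) simp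
  from DERIV_chain2[OF dX this] show ?thesis by (rule DERIV_imp_deriv)
 qed
 ultimately have "cmod (deriv X z) * cmod (deriv \<pi> 0) <= 2 * Re (X z)" by (simp add: norm_mult \<pi>(3))
 thus "cmod (deriv X z) <= \<rho> z * Re (X z)" using \<pi>(4) by (simp add: \<pi>(5) field_simps)
qed

text \<open>The quadratic differential \<open>\<nu> dz\<^sup>2\<close> in the coordinate \<open>X\<close>.\<close>

definition N where "N z = \<nu> z / (deriv X z)\<^sup>2"
definition C1 where "C1 = {z\<in>C. deriv X z ~= 0}"

lemma C1: "open C1" "connected C1" "C1 \<subseteq> C"
proof -
 have "C1 = C \<inter> deriv X -` (- {0})" by (auto simp: C1_def)
 thus "open C1" using continuous_open_preimage[OF holomorphic_on_imp_continuous_on[OF holomorphic_deriv[OF X C(1)]] C(1)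
    open_Compl[OF closed_singleton]] by (simp only:)
 have "C1 = C - {z\<in>C. deriv X z = 0}" by (auto simp: C1_def)
 moreover have "connected (C - {z\<in>C. deriv X z = 0})"
  by (rule connected_open_diff_countable[OF _ C holomorphic_countable_critical[OF C X X_nonconstant]]) simp
 ultimately show "connected C1" by simp
qed (auto simp: C1_def)

lemma N: "N holomorphic_on C1" unfolding N_def
 by (intro holomorphic_intros holomorphic_on_subset[OF \<nu> C1(3)] holomorphic_on_subset[OF holomorphic_deriv[OF X C(1)] C1(3)])
   (auto simp: C1_def)

lemma N_good:
 assumes "z \<in> C1" "good z"
 shows "cnj (N z) = m (Re (X z)) * of_real ((\<rho> z)\<^sup>2 / (cmod (deriv X z))\<^sup>2)"
proof -
 have nz: "deriv X z ~= 0" "\<rho> z ~= 0" using assms density_bound(1)[of z] by (auto simp: C1_def)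
 have "cnj (\<nu> z) = m (Re (X z)) * (cnj (deriv X z) / deriv X z) * of_real ((\<rho> z)\<^sup>2)"
  using assms(2) nz unfolding good_def by (simp add: divide_eq_eq)
 hence "cnj (N z) = m (Re (X z)) * of_real ((\<rho> z)\<^sup>2) / (deriv X z * cnj (deriv X z))"
  using nz by (simp add: N_def field_simps power2_eq_square)
 also have "deriv X z * cnj (deriv X z) = of_real ((cmod (deriv X z))\<^sup>2)" by (rule complex_norm_square[symmetric])
 finally show ?thesis by simp
qed

text \<open>
  The argument of \<open>N\<close> depends on \<open>Re X\<close> only, off a null set, so the logarithmic derivative of \<open>N\<close> with
  respect to \<open>X\<close> is holomorphic with values in the imaginary axis, that is, constant.
\<close>

lemma N_exponential:
 assumes ne: "\<exists>z\<in>C1. N z ~= 0"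
 shows "\<exists>c a S. c ~= 0 & countable S & (\<forall>z\<in>C1 - S. N z = c * exp (\<i> * of_real a * X z))"
proof -
 define S where "S = {z\<in>C1. N z = 0}"
 have cS: "countable S"
 proof (cases "N constant_on C1")
  case True
  then obtain k where k: "\<And>z. z \<in> C1 ==> N z = k" unfolding constant_on_def by blast
  hence "S = {}" using ne by (auto simp: S_def)
  thus ?thesis by simp
 qed (unfold S_def, rule holomorphic_countable_zeros[OF N C1(1,2) open_fsigma[OF C1(1)]])
 define C2 where "C2 = C1 - S"
 have conn: "connected C2" unfolding C2_def by (rule connected_open_diff_countable[OF _ C1(1,2) cS]) simp
 have "C2 = C1 \<inter> N -` (- {0})" by (auto simp: C2_def S_def)
 hence op: "open C2" using continuous_open_preimage[OF holomorphic_on_imp_continuous_on[OF N] C1(1)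
    open_Compl[OF closed_singleton]] by (simp only:)
 have C2: "z \<in> C1" "N z ~= 0" "deriv X z ~= 0" "z \<in> C" if "z \<in> C2" for z using that by (auto simp: C2_def S_def C1_def)
 have sub: "C2 \<subseteq> C1" by (simp add: C2_def)
 define q where "q = (\<lambda>z. deriv N z / (N z * deriv X z))"
 have XC1: "X holomorphic_on C1" by (rule holomorphic_on_subset[OF X C1(3)])
 have q: "q holomorphic_on C2" unfolding q_def
  by (intro holomorphic_intros holomorphic_on_subset[OF holomorphic_deriv[OF N C1(1)] sub]
    holomorphic_on_subset[OF N sub] holomorphic_on_subset[OF holomorphic_deriv[OF XC1 C1(1)] sub])
    (use C2 in auto)
 have Req: "Re (q z) = 0" if z: "z \<in> C2" for z
 proof -
  obtain r where r: "r > 0" "ball z r \<subseteq> C1" "inj_on X (ball z r)"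
   using has_complex_derivative_locally_injective[OF XC1 C2(1)[OF z] C1(1) C2(3)[OF z]] by blast
  show ?thesis unfolding q_def
  proof (rule log_derivative_imaginary[OF open_ball holomorphic_on_subset[OF XC1 r(2)] r(3)
     holomorphic_on_subset[OF N r(2)] B _ _ C2(2)[OF z], where \<theta> = "\<lambda>x. cnj (m x)"])
   fix w assume w: "w \<in> ball z r" "w \<notin> B"
   hence "w \<in> C1" using r(2) by blast
   hence g: "good w" using w(2) by (simp add: B_def C1_def)
   have "N w = cnj (cnj (N w))" by simp
   also have "... = of_real ((\<rho> w)\<^sup>2 / (cmod (deriv X w))\<^sup>2) * cnj (m (Re (X w)))"
    unfolding N_good[OF \<open>w \<in> C1\<close> g] by (simp only: complex_cnj_mult complex_cnj_complex_of_real mult.commute)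
   finally show "\<exists>r::real. N w = of_real r * cnj (m (Re (X w)))" by (rule exI)
  qed (use r in simp)
 qed
 obtain z0 where z0: "z0 \<in> C2" using ne by (auto simp: C2_def S_def)
 define a where "a = Im (q z0)"
 have q_const: "q z = \<i> * of_real a" if "z \<in> C2" for z
 proof -
  have "q z = q z0" by (rule holomorphic_eq_by_Re[OF op conn q holomorphic_on_const _ z0 refl that]) (simp add: Req z0)
  also have "... = \<i> * of_real a" using Req[OF z0] by (simp add: a_def complex_eq_iff)
  finally show ?thesis .
 qed
 define e where "e = (\<lambda>z. N z * exp (- (\<i> * of_real a * X z)))"
 have De: "(e has_field_derivative 0) (at z)" if z: "z \<in> C2" for z
 proof -
  have dN: "(N has_field_derivative deriv N z) (at z)" by (rule holomorphic_derivI[OF N C1(1) C2(1)[OF z]])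
  have dX: "(X has_field_derivative deriv X z) (at z)" by (rule holomorphic_derivI[OF X C(1) C2(4)[OF z]])
  have "deriv N z = q z * (N z * deriv X z)" using C2(2,3)[OF z] by (simp add: q_def)
  hence N': "deriv N z = \<i> * of_real a * N z * deriv X z" by (simp add: q_const[OF z])
  have dE: "((\<lambda>z. exp (- (\<i> * of_real a * X z))) has_field_derivative
    exp (- (\<i> * of_real a * X z)) * (- (\<i> * of_real a * deriv X z))) (at z)"
   by (rule DERIV_fun_exp, rule DERIV_minus, rule DERIV_cmult, rule dX)
  have "(e has_field_derivative deriv N z * exp (- (\<i> * of_real a * X z)) +
    exp (- (\<i> * of_real a * X z)) * (- (\<i> * of_real a * deriv X z)) * N z) (at z)"
   unfolding e_def by (rule DERIV_mult[OF dN dE])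
  thus ?thesis by (simp add: N' algebra_simps)
 qed
 have econst: "e z = e z0" if "z \<in> C2" for z
 proof -
  have "continuous_on C2 e" by (rule DERIV_continuous_on) (use De has_field_derivative_at_within in blast)
  from DERIV_zero_connected_constant[OF conn op finite.emptyI this] De
  have "\<exists>c. \<forall>z\<in>C2. e z = c" by (metis Diff_empty)
  thus ?thesis using that z0 by metis
 qed
 show ?thesis
 proof (intro exI[of _ "e z0"] exI[of _ a] exI[of _ S] conjI ballI cS)
  show "e z0 ~= 0" using C2(2)[OF z0] by (simp add: e_def)
  fix z assume "z \<in> C1 - S"
  hence "e z = e z0" by (intro econst) (simp add: C2_def)
  hence "N z * (exp (- (\<i> * of_real a * X z)) * exp (\<i> * of_real a * X z)) = e z0 * exp (\<i> * of_real a * X z)"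
   by (simp add: e_def)
  thus "N z = e z0 * exp (\<i> * of_real a * X z)" by (simp flip: exp_add)
 qed
qed

lemma values_off:
 assumes "countable S"
 shows "negligible {x \<in> I. \<forall>z\<in>C1 - S. good z --> Re (X z) ~= x}"
proof -
 have "negligible S" using assms
  by (simp add: negligible_iff_null_sets null_sets_completionI countable_imp_null_set_lborel)
 hence "negligible (B \<union> S)" by (rule negligible_Un[OF B])
 from Re_values_off_negligible[OF C X X_nonconstant this]
 show ?thesis
 proof (rule negligible_subset, intro subsetI CollectI conjI ballI impI)
  fix x assume x: "x \<in> {x \<in> I. \<forall>z\<in>C1 - S. good z --> Re (X z) ~= x}"
  thus "x \<in> (\<lambda>z. Re (X z)) ` C" by (simp add: I_def)
  fix z assume "z \<in> C - (B \<union> S)" "deriv X z ~= 0"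
  hence "z \<in> C1 - S" "good z" by (auto simp: C1_def B_def)
  thus "Re (X z) ~= x" using x by blast
 qed
qed

lemma derivative_scale:
 assumes x: "x \<in> I" "real d * x < s" "s \<in> I" and diff: "\<alpha> differentiable (at (real d * x))"
 shows "(\<alpha> has_vector_derivative vector_derivative \<alpha> (at (real d * x))) (at x)"
proof -
 define a where "a = vector_derivative \<alpha> (at (real d * x))"
 have a: "(\<alpha> has_vector_derivative a) (at (real d * x))"
  using diff unfolding a_def by (simp add: vector_derivative_works)
 have "((\<lambda>y. real d * y) has_vector_derivative real d) (at x)" by (auto intro!: derivative_eq_intros)
 hence "((\<lambda>y. \<alpha> (real d * y)) has_vector_derivative real d *\<^sub>R a) (at x)"
  using vector_diff_chain_at[of "\<lambda>y. real d * y" "real d" x \<alpha> a] a by (simp add: o_def)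
 hence "((\<lambda>y. (1 / real d) *\<^sub>R \<alpha> (real d * y)) has_vector_derivative (1 / real d) *\<^sub>R (real d *\<^sub>R a)) (at x)"
  by (rule bounded_linear.has_vector_derivative[OF bounded_linear_scaleR_right])
 hence 1: "((\<lambda>y. (1 / real d) *\<^sub>R \<alpha> (real d * y)) has_vector_derivative a) (at x)" using d by simp
 have xs: "x < s"
 proof -
  have "1 * x <= real d * x" using I_pos[OF x(1)] d by (intro mult_right_mono) auto
  thus ?thesis using x(2) by linarith
 qed
 have "(\<alpha> has_vector_derivative a) (at x)"
 proof (rule has_vector_derivative_transform_within_open[OF 1 open_greaterThanLessThan])
  show "x \<in> {0<..<s}" using xs I_pos[OF x(1)] by simp
  fix y assume "y \<in> {0<..<s}"
  hence "y \<in> I" using I_down[OF x(3)] by simp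
  hence "\<alpha> (real d * y) = of_nat d * \<alpha> y" using scale by (simp add: I_def)
  thus "(1 / real d) *\<^sub>R \<alpha> (real d * y) = \<alpha> y" using d by (simp add: scaleR_conv_of_real)
 qed
 thus ?thesis by (simp add: a_def)
qed

lemma m_scale:
 assumes x: "x \<in> I" "real d * x < s" "s \<in> I" and diff: "\<alpha> differentiable (at (real d * x))"
 shows "m (real d * x) = m x" using vector_derivative_at[OF derivative_scale[OF assms]] by (simp add: m_def)

text \<open>
  The constant \<open>a\<close> in the exponent vanishes because \<open>m\<close> is invariant under multiplication by \<open>d\<close>
  while the phase \<open>exp (- \<i> a x)\<close> is not. The bound then follows from the Schwarz lemma.
\<close>

lemma m_bound:
 "\<exists>c\<ge>0. \<exists>S. countable S & (\<forall>z\<in>C1 - S. good z --> cmod (m (Re (X z))) <= c * (Re (X z))\<^sup>2)"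
proof -
 have bd: "cmod (m (Re (X z))) <= cmod (N z) * (Re (X z))\<^sup>2" if z: "z \<in> C1" "good z" for z
 proof -
  have zC: "z \<in> C" using z(1) by (simp add: C1_def)
  have nz: "cmod (deriv X z) > 0" using z(1) by (simp add: C1_def)
  have "cmod (cnj (N z)) = cmod (m (Re (X z))) * ((\<rho> z)\<^sup>2 / (cmod (deriv X z))\<^sup>2)"
   unfolding N_good[OF z] norm_mult norm_of_real by simp
  hence "cmod (m (Re (X z))) = cmod (N z) * ((cmod (deriv X z))\<^sup>2 / (\<rho> z)\<^sup>2)" using nz density_bound(1)[OF zC] by simp
  also have "(cmod (deriv X z))\<^sup>2 / (\<rho> z)\<^sup>2 <= (Re (X z))\<^sup>2"
  proof -
   have "(cmod (deriv X z))\<^sup>2 <= (\<rho> z * Re (X z))\<^sup>2" using density_bound(2)[OF zC] by (rule power_mono) simp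
   thus ?thesis using density_bound(1)[OF zC] by (simp add: power_mult_distrib divide_le_eq mult.commute)
  qed
  finally show ?thesis by (simp add: mult_left_mono)
 qed
 show ?thesis
 proof (cases "\<exists>z\<in>C1. N z ~= 0")
  case False
  show ?thesis
  proof (intro exI[of _ "0::real"] conjI exI[of _ "{}"] ballI impI)
   fix z assume z: "z \<in> C1 - {}" "good z"
   hence "N z = 0" using False by blast
   thus "cmod (m (Re (X z))) <= 0 * (Re (X z))\<^sup>2" using bd[of z] z by simp
  qed simp_all
 next
  case True
  obtain c a S where S1: "c ~= 0" "countable S" "\<forall>z\<in>C1 - S. N z = c * exp (\<i> * of_real a * X z)"
   using N_exponential[OF True] by (elim exE conjE)
  note S = S1(1,2) bspec[OF S1(3)]
  have phase: "\<exists>r>0. m x = of_real r * (cnj c * cis (- a * x))" if "z \<in> C1 - S" "good z" "Re (X z) = x" for z x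
  proof -
   have zC: "z \<in> C" "z \<in> C1" using that(1) by (auto simp: C1_def)
   have pos: "\<rho> z > 0" "cmod (deriv X z) > 0" using density_bound(1)[OF zC(1)] zC(2) by (auto simp: C1_def)
   define r where "r = (cmod (deriv X z))\<^sup>2 / (\<rho> z)\<^sup>2"
   have r: "r > 0" "r * ((\<rho> z)\<^sup>2 / (cmod (deriv X z))\<^sup>2) = 1" using pos by (simp_all add: r_def)
   have "m x = m x * of_real (r * ((\<rho> z)\<^sup>2 / (cmod (deriv X z))\<^sup>2))" unfolding r by simp
   also have "... = of_real r * cnj (N z)" unfolding N_good[OF zC(2) that(2)] that(3) by (simp only: of_real_mult mult_ac)
   also have "cnj (N z) = cnj c * exp (cnj (\<i> * of_real a * X z))"
    unfolding S(3)[OF that(1)] by (simp only: complex_cnj_mult exp_cnj)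
   also have "cnj (\<i> * of_real a * X z) = of_real (- a * Im (X z)) + \<i> * of_real (- a * x)"
    using that(3) by (simp add: complex_eq_iff)
   also have "exp ... = of_real (exp (- a * Im (X z))) * cis (- a * x)" unfolding exp_add cis_conv_exp exp_of_real ..
   finally show ?thesis using r(1) by (intro exI[of _ "r * exp (- a * Im (X z))"]) (simp add: mult_ac)
  qed
  have "a = 0"
  proof (rule ccontr)
   assume a: "a ~= 0"
   define T where "T = {x \<in> I. \<forall>z\<in>C1 - S. good z --> Re (X z) ~= x}"
   have T: "negligible T" unfolding T_def by (rule values_off[OF S(2)])
   obtain s where s: "s \<in> I" using C_ne by (auto simp: I_def)
   define b where "b = a * (real d - 1)"
   have b: "b ~= 0" using a d by (simp add: b_def)
   \<comment> \<open>Below \<open>s'\<close> the difference \<open>b * x\<close> of the phases at \<open>x\<close> and \<open>d * x\<close> is less than \<open>\<pi>\<close>.\<close>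
   define s' where "s' = min (s / real d) (pi / \<bar>b\<bar>)"
   have "s' > 0" using I_pos[OF s] d b by (simp add: s'_def)
   have "negligible ((\<lambda>x. x / real d) ` T)" by (rule negligible_differentiable_image_negligible[OF _ T])
      (auto intro!: linear_imp_differentiable_on bounded_linear.linear bounded_linear_divide)
   hence neg: "negligible (T \<union> (\<lambda>x. x / real d) ` T)" by (rule negligible_Un[OF T])
   have nn: "\<not> negligible {0<..<s'}" by (rule open_not_negligible) (use \<open>s' > 0\<close> in auto)
   have "\<not> {0<..<s'} \<subseteq> T \<union> (\<lambda>x. x / real d) ` T"
   proof
    assume "{0<..<s'} \<subseteq> T \<union> (\<lambda>x. x / real d) ` T"
    hence "negligible {0<..<s'}" by (rule negligible_subset[OF neg])
    thus False using nn by simp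
   qed
   then obtain x where x': "x \<in> {0<..<s'}" "x \<notin> T \<union> (\<lambda>x. x / real d) ` T" by (meson subsetI)
   hence x: "0 < x" "x < s'" "x \<notin> T" "x \<notin> (\<lambda>x. x / real d) ` T" by simp_all
   have dx: "real d * x \<notin> T"
   proof
    assume "real d * x \<in> T"
    hence "real d * x / real d \<in> (\<lambda>x. x / real d) ` T" by (rule imageI)
    thus False using x(4) d by simp
   qed
   have xs: "real d * x < s" "\<bar>b * x\<bar> < pi" using x(1,2) d b by (auto simp: s'_def field_simps abs_mult)
   have dxI: "real d * x \<in> I" using I_down[OF s] xs(1) x(1) d by simp
   have xI: "x \<in> I" using I_d[OF dxI, of 1] d by simp
   obtain z1 where z1: "z1 \<in> C1 - S" "good z1" "Re (X z1) = x" using x(3) xI by (auto simp: T_def)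
   obtain z2 where z2: "z2 \<in> C1 - S" "good z2" "Re (X z2) = real d * x" using dx dxI by (auto simp: T_def)
   obtain r1 where r1: "r1 > 0" "m x = of_real r1 * (cnj c * cis (- a * x))" using phase[OF z1] by blast
   obtain r2 where r2: "r2 > 0" "m (real d * x) = of_real r2 * (cnj c * cis (- a * (real d * x)))"
    using phase[OF z2] by blast
   have "m (real d * x) = m x" by (rule m_scale[OF xI xs(1) s]) (use z2 in \<open>simp add: good_def\<close>)
   hence "cnj c * (of_real r2 * cis (- a * (real d * x))) = cnj c * (of_real r1 * cis (- a * x))"
    unfolding r1(2) r2(2) by (simp only: mult_ac)
   hence "of_real r2 * cis (- a * (real d * x)) = of_real r1 * cis (- a * x)" using S(1) by simp
   hence "of_real r2 * cis (- a * (real d * x)) * cis (a * x) = of_real r1 * (cis (- a * x) * cis (a * x))"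
    by (simp add: mult.assoc)
   hence eq: "of_real r2 * cis (- (b * x)) = of_real r1" by (simp add: cis_mult mult.assoc b_def algebra_simps)
   have "Im (of_real r2 * cis (- (b * x))) = Im (of_real r1)" unfolding eq ..
   hence "r2 * sin (- (b * x)) = 0" by simp
   hence "sin (b * x) = 0" using r2(1) by simp
   moreover have "b * x ~= 0" using b x(1) by simp
  ultimately show False using sin_zero_pi_iff[OF xs(2)] by simp
  qed
  show ?thesis
  proof (intro exI[of _ "cmod c"] conjI exI[of _ S] S ballI impI)
   fix z assume z: "z \<in> C1 - S" "good z"
   thus "cmod (m (Re (X z))) <= cmod c * (Re (X z))\<^sup>2" using bd[of z] S(3)[OF z(1)] \<open>a = 0\<close> by simp
  qed simp
 qed
qed

text \<open>For almost all \<open>x\<close> the invariant \<open>m x\<close> equals \<open>m (x / d ^ k)\<close>, which tends to 0 by the quadratic bound.\<close>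

lemma derivative_1:
 assumes s: "s \<in> I"
 shows "\<exists>E. negligible E & (\<forall>x\<in>{0<..<s} - E. (\<alpha> has_vector_derivative 1) (at x))"
proof -
 obtain c S where c: "c >= 0" "countable S" "\<And>z. z \<in> C1 - S ==> good z ==> cmod (m (Re (X z))) <= c * (Re (X z))\<^sup>2"
  using m_bound by blast
 define T where "T = {x \<in> I. \<forall>z\<in>C1 - S. good z --> Re (X z) ~= x}"
 have T: "negligible T" unfolding T_def by (rule values_off[OF c(2)])
 define E where "E = (\<Union>k. (\<lambda>x. x * real d ^ k) ` T)"
 have "negligible ((\<lambda>x. x * real d ^ k) ` T)" for k by (rule negligible_differentiable_image_negligible[OF _ T])
    (auto intro!: linear_imp_differentiable_on bounded_linear.linear bounded_linear_mult_left)
 hence "negligible E" unfolding E_def by (intro negligible_countable_Union) auto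
 moreover have "(\<alpha> has_vector_derivative 1) (at x)" if x: "x \<in> {0<..<s}" "x \<notin> E" for x
 proof -
  have xI: "x \<in> I" using I_down[OF s] x(1) by simp
  have nT: "x / real d ^ k \<notin> T" for k
  proof
   assume "x / real d ^ k \<in> T"
   hence "x / real d ^ k * real d ^ k \<in> E" unfolding E_def by blast
   thus False using x(2) d by simp
  qed
  have z: "\<alpha> differentiable (at (x / real d ^ k)) & vector_derivative \<alpha> (at (x / real d ^ k)) + 1 ~= 0 \<and>
    cmod (m (x / real d ^ k)) <= c * (x / real d ^ k)\<^sup>2" for k
  proof -
   obtain z where z: "z \<in> C1 - S" "good z" "Re (X z) = x / real d ^ k"
    using nT[of k] I_d[OF xI, of k] by (auto simp: T_def)
   show ?thesis using z(2) c(3)[OF z(1,2)] unfolding good_def z(3) by blast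
  qed
  have ms: "m (x / real d ^ k) = m x" for k
  proof (induction k)
   case (Suc k)
   have eq: "real d * (x / real d ^ Suc k) = x / real d ^ k" using d by simp
   have "x / real d ^ k <= x / 1" using d x(1) by (intro divide_left_mono) (auto simp: one_le_power)
   hence "real d * (x / real d ^ Suc k) < s" unfolding eq using x(1) by simp
   from m_scale[OF I_d[OF xI] this s] z[of k] have "m (x / real d ^ k) = m (x / real d ^ Suc k)" unfolding eq by simp
   thus ?case using Suc by simp
  qed simp
  have lim: "(\<lambda>k. c * (x / real d ^ k)\<^sup>2) \<longlonglongrightarrow> c * 0\<^sup>2"
  proof (intro tendsto_intros)
   have "(\<lambda>k. x * (1 / real d) ^ k) \<longlonglongrightarrow> x * 0" using d by (intro tendsto_intros LIMSEQ_realpow_zero) auto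
   thus "(\<lambda>k. x / real d ^ k) \<longlonglongrightarrow> 0" by (simp add: power_divide)
  qed
  have "cmod (m x) <= c * 0\<^sup>2" by (rule LIMSEQ_le_const[OF lim]) (metis ms z)
  hence "m x = 0" by simp
  hence "vector_derivative \<alpha> (at x) = 1" using z[of 0] by (simp add: m_def)
  thus ?thesis using z[of 0] by (simp add: vector_derivative_works)
 qed
 ultimately show ?thesis by blast
qed

text \<open>
  By the preceding lemma and the Lipschitz condition \<open>\<alpha> x - x\<close> is constant for small \<open>x\<close>. The substitution of \<open>d * x\<close> for \<open>x\<close>
  multiplies it by \<open>d\<close>, so it is 0.
\<close>

theorem radial_identity: "\<exists>\<epsilon>>0. \<forall>x\<in>{0<..<\<epsilon>}. \<alpha> x = of_real x"
proof -
 obtain s where s: "s \<in> I" using C_ne by (auto simp: I_def)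
 obtain E where E: "negligible E" "\<And>x. x \<in> {0<..<s} - E ==> (\<alpha> has_vector_derivative 1) (at x)"
  using derivative_1[OF s] by blast
 have mem: "x \<in> I" if "x \<in> {0<..<s}" for x using I_down[OF s] that by simp
 have const: "\<alpha> x - of_real x = \<alpha> y - of_real y" if xy: "0 < x" "x <= y" "y < s" for x y
 proof (rule Lipschitz_zero_derivative_constant[OF xy(2) E(1), where L = "\<Lambda> + 1"])
  fix u assume u: "u \<in> {x..y}"
  have uI: "u \<in> I" using u xy by (intro mem) auto
  show "cmod (\<alpha> u - of_real u - (\<alpha> v - of_real v)) <= (\<Lambda> + 1) * \<bar>u - v\<bar>" if v: "v \<in> {x..y}" for v
  proof -
   have "v \<in> I" using v xy by (intro mem) auto
   hence "cmod (\<alpha> u - \<alpha> v) <= \<Lambda> * \<bar>u - v\<bar>" using Lip uI by (simp add: I_def)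
   moreover have "cmod (of_real u - of_real v) = \<bar>u - v\<bar>" by (metis norm_of_real of_real_diff)
   moreover have "\<alpha> u - of_real u - (\<alpha> v - of_real v) = (\<alpha> u - \<alpha> v) - (of_real u - of_real v)" by simp
   ultimately show ?thesis
    using norm_triangle_ineq4[of "\<alpha> u - \<alpha> v" "of_real u - of_real v"] by (simp add: algebra_simps)
  qed
  assume uE: "u \<notin> E"
  have "(\<alpha> has_vector_derivative 1) (at u)" using u uE xy by (intro E(2)) auto
  hence "((\<lambda>u. \<alpha> u - of_real u) has_vector_derivative 1 - 1) (at u)"
   by (intro has_vector_derivative_diff) (auto intro!: derivative_eq_intros simp: has_vector_derivative_def scaleR_conv_of_real)
  thus "((\<lambda>u. \<alpha> u - of_real u) has_vector_derivative 0) (at u within {x..y})"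
   by (simp add: has_vector_derivative_at_within)
 qed
 show ?thesis
 proof (intro exI[of _ "s / real d"] conjI ballI)
  show "s / real d > 0" using I_pos[OF s] d by simp
  fix x assume x: "x \<in> {0<..<s / real d}"
  have le: "x <= real d * x" using x d mult_right_mono[of 1 "real d" x] by simp
  have dx: "real d * x < s" using x d by (simp add: field_simps)
  have xI: "x \<in> I" using x le_less_trans[OF le dx] by (intro mem) simp
  have "\<alpha> x - of_real x = \<alpha> (real d * x) - of_real (real d * x)" using x le dx by (intro const) auto
  also have "... = of_nat d * (\<alpha> x - of_real x)" using scale xI by (simp add: I_def algebra_simps)
  finally have "(of_nat d - 1) * (\<alpha> x - of_real x) = 0" by (simp add: algebra_simps)
  moreover have "of_nat d ~= (of_nat 1 :: complex)" using d unfolding of_nat_eq_iff by simp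
  ultimately show "\<alpha> x = of_real x" by auto
 qed
qed

end


section \<open>The Beltrami coefficient of a motion along an unstable manifold\<close>

lemma countable_roots_of_unity: "countable {z::complex. \<exists>N>0. z ^ N = 1}"
proof -
 have "{z::complex. \<exists>N>0. z ^ N = 1} = (\<Union>N\<in>{0<..}. {z. z ^ N = 1})" by auto
 moreover have "countable (\<Union>N\<in>{0<..}. {z::complex. z ^ N = 1})"
  by (rule countable_UN[OF countableI_type]) (rule countable_finite, rule finite_roots_unity, simp)
 ultimately show ?thesis by simp
qed

lemma covering_space_deriv_nonzero:
 assumes \<pi>: "\<pi> holomorphic_on S" "covering_space S \<pi> T" and S: "open S" "z \<in> S"
 shows "deriv \<pi> z ~= 0"
proof -
 obtain A u q where A: "z \<in> A" "openin (top_of_set S) A" "homeomorphism A u \<pi> q"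
  using covering_space_local_homeomorphism[OF \<pi>(2) S(2)] by metis
 have "open A" using A(2) S(1) by (simp add: openin_open_eq)
 moreover have "A \<subseteq> S" using A(2) by (rule openin_imp_subset)
 moreover have "inj_on \<pi> A" using A(3) by (auto simp: homeomorphism_def intro: inj_on_inverseI)
 ultimately show ?thesis using holomorphic_injective_imp_regular[OF holomorphic_on_subset[OF \<pi>(1)]] A(1) by blast
qed

text \<open>\<open>exp\<close> has a local inverse, which continuity selects.\<close>

lemma differentiable_logarithm:
 fixes \<alpha> :: "real => complex"
 assumes cont: "isCont \<alpha> x" and der: "((\<lambda>t. exp (\<alpha> t)) has_vector_derivative e) (at x)"
 shows "(\<alpha> has_vector_derivative e / exp (\<alpha> x)) (at x)"
proof -
 define q where "q = (\<lambda>t. exp (\<alpha> t) / exp (\<alpha> x))"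
 have q: "(q has_vector_derivative e / exp (\<alpha> x)) (at x)" unfolding q_def using has_vector_derivative_divide[OF der] .
 have "(Ln has_field_derivative inverse (q x)) (at (q x))" by (rule has_field_derivative_Ln) (simp add: q_def)
 from field_vector_diff_chain_at[OF q this]
 have "((\<lambda>t. Ln (q t)) has_vector_derivative e / exp (\<alpha> x)) (at x)" by (simp add: o_def q_def)
 hence D: "((\<lambda>t. \<alpha> x + Ln (q t)) has_vector_derivative e / exp (\<alpha> x)) (at x)"
  using has_vector_derivative_add[OF has_vector_derivative_const] by fastforce
 have "\<forall>\<^sub>F t in nhds x. dist (\<alpha> t) (\<alpha> x) < pi"
  using cont unfolding isCont_def tendsto_at_iff_tendsto_nhds by (rule tendstoD) simp
 then obtain r where r: "r > 0" "\<And>t. dist t x < r ==> dist (\<alpha> t) (\<alpha> x) < pi" unfolding eventually_nhds_metric by blast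
 show ?thesis
 proof (rule has_vector_derivative_transform_within_open[OF D open_ball])
  show "x \<in> ball x r" using r by simp
  fix t assume "t \<in> ball x r"
  hence "cmod (\<alpha> t - \<alpha> x) < pi" using r(2)[of t] by (simp add: dist_commute dist_norm)
  hence "\<bar>Im (\<alpha> t - \<alpha> x)\<bar> < pi" using abs_Im_le_cmod by (rule le_less_trans[rotated])
  hence "Ln (exp (\<alpha> t - \<alpha> x)) = \<alpha> t - \<alpha> x" by (intro Ln_exp) auto
  thus "\<alpha> x + Ln (q t) = \<alpha> t" by (simp add: q_def exp_diff)
 qed
qed

text \<open>
  In the coordinate \<open>X\<close> the map \<open>k\<close> is, up to the conformal coordinate \<open>g\<close> in the range,
  \<open>X \<mapsto> X + \<alpha> (Re X) - Re X\<close>.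
\<close>

lemma beltrami_radial:
 fixes X k g :: "complex => complex" and \<alpha> :: "real => complex" and D :: real
 assumes S: "open S" "z \<in> S" and X: "X holomorphic_on S" "deriv X z ~= 0"
  and k: "k differentiable (at z)" and g: "(g has_field_derivative g') (at (k z))"
  and eq: "\<And>w. w \<in> S ==> g (k w) = c * exp (of_real D * (X w + \<alpha> (Re (X w)) - of_real (Re (X w))))"
  and c: "c ~= 0" "D ~= 0" and cont: "isCont \<alpha> (Re (X z))"
  and mono: "\<forall>\<^sub>F t in at_right (Re (X z)). Re (\<alpha> (Re (X z))) <= Re (\<alpha> t)"
 shows "\<exists>a. (\<alpha> has_vector_derivative a) (at (Re (X z))) & a + 1 ~= 0 \<and>
  d_zbar k z / d_z k z = (a - 1) / (a + 1) * (cnj (deriv X z) / deriv X z)"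
proof -
 define x where "x = Re (X z)"
 define K where "K = frechet_derivative k (at z)"
 have K: "(k has_derivative K) (at z)" using k unfolding K_def by (simp add: frechet_derivative_works)
 have gk: "((\<lambda>w. g (k w)) has_derivative (\<lambda>v. g' * K v)) (at z)"
  using has_derivative_compose[OF K] g unfolding has_field_derivative_def by blast
 obtain r where r: "r > 0" "ball z r \<subseteq> S" "inj_on X (ball z r)"
  using has_complex_derivative_locally_injective[OF X(1) S(2,1) X(2)] by blast
 have Xr: "X holomorphic_on ball z r" by (rule holomorphic_on_subset[OF X(1) r(2)])
 obtain h where h': "h holomorphic_on (X ` ball z r)"
   "\<And>w. w \<in> ball z r ==> deriv X w * deriv h (X w) = 1" "\<And>w. w \<in> ball z r ==> h (X w) = w"
  using holomorphic_has_inverse[OF Xr open_ball r(3)] by blast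
 note h = h'(1,3)
 have T: "open (X ` ball z r)" by (rule open_mapping_thm3[OF Xr open_ball r(3)])
 have Xz: "X z \<in> X ` ball z r" using r(1) by simp
 obtain e where e: "e > 0" "ball (X z) e \<subseteq> X ` ball z r" by (rule openE[OF T Xz])
 have hd: "(h has_field_derivative deriv h (X z)) (at (X z))" by (rule holomorphic_derivI[OF h(1) T Xz])
 have hz: "h (X z) = z" using h(2) r(1) by simp
 \<comment> \<open>Where \<open>X\<close> moves horizontally with unit speed, \<open>g \<circ> k\<close> exhibits the derivative of \<open>\<alpha>\<close>.\<close>
 have line: "((\<lambda>t. X z + of_real (t - x)) has_vector_derivative 1) (at x)"
  by (auto intro!: derivative_eq_intros simp: has_vector_derivative_def scaleR_conv_of_real)
 have "((\<lambda>t. h (X z + of_real (t - x))) has_vector_derivative 1 * deriv h (X z)) (at x)"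
  using field_vector_diff_chain_at[OF line, of h "deriv h (X z)"] hd by (simp add: o_def)
 hence "((\<lambda>t. h (X z + of_real (t - x))) has_derivative (\<lambda>s. s *\<^sub>R (1 * deriv h (X z)))) (at x)"
  by (simp add: has_vector_derivative_def)
 from has_derivative_compose[OF this, of "\<lambda>w. g (k w)" "\<lambda>v. g' * K v"] gk
 have "((\<lambda>t. g (k (h (X z + of_real (t - x))))) has_derivative (\<lambda>s. g' * K (s *\<^sub>R (1 * deriv h (X z))))) (at x)"
  by (simp add: hz)
 moreover have "(\<lambda>s. g' * K (s *\<^sub>R (1 * deriv h (X z)))) = (\<lambda>s. s *\<^sub>R (g' * K (deriv h (X z))))"
 proof
  fix s :: real
  have "K (s *\<^sub>R (1 * deriv h (X z))) = s *\<^sub>R K (1 * deriv h (X z))"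
   by (rule linear_scale[OF has_derivative_linear[OF K]])
  thus "g' * K (s *\<^sub>R (1 * deriv h (X z))) = s *\<^sub>R (g' * K (deriv h (X z)))" by (simp only: mult_1 mult_scaleR_right)
 qed
 ultimately have path: "((\<lambda>t. g (k (h (X z + of_real (t - x))))) has_vector_derivative g' * K (deriv h (X z))) (at x)"
  by (simp add: has_vector_derivative_def)
 define b where "b = c * exp (of_real D * (X z - of_real x))"
 have b: "b ~= 0" using c by (simp add: b_def)
 have "((\<lambda>t. b * exp (of_real D * \<alpha> t)) has_vector_derivative g' * K (deriv h (X z))) (at x)"
 proof (rule has_vector_derivative_transform_within_open[OF path open_ball])
  show "x \<in> ball x e" using e by simp
  fix t assume t: "t \<in> ball x e"
  define w where "w = h (X z + of_real (t - x))"
  have "X z + of_real (t - x) \<in> ball (X z) e" using t by (simp add: dist_norm abs_minus_commute del: of_real_diff)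
  then obtain w' where w': "w' \<in> ball z r" "X z + of_real (t - x) = X w'" using e(2) by blast
  hence w: "w \<in> S" "X w = X z + of_real (t - x)" using h(2) r(2) by (auto simp: w_def)
  have "Re (X w) = t" by (simp add: w(2) x_def)
  hence "g (k w) = c * exp (of_real D * (X z - of_real x + \<alpha> t))" using eq[OF w(1)] by (simp add: w(2) algebra_simps)
  also have "of_real D * (X z - of_real x + \<alpha> t) = of_real D * (X z - of_real x) + of_real D * \<alpha> t"
   by (simp add: algebra_simps)
  finally show "g (k (h (X z + of_real (t - x)))) = b * exp (of_real D * \<alpha> t)"
   unfolding exp_add b_def w_def by (simp only: mult.assoc)
 qed
 hence "((\<lambda>t. b * exp (of_real D * \<alpha> t) / b) has_vector_derivative g' * K (deriv h (X z)) / b) (at x)"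
  by (rule has_vector_derivative_divide)
 hence "((\<lambda>t. exp (of_real D * \<alpha> t)) has_vector_derivative g' * K (deriv h (X z)) / b) (at x)" using b by simp
 moreover have "isCont (\<lambda>t. of_real D * \<alpha> t) x" using cont unfolding x_def by (intro continuous_intros)
 ultimately have "\<exists>a'. ((\<lambda>t. of_real D * \<alpha> t) has_vector_derivative a') (at x)" using differentiable_logarithm by blast
 then obtain a' where "((\<lambda>t. of_real D * \<alpha> t) has_vector_derivative a') (at x)" by blast
 hence "((\<lambda>t. of_real D * \<alpha> t / of_real D) has_vector_derivative a' / of_real D) (at x)"
  by (rule has_vector_derivative_divide)
 then obtain a where a: "(\<alpha> has_vector_derivative a) (at x)" using c(2) by auto
 have "0 <= Re a"
 proof (rule tendsto_lowerbound)
  have "((\<lambda>t. Re (\<alpha> t)) has_real_derivative Re a) (at x)" unfolding has_real_derivative_iff_has_vector_derivative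
   by (rule bounded_linear.has_vector_derivative[OF bounded_linear_Re a])
  hence "((\<lambda>t. (Re (\<alpha> t) - Re (\<alpha> x)) / (t - x)) \<longlongrightarrow> Re a) (at x)" by (simp add: has_field_derivative_iff)
  thus "((\<lambda>t. (Re (\<alpha> t) - Re (\<alpha> x)) / (t - x)) \<longlongrightarrow> Re a) (at_right x)"
   by (rule filterlim_mono) (auto simp: at_within_le_at)
  have "\<forall>\<^sub>F t in at_right x. x < t" by (simp add: eventually_at_right_less)
  thus "\<forall>\<^sub>F t in at_right x. 0 <= (Re (\<alpha> t) - Re (\<alpha> x)) / (t - x)"
   using mono unfolding x_def[symmetric] by eventually_elim simp
 qed simp
 hence "Re (a + 1) ~= 0" by simp
 hence a1: "a + 1 ~= 0" by (intro notI) (simp only: zero_complex.sel)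
 define R where "R = c * exp (of_real D * (X z + \<alpha> x - of_real x)) * of_real D"
 have R: "R ~= 0" using c by (simp add: R_def)
 define T' where "T' = (\<lambda>v. deriv X z * v + of_real (Re (deriv X z * v)) * (a - 1))"
 have "((\<lambda>w. X w) has_derivative (\<lambda>v. deriv X z * v)) (at z)"
  using holomorphic_derivI[OF X(1) S(1,2)] by (simp add: has_field_derivative_def)
 moreover have dRe: "((\<lambda>w. Re (X w)) has_derivative (\<lambda>v. Re (deriv X z * v))) (at z)"
  by (rule bounded_linear.has_derivative[OF bounded_linear_Re calculation])
 moreover have "((\<lambda>w. \<alpha> (Re (X w))) has_derivative (\<lambda>v. Re (deriv X z * v) *\<^sub>R a)) (at z)"
  using has_derivative_compose[OF dRe] a unfolding has_vector_derivative_def x_def by blast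
 moreover have "((\<lambda>w. complex_of_real (Re (X w))) has_derivative (\<lambda>v. of_real (Re (deriv X z * v)))) (at z)"
  by (rule bounded_linear.has_derivative[OF bounded_linear_of_real dRe])
 ultimately have "((\<lambda>w. X w + \<alpha> (Re (X w)) - of_real (Re (X w))) has_derivative
   (\<lambda>v. deriv X z * v + Re (deriv X z * v) *\<^sub>R a - of_real (Re (deriv X z * v)))) (at z)"
  by (intro has_derivative_diff has_derivative_add)
 also have "(\<lambda>v. deriv X z * v + Re (deriv X z * v) *\<^sub>R a - of_real (Re (deriv X z * v))) = T'"
  by (simp add: T'_def scaleR_conv_of_real algebra_simps)
 finally have L: "((\<lambda>w. X w + \<alpha> (Re (X w)) - of_real (Re (X w))) has_derivative T') (at z)" .
 have "((\<lambda>y. c * exp (of_real D * y)) has_field_derivative R) (at (X z + \<alpha> (Re (X z)) - of_real (Re (X z))))"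
  by (auto intro!: derivative_eq_intros simp: R_def x_def)
 hence "((\<lambda>w. c * exp (of_real D * (X w + \<alpha> (Re (X w)) - of_real (Re (X w))))) has_derivative (\<lambda>v. R * T' v)) (at z)"
  using has_derivative_compose[OF L] unfolding has_field_derivative_def by blast
 hence "((\<lambda>w. g (k w)) has_derivative (\<lambda>v. R * T' v)) (at z)"
  by (rule has_derivative_transform_within_open[OF _ S]) (simp add: eq)
 from has_derivative_unique[OF gk this] have KT: "g' * K v = R * T' v" for v by (rule fun_cong)
 have dz: "g' * d_z k z = R * (deriv X z * (a + 1) / 2)"
 proof -
  have "g' * d_z k z = (g' * K 1 - \<i> * (g' * K \<i>)) / 2" by (simp add: d_z_def K_def algebra_simps)
  also have "... = R * ((T' 1 - \<i> * T' \<i>) / 2)" unfolding KT by (simp add: algebra_simps)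
  also have "T' 1 - \<i> * T' \<i> = deriv X z * (a + 1)" by (simp add: T'_def complex_eq_iff algebra_simps)
  finally show ?thesis .
 qed
 have dzb: "g' * d_zbar k z = R * (cnj (deriv X z) * (a - 1) / 2)"
 proof -
  have "g' * d_zbar k z = (g' * K 1 + \<i> * (g' * K \<i>)) / 2" by (simp add: d_zbar_def K_def algebra_simps)
  also have "... = R * ((T' 1 + \<i> * T' \<i>) / 2)" unfolding KT by (simp add: algebra_simps)
  also have "T' 1 + \<i> * T' \<i> = cnj (deriv X z) * (a - 1)" by (simp add: T'_def complex_eq_iff algebra_simps)
  finally show ?thesis .
 qed
 have g'nz: "g' ~= 0" using dz R X(2) a1 by auto
 have "d_zbar k z / d_z k z = (g' * d_zbar k z) / (g' * d_z k z)" using g'nz by simp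
 also have "... = (a - 1) / (a + 1) * (cnj (deriv X z) / deriv X z)" unfolding dz dzb using R by (simp add: mult.commute)
 finally show ?thesis using a a1 unfolding x_def by blast
qed

context disc_motion
begin

lemma green_continuous_0: "continuous_on U (G0)" by (rule henon_dyn.green_continuous[OF dyn[OF zero_cball]])

lemma one_cball: "1 \<in> cball (0::complex) \<rho>" using \<rho> by simp

lemma open_U: "open U" by (rule henon.open_U_plus[OF henon[OF zero_cball]])

lemma continuous_A: "continuous_on U (\<lambda>p. A (G0 p) 1)"
proof (rule continuous_on_compose2[OF _ green_continuous_0])
 show "continuous_on X (\<lambda>x. A x 1)"
 proof (rule lipschitz_on_continuous_on)
  show "((\<rho> + 1) / (\<rho> - 1))-lipschitz_on X (\<lambda>x. A x 1)"
   using A_Lipschitz \<rho> by (intro lipschitz_onI) (auto simp: dist_norm)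
 qed
qed (simp add: X_def)

lemma phi_relation_local:
 assumes p: "p \<in> U"
 shows "\<exists>n r. r > 0 & ball p r \<subseteq> U & (\<forall>q\<in>ball p r. (F 0 ^^ n) q \<in> V & P 1 ((F 0 ^^ n) q) \<in> V \<and>
  ph 1 (P 1 ((F 0 ^^ n) q)) = ph 0 ((F 0 ^^ n) q) *
   exp (of_nat d ^ n * (A (G0 q) 1 - of_real (G0 q))))"
proof -
 have P0': "P 0 ((F 0 ^^ n) q) = (F 0 ^^ n) q" if "q \<in> U" for n q by (rule P0[OF MD_iterate[OF U_MD[OF that]]])
 obtain n where n: "\<forall>\<zeta>\<in>cball 0 \<rho>. P \<zeta> ((F 0 ^^ n) p) \<in> V" using eventually_in_V[OF p] by (elim exE)
 have cP: "continuous_on U (\<lambda>q. P 1 ((F 0 ^^ n) q))"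
 proof (rule continuous_on_compose2[OF henon_conj.contf[OF conj[OF one_cball]] henon_growth.cont_iterate(1)[OF growth[OF zero_cball]]])
  show "(F 0 ^^ n) ` U \<subseteq> motion_domain (F 0)" using MD_iterate[OF U_MD] by blast
 qed
 define O1 where "O1 = {q\<in>U. (F 0 ^^ n) q \<in> V & P 1 ((F 0 ^^ n) q) \<in> V}"
 have "open (U \<inter> (F 0 ^^ n) -` V)" "open (U \<inter> (\<lambda>q. P 1 ((F 0 ^^ n) q)) -` V)"
  by (rule continuous_open_preimage[OF _ open_U open_Vo], rule henon_growth.cont_iterate(1)[OF growth[OF zero_cball]],
    rule continuous_open_preimage[OF cP open_U open_Vo])
 hence "open ((U \<inter> (F 0 ^^ n) -` V) \<inter> (U \<inter> (\<lambda>q. P 1 ((F 0 ^^ n) q)) -` V))" by (rule open_Int)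
 also have "(U \<inter> (F 0 ^^ n) -` V) \<inter> (U \<inter> (\<lambda>q. P 1 ((F 0 ^^ n) q)) -` V) = O1" unfolding O1_def by blast
 finally have "open O1" .
 moreover have "p \<in> O1"
 proof -
  have "P 0 ((F 0 ^^ n) p) \<in> V" "P 1 ((F 0 ^^ n) p) \<in> V" by (rule bspec[OF n], rule zero_cball, rule bspec[OF n], rule one_cball)
  thus ?thesis using p unfolding O1_def P0'[OF p] by blast
 qed
 ultimately obtain r where r: "r > 0" "ball p r \<subseteq> O1" by (rule openE)
 have O1D: "q \<in> U" "(F 0 ^^ n) q \<in> V" "P 1 ((F 0 ^^ n) q) \<in> V" if "q \<in> ball p r" for q
  using subsetD[OF r(2) that] unfolding O1_def by simp_all
 define e where "e = (\<lambda>q. ph 0 ((F 0 ^^ n) q) *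
   exp (of_nat d ^ n * (A (G0 q) 1 - of_real (G0 q))))"
 define u where "u = (\<lambda>q. ph 1 (P 1 ((F 0 ^^ n) q)) / e q)"
 have ne0: "ph 0 ((F 0 ^^ n) q) ~= 0" if "q \<in> ball p r" for q
  by (rule henon_growth.phi_nz[OF growth[OF zero_cball] O1D(2)[OF that]])
 have enz: "e q ~= 0" if "q \<in> ball p r" for q using ne0[OF that] by (simp add: e_def)
 have cphi: "continuous_on V (ph \<zeta>)" if "\<zeta> \<in> cball 0 \<rho>" for \<zeta>
  by (rule hmap_continuous_on[OF henon_growth.phi_holomorphic[OF growth[OF that]]])
 have bU: "ball p r \<subseteq> U" using O1D(1) by blast
 have c1: "continuous_on (ball p r) (\<lambda>q. ph 1 (P 1 ((F 0 ^^ n) q)))"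
  by (rule continuous_on_compose2[OF cphi[OF one_cball] continuous_on_subset[OF cP bU]]) (rule image_subsetI, rule O1D(3))
 have c2: "continuous_on (ball p r) (\<lambda>q. ph 0 ((F 0 ^^ n) q))"
  by (rule continuous_on_compose2[OF cphi[OF zero_cball] henon_growth.cont_iterate(1)[OF growth[OF zero_cball]]])
   (rule image_subsetI, rule O1D(2))
 have ce: "continuous_on (ball p r) e" unfolding e_def
  by (intro continuous_intros c2 continuous_on_subset[OF continuous_A bU] continuous_on_subset[OF green_continuous_0 bU])
 have cu: "continuous_on (ball p r) u" unfolding u_def by (rule continuous_on_divide[OF c1 ce]) (intro ballI enz)
 have root: "\<exists>N>0. u q ^ N = 1" if q: "q \<in> ball p r" for q
 proof -
  have qU: "q \<in> U" by (rule O1D(1)[OF q])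
  obtain n' where n': "\<forall>\<zeta>\<in>cball 0 \<rho>. P \<zeta> ((F 0 ^^ n') q) \<in> V" using eventually_in_V[OF qU] by (elim exE)
  define k where "k = n' - n"
  have kn: "n' <= k + n" by (simp add: k_def)
  have VN: "P \<zeta> ((F 0 ^^ (k + n)) q) \<in> V" if z: "\<zeta> \<in> cball 0 \<rho>" for \<zeta>
   using henon_growth.iterate_later[OF growth[OF z] _ kn, of "P \<zeta> q"] bspec[OF n' z]
   unfolding P_iterate[OF z U_MD[OF qU]] by blast
  have it: "(F 0 ^^ (k + n)) q = (F 0 ^^ k) ((F 0 ^^ n) q)" by (simp add: funpow_add)
  have "P 1 ((F 0 ^^ (k + n)) q) = (F 1 ^^ k) (P 1 ((F 0 ^^ n) q))"
   unfolding it by (rule P_iterate[OF one_cball MD_iterate[OF U_MD[OF qU]]])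
  hence l: "ph 1 (P 1 ((F 0 ^^ (k + n)) q)) = ph 1 (P 1 ((F 0 ^^ n) q)) ^ (d ^ k)"
   using henon_growth.phi_iterate[OF growth[OF one_cball] O1D(3)[OF q]] by simp
  have r0: "ph 0 ((F 0 ^^ (k + n)) q) = ph 0 ((F 0 ^^ n) q) ^ (d ^ k)"
   unfolding it by (rule henon_growth.phi_iterate[OF growth[OF zero_cball] O1D(2)[OF q]])
  have ex: "exp (of_nat d ^ (k + n) * y) = exp (of_nat d ^ n * y) ^ (d ^ k)" for y :: complex
   by (simp add: power_add mult.assoc flip: exp_of_nat_mult)
  have "ph 1 (P 1 ((F 0 ^^ n) q)) ^ (d ^ k) = e q ^ (d ^ k)"
   using exp_A[OF qU refl VN D(4)] unfolding l r0 ex e_def power_mult_distrib .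
  hence "u q ^ (d ^ k) = 1" using enz[OF q] by (simp add: u_def power_divide)
  thus ?thesis using d_pos(2) by (intro exI[of _ "d ^ k"]) simp
 qed
 have up: "u p = 1"
 proof -
  have "ph 1 (P 1 ((F 0 ^^ n) p)) = e p" unfolding e_def by (rule exp_A[OF p refl _ D(4)]) (rule bspec[OF n])
  thus ?thesis using enz[of p] r(1) by (simp add: u_def)
 qed
 have "u q = 1" if q: "q \<in> ball p r" for q
 proof -
  have "countable (u ` ball p r)"
   by (rule countable_subset[OF _ countable_roots_of_unity]) (rule image_subsetI, rule CollectI, rule root)
  from continuous_countable_range_constant[OF convex_connected[OF convex_ball] cu this q, of p] r(1) up
  show ?thesis by simp
 qed
 hence "ph 1 (P 1 ((F 0 ^^ n) q)) = e q" if "q \<in> ball p r" for q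
  using that enz[OF that] by (metis divide_eq_1_iff u_def)
 thus ?thesis using r(1) bU O1D unfolding e_def by blast
qed

lemma phi_preserved:
 assumes "\<And>p. p \<in> U ==> A (G0 p) 1 = of_real (G0 p)" "p \<in> U"
 shows "\<exists>n r. r > 0 & ball p r \<subseteq> U & (\<forall>q\<in>ball p r. (F 0 ^^ n) q \<in> V & P 1 ((F 0 ^^ n) q) \<in> V \<and>
  ph 1 (P 1 ((F 0 ^^ n) q)) = ph 0 ((F 0 ^^ n) q))"
 using phi_relation_local[OF assms(2)] by (elim ex_forward) (auto simp: assms(1) subset_iff)

end


section \<open>The motion preserves the Green function\<close>

lemma Re_image_neighbourhood:
 fixes X :: "complex => complex"
 assumes S: "open S" "z \<in> S" and X: "X holomorphic_on S" "deriv X z ~= 0"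
 shows "\<exists>e>0. {Re (X z) - e<..<Re (X z) + e} \<subseteq> (\<lambda>w. Re (X w)) ` S"
proof -
 obtain r where r: "r > 0" "ball z r \<subseteq> S" "inj_on X (ball z r)"
  using has_complex_derivative_locally_injective[OF X(1) S(2,1) X(2)] by blast
 have "open (X ` ball z r)" by (rule open_mapping_thm3[OF holomorphic_on_subset[OF X(1) r(2)] open_ball r(3)])
 moreover have "X z \<in> X ` ball z r" using r(1) by simp
 ultimately obtain e where e: "e > 0" "ball (X z) e \<subseteq> X ` ball z r" by (rule openE)
 show ?thesis
 proof (intro exI[of _ e] conjI e(1) subsetI)
  fix t assume t: "t \<in> {Re (X z) - e<..<Re (X z) + e}"
  define v where "v = X z + of_real (t - Re (X z))"
  have "dist (X z) v = \<bar>t - Re (X z)\<bar>"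
   unfolding v_def dist_norm by (metis abs_minus_commute add_diff_cancel_left' norm_minus_commute norm_of_real)
  also have "... < e" using t by (simp add: abs_less_iff)
  finally have "v \<in> X ` ball z r" by (intro subsetD[OF e(2)]) simp
  then obtain w where w: "v = X w" "w \<in> ball z r" by (rule imageE)
  have "t = Re v" by (simp add: v_def)
  thus "t \<in> (\<lambda>w. Re (X w)) ` S" unfolding w(1) using subsetD[OF r(2) w(2)] by (rule image_eqI)
 qed
qed

context henon_dyn
begin

text \<open>
  The functions \<open>Lam n \<circ> \<tau>\<close> are powers of each other, so their logarithmic derivatives, divided by
  \<open>d ^ n\<close>, fit together to one holomorphic function on \<open>C\<close>; \<open>X\<close> is an antiderivative of it.
\<close>

lemma global_log:
 fixes \<tau> :: "complex => C2"
 assumes C: "open C" "simply_connected C" and \<tau>: "hmap \<tau> C" "\<tau> ` C \<subseteq> U_plus H"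
 shows "\<exists>X. X holomorphic_on C & (\<forall>z\<in>C. Re (X z) = green_plus d H (\<tau> z)) \<and>
  (\<forall>z\<in>C. \<forall>n. \<tau> z \<in> E n --> (\<exists>c r. c ~= 0 & r > 0 & ball z r \<subseteq> C \<and>
    (\<forall>w\<in>ball z r. Lam n (\<tau> w) = c * exp (of_nat d ^ n * X w))))"
proof -
 have conn: "connected C" by (rule simply_connected_imp_connected[OF C(2)])
 have ct: "continuous_on C \<tau>" by (rule hmap_continuous_on[OF \<tau>(1)])
 define S where "S n = C \<inter> \<tau> -` E n" for n
 have S: "open (S n)" for n unfolding S_def by (rule continuous_open_preimage[OF ct C(1) open_E])
 define L where "L n z = Lam n (\<tau> z)" for n z
 have L: "L n holomorphic_on S n" for n
 proof -
  have "hmap (\<lambda>z. Lam n (\<tau> z)) (S n)" by (rule hmap_compose[OF hmap_subset[OF \<tau>(1)] Lam_holomorphic]) (auto simp: S_def)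
  thus ?thesis unfolding L_def hmap_complex[OF S] .
 qed
 have Lnz: "L n z ~= 0" if "z \<in> S n" for n z using that Lam_nz by (simp add: S_def L_def)
 have SS: "S n \<subseteq> S m" if "n <= m" for n m using E_mono[OF that] by (auto simp: S_def)
 have d0: "d > 0" using d by simp
 define f where "f n z = deriv (L n) z / (of_nat d ^ n * L n z)" for n z
 have fhol: "f n holomorphic_on S n" for n
  unfolding f_def[abs_def] by (intro holomorphic_intros holomorphic_deriv L S) (use Lnz d0 in auto)
 have f_add: "f (k + n) z = f n z" if z: "z \<in> S n" for k n z
 proof -
  have "((\<lambda>w. L n w ^ (d ^ k)) has_field_derivative of_nat (d ^ k) * L n z ^ (d ^ k - 1) * deriv (L n) z) (at z)"
   using DERIV_power[OF holomorphic_derivI[OF L S z], of "d ^ k"] by (simp add: mult_ac)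
  moreover have "L n w ^ (d ^ k) = L (k + n) w" if "w \<in> S n" for w
   using Lam_add[of "\<tau> w" n k] that by (simp add: L_def S_def)
  ultimately have "(L (k + n) has_field_derivative of_nat (d ^ k) * L n z ^ (d ^ k - 1) * deriv (L n) z) (at z)"
   using has_field_derivative_transform_within_open[OF _ S z] by blast
  hence D: "deriv (L (k + n)) z = of_nat (d ^ k) * L n z ^ (d ^ k - 1) * deriv (L n) z" by (rule DERIV_imp_deriv)
  have P: "L (k + n) z = L n z * L n z ^ (d ^ k - 1)"
  proof -
   have "d ^ k = Suc (d ^ k - 1)" using d0 by simp
   hence "L n z ^ (d ^ k) = L n z * L n z ^ (d ^ k - 1)" by (metis power_Suc)
   thus ?thesis using Lam_add[of "\<tau> z" n k] z by (simp add: L_def S_def)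
  qed
  show ?thesis unfolding f_def D P using Lnz[OF z] d0 by (simp add: power_add field_simps)
 qed
 define nn where "nn z = (LEAST n. \<tau> z \<in> E n)" for z
 have nn: "z \<in> S (nn z)" if "z \<in> C" for z
 proof -
  have "\<exists>n. \<tau> z \<in> E n" using \<tau>(2) that unfolding U_eq_E by blast
  hence "\<tau> z \<in> E (nn z)" unfolding nn_def by (rule LeastI_ex)
  thus ?thesis using that by (simp add: S_def)
 qed
 define \<omega> where "\<omega> z = f (nn z) z" for z
 have om: "\<omega> z = f n z" if z: "z \<in> S n" for n z
 proof -
  have "nn z <= n" unfolding nn_def by (rule Least_le) (use z in \<open>simp add: S_def\<close>)
  then obtain k where "n = k + nn z" by (metis le_add_diff_inverse2)
  moreover have "z \<in> C" using z by (simp add: S_def)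
  ultimately show ?thesis using f_add[OF nn] by (simp add: \<omega>_def)
 qed
 have "\<omega> holomorphic_on C" unfolding holomorphic_on_def
 proof
  fix z assume z: "z \<in> C"
  have "\<omega> holomorphic_on S (nn z)" by (rule holomorphic_transform[OF fhol]) (simp add: om)
  hence "\<omega> field_differentiable (at z)" by (rule holomorphic_on_imp_differentiable_at[OF _ S nn[OF z]])
  thus "\<omega> field_differentiable (at z within C)" by (rule field_differentiable_at_within)
 qed
 then obtain X where X: "\<And>z. z \<in> C ==> (X has_field_derivative \<omega> z) (at z)"
  using simply_connected_eq_global_primitive[OF C(1)] C(2) by blast
 have loc: "\<exists>c r. c ~= 0 & r > 0 & ball z r \<subseteq> S n & (\<forall>w\<in>ball z r. L n w = c * exp (of_nat d ^ n * X w))"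
  if z: "z \<in> S n" for z n
 proof -
  obtain r where r: "r > 0" "ball z r \<subseteq> S n" by (rule openE[OF S z])
  define e where "e w = L n w * exp (- (of_nat d ^ n * X w))" for w
  have De: "(e has_field_derivative 0) (at w)" if w: "w \<in> S n" for w
  proof -
   have wC: "w \<in> C" using w by (simp add: S_def)
   have dE: "((\<lambda>w. exp (- (of_nat d ^ n * X w))) has_field_derivative
     exp (- (of_nat d ^ n * X w)) * (- (of_nat d ^ n * \<omega> w))) (at w)"
    by (rule DERIV_fun_exp, rule DERIV_minus, rule DERIV_cmult, rule X[OF wC])
   have "of_nat d ^ n * \<omega> w * L n w = deriv (L n) w" unfolding om[OF w] f_def using Lnz[OF w] d0 by simp
   hence "deriv (L n) w * exp (- (of_nat d ^ n * X w)) +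
     exp (- (of_nat d ^ n * X w)) * (- (of_nat d ^ n * \<omega> w)) * L n w = 0" by (simp add: algebra_simps)
   moreover have "(e has_field_derivative deriv (L n) w * exp (- (of_nat d ^ n * X w)) +
     exp (- (of_nat d ^ n * X w)) * (- (of_nat d ^ n * \<omega> w)) * L n w) (at w)"
    unfolding e_def[abs_def] by (rule DERIV_mult[OF holomorphic_derivI[OF L S w] dE])
   ultimately show ?thesis by simp
  qed
  have "\<exists>k. \<forall>w\<in>ball z r. e w = k" by (rule has_field_derivative_zero_constant[OF convex_ball])
     (use De r(2) has_field_derivative_at_within in blast)
  hence econst: "e w = e z" if "w \<in> ball z r" for w using that r(1) by auto
  show ?thesis
  proof (intro exI[of _ "e z"] exI[of _ r] conjI r ballI)
   show "e z ~= 0" using Lnz[OF z] by (simp add: e_def)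
   fix w assume "w \<in> ball z r"
   hence "e w = e z" by (rule econst)
   hence "L n w * (exp (- (of_nat d ^ n * X w)) * exp (of_nat d ^ n * X w)) = e z * exp (of_nat d ^ n * X w)"
    by (simp add: e_def)
   thus "L n w = e z * exp (of_nat d ^ n * X w)" by (simp flip: exp_add)
  qed
 qed
 have "(\<lambda>z. green_plus d H (\<tau> z) - Re (X z)) constant_on C"
 proof (rule locally_constant_imp_constant[OF conn])
  fix z assume z: "z \<in> C"
  define n where "n = nn z"
  obtain c r where cr: "c ~= 0" "r > 0" "ball z r \<subseteq> S n" "\<forall>w\<in>ball z r. L n w = c * exp (of_nat d ^ n * X w)"
   using loc[OF nn[OF z]] unfolding n_def by (elim exE conjE)
  have "green_plus d H (\<tau> w) - Re (X w) = ln (cmod c) / real d ^ n" if w: "w \<in> ball z r" for w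
  proof -
   have "\<tau> w \<in> E n" using cr(3) w by (auto simp: S_def)
   hence "green_plus d H (\<tau> w) = ln (cmod (L n w)) / real d ^ n" unfolding L_def by (rule green_eq(2))
   also have "cmod (L n w) = cmod c * exp (real d ^ n * Re (X w))"
   proof -
    have "of_nat d ^ n * X w = of_real (real d ^ n) * X w" by simp
    hence "Re (of_nat d ^ n * X w) = real d ^ n * Re (X w)"
     by (simp only: times_complex.sel Re_complex_of_real Im_complex_of_real mult_zero_left diff_zero)
    thus ?thesis unfolding bspec[OF cr(4) w] norm_mult norm_exp_eq_Re by (simp only:)
   qed
   also have "ln (cmod c * exp (real d ^ n * Re (X w))) = ln (cmod c) + real d ^ n * Re (X w)"
    using cr(1) by (simp add: ln_mult)
   finally show ?thesis using d0 by (simp add: add_divide_distrib)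
  qed
  moreover have "z \<in> ball z r" using cr(2) by simp
  moreover have "openin (top_of_set C) (ball z r)" using cr(3) by (intro open_subset) (auto simp: S_def)
  ultimately show "\<exists>T. openin (top_of_set C) T & z \<in> T \<and>
    (\<forall>w\<in>T. green_plus d H (\<tau> w) - Re (X w) = green_plus d H (\<tau> z) - Re (X z))" by (intro exI[of _ "ball z r"]) simp
 qed
 then obtain b where b: "\<And>z. z \<in> C ==> green_plus d H (\<tau> z) - Re (X z) = b" unfolding constant_on_def by blast
 have XH: "(\<lambda>z. X z + of_real b) holomorphic_on C"
  by (intro holomorphic_intros) (use X C(1) holomorphic_on_open in blast)
 show ?thesis
 proof (intro exI[of _ "\<lambda>z. X z + of_real b"] conjI ballI allI impI XH)
  fix z assume z: "z \<in> C"
  show "Re (X z + of_real b) = green_plus d H (\<tau> z)" using b[OF z] by simp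
  fix n assume "\<tau> z \<in> E n"
  hence "z \<in> S n" using z by (simp add: S_def)
  from loc[OF this] obtain c r where cr: "c ~= 0" "r > 0" "ball z r \<subseteq> S n"
   "\<forall>w\<in>ball z r. L n w = c * exp (of_nat d ^ n * X w)" by (elim exE conjE)
  show "\<exists>c r. c ~= 0 & r > 0 & ball z r \<subseteq> C \<and>
    (\<forall>w\<in>ball z r. Lam n (\<tau> w) = c * exp (of_nat d ^ n * (X w + of_real b)))"
  proof (intro exI[of _ "c / exp (of_nat d ^ n * of_real b)"] exI[of _ r] conjI cr ballI)
   show "c / exp (of_nat d ^ n * of_real b) ~= 0" using cr(1) by simp
   show "ball z r \<subseteq> C" using cr(3) by (auto simp: S_def)
   fix w assume "w \<in> ball z r"
   thus "Lam n (\<tau> w) = c / exp (of_nat d ^ n * of_real b) * exp (of_nat d ^ n * (X w + of_real b))"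
    using cr(4) unfolding L_def by (simp add: distrib_left exp_add)
  qed
 qed
qed

lemma green_small_on_component:
 fixes \<tau> :: "complex => C2"
 assumes ct: "continuous_on UNIV \<tau>" and C: "C \<in> components (\<tau> -` U_plus H)"
  and z0: "\<tau> z0 \<notin> U_plus H" and e: "e > 0"
 shows "\<exists>z\<in>C. green_plus d H (\<tau> z) < e"
proof -
 have openU: "open (\<tau> -` U_plus H)" by (rule open_vimage[OF open_U ct])
 have C_sub: "C \<subseteq> \<tau> -` U_plus H" using C by (rule in_components_subset)
 have C_ne: "C ~= {}" using C by (rule in_components_nonempty)
 have C_open: "open C" using open_components[OF openU C] .
 have "C ~= UNIV" using C_sub z0 by blast
 hence "frontier C ~= {}" using frontier_not_empty[of C] C_ne by blast
 then obtain \<xi> where \<xi>: "\<xi> \<in> frontier C" by blast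
 have \<xi>C: "\<xi> \<notin> C" using \<xi> C_open by (simp add: frontier_def interior_open)
 have \<xi>U: "\<tau> \<xi> \<notin> U_plus H"
 proof
  assume "\<tau> \<xi> \<in> U_plus H"
  hence "\<xi> \<in> \<tau> -` U_plus H" by simp
  then obtain r where r: "r > 0" "ball \<xi> r \<subseteq> \<tau> -` U_plus H" by (rule openE[OF openU])
  have "C \<inter> ball \<xi> r ~= {}" using \<xi> r(1) open_Int_closure_eq_empty[of "ball \<xi> r" C] unfolding frontier_def
   by (metis DiffD1 IntI centre_in_ball empty_iff open_ball Int_commute)
  hence "ball \<xi> r \<subseteq> C" by (rule components_maximal[OF C convex_connected[OF convex_ball] r(2)])
  hence "\<xi> \<in> C" by (rule subsetD) (simp add: r(1))
  thus False using \<xi>C by (rule notE[rotated])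
 qed
 have "\<forall>\<^sub>F q in nhds (\<tau> \<xi>). q \<in> U_plus H --> green_plus d H q < e" by (rule green_small_near_K[OF \<xi>U e])
 moreover have "isCont \<tau> \<xi>" using ct by (simp add: continuous_on_eq_continuous_at)
 hence "(\<tau> \<longlongrightarrow> \<tau> \<xi>) (nhds \<xi>)" unfolding isCont_def tendsto_at_iff_tendsto_nhds .
 ultimately have "\<forall>\<^sub>F z in nhds \<xi>. \<tau> z \<in> U_plus H --> green_plus d H (\<tau> z) < e" by (rule eventually_compose_filterlim)
 then obtain W where W: "open W" "\<xi> \<in> W" "\<forall>z\<in>W. \<tau> z \<in> U_plus H --> green_plus d H (\<tau> z) < e"
  unfolding eventually_nhds by blast
 have "W \<inter> C ~= {}" using \<xi> W(1,2) open_Int_closure_eq_empty[of W C] unfolding frontier_def by blast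
 then obtain z where "z \<in> W" "z \<in> C" by blast
 thus ?thesis using W(3) C_sub by (intro bexI[of _ z]) auto
qed

text \<open>
  By analytic continuation \<open>G\<close> would be constant on the whole component; but it is positive there and
  tends to 0 at the boundary.
\<close>

lemma leaf_green_nonconstant:
 fixes \<tau> :: "complex => C2"
 assumes \<tau>: "hmap \<tau> UNIV" and C: "C \<in> components (\<tau> -` U_plus H)"
  and z0: "\<tau> z0 \<notin> U_plus H" and r: "r > 0" "ball z r \<subseteq> C"
 shows "\<exists>w\<in>ball z r. green_plus d H (\<tau> w) ~= green_plus d H (\<tau> z)"
proof (rule ccontr)
 assume c: "\<not> (\<exists>w\<in>ball z r. green_plus d H (\<tau> w) ~= green_plus d H (\<tau> z))"
 have ct: "continuous_on UNIV \<tau>" by (rule hmap_continuous_on[OF \<tau>])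
 have C_sub: "C \<subseteq> \<tau> -` U_plus H" using C by (rule in_components_subset)
 have C_open: "open C" using open_components[OF open_vimage[OF open_U ct] C] .
 have conn: "connected C" using C by (rule in_components_connected)
 have zC: "z \<in> C" using r by auto
 define G where "G w = green_plus d H (\<tau> w)" for w
 define Q where "Q w \<longleftrightarrow> (\<exists>s>0. \<forall>v\<in>ball w s. G v = G z)" for w
 have nbd: "\<exists>s>0. ball w s \<subseteq> C & (\<forall>x\<in>ball w s. Q x --> (\<forall>v\<in>ball w s. G v = G z))" if w: "w \<in> C" for w
 proof -
  obtain n where n: "\<tau> w \<in> E n" using C_sub w unfolding U_eq_E by blast
  have op: "open (C \<inter> \<tau> -` E n)" by (intro open_Int C_open open_vimage open_E ct)
  have "w \<in> C \<inter> \<tau> -` E n" using w n by simp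
  then obtain s where s: "s > 0" "ball w s \<subseteq> C \<inter> \<tau> -` E n" by (rule openE[OF op])
  define L where "L v = Lam n (\<tau> v)" for v
  have "hmap (\<lambda>v. Lam n (\<tau> v)) (ball w s)"
   by (rule hmap_compose[OF hmap_subset[OF \<tau> subset_UNIV] Lam_holomorphic]) (use s(2) in blast)
  hence L: "L holomorphic_on ball w s" unfolding L_def hmap_complex[OF open_ball] .
  have mod: "cmod (L v) = exp (real d ^ n * G v)" if "v \<in> ball w s" for v
   unfolding L_def G_def by (rule cmod_Lam) (use s(2) that in blast)
  have "G v = G z" if x: "x \<in> ball w s" "Q x" and v: "v \<in> ball w s" for x v
  proof -
   obtain t where t: "t > 0" "\<forall>v\<in>ball x t. G v = G z" using x(2) unfolding Q_def by blast
   have Gx: "G x = G z" using t by simp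
   have op2: "open (ball x t \<inter> ball w s)" by auto
   have "x \<in> ball x t \<inter> ball w s" using t(1) x(1) by simp
   then obtain t' where t': "t' > 0" "ball x t' \<subseteq> ball x t \<inter> ball w s" by (rule openE[OF op2])
   have Lx: "L y = L x" if y: "y \<in> ball x t'" for y
   proof (rule holomorphic_same_modulus[OF open_ball convex_connected[OF convex_ball] _ holomorphic_on_const _ _ _ refl y])
    show "L holomorphic_on ball x t'" using L t'(2) holomorphic_on_subset by blast
    show "L x ~= 0" using mod[OF x(1)] by auto
    show "x \<in> ball x t'" using t'(1) by simp
    fix y assume "y \<in> ball x t'"
    hence "y \<in> ball x t" "y \<in> ball w s" using t'(2) by blast+
    thus "cmod (L y) = cmod (L x)" using mod x(1) t(2) Gx by simp
   qed
   have "L y - L x = 0" if "y \<in> ball w s" for y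
   proof (rule analytic_continuation[of "\<lambda>y. L y - L x" "ball w s" "ball x t'" x])
    show "(\<lambda>y. L y - L x) holomorphic_on ball w s" by (intro holomorphic_intros L)
    show "ball x t' \<subseteq> ball w s" using t'(2) by blast
    show "x islimpt ball x t'" using t'(1) by (intro interior_limit_point) (simp add: interior_open)
    show "L y - L x = 0" if "y \<in> ball x t'" for y using Lx[OF that] by simp
   qed (use that x(1) in auto)
   hence Lvx: "L v = L x" using v by simp
   have "exp (real d ^ n * G v) = cmod (L v)" by (rule mod[OF v, symmetric])
   also have "... = exp (real d ^ n * G x)" unfolding Lvx by (rule mod[OF x(1)])
   finally show ?thesis using d Gx by auto
  qed
  thus ?thesis using s by blast
 qed
 have Q: "Q w" if w: "w \<in> C" for w
 proof (rule connected_induction_simple[OF conn zC w])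
  show "Q z" unfolding Q_def G_def using c r(1) by blast
  fix a assume "a \<in> C"
  from nbd[OF this] obtain s where s: "s > 0" "ball a s \<subseteq> C"
   "\<forall>x\<in>ball a s. Q x --> (\<forall>v\<in>ball a s. G v = G z)" by (elim exE conjE)
  show "\<exists>T. openin (top_of_set C) T & a \<in> T & (\<forall>x\<in>T. \<forall>y\<in>T. Q x --> Q y)"
  proof (intro exI[of _ "ball a s"] conjI ballI impI)
   show "openin (top_of_set C) (ball a s)" using s(2) by (intro open_subset) auto
   show "a \<in> ball a s" using s(1) by simp
   fix x y assume xy: "x \<in> ball a s" "y \<in> ball a s" "Q x"
   obtain t where t: "t > 0" "ball y t \<subseteq> ball a s" by (rule openE[OF open_ball xy(2)])
   show "Q y" unfolding Q_def using t s(3) xy by blast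
  qed
 qed
 have k: "G w = G z" if "w \<in> C" for w using Q[OF that] by (auto simp: Q_def)
 have "0 < G z" using green_pos[of "\<tau> z"] C_sub zC by (auto simp: G_def)
 from green_small_on_component[OF ct C z0 this] obtain w where "w \<in> C" "G w < G z" unfolding G_def by blast
 thus False using k by simp
qed

end


lemma unstable_param_into:
 assumes "unstable_param H p \<tau>" "q \<in> W_unstable H p"
 shows "\<tau> (inv \<tau> q) = q" using assms by (simp add: unstable_param_def f_inv_into_f)

text \<open>
  The transition between two parametrizations is continuous in both directions, although the
  unstable manifold need not carry the subspace topology.
\<close>

lemma component_reparametrize:
 assumes h: "henon_map d H" "hyperbolic H" and p: "p \<in> Julia H"
  and \<sigma>: "unstable_param H p \<sigma>" and \<tau>: "unstable_param H p \<tau>"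
  and C: "C \<in> components (\<sigma> -` U_plus H)" "simply_connected C"
 shows "\<exists>C'. C' \<in> components (\<tau> -` U_plus H) & simply_connected C'"
proof -
 interpret henon_conj d H H id id by (rule henon_conj_id[OF h(1)])
 define k where "k = (\<lambda>z. inv \<tau> (\<sigma> z))"
 define k' where "k' = (\<lambda>z. inv \<sigma> (\<tau> z))"
 have inW: "\<sigma> z \<in> W_unstable H p" "\<tau> z \<in> W_unstable H p" for z using \<sigma> \<tau> by (auto simp: unstable_param_def)
 have k: "\<tau> (k z) = \<sigma> z" and k': "\<sigma> (k' z) = \<tau> z" for z
  unfolding k_def k'_def using unstable_param_into[OF \<tau>] unstable_param_into[OF \<sigma>] inW by blast+
 have "inj \<tau>" "inj \<sigma>" using \<sigma> \<tau> by (auto simp: unstable_param_def)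
 hence kk': "k (k' z) = z" and k'k: "k' (k z) = z" for z using k k' by (metis injD)+
 have ck: "continuous_on UNIV k" "continuous_on UNIV k'"
  using continuous_transition[OF h(2,2) p p \<sigma> \<tau>] continuous_transition[OF h(2,2) p p \<tau> \<sigma>]
  by (simp_all add: k_def k'_def)
 have Cs: "C \<subseteq> \<sigma> -` U_plus H" "C ~= {}" "connected C"
  using C(1) in_components_subset in_components_nonempty in_components_connected by blast+
 have maxC: "D \<subseteq> C" if "connected D" "D \<subseteq> \<sigma> -` U_plus H" "D \<inter> C ~= {}" for D
  using components_maximal[OF C(1) that(1,2)] that(3) by blast
 have "k ` C \<in> components (\<tau> -` U_plus H)" unfolding in_components_maximal
 proof (intro conjI allI impI)
  show "k ` C ~= {}" using Cs(2) by simp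
  show "connected (k ` C)" by (rule connected_continuous_image[OF continuous_on_subset[OF ck(1)] Cs(3)]) simp
  show "k ` C \<subseteq> \<tau> -` U_plus H" using Cs(1) k by auto
  fix D assume D: "D ~= {} & k ` C \<subseteq> D & D \<subseteq> \<tau> -` U_plus H & connected D"
  have "connected (k' ` D)" by (rule connected_continuous_image[OF continuous_on_subset[OF ck(2)]]) (use D in auto)
  moreover have "k' ` D \<subseteq> \<sigma> -` U_plus H" using D k' by auto
  moreover have "k' ` D \<inter> C ~= {}"
  proof -
   obtain c where c: "c \<in> C" using Cs(2) by blast
   hence "k c \<in> D" using D by blast
   hence "k' (k c) \<in> k' ` D" by (rule imageI)
   thus ?thesis using c k'k by auto
  qed
  ultimately have "k' ` D \<subseteq> C" by (rule maxC)
  hence "k ` k' ` D \<subseteq> k ` C" by (rule image_mono)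
  moreover have "k ` k' ` D = D" by (simp add: image_image kk')
  ultimately have "D \<subseteq> k ` C" by (simp only:)
  thus "D = k ` C" using D by blast
 qed
 moreover have "simply_connected (k ` C)"
 proof -
  have "homeomorphism C (k ` C) k k'" by (rule homeomorphismI) (auto simp: k'k kk' intro: continuous_on_subset ck)
  hence "C homeomorphic k ` C" by (auto simp: homeomorphic_def)
  thus ?thesis using C(2) homeomorphic_simply_connected_eq[of C "k ` C"] by simp
 qed
 ultimately show ?thesis by blast
qed

context disc_motion
begin

text \<open>
  On the component \<open>C\<close> the assumptions of \<open>radial_beltrami\<close> hold, so \<open>A x 1 = x\<close> for small \<open>x\<close>. Every level
  is the image of a small one under iteration, and \<open>A\<close> commutes with multiplication by \<open>d\<close>.
\<close>

lemma unstable_rigidity: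
 assumes hyp: "hyperbolic (F 0)" "hyperbolic (F 1)" and p0: "p0 \<in> Julia (F 0)"
  and \<tau>: "unstable_param (F 0) p0 \<tau>" and \<tau>1: "unstable_param (F 1) (P 1 p0) \<tau>1"
  and C: "C \<in> components (\<tau> -` U)" "simply_connected C"
  and \<Omega>: "\<Omega> = \<tau> -` (W_unstable (F 0) p0 - Julia (F 0))"
  and bel: "has_beltrami_coeff_on (\<lambda>z. inv \<tau>1 (P 1 (\<tau> z))) \<Omega> \<mu>" and har: "harmonic_beltrami \<Omega> \<mu>"
  and p: "p \<in> U"
 shows "A (G0 p) 1 = of_real (G0 p)"
proof -
 obtain Es0 Eu0 C0 \<kappa>0 where hh0: "hyperbolic_henon d (F 0) Es0 Eu0 C0 \<kappa>0"
  using hyperbolic_henonI[OF henon.henon[OF henon[OF zero_cball]] hyp(1)] by (elim exE)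
 interpret h0: henon_dyn d M "F 0" "inv (F 0)" by (rule dyn[OF zero_cball])
 interpret h1: henon_dyn d M "F 1" "inv (F 1)" by (rule dyn[OF one_cball])
 interpret H0: henon d "F 0" by (rule henon[OF zero_cball])
 interpret mo: henon_motion d "F 0" "F 1" "P 1" "P' 1" by (rule motion[OF one_cball])
 have WJ: "W_unstable (F 0) p0 \<subseteq> J_minus (F 0)" using hyperbolic_henon.unstable_in_J_minus[OF hh0 p0] by blast
 have \<tau>h: "hmap \<tau> UNIV" and \<tau>W: "\<And>z. \<tau> z \<in> W_unstable (F 0) p0" using \<tau> by (auto simp: unstable_param_def)
 have ct: "continuous_on UNIV \<tau>" by (rule hmap_continuous_on[OF \<tau>h])
 have openU: "open (\<tau> -` U)" by (rule open_vimage[OF open_U ct])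
 have C_sub: "C \<subseteq> \<tau> -` U" using C(1) by (rule in_components_subset)
 have C_ne: "C ~= {}" using C(1) by (rule in_components_nonempty)
 have C_open: "open C" using open_components[OF openU C(1)] .
 have C_conn: "connected C" using C(1) by (rule in_components_connected)
 have CU: "\<tau> z \<in> U" if "z \<in> C" for z using C_sub that by blast
 obtain X0 where X0: "X0 holomorphic_on C" "\<forall>z\<in>C. Re (X0 z) = G0 (\<tau> z)"
  "\<forall>z\<in>C. \<forall>n. \<tau> z \<in> h0.E n --> (\<exists>c r. c ~= 0 & r > 0 & ball z r \<subseteq> C \<and>
    (\<forall>w\<in>ball z r. h0.Lam n (\<tau> w) = c * exp (of_nat d ^ n * X0 w)))"
  using h0.global_log[OF C_open C(2) hmap_subset[OF \<tau>h subset_UNIV]] CU by blast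
 have sub_X: "(\<lambda>z. Re (X0 z)) ` C \<subseteq> X" using X0(2) CU by (auto simp: X_def)
 have small: "\<exists>z\<in>C. Re (X0 z) < e" if e: "e > 0" for e
 proof -
  have "p0 \<in> range \<tau>" using \<tau> H0.W_unstable_refl by (simp add: unstable_param_def)
  then obtain z0 where "p0 = \<tau> z0" by blast
  moreover have "p0 \<notin> U" using p0 by (simp add: Julia_def H0.J_plus_iff U_plus_def)
  ultimately have "\<tau> z0 \<notin> U" by simp
  from h0.green_small_on_component[OF ct C(1) this e] show ?thesis using X0(2) by auto
 qed
 have \<Omega>_eq: "\<Omega> = {z. \<tau> z \<notin> J_plus (F 0)}" unfolding \<Omega> using \<tau>W WJ by (auto simp: Julia_def)
 have C\<Omega>: "C \<subseteq> \<Omega>" unfolding \<Omega>_eq using CU by (auto simp: H0.J_plus_iff U_plus_def)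
 \<comment> \<open>The harmonic coefficient refers to the hyperbolic metric of the component of \<open>\<Omega>\<close>, which is \<open>C\<close>.\<close>
 have comp: "connected_component_set \<Omega> z = C" if z: "z \<in> C" for z
 proof
  define K where "K = connected_component_set \<Omega> z"
  have zK: "z \<in> K" unfolding K_def mem_Collect_eq connected_component_refl_eq by (rule subsetD[OF C\<Omega> z])
  show "C \<subseteq> connected_component_set \<Omega> z" by (rule connected_component_maximal[OF z C_conn C\<Omega>])
  have cK: "connected K" unfolding K_def by (rule connected_connected_component)
  have c: "connected (\<tau> ` K)" by (rule connected_continuous_image[OF continuous_on_subset[OF ct subset_UNIV] cK])
  have K\<Omega>: "K \<subseteq> \<Omega>" unfolding K_def by (rule connected_component_subset)
  have f: "\<tau> ` K \<inter> frontier (K_plus (F 0)) = {}"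
  proof (rule equals0I, elim IntE imageE)
   fix q w assume "q \<in> frontier (K_plus (F 0))" "q = \<tau> w" "w \<in> K"
   thus False using subsetD[OF K\<Omega>, of w] unfolding \<Omega>_eq J_plus_def by simp
  qed
  have "\<tau> z \<notin> K_plus (F 0)" using CU[OF z] by (simp add: U_plus_def)
  hence "\<tau> ` K - K_plus (F 0) ~= {}" using zK by blast
  hence "\<tau> ` K \<inter> K_plus (F 0) = {}" using connected_Int_frontier[OF c, of "K_plus (F 0)"] f by argo
  hence KU: "K \<subseteq> \<tau> -` U" unfolding U_plus_def by fast
  have "K \<inter> C ~= {}" using zK z by blast
  hence "C \<inter> K ~= {}" by (simp add: Int_commute)
  hence "K \<subseteq> C" using components_maximal[OF C(1) cK KU] by argo
  thus "connected_component_set \<Omega> z \<subseteq> C" by (simp only: K_def)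
 qed
 obtain \<nu> rho where nu: "\<nu> holomorphic_on \<Omega>" "hyperbolic_density \<Omega> rho"
  "\<forall>z\<in>\<Omega>. \<mu> z = cnj (\<nu> z) / complex_of_real ((rho z)\<^sup>2)" using har unfolding harmonic_beltrami_def by (elim exE conjE)
 have dens: "\<exists>\<pi>. \<pi> holomorphic_on ball 0 1 & \<pi> ` ball 0 1 \<subseteq> C & \<pi> 0 = z \<and>
   deriv \<pi> 0 ~= 0 & rho z = 2 / cmod (deriv \<pi> 0)" if z: "z \<in> C" for z
 proof -
  obtain \<pi> where \<pi>: "\<pi> holomorphic_on ball 0 1" "covering_space (ball 0 1) \<pi> (connected_component_set \<Omega> z)"
    "\<pi> 0 = z" "rho z = 2 / cmod (deriv \<pi> 0)"
   using bspec[OF nu(2)[unfolded hyperbolic_density_def] subsetD[OF C\<Omega> z]] by (elim exE conjE)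
  have "\<pi> ` ball 0 1 = C" using covering_space_imp_surjective[OF \<pi>(2)] comp[OF z] by simp
  moreover have "deriv \<pi> 0 ~= 0" by (rule covering_space_deriv_nonzero[OF \<pi>(1,2) open_ball]) simp
  ultimately show ?thesis using \<pi> by (intro exI[of _ \<pi>]) simp
 qed
 define k where "k = (\<lambda>z. inv \<tau>1 (P 1 (\<tau> z)))"
 have MD: "\<tau> z \<in> motion_domain (F 0)" for z using \<tau>W WJ by (auto simp: motion_domain_def)
 have k: "\<tau>1 (k z) = P 1 (\<tau> z)" for z
 proof -
  obtain p'' where "p'' \<in> Julia (F 1)" "P 1 ` W_unstable (F 0) p0 = W_unstable (F 1) p''"
   using mo.unstable_image[OF p0] by blast
  hence "P 1 p0 \<in> W_unstable (F 1) p''" "P 1 (\<tau> z) \<in> W_unstable (F 1) p''" using H0.W_unstable_refl \<tau>W by blast+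
  hence "P 1 (\<tau> z) \<in> W_unstable (F 1) (P 1 p0)" using mo.h1.W_unstable_eq by blast
  thus ?thesis unfolding k_def by (rule unstable_param_into[OF \<tau>1])
 qed
 have local: "\<exists>a. ((\<lambda>x. A x 1) has_vector_derivative a) (at (Re (X0 z))) & a + 1 ~= 0 \<and>
   d_zbar k z / d_z k z = (a - 1) / (a + 1) * (cnj (deriv X0 z) / deriv X0 z)"
  if z: "z \<in> C" and nz: "deriv X0 z ~= 0" and kd: "k differentiable (at z)" for z
 proof -
  obtain n r where r: "r > 0" "ball (\<tau> z) r \<subseteq> U" "\<forall>q\<in>ball (\<tau> z) r. (F 0 ^^ n) q \<in> V & P 1 ((F 0 ^^ n) q) \<in> V \<and>
    ph 1 (P 1 ((F 0 ^^ n) q)) = ph 0 ((F 0 ^^ n) q) *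
     exp (of_nat d ^ n * (A (G0 q) 1 - of_real (G0 q)))" using phi_relation_local[OF CU[OF z]] by (elim exE conjE)
  have "(F 0 ^^ n) (\<tau> z) \<in> V" using bspec[OF r(3), of "\<tau> z"] r(1) by simp
  hence "\<tau> z \<in> h0.E n" by (simp add: h0.E_def)
  then obtain c s where cs: "c ~= 0" "s > 0" "ball z s \<subseteq> C"
    "\<forall>w\<in>ball z s. h0.Lam n (\<tau> w) = c * exp (of_nat d ^ n * X0 w)" using bspec[OF X0(3) z] by blast
  define S where "S = ball z s \<inter> \<tau> -` ball (\<tau> z) r"
  have S: "open S" unfolding S_def by (intro open_Int open_ball open_vimage ct)
  have zS: "z \<in> S" using cs(2) r(1) by (simp add: S_def)
  have SC: "S \<subseteq> C" using cs(3) by (auto simp: S_def)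
  define g where "g = (\<lambda>y. h1.Lam n (\<tau>1 y))"
  have E1: "P 1 (\<tau> w) \<in> h1.E n & h1.Lam n (P 1 (\<tau> w)) =
    ph 0 ((F 0 ^^ n) (\<tau> w)) * exp (of_nat d ^ n * (A (G0 (\<tau> w)) 1 - of_real (G0 (\<tau> w))))" if "w \<in> S" for w
  proof -
   have "\<tau> w \<in> ball (\<tau> z) r" using that by (simp add: S_def)
   from bspec[OF r(3) this] show ?thesis
    unfolding h1.E_def h1.Lam_def vimage_eq P_iterate[OF one_cball MD, symmetric] by blast
  qed
  have "k z \<in> \<tau>1 -` h1.E n" using E1[OF zS] k by simp
  moreover have t1: "hmap \<tau>1 UNIV" using \<tau>1 by (simp add: unstable_param_def)
  moreover have op: "open (\<tau>1 -` h1.E n)" by (rule open_vimage[OF h1.open_E hmap_continuous_on[OF t1]])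
  moreover have "hmap g (\<tau>1 -` h1.E n)"
   unfolding g_def by (rule hmap_compose[OF hmap_subset[OF t1 subset_UNIV] h1.Lam_holomorphic]) blast
  ultimately have gd: "(g has_field_derivative deriv g (k z)) (at (k z))"
   using holomorphic_derivI unfolding hmap_complex[OF op] by blast
  have eq: "g (k w) = c * exp (of_real (real d ^ n) * (X0 w + A (Re (X0 w)) 1 - of_real (Re (X0 w))))" if w: "w \<in> S" for w
  proof -
   have wC: "w \<in> C" using SC w by blast
   have x: "G0 (\<tau> w) = Re (X0 w)" using X0(2) wC by simp
   have "ph 0 ((F 0 ^^ n) (\<tau> w)) = c * exp (of_nat d ^ n * X0 w)"
    using bspec[OF cs(4), of w] w unfolding h0.Lam_def by (simp add: S_def)
   hence "g (k w) = c * exp (of_nat d ^ n * X0 w) * exp (of_nat d ^ n * (A (Re (X0 w)) 1 - of_real (Re (X0 w))))"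
    using E1[OF w] by (simp add: g_def k x)
   also have "... = c * exp (of_nat d ^ n * X0 w + of_nat d ^ n * (A (Re (X0 w)) 1 - of_real (Re (X0 w))))"
    by (simp add: exp_add)
   also have "of_nat d ^ n * X0 w + of_nat d ^ n * (A (Re (X0 w)) 1 - of_real (Re (X0 w)))
     = of_real (real d ^ n) * (X0 w + A (Re (X0 w)) 1 - of_real (Re (X0 w)))" by (simp add: algebra_simps)
   finally show ?thesis .
  qed
  obtain e where e: "e > 0" "{Re (X0 z) - e<..<Re (X0 z) + e} \<subseteq> (\<lambda>w. Re (X0 w)) ` C"
   using Re_image_neighbourhood[OF C_open z X0(1) nz] by (elim exE conjE)
  have eX: "t \<in> X" if "t \<in> {Re (X0 z) - e<..<Re (X0 z) + e}" for t using e(2) sub_X that by blast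
  have "continuous_on {Re (X0 z) - e<..<Re (X0 z) + e} (\<lambda>x. A x 1)"
  proof (rule lipschitz_on_continuous_on)
   show "((\<rho> + 1) / (\<rho> - 1))-lipschitz_on {Re (X0 z) - e<..<Re (X0 z) + e} (\<lambda>x. A x 1)"
    using A_Lipschitz[OF eX eX] \<rho> by (intro lipschitz_onI) (auto simp: dist_norm)
  qed
  hence ic: "isCont (\<lambda>x. A x 1) (Re (X0 z))" by (rule continuous_on_interior) (use e(1) in \<open>simp add: interior_open\<close>)
  have mono: "\<forall>\<^sub>F t in at_right (Re (X0 z)). Re (A (Re (X0 z)) 1) <= Re (A t 1)" unfolding eventually_at_right_field
  proof (intro exI[of _ "Re (X0 z) + e"] conjI allI impI)
   show "Re (X0 z) < Re (X0 z) + e" using e(1) by simp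
   fix t assume t: "Re (X0 z) < t" "t < Re (X0 z) + e"
   show "Re (A (Re (X0 z)) 1) <= Re (A t 1)" using A_mono[OF eX eX t(1) D(4)] t e(1) by (simp add: less_imp_le)
  qed
  have dn: "real d ^ n ~= 0" using h0.d by simp
  show ?thesis by (rule beltrami_radial[OF S zS holomorphic_on_subset[OF X0(1) SC] nz kd gd eq cs(1) dn ic mono])
 qed
 have ae: "AE z in lborel. z \<in> \<Omega> --> k differentiable (at z) & d_z k z ~= 0 & \<mu> z = d_zbar k z / d_z k z"
  using bel unfolding has_beltrami_coeff_on_def k_def .
 then obtain Nl where Nl: "Nl \<in> null_sets lborel"
   "{z. \<not> (z \<in> \<Omega> --> k differentiable (at z) & d_z k z ~= 0 & \<mu> z = d_zbar k z / d_z k z)} \<subseteq> Nl"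
  unfolding eventually_ae_filter by auto
 have Nn: "negligible Nl" using Nl(1) by (simp add: negligible_iff_null_sets null_sets_completionI)
 have neg: "negligible {z\<in>C. deriv X0 z ~= 0 & \<not> (\<exists>a. ((\<lambda>x. A x 1) has_vector_derivative a) (at (Re (X0 z))) \<and>
   a + 1 ~= 0 & cnj (\<nu> z) / of_real ((rho z)\<^sup>2) = (a - 1) / (a + 1) * (cnj (deriv X0 z) / deriv X0 z))}"
 proof (rule negligible_subset[OF Nn], rule subsetI, rule ccontr)
  fix z assume z: "z \<in> {z\<in>C. deriv X0 z ~= 0 & \<not> (\<exists>a. ((\<lambda>x. A x 1) has_vector_derivative a) (at (Re (X0 z))) \<and>
    a + 1 ~= 0 & cnj (\<nu> z) / of_real ((rho z)\<^sup>2) = (a - 1) / (a + 1) * (cnj (deriv X0 z) / deriv X0 z))}"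
   and nN: "z \<notin> Nl"
  have zC: "z \<in> C" "deriv X0 z ~= 0" using z by blast+
  have "k differentiable (at z)" "\<mu> z = d_zbar k z / d_z k z" using nN Nl(2) subsetD[OF C\<Omega> zC(1)] by blast+
  hence "\<exists>a. ((\<lambda>x. A x 1) has_vector_derivative a) (at (Re (X0 z))) & a + 1 ~= 0 \<and>
    cnj (\<nu> z) / of_real ((rho z)\<^sup>2) = (a - 1) / (a + 1) * (cnj (deriv X0 z) / deriv X0 z)"
   using local[OF zC] bspec[OF nu(3) subsetD[OF C\<Omega> zC(1)]] by simp
  thus False using z by blast
 qed
 have rb: "radial_beltrami C X0 \<nu> rho (\<lambda>x. A x 1) d ((\<rho> + 1) / (\<rho> - 1))"
 proof
  show "0 < Re (X0 z)" if "z \<in> C" for z using h0.green_pos[OF CU[OF that]] X0(2) that by simp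
  show "\<nu> holomorphic_on C" by (rule holomorphic_on_subset[OF nu(1) C\<Omega>])
  show "2 <= d" by (rule h0.d)
  show "0 <= (\<rho> + 1) / (\<rho> - 1)" using \<rho> by simp
  show "cmod (A x 1 - A y 1) <= (\<rho> + 1) / (\<rho> - 1) * \<bar>x - y\<bar>"
   if "x \<in> (\<lambda>z. Re (X0 z)) ` C" "y \<in> (\<lambda>z. Re (X0 z)) ` C" for x y using that sub_X by (intro A_Lipschitz) blast+
  show "A (real d * x) 1 = of_nat d * A x 1" if "x \<in> (\<lambda>z. Re (X0 z)) ` C" for x
   using that sub_X by (intro A_d(2) D(4)) blast
 qed (fact C_open C_conn X0(1) small dens neg)+
 obtain \<epsilon> where \<epsilon>: "\<epsilon> > 0" "\<forall>x\<in>{0<..<\<epsilon>}. A x 1 = of_real x"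
  using radial_beltrami.radial_identity[OF rb] by (elim exE conjE)
 have d1: "1 < real d" using h0.d by simp
 obtain n where n: "G0 p / \<epsilon> < real d ^ n"  using real_arch_pow[OF d1, of "G0 p / \<epsilon>"] by (elim exE)
 define q where "q = (inv (F 0) ^^ n) p"
 have qU: "q \<in> U" using p H0.backward_invariant(2)[of U, OF H0.U_plus_inv] by (simp add: q_def)
 have Gq: "G0 p = real d ^ n * G0 q" using h0.green_iterate[OF qU, of n] by (simp add: q_def H0.fp.iterate_cancel)
 have "G0 q < \<epsilon>" using n \<epsilon>(1) d1 unfolding Gq by (simp add: divide_less_eq)
 hence base: "A (G0 q) 1 = of_real (G0 q)" using \<epsilon>(2) h0.green_pos[OF qU] by simp
 have "real d ^ m * G0 q \<in> X \<and>
   A (real d ^ m * G0 q) 1 = of_real (real d ^ m * G0 q)" for m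
 proof (induction m)
  case 0 thus ?case using base qU by (simp add: X_def)
 next
  case (Suc m)
  thus ?case using A_d[of "real d ^ m * G0 q" 1] D(4) by (simp add: mult.assoc)
 qed
 thus ?thesis by (simp add: Gq)
qed

end


section \<open>Equality of the solenoidal maps and holomorphy on leaves\<close>

text \<open>
  Where \<open>g' \<noteq> 0\<close>, \<open>k\<close> is \<open>g \<circ> k\<close> followed by a local inverse of \<open>g\<close>. The other points are isolated since \<open>k\<close> is
  injective, and they are removable since \<open>k\<close> is continuous.
\<close>

lemma holomorphic_lift:
 fixes k g :: "complex => complex"
 assumes S: "open S" and k: "continuous_on S k" "inj_on k S" and g: "g holomorphic_on \<Omega>" and \<Omega>: "open \<Omega>"
  and sub: "k ` S \<subseteq> \<Omega>" and gk: "(\<lambda>w. g (k w)) holomorphic_on S"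
  and nc: "\<And>w r. r > 0 ==> ball w r \<subseteq> S ==> \<exists>v\<in>ball w r. g (k v) ~= g (k w)"
 shows "k holomorphic_on S"
proof -
 have regular: "k field_differentiable (at w)" if w: "w \<in> S" and nz: "deriv g (k w) ~= 0" for w
 proof -
  obtain r where r: "r > 0" "ball (k w) r \<subseteq> \<Omega>" "inj_on g (ball (k w) r)"
   using has_complex_derivative_locally_injective[OF g _ \<Omega> nz] sub w by blast
  have gr: "g holomorphic_on ball (k w) r" by (rule holomorphic_on_subset[OF g r(2)])
  obtain h where h: "h holomorphic_on (g ` ball (k w) r)"
   "\<And>z. z \<in> ball (k w) r ==> deriv g z * deriv h (g z) = 1" "\<And>z. z \<in> ball (k w) r ==> h (g z) = z"
   using holomorphic_has_inverse[OF gr open_ball r(3)] by blast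
  define V where "V = S \<inter> k -` ball (k w) r"
  have V: "open V" unfolding V_def by (rule continuous_open_preimage[OF k(1) S open_ball])
  have wV: "w \<in> V" using w r(1) by (simp add: V_def)
  have gkV: "(\<lambda>v. g (k v)) holomorphic_on V" by (rule holomorphic_on_subset[OF gk]) (auto simp: V_def)
  have "(\<lambda>v. g (k v)) ` V \<subseteq> g ` ball (k w) r" by (auto simp: V_def)
  from holomorphic_on_compose_gen[OF gkV h(1) this] have "(\<lambda>v. h (g (k v))) holomorphic_on V" by (simp add: o_def)
  hence "k holomorphic_on V" by (rule holomorphic_transform) (use h(3) in \<open>simp add: V_def\<close>)
  thus ?thesis by (rule holomorphic_on_imp_differentiable_at[OF _ V wV])
 qed
 show ?thesis unfolding holomorphic_on_def
 proof
  fix w assume w: "w \<in> S"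
  show "k field_differentiable (at w within S)"
  proof (cases "deriv g (k w) = 0")
   case False
   thus ?thesis using regular[OF w] field_differentiable_at_within by blast
  next
   case True
   have "k w \<in> \<Omega>" using w sub by blast
   then obtain r where r: "r > 0" "ball (k w) r \<subseteq> \<Omega>" by (rule openE[OF \<Omega>])
   have gr: "g holomorphic_on ball (k w) r" by (rule holomorphic_on_subset[OF g r(2)])
   define V where "V = S \<inter> k -` ball (k w) r"
   have V: "open V" unfolding V_def by (rule continuous_open_preimage[OF k(1) S open_ball])
   have wV: "w \<in> V" using w r(1) by (simp add: V_def)
   obtain s where s: "s > 0" "ball w s \<subseteq> V" by (rule openE[OF V wV])
   have "\<exists>\<beta>\<in>ball (k w) r. deriv g \<beta> ~= 0"
   proof (rule ccontr)
    assume all: "\<not> (\<exists>\<beta>\<in>ball (k w) r. deriv g \<beta> ~= 0)"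
    have "(g has_field_derivative 0) (at y within ball (k w) r)" if "y \<in> ball (k w) r" for y
     using holomorphic_derivI[OF gr open_ball that] all that has_field_derivative_at_within by fastforce
    then obtain c where c: "\<forall>y\<in>ball (k w) r. g y = c" using has_field_derivative_zero_constant[OF convex_ball] by metis
    have "ball w s \<subseteq> S" using s(2) by (auto simp: V_def)
    from nc[OF s(1) this] obtain v where v: "v \<in> ball w s" "g (k v) ~= g (k w)" by (elim bexE)
    have "k v \<in> ball (k w) r" using s(2) v(1) by (auto simp: V_def)
    thus False using c v(2) r(1) by simp
   qed
   then obtain \<beta> where \<beta>: "\<beta> \<in> ball (k w) r" "deriv g \<beta> ~= 0" by (elim bexE)
   have kw: "k w \<in> ball (k w) r" using r(1) by simp
   obtain t where t: "0 < t" "ball (k w) t \<subseteq> ball (k w) r" "\<And>z. z \<in> ball (k w) t - {k w} ==> deriv g z ~= 0"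
    using isolated_zeros[OF holomorphic_deriv[OF gr open_ball] open_ball convex_connected[OF convex_ball] kw True \<beta>] by blast
   define T where "T = S \<inter> k -` ball (k w) t"
   have T: "open T" unfolding T_def by (rule continuous_open_preimage[OF k(1) S open_ball])
   have wT: "w \<in> T" using w t(1) by (simp add: T_def)
   have "k holomorphic_on T - {w}" unfolding holomorphic_on_def
   proof
    fix v assume v: "v \<in> T - {w}"
    hence vS: "v \<in> S" and "k v \<in> ball (k w) t" by (auto simp: T_def)
    moreover have "k v ~= k w" using k(2) v vS w by (auto dest: inj_onD)
    ultimately have "deriv g (k v) ~= 0" by (intro t(3)) simp
    from regular[OF vS this] show "k field_differentiable (at v within T - {w})" by (rule field_differentiable_at_within)
   qed
   hence "k holomorphic_on T" by (rule no_isolated_singularity[OF _ _ T, rotated])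
      (simp, rule continuous_on_subset[OF k(1)], simp add: T_def)
   hence "k field_differentiable (at w)" by (rule holomorphic_on_imp_differentiable_at[OF _ T wT])
   thus ?thesis by (rule field_differentiable_at_within)
  qed
 qed
qed

context henon_dyn
begin

text \<open>Far enough along an orbit the extension of \<open>\<phi>\<^sup>+\<close> is given by the formula on \<open>V\<^sup>+\<close>.\<close>

lemma phi_extension_deep:
 assumes \<phi>: "phi_plus_extension d H \<phi>"
 shows "\<exists>R\<ge>400 * M. \<forall>p\<in>J_minus H \<inter> Vo R. \<phi> p = phi p"
proof -
 obtain R \<phi>V where R: "R > 0" "phi_plus_on_V d H R \<phi>V" "\<forall>p\<in>J_minus H \<inter> V_plus R. \<phi> p = \<phi>V p"
  using \<phi> unfolding phi_plus_extension_def by (elim exE conjE)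
 show ?thesis
 proof (intro exI[of _ "max R (400 * M)"] conjI ballI)
  fix p assume p: "p \<in> J_minus H \<inter> Vo (max R (400 * M))"
  hence "p \<in> V_plus R" by (simp add: Vo_def V_plus_def case_prod_beta)
  hence "\<phi> p = \<phi>V p" using R(3) p by blast
  also have "... = phi p" by (rule phi_unique[OF R(1,2) IntD2[OF p]])
  finally show "\<phi> p = phi p" .
 qed simp
qed

lemma eventually_Vo:
 assumes p: "p \<in> U_plus H"
 shows "\<exists>n. \<forall>m\<ge>n. (H ^^ m) p \<in> Vo R"
proof -
 obtain n where n: "(H ^^ n) p \<in> V" using U_iff p by blast
 define R' where "R' = max R (400 * M)"
 obtain k where k: "R' < 2 ^ k" using real_arch_pow[of 2 R'] by auto
 have s1: "1 <= cmod (snd ((H ^^ n) p))" using VoD(2)[OF n] M by linarith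
 have "2 ^ k * 1 <= 2 ^ k * cmod (snd ((H ^^ n) p))" using s1 by (intro mult_left_mono) auto
 also have "... <= cmod (snd ((H ^^ k) ((H ^^ n) p)))" by (rule iterate_growth[OF n])
 finally have "R' < cmod (snd ((H ^^ (k + n)) p))" using k by (simp add: funpow_add)
 moreover have "(H ^^ (k + n)) p \<in> V" using iterate_later[OF n, of "k + n"] by simp
 ultimately have kn: "(H ^^ (k + n)) p \<in> Vo R'" by (simp add: Vo_def)
 show ?thesis
 proof (intro exI[of _ "k + n"] allI impI)
  fix m assume "k + n <= m"
  then obtain j where "m = j + (k + n)" by (metis le_add_diff_inverse2)
  hence "(H ^^ m) p = (H ^^ j) ((H ^^ (k + n)) p)" by (simp add: funpow_add)
  also have "... \<in> Vo R'" by (rule iterate_Vo[OF kn]) (simp add: R'_def)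
  finally show "(H ^^ m) p \<in> Vo R" using Vo_mono[of R R'] by (auto simp: R'_def)
 qed
qed

end

lemma (in henon) phi_extension_iterate:
 assumes "phi_plus_extension d H \<phi>" "p \<in> J_minus_plus H"
 shows "\<phi> ((H ^^ n) p) = \<phi> p ^ (d ^ n)"
proof (induction n)
 case (Suc n)
 have "(H ^^ n) p \<in> J_minus_plus H" using assms(2) by (simp add: J_minus_plus_iterate)
 hence "\<phi> (H ((H ^^ n) p)) = \<phi> ((H ^^ n) p) ^ d" using assms(1) by (simp add: phi_plus_extension_def)
 thus ?case by (simp add: Suc mult.commute flip: power_mult)
qed simp

text \<open>What is left of the motion to one parameter value once it is known to preserve \<open>G\<close>: it preserves \<open>phi\<close>.\<close>

locale rigid_motion = henon_motion +
 fixes M :: real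
 assumes M: "M >= 1" and lead: "leading_power 1 d M H0" "leading_power 1 d M H1"
  and hyp: "hyperbolic H0" "hyperbolic H1"
  and phi_eq: "p \<in> U_plus H0 ==> \<exists>n r. r > 0 & ball p r \<subseteq> U_plus H0 \<and>
   (\<forall>q\<in>ball p r. (H0 ^^ n) q \<in> Vo (400 * M) & f ((H0 ^^ n) q) \<in> Vo (400 * M) \<and>
    henon_growth.phi d H1 (f ((H0 ^^ n) q)) = henon_growth.phi d H0 ((H0 ^^ n) q))"
begin

lemma dyn0: "henon_dyn d M H0 (inv H0)" by (rule henon_dynI[OF h0.henon M lead(1)])
lemma dyn1: "henon_dyn d M H1 (inv H1)" by (rule henon_dynI[OF h1.henon M lead(2)])

sublocale D0: henon_dyn d M H0 "inv H0" by (rule dyn0)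
sublocale D1: henon_dyn d M H1 "inv H1" by (rule dyn1)

lemma phi_eq_iterate:
 assumes p: "p \<in> U_plus H0"
 shows "\<exists>n r. r > 0 & ball p r \<subseteq> U_plus H0 & (\<forall>q\<in>ball p r. \<forall>m\<ge>n. q \<in> D0.E m & f q \<in> D1.E m & D1.Lam m (f q) = D0.Lam m q)"
proof -
 obtain n r where r: "r > 0" "ball p r \<subseteq> U_plus H0" "\<forall>q\<in>ball p r. (H0 ^^ n) q \<in> Vo (400 * M) & f ((H0 ^^ n) q) \<in> Vo (400 * M) \<and>
    D1.phi (f ((H0 ^^ n) q)) = D0.phi ((H0 ^^ n) q)" using phi_eq[OF p] by (elim exE conjE)
 show ?thesis
 proof (intro exI[of _ n] exI[of _ r] conjI r ballI allI impI)
  fix q m assume q: "q \<in> ball p r" and nm: "n <= m"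
  have qM: "q \<in> motion_domain H0" using subsetD[OF r(2) q] h0.U_plus_motion_domain by blast
  have E: "q \<in> D0.E n" "f q \<in> D1.E n" "D1.Lam n (f q) = D0.Lam n q"
   using bspec[OF r(3) q] unfolding D0.E_def D1.E_def D0.Lam_def D1.Lam_def vimage_eq conj_iterate[OF qM] by blast+
  show Em: "q \<in> D0.E m" by (rule subsetD[OF D0.E_mono[OF nm] E(1)])
  show "f q \<in> D1.E m" by (rule subsetD[OF D1.E_mono[OF nm] E(2)])
  obtain k where k: "m = k + n" using nm by (metis le_add_diff_inverse2)
  show "D1.Lam m (f q) = D0.Lam m q" unfolding k D1.Lam_add[OF E(2)] D0.Lam_add[OF E(1)] E(3) ..
 qed
qed

text \<open>
  Far along the orbit of \<open>p\<close> both extensions are given by \<open>phi\<close>, which the motion preserves. Hence they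
  agree at \<open>p\<close> up to a root of unity, which is locally constant because the roots of a given order
  are finitely many.
\<close>

lemma phi_extension_eq:
 assumes \<phi>0: "phi_plus_extension d H0 \<phi>0" and \<phi>1: "phi_plus_extension d H1 \<phi>1" and p: "p \<in> J_minus_plus H0"
 shows "\<phi>1 (f p) = \<phi>0 p"
proof -
 define u where "u p = \<phi>1 (f p) / \<phi>0 p" for p
 obtain R0 where R0: "R0 >= 400 * M" "\<forall>p\<in>J_minus H0 \<inter> Vo R0. \<phi>0 p = D0.phi p"
  using D0.phi_extension_deep[OF \<phi>0] by (elim exE conjE)
 obtain R1 where R1: "R1 >= 400 * M" "\<forall>p\<in>J_minus H1 \<inter> Vo R1. \<phi>1 p = D1.phi p"
  using D1.phi_extension_deep[OF \<phi>1] by (elim exE conjE)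
 have nz: "\<phi>0 p ~= 0" if "p \<in> J_minus_plus H0" for p
 proof -
  have "\<phi>0 p \<in> - cball 0 1" using \<phi>0 that unfolding phi_plus_extension_def by blast
  thus ?thesis by auto
 qed
 have JU: "p \<in> U_plus H0" "p \<in> J_minus H0" "p \<in> motion_domain H0" if "p \<in> J_minus_plus H0" for p
  using that by (auto simp: J_minus_plus_def motion_domain_def)
 have local: "\<exists>\<delta>>0. \<exists>m. \<forall>q\<in>J_minus_plus H0. dist p q < \<delta> --> u q ^ (d ^ m) = 1" if p: "p \<in> J_minus_plus H0" for p
 proof -
  obtain n r where r: "r > 0" "ball p r \<subseteq> U_plus H0"
   "\<forall>q\<in>ball p r. \<forall>m\<ge>n. q \<in> D0.E m & f q \<in> D1.E m & D1.Lam m (f q) = D0.Lam m q"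
   using phi_eq_iterate[OF JU(1)[OF p]] by (elim exE conjE)
  obtain n0 where n0: "\<forall>m\<ge>n0. (H0 ^^ m) p \<in> Vo R0" using D0.eventually_Vo[OF JU(1)[OF p], of R0] by (elim exE)
  obtain n1 where n1: "\<forall>m\<ge>n1. (H1 ^^ m) (f p) \<in> Vo R1" using D1.eventually_Vo[OF f_U[OF JU(1)[OF p]], of R1] by (elim exE)
  define m where "m = max n (max n0 n1)"
  have m: "n <= m" "n0 <= m" "n1 <= m" by (auto simp: m_def)
  have cf: "continuous_on (ball p r) f"
   by (rule continuous_on_subset[OF contf subset_trans[OF r(2) h0.U_plus_motion_domain]])
  define O1 where "O1 = (ball p r \<inter> (H0 ^^ m) -` Vo R0) \<inter> (ball p r \<inter> (\<lambda>q. (H1 ^^ m) (f q)) -` Vo R1)"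
  have "open O1" unfolding O1_def by (intro open_Int continuous_open_preimage open_ball open_Vo h0.cont_iterate
     continuous_on_compose2[OF h1.cont_iterate(1)[of UNIV] cf]) auto
  moreover have "p \<in> O1" unfolding O1_def using r(1) n0 n1 m by simp
  ultimately obtain \<delta> where \<delta>: "\<delta> > 0" "ball p \<delta> \<subseteq> O1" by (rule openE)
  have "u q ^ (d ^ m) = 1" if q: "q \<in> J_minus_plus H0" "dist p q < \<delta>" for q
  proof -
   have "q \<in> O1" by (rule subsetD[OF \<delta>(2)]) (simp add: q(2))
   hence qO: "q \<in> ball p r" "(H0 ^^ m) q \<in> Vo R0" "(H1 ^^ m) (f q) \<in> Vo R1" unfolding O1_def by blast+
   have fq: "f q \<in> J_minus_plus H1" by (rule J_minus_plus_imp[OF q(1)])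
   have "(H0 ^^ m) q \<in> J_minus_plus H0" "(H1 ^^ m) (f q) \<in> J_minus_plus H1"
    using q(1) fq by (simp_all add: h0.J_minus_plus_iterate h1.J_minus_plus_iterate)
   hence "\<phi>0 ((H0 ^^ m) q) = D0.phi ((H0 ^^ m) q)" "\<phi>1 ((H1 ^^ m) (f q)) = D1.phi ((H1 ^^ m) (f q))"
    using R0(2) R1(2) qO unfolding J_minus_plus_def by blast+
   moreover have "D1.phi ((H1 ^^ m) (f q)) = D0.phi ((H0 ^^ m) q)"
    using mp[OF spec[OF bspec[OF r(3) qO(1)], of m] m(1)] unfolding D0.Lam_def D1.Lam_def by blast
   ultimately have "\<phi>1 (f q) ^ (d ^ m) = \<phi>0 q ^ (d ^ m)"
    using h0.phi_extension_iterate[OF \<phi>0 q(1)] h1.phi_extension_iterate[OF \<phi>1 fq] by simp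
   thus ?thesis using nz[OF q(1)] by (simp add: u_def power_divide)
  qed
  thus ?thesis using \<delta>(1) by blast
 qed
 have cu: "continuous_on (J_minus_plus H0) u"
 proof -
  have c0: "continuous_on (J_minus_plus H0) \<phi>0" and c1: "continuous_on (J_minus_plus H1) \<phi>1"
   using \<phi>0 \<phi>1 by (auto simp: phi_plus_extension_def)
  have "continuous_on (J_minus_plus H0) (\<lambda>p. \<phi>1 (f p))"
   by (rule continuous_on_compose2[OF c1 continuous_on_subset[OF contf]])
     (use JU(3) in blast, use J_minus_plus_imp in blast)
  thus ?thesis unfolding u_def[abs_def] using nz by (intro continuous_on_divide c0 ballI)
 qed
 have "u p = 1"
 proof (rule h0.locally_constant_root_eq_1[OF _ _ _ p])
  fix p assume p: "p \<in> J_minus_plus H0"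
  obtain \<delta> m where \<delta>: "\<delta> > 0" "\<forall>q\<in>J_minus_plus H0. dist p q < \<delta> --> u q ^ (d ^ m) = 1"
   using local[OF p] by (elim exE conjE)
  show "\<exists>N. u p ^ (d ^ N) = 1" using \<delta> p by (intro exI[of _ m]) simp
  have "d ^ m >= 1" using D0.d by simp
  hence "finite {z::complex. z ^ (d ^ m) = 1}" by (rule finite_roots_unity)
  from finite_set_avoid[OF this, of "u p"] obtain e where e: "e > 0"
   "\<forall>x\<in>{z. z ^ (d ^ m) = 1}. x ~= u p --> e <= dist (u p) x" by (elim exE conjE)
  obtain \<delta>' where \<delta>': "\<delta>' > 0" "\<forall>q\<in>J_minus_plus H0. dist q p < \<delta>' --> dist (u q) (u p) < e"
   using cu p e(1) unfolding continuous_on_iff by meson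
  show "\<exists>\<delta>>0. \<forall>q\<in>J_minus_plus H0. dist p q < \<delta> --> u q = u p"
  proof (intro exI[of _ "min \<delta> \<delta>'"] conjI ballI impI)
   show "0 < min \<delta> \<delta>'" using \<delta>(1) \<delta>'(1) by simp
   fix q assume q: "q \<in> J_minus_plus H0" and pq: "dist p q < min \<delta> \<delta>'"
   have "u q \<in> {z. z ^ (d ^ m) = 1}" using bspec[OF \<delta>(2) q] pq by simp
   moreover have "dist (u p) (u q) < e" using bspec[OF \<delta>'(2) q] pq by (simp add: dist_commute)
   ultimately show "u q = u p" using e(2) by (meson not_le)
  qed
  have "\<phi>1 (H1 (f p)) = \<phi>1 (f p) ^ d" "\<phi>0 (H0 p) = \<phi>0 p ^ d"
   using h1.phi_extension_iterate[OF \<phi>1 J_minus_plus_imp[OF p], of 1] h0.phi_extension_iterate[OF \<phi>0 p, of 1]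
   by simp_all
  thus "u (H0 p) = u p ^ d" using conj[OF JU(3)[OF p]] by (simp add: u_def power_divide)
 qed
 thus ?thesis using nz[OF p] by (simp add: u_def divide_eq_1_iff)
qed

lemma int_iterate_conj:
 assumes "p \<in> motion_domain H0" shows "f (int_iterate H0 t p) = int_iterate H1 t (f p)"
 unfolding int_iterate_def using conj_iterate[OF assms] conj_inv_iterate[OF assms] by simp

lemma solenoidal_map_eq:
 assumes \<Phi>0: "solenoidal_map d H0 \<Phi>0" and \<Phi>1: "solenoidal_map d H1 \<Phi>1" and p: "p \<in> J_minus_plus H0"
 shows "\<Phi>0 p = \<Phi>1 (f p)"
proof
 fix t
 obtain \<phi>0 where 0: "phi_plus_extension d H0 \<phi>0" "\<forall>p\<in>J_minus_plus H0. \<forall>t. \<Phi>0 p t = \<phi>0 (int_iterate H0 t p)"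
  using \<Phi>0 unfolding solenoidal_map_def by (elim exE conjE)
 obtain \<phi>1 where 1: "phi_plus_extension d H1 \<phi>1" "\<forall>p\<in>J_minus_plus H1. \<forall>t. \<Phi>1 p t = \<phi>1 (int_iterate H1 t p)"
  using \<Phi>1 unfolding solenoidal_map_def by (elim exE conjE)
 have "int_iterate H0 t p \<in> J_minus_plus H0" unfolding int_iterate_def using p by (simp add: h0.J_minus_plus_iterate)
 from phi_extension_eq[OF 0(1) 1(1) this]
 have "\<phi>1 (int_iterate H1 t (f p)) = \<phi>0 (int_iterate H0 t p)"
  using int_iterate_conj[of p t] p by (simp add: J_minus_plus_def motion_domain_def)
 thus "\<Phi>0 p t = \<Phi>1 (f p) t" using 0(2) 1(2) p J_minus_plus_imp[OF p] by simp
qed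

text \<open>
  In the parameters of the two leaves, the motion is a continuous injective lift of the holomorphic
  map \<open>Lam n \<circ> \<tau>\<close> through a map of the same kind.
\<close>

lemma holomorphic_on_leaf:
 assumes x: "x \<in> Julia H0" and \<tau>: "unstable_param H0 x \<tau>" and \<tau>1: "unstable_param H1 (f x) \<tau>1"
  and C: "C \<in> components (\<tau> -` U_plus H0)"
 shows "hmap (f \<circ> \<tau>) C"
proof -
 obtain Es0 Eu0 C0 \<kappa>0 where hh0: "hyperbolic_henon d H0 Es0 Eu0 C0 \<kappa>0"
  using hyperbolic_henonI[OF h0.henon hyp(1)] by (elim exE)
 have WJ: "W_unstable H0 x \<subseteq> J_minus H0" using hyperbolic_henon.unstable_in_J_minus[OF hh0 x] by blast
 obtain x1 where x1: "x1 \<in> Julia H1" "f ` W_unstable H0 x = W_unstable H1 x1" using unstable_image[OF x] by (elim bexE)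
 have "f x \<in> W_unstable H1 x1" using x1(2) h0.W_unstable_refl by blast
 hence Weq: "W_unstable H1 (f x) = W_unstable H1 x1" by (rule h1.W_unstable_eq)
 hence \<tau>1': "unstable_param H1 x1 \<tau>1" using \<tau>1 by (simp add: unstable_param_def)
 have \<tau>h: "hmap \<tau> UNIV" "inj \<tau>" and \<tau>W: "\<And>z. \<tau> z \<in> W_unstable H0 x" using \<tau> by (auto simp: unstable_param_def)
 have \<tau>1h: "hmap \<tau>1 UNIV" using \<tau>1 by (simp add: unstable_param_def)
 define k where "k = (\<lambda>z. inv \<tau>1 (f (\<tau> z)))"
 have ck: "continuous_on UNIV k" unfolding k_def by (rule continuous_transition[OF hyp x x1(1) \<tau> \<tau>1']) (simp add: x1(2))
 have k: "\<tau>1 (k z) = f (\<tau> z)" for z unfolding k_def by (rule unstable_param_into[OF \<tau>1']) (use x1(2) \<tau>W in blast)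
 have MD: "\<tau> z \<in> motion_domain H0" for z using \<tau>W WJ by (auto simp: motion_domain_def)
 have injk: "inj k"
 proof (rule injI)
  fix z w assume "k z = k w"
  hence "f (\<tau> z) = f (\<tau> w)" using k by metis
  thus "z = w" using f_eq_iff[OF MD MD] \<tau>h(2) by (auto dest: injD)
 qed
 have ct: "continuous_on UNIV \<tau>" by (rule hmap_continuous_on[OF \<tau>h(1)])
 have C_open: "open C" using open_components[OF open_vimage[OF h0.open_U_plus ct] C] .
 have C_sub: "C \<subseteq> \<tau> -` U_plus H0" using C by (rule in_components_subset)
 have "x \<in> range \<tau>" using \<tau> h0.W_unstable_refl by (simp add: unstable_param_def)
 then obtain z0 where "x = \<tau> z0" by blast
 moreover have "x \<notin> U_plus H0" using x by (simp add: Julia_def h0.J_plus_iff U_plus_def)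
 ultimately have z0: "\<tau> z0 \<notin> U_plus H0" by simp
 have kd: "\<exists>S. open S & z \<in> S & k holomorphic_on S" if z: "z \<in> C" for z
 proof -
  have "\<tau> z \<in> U_plus H0" using C_sub z by blast
  from phi_eq_iterate[OF this] obtain n r where r: "r > 0" "ball (\<tau> z) r \<subseteq> U_plus H0"
   "\<forall>q\<in>ball (\<tau> z) r. \<forall>m\<ge>n. q \<in> D0.E m & f q \<in> D1.E m & D1.Lam m (f q) = D0.Lam m q" by (elim exE conjE)
  have E: "q \<in> D0.E n & f q \<in> D1.E n & D1.Lam n (f q) = D0.Lam n q" if "q \<in> ball (\<tau> z) r" for q
   by (rule mp[OF spec[OF bspec[OF r(3) that], of n] order_refl])
  define S where "S = C \<inter> \<tau> -` ball (\<tau> z) r"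
  have S: "open S" unfolding S_def by (intro open_Int C_open open_vimage open_ball ct)
  have zS: "z \<in> S" using z r(1) by (simp add: S_def)
  define \<Omega> where "\<Omega> = \<tau>1 -` D1.E n"
  have \<Omega>: "open \<Omega>" unfolding \<Omega>_def by (rule open_vimage[OF D1.open_E hmap_continuous_on[OF \<tau>1h]])
  have "hmap (\<lambda>y. D1.Lam n (\<tau>1 y)) \<Omega>"
   by (rule hmap_compose[OF hmap_subset[OF \<tau>1h subset_UNIV] D1.Lam_holomorphic]) (auto simp: \<Omega>_def)
  hence g: "(\<lambda>y. D1.Lam n (\<tau>1 y)) holomorphic_on \<Omega>" unfolding hmap_complex[OF \<Omega>] .
  have inS: "\<tau> w \<in> ball (\<tau> z) r" if "w \<in> S" for w using that by (simp add: S_def)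
  have "hmap (\<lambda>w. D0.Lam n (\<tau> w)) S" by (rule hmap_compose[OF hmap_subset[OF \<tau>h(1) subset_UNIV] D0.Lam_holomorphic])
     (use E inS in blast)
  hence G: "(\<lambda>w. D0.Lam n (\<tau> w)) holomorphic_on S" unfolding hmap_complex[OF S] .
  have gk: "D1.Lam n (\<tau>1 (k w)) = D0.Lam n (\<tau> w)" if "w \<in> S" for w unfolding k using E[OF inS[OF that]] by blast
  have "k holomorphic_on S"
  proof (rule holomorphic_lift[OF S continuous_on_subset[OF ck subset_UNIV] inj_on_subset[OF injk subset_UNIV] g \<Omega>])
   show "k ` S \<subseteq> \<Omega>" unfolding \<Omega>_def
   proof (rule image_subsetI)
    fix w assume "w \<in> S"
    thus "k w \<in> \<tau>1 -` D1.E n" using E[OF inS] by (simp add: k)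
   qed
   show "(\<lambda>w. D1.Lam n (\<tau>1 (k w))) holomorphic_on S" by (rule holomorphic_transform[OF G]) (simp add: gk)
   fix w s assume s: "0 < (s::real)" "ball w s \<subseteq> S"
   hence "ball w s \<subseteq> C" by (auto simp: S_def)
   from D0.leaf_green_nonconstant[OF \<tau>h(1) C z0 s(1) this]
   obtain v where v: "v \<in> ball w s" "green_plus d H0 (\<tau> v) ~= green_plus d H0 (\<tau> w)" by (elim bexE)
   have vS: "v \<in> S" "w \<in> S" using s v(1) by auto
   have "D0.Lam n (\<tau> v) ~= D0.Lam n (\<tau> w)"
    using v(2) D0.green_eq(2)[of "\<tau> v" n] D0.green_eq(2)[of "\<tau> w" n] E[OF inS[OF vS(1)]] E[OF inS[OF vS(2)]] by auto
   thus "\<exists>v\<in>ball w s. D1.Lam n (\<tau>1 (k v)) ~= D1.Lam n (\<tau>1 (k w))"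
    using v(1) gk[OF vS(1)] gk[OF vS(2)] by (intro bexI[of _ v]) simp_all
  qed
  thus ?thesis using S zS by blast
 qed
 have "k holomorphic_on C" unfolding holomorphic_on_def
 proof
  fix z assume z: "z \<in> C"
  obtain S where S: "open S" "z \<in> S" "k holomorphic_on S" using kd[OF z] by (elim exE conjE)
  show "k field_differentiable (at z within C)"
   by (rule field_differentiable_at_within[OF holomorphic_on_imp_differentiable_at[OF S(3,1,2)]])
 qed
 hence "hmap k C" by (simp add: hmap_complex[OF C_open])
 hence "hmap (\<lambda>z. \<tau>1 (k z)) C" by (rule hmap_compose[OF _ \<tau>1h]) simp
 thus ?thesis by (simp add: k o_def)
qed

end


section \<open>The family over a disk of parameters\<close>

lemma polydisk_disk:
 fixes r :: "'n::finite => real"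
 assumes r: "\<And>i. r i > 0" and l: "l \<in> polydisk r"
 shows "\<exists>\<rho>>1. \<forall>\<zeta>\<in>cball 0 \<rho>. \<zeta> *\<^sub>C l \<in> polydisk r"
proof -
 define t where "t = Max (range (\<lambda>i. cmod (l $ i) / r i))"
 have le: "cmod (l $ i) / r i <= t" for i unfolding t_def by (rule Max_ge) auto
 have "t \<in> range (\<lambda>i. cmod (l $ i) / r i)" unfolding t_def by (rule Max_in) auto
 hence t1: "t < 1" using l r by (auto simp: polydisk_def)
 have t0: "0 <= t" using le[of undefined] r[of undefined] by (meson divide_nonneg_pos norm_ge_zero order_trans)
 define \<rho> where "\<rho> = 2 / (1 + t)"
 have "\<rho> > 1" using t0 t1 by (simp add: \<rho>_def)
 moreover have "\<zeta> *\<^sub>C l \<in> polydisk r" if "\<zeta> \<in> cball 0 \<rho>" for \<zeta>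
 proof -
  have "cmod (\<zeta> * l $ i) < r i" for i
  proof -
   have "cmod (l $ i) <= t * r i" using le[of i] r[of i] by (simp add: divide_le_eq)
   hence "cmod (\<zeta> * l $ i) <= \<rho> * (t * r i)" unfolding norm_mult using that \<open>\<rho> > 1\<close> by (intro mult_mono) auto
   also have "\<rho> * t < 1" using t0 t1 by (simp add: \<rho>_def divide_less_eq)
   hence "\<rho> * (t * r i) < 1 * r i" unfolding mult.assoc[symmetric] using r[of i] by (rule mult_strict_right_mono)
   finally show ?thesis by simp
  qed
  thus ?thesis by (simp add: polydisk_def scaleC_vec_def scaleC_complex_def)
 qed
 ultimately show ?thesis by blast
qed

text \<open>Only the supremum over the unit bidisk enters, which is bounded on compact sets of parameters.\<close>

lemma henon_family_uniform_leading_power: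
 fixes H :: "'p::complex_normed_vector => C2 => C2"
 assumes fam: "henon_family d W H" and K: "compact K" "K \<subseteq> W"
 shows "\<exists>M\<ge>1. \<forall>l\<in>K. leading_power 1 d M (H l)"
proof -
 have hm: "henon_map d (H l)" if "l \<in> W" for l using fam that by (simp add: henon_family_def)
 have "hmap (\<lambda>(l, p). H l p) (W \<times> UNIV)" using fam by (simp add: henon_family_def)
 hence c: "continuous_on (W \<times> UNIV) (\<lambda>(l, p). H l p)" by (rule hmap_continuous_on)
 define B where "B = K \<times> (cball (0::complex) 1 \<times> cball (0::complex) 1)"
 have "compact B" unfolding B_def by (intro compact_Times K(1) compact_cball)
 have cB: "continuous_on B (\<lambda>(l, p). H l p)" by (rule continuous_on_subset[OF c]) (use K(2) in \<open>auto simp: B_def\<close>)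
 hence cB': "continuous_on B (\<lambda>x. H (fst x) (snd x))" by (simp add: case_prod_beta)
 have c1: "continuous_on B (\<lambda>x. fst (H (fst x) (snd x)))" by (rule continuous_on_fst[OF cB'])
 have c2: "continuous_on B (\<lambda>x. snd (H (fst x) (snd x)) - 1 * snd (snd x) ^ d)"
  by (intro continuous_intros continuous_on_snd[OF cB'])
 have "bounded ((\<lambda>x. fst (H (fst x) (snd x))) ` B)"
  by (rule compact_imp_bounded[OF compact_continuous_image[OF c1 \<open>compact B\<close>]])
 then obtain b1 where b1: "\<forall>y\<in>(\<lambda>x. fst (H (fst x) (snd x))) ` B. cmod y <= b1" unfolding bounded_iff by (elim exE)
 have "bounded ((\<lambda>x. snd (H (fst x) (snd x)) - 1 * snd (snd x) ^ d) ` B)"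
  by (rule compact_imp_bounded[OF compact_continuous_image[OF c2 \<open>compact B\<close>]])
 then obtain b2 where b2: "\<forall>y\<in>(\<lambda>x. snd (H (fst x) (snd x)) - 1 * snd (snd x) ^ d) ` B. cmod y <= b2"
  unfolding bounded_iff by (elim exE)
 define b where "b = max b1 b2"
 have "leading_power 1 d (max 1 (real d * b)) (H l)" if l: "l \<in> K" for l
 proof -
  have hl: "henon_map d (H l)" by (rule hm[OF subsetD[OF K(2) l]])
  obtain M0 where M0: "leading_power 1 d M0 (H l)" using henon_inv(5)[OF hl] by (elim exE)
  have "leading_power 1 d (real d * b) (H l)"
  proof (rule leading_power_of_bidisk_bound[OF henon_inv(3)[OF hl] M0])
   show "1 <= d" using henon_map_degree[OF hl] by simp
   fix p :: C2 assume "size_max p <= 1"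
   hence "cmod (fst p) <= 1" "cmod (snd p) <= 1" using size_max_ge[of p] by auto
   hence m: "(l, p) \<in> B" using l by (simp add: B_def mem_Times_iff)
   have "cmod (fst (H l p)) <= b1" using bspec[OF b1 imageI[OF m]] by simp
   moreover have "cmod (snd (H l p) - 1 * snd p ^ d) <= b2" using bspec[OF b2 imageI[OF m]] by simp
   ultimately show "cmod (fst (H l p)) <= b & cmod (snd (H l p) - 1 * snd p ^ d) <= b" by (auto simp: b_def)
  qed
  thus ?thesis by (rule leading_power_mono) simp
 qed
 thus ?thesis by (intro exI[of _ "max 1 (real d * b)"]) simp
qed

lemma buzzard_verma_henon_motion:
 assumes bv: "buzzard_verma_motion d \<Delta> H \<Psi>" and h: "henon_map d (H 0)" "henon_map d (H l)" and l: "l \<in> \<Delta>"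
 shows "\<exists>\<Psi>'. henon_motion d (H 0) (H l) (\<Psi> l) \<Psi>'"
proof -
 obtain \<Psi>' where \<Psi>': "homeomorphism (motion_domain (H 0)) (motion_domain (H l)) (\<Psi> l) \<Psi>'"
  using bv l unfolding buzzard_verma_motion_def by (elim conjE) (drule bspec, assumption, blast)
 have conj: "\<Psi> l (H 0 p) = H l (\<Psi> l p)" if "p \<in> motion_domain (H 0)" for p
  using bv l that unfolding buzzard_verma_motion_def by (elim conjE) simp
 have leaves: "(\<forall>L\<in>leaves_J_minus (H 0). \<Psi> l ` L \<in> leaves_J_minus (H l)) \<and>
   (\<forall>L\<in>leaves_plus d (H 0). \<Psi> l ` L \<in> leaves_plus d (H l))"
  using bv l unfolding buzzard_verma_motion_def by (elim conjE) simp
 have "henon_motion d (H 0) (H l) (\<Psi> l) \<Psi>'"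
 proof (unfold_locales)
 qed (use h \<Psi>' conj leaves in blast)+
 thus ?thesis by (rule exI[of _ \<Psi>'])
qed

abbreviation "has_harmonic_coeff S k \<equiv> \<exists>\<mu>. has_beltrami_coeff_on k S \<mu> & harmonic_beltrami S \<mu>"

lemma buzzard_verma_params:
 assumes bv: "buzzard_verma_motion d \<Delta> H \<Psi>" and p0: "p0 \<in> Julia (H 0)" and \<sigma>: "unstable_param (H 0) p0 \<sigma>"
 shows "\<exists>\<tau>. (\<forall>l\<in>\<Delta>. unstable_param (H l) (\<Psi> l p0) (\<tau> l)) \<and>
  (\<forall>l\<in>\<Delta>. has_harmonic_coeff (\<tau> 0 -` (W_unstable (H 0) p0 - Julia (H 0))) (\<lambda>z. inv (\<tau> l) (\<Psi> l (\<tau> 0 z))))"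
proof -
 have "inj \<sigma>" "range \<sigma> = W_unstable (H 0) p0" using \<sigma> by (auto simp: unstable_param_def)
 hence "\<sigma> 0 ~= \<sigma> 1" "\<sigma> 0 \<in> W_unstable (H 0) p0" "\<sigma> 1 \<in> W_unstable (H 0) p0" by (auto dest: injD)
 then obtain q0 where q0: "q0 \<in> W_unstable (H 0) p0 - {p0}" by (metis Diff_iff singletonD)
 note params = bv[unfolded buzzard_verma_motion_def, THEN conjunct2, THEN conjunct2, THEN conjunct2, THEN conjunct2, THEN conjunct2]
 from bspec[OF bspec[OF params p0] q0] obtain \<tau>
  where \<tau>: "\<forall>l\<in>\<Delta>. unstable_param (H l) (\<Psi> l p0) (\<tau> l) & \<tau> l 0 = \<Psi> l p0 & \<tau> l 1 = \<Psi> l q0"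
   "\<forall>l\<in>\<Delta>. has_harmonic_coeff (\<tau> 0 -` (W_unstable (H 0) p0 - Julia (H 0))) (\<lambda>z. inv (\<tau> l) (\<Psi> l (\<tau> 0 z)))" by (elim exE conjE)
 show ?thesis
 proof (intro exI[of _ \<tau>] conjI \<tau>(2) ballI)
  show "unstable_param (H l) (\<Psi> l p0) (\<tau> l)" if "l \<in> \<Delta>" for l using bspec[OF \<tau>(1) that] by (elim conjE)
 qed
qed

text \<open>
  Restriction to the complex line through \<open>l\<close>: the motion over \<open>\<zeta> \<mapsto> \<zeta> l\<close> is defined on a disk of radius
  greater than 1, and its value at 1 is the motion at \<open>l\<close>.
\<close>

lemma buzzard_verma_rigid_motion:
 fixes r :: "'n::finite => real" and H :: "complex ^ 'n => C2 => C2"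
 assumes r: "\<And>i. r i > 0" and fam: "henon_family d W H" and W: "closure (polydisk r) \<subseteq> W"
  and hyp: "hyperbolic (H 0)" "hyperbolic (H l)" and uc: "unstably_connected (H 0)"
  and bv: "buzzard_verma_motion d (polydisk r) H \<Psi>" and l: "l \<in> polydisk r"
 shows "\<exists>\<Psi>' M. rigid_motion d (H 0) (H l) (\<Psi> l) \<Psi>' M"
proof -
 obtain \<rho> where \<rho>: "\<rho> > 1" "\<forall>\<zeta>\<in>cball 0 \<rho>. \<zeta> *\<^sub>C l \<in> polydisk r" using polydisk_disk[OF r l] by (elim exE conjE)
 have PW: "polydisk r \<subseteq> W" using closure_subset W by (rule subset_trans)
 have z: "0 \<in> polydisk r" using r by (simp add: polydisk_def)
 have hm: "henon_map d (H l)" if "l \<in> polydisk r" for l using fam subsetD[OF PW that] by (simp add: henon_family_def)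
 define K where "K = (\<lambda>\<zeta>. \<zeta> *\<^sub>C l) ` cball 0 \<rho>"
 have line: "hmap (\<lambda>\<zeta>. \<zeta> *\<^sub>C l) S" for S using hmap_complex_line[of 0 l S] by simp
 have "compact K" unfolding K_def by (intro compact_continuous_image compact_cball hmap_continuous_on line)
 have Kr: "K \<subseteq> polydisk r" using \<rho>(2) by (auto simp: K_def)
 obtain M where M: "M >= 1" "\<forall>l\<in>K. leading_power 1 d M (H l)"
  using henon_family_uniform_leading_power[OF fam \<open>compact K\<close> subset_trans[OF Kr PW]] by (elim exE conjE)
 define F where "F \<zeta> = H (\<zeta> *\<^sub>C l)" for \<zeta>
 define P where "P \<zeta> = \<Psi> (\<zeta> *\<^sub>C l)" for \<zeta>
 have F01: "F 0 = H 0" "F 1 = H l" "P 0 = \<Psi> 0" "P 1 = \<Psi> l" by (simp_all add: F_def P_def)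
 have ex: "\<exists>\<Psi>'. henon_motion d (F 0) (F \<zeta>) (P \<zeta>) \<Psi>'" if "\<zeta> \<in> cball 0 \<rho>" for \<zeta> unfolding F01 unfolding F_def P_def
  by (rule buzzard_verma_henon_motion[OF bv hm[OF z] hm]) (use \<rho>(2) that in blast)+
 define P' where "P' \<zeta> = (SOME \<Psi>'. henon_motion d (F 0) (F \<zeta>) (P \<zeta>) \<Psi>')" for \<zeta>
 have mot: "henon_motion d (F 0) (F \<zeta>) (P \<zeta>) (P' \<zeta>)" if "\<zeta> \<in> cball 0 \<rho>" for \<zeta>
  unfolding P'_def by (rule someI_ex[OF ex[OF that]])
 have \<Psi>hol: "hmap (\<lambda>l. \<Psi> l p) (polydisk r)" if "p \<in> motion_domain (H 0)" for p
  using bv that unfolding buzzard_verma_motion_def by (elim conjE) simp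
 have \<Psi>0: "\<Psi> 0 p = p" if "p \<in> motion_domain (H 0)" for p
  using bv that unfolding buzzard_verma_motion_def by (elim conjE) simp
 have Phol: "hmap (\<lambda>\<zeta>. P \<zeta> p) (cball 0 \<rho>)" if "p \<in> motion_domain (F 0)" for p
 proof -
  have "p \<in> motion_domain (H 0)" using that unfolding F01 .
  moreover have "(\<lambda>\<zeta>. \<zeta> *\<^sub>C l) ` cball 0 \<rho> \<subseteq> polydisk r" by (rule image_subsetI) (rule bspec[OF \<rho>(2)])
  ultimately show ?thesis unfolding P_def by (rule hmap_compose[OF line \<Psi>hol])
 qed
 interpret dm: disc_motion d F P P' \<rho> M
 proof (rule disc_motion.intro)
  show "1 < \<rho>" by (rule \<rho>(1))
  show "1 <= M" by (rule M(1))
  show "henon_motion d (F 0) (F \<zeta>) (P \<zeta>) (P' \<zeta>)" if "\<zeta> \<in> cball 0 \<rho>" for \<zeta> by (rule mot[OF that])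
  show "leading_power 1 d M (F \<zeta>)" if "\<zeta> \<in> cball 0 \<rho>" for \<zeta>
   unfolding F_def by (rule bspec[OF M(2)]) (use that in \<open>simp add: K_def del: mem_cball\<close>)
  show "P 0 p = p" if "p \<in> motion_domain (F 0)" for p using \<Psi>0 that unfolding F01 by blast
  show "continuous_on (cball 0 \<rho>) (\<lambda>\<zeta>. P \<zeta> p)" if "p \<in> motion_domain (F 0)" for p
   by (rule hmap_continuous_on[OF Phol[OF that]])
  show "hmap (\<lambda>\<zeta>. P \<zeta> p) (ball 0 \<rho>)" if "p \<in> motion_domain (F 0)" for p
   by (rule hmap_subset[OF Phol[OF that] ball_subset_cball])
 qed
 obtain p0 \<sigma> C where uc': "saddle_periodic (H 0) p0" "unstable_param (H 0) p0 \<sigma>"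
   "C \<in> components (\<sigma> -` U_plus (H 0))" "simply_connected C"
  using uc unfolding unstably_connected_def by (elim exE conjE)
 interpret h0: henon d "H 0" by unfold_locales (rule hm[OF z])
 obtain c where "c \<in> C" using in_components_nonempty[OF uc'(3)] by blast
 hence "\<sigma> c \<in> U_plus (H 0)" using in_components_subset[OF uc'(3)] by blast
 hence p0: "p0 \<in> Julia (H 0)" by (rule h0.saddle_in_Julia[OF uc'(1,2)])
 have p0M: "p0 \<in> motion_domain (H 0)" using p0 by (simp add: Julia_def motion_domain_def)
 obtain \<tau> where \<tau>: "\<forall>l\<in>polydisk r. unstable_param (H l) (\<Psi> l p0) (\<tau> l)"
  "\<forall>l\<in>polydisk r. has_harmonic_coeff (\<tau> 0 -` (W_unstable (H 0) p0 - Julia (H 0))) (\<lambda>z. inv (\<tau> l) (\<Psi> l (\<tau> 0 z)))"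
  using buzzard_verma_params[OF bv p0 uc'(2)] by (elim exE conjE)
 have \<tau>0: "unstable_param (H 0) p0 (\<tau> 0)" using bspec[OF \<tau>(1) z] \<Psi>0[OF p0M] by simp
 have \<tau>l: "unstable_param (H l) (\<Psi> l p0) (\<tau> l)" by (rule bspec[OF \<tau>(1) l])
 obtain \<mu> where \<mu>: "has_beltrami_coeff_on (\<lambda>z. inv (\<tau> l) (\<Psi> l (\<tau> 0 z))) (\<tau> 0 -` (W_unstable (H 0) p0 - Julia (H 0))) \<mu>"
   "harmonic_beltrami (\<tau> 0 -` (W_unstable (H 0) p0 - Julia (H 0))) \<mu>" using bspec[OF \<tau>(2) l] by (elim exE conjE)
 obtain C' where C': "C' \<in> components (\<tau> 0 -` U_plus (H 0))" "simply_connected C'"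
  using component_reparametrize[OF hm[OF z] hyp(1) p0 uc'(2) \<tau>0 uc'(3,4)] by (elim exE conjE)
 have Ax: "dm.A (green_plus d (H 0) p) 1 = of_real (green_plus d (H 0) p)" if "p \<in> U_plus (H 0)" for p
  using dm.unstable_rigidity[of p0 "\<tau> 0" "\<tau> l" C' _ \<mu> p, OF _ _ _ _ _ _ _ refl] hyp p0 \<tau>0 \<tau>l C' \<mu> that
  unfolding F01 by blast
 have m1: "henon_motion d (H 0) (H l) (\<Psi> l) (P' 1)" using mot[of 1] \<rho>(1) unfolding F01 by simp
 have "rigid_motion d (H 0) (H l) (\<Psi> l) (P' 1) M"
 proof (intro rigid_motion.intro m1 rigid_motion_axioms.intro M(1) hyp)
  show "leading_power 1 d M (H 0)" using dm.lead[of 0] \<rho>(1) unfolding F01 by simp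
  show "leading_power 1 d M (H l)" using dm.lead[of 1] \<rho>(1) unfolding F01 by simp
 qed (rule dm.phi_preserved[unfolded F01, OF Ax])
 thus ?thesis by (intro exI)
qed

theorem theorem1p2:
 fixes d :: nat
  and r :: "'n::finite \<Rightarrow> real"
  and H :: "complex ^ 'n \<Rightarrow> C2 \<Rightarrow> C2"
  and \<Psi> :: "complex ^ 'n \<Rightarrow> C2 \<Rightarrow> C2"
  and \<Phi> :: "complex ^ 'n \<Rightarrow> C2 \<Rightarrow> int \<Rightarrow> complex"
 assumes radii: "\<And>i. r i > 0"
  and family: "\<exists>W. closure (polydisk r) \<subseteq> W \<and> henon_family d W H"
  and hyperbolic: "\<And>l. l \<in> closure (polydisk r) \<Longrightarrow> hyperbolic (H l)"
  and unstably_connected: "\<And>l. l \<in> closure (polydisk r) \<Longrightarrow> unstably_connected (H l)"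
  and motion: "buzzard_verma_motion d (polydisk r) H \<Psi>"
  and solenoidal: "\<And>l. l \<in> polydisk r \<Longrightarrow> solenoidal_map d (H l) (\<Phi> l)"
 shows "(\<forall>l\<in>polydisk r. \<forall>p\<in>J_minus_plus (H 0). \<Phi> 0 p = \<Phi> l (\<Psi> l p)) \<and>
     (\<forall>l\<in>polydisk r. holomorphic_on_leaves_J_minus_plus (H 0) (\<Psi> l))"
proof -
 have z: "0 \<in> polydisk r" using radii by (simp add: polydisk_def)
 have hyp: "hyperbolic (H l)" if "l \<in> polydisk r" for l by (rule hyperbolic[OF subsetD[OF closure_subset that]])
 have uc: "unstably_connected (H 0)" by (rule unstably_connected[OF subsetD[OF closure_subset z]])
 obtain W where W: "closure (polydisk r) \<subseteq> W" "henon_family d W H" using family by (elim exE conjE)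
 have rigid: "\<exists>\<Psi>' M. rigid_motion d (H 0) (H l) (\<Psi> l) \<Psi>' M" if "l \<in> polydisk r" for l
  by (rule buzzard_verma_rigid_motion[OF radii W(2,1) hyp[OF z] hyp[OF that] uc motion that])
 show ?thesis
 proof (intro conjI ballI)
  fix l p assume l: "l \<in> polydisk r" and p: "p \<in> J_minus_plus (H 0)"
  obtain \<Psi>' M where "rigid_motion d (H 0) (H l) (\<Psi> l) \<Psi>' M" using rigid[OF l] by (elim exE)
  thus "\<Phi> 0 p = \<Phi> l (\<Psi> l p)" by (rule rigid_motion.solenoidal_map_eq[OF _ solenoidal[OF z] solenoidal[OF l] p])
 next
  fix l assume l: "l \<in> polydisk r"
  obtain \<Psi>' M where rm: "rigid_motion d (H 0) (H l) (\<Psi> l) \<Psi>' M" using rigid[OF l] by (elim exE)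
  show "holomorphic_on_leaves_J_minus_plus (H 0) (\<Psi> l)" unfolding holomorphic_on_leaves_J_minus_plus_def leaf_chart_def
  proof (intro allI impI, elim bexE conjE)
   fix \<tau> C p0 assume p0: "p0 \<in> Julia (H 0)" and \<tau>: "unstable_param (H 0) p0 \<tau>"
    and C: "C \<in> components (\<tau> -` U_plus (H 0))"
   obtain \<tau>' where "\<forall>l\<in>polydisk r. unstable_param (H l) (\<Psi> l p0) (\<tau>' l)"
    using buzzard_verma_params[OF motion p0 \<tau>] by (elim exE conjE)
   from rigid_motion.holomorphic_on_leaf[OF rm p0 \<tau> bspec[OF this l] C]
   show "hmap (\<Psi> l \<circ> \<tau>) C" .
  qed
 qed
qed


end
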